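(* Let $\mathfrak g$ be a simple complex Lie algebra, $V$ a finite-dimensional faithful $\mathfrak g$-module and $\mathfrak g_r$ the associated $r$-matrix Lie algebra with generating matrices $L^\pm$. The assignment $L^\pm\mapsto\mathbb L^\pm\pm\mathfrak Z^\pm$ uniquely extends to an isomorphism of Lie algebras $$\Phi_r:\mathfrak g_r\xrightarrow{\ \sim\ }D(\mathfrak b^+)\oplus\mathfrak z_V^+\oplus\mathfrak z_V^-.$$ Moreover, the unique Lie cobracket $\delta_r:\mathfrak g_r\to\mathfrak g_r\wedge\mathfrak g_r$ satisfying $\Phi_r^{\otimes2}\circ\delta_r=\delta\circ\Phi_r$ (where $\delta$ is the Lie cobracket of the direct sum of Lie bialgebras $D(\mathfrak b^+)\oplus\mathfrak z_V^+\oplus\mathfrak z_V^-$) is given by $\delta_r(L^\pm)=[L^\pm_{[1]},L^\pm_{[2]}]$.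
   Context: $\mathfrak h\subset\mathfrak g$ is a Cartan subalgebra, $\{\alpha_i\}_{i\in\mathbf I}$ simple roots, $\Phi^+$ positive roots; $(\,,)$ is the invariant nondegenerate symmetric form on $\mathfrak g$ with short roots of squared length $2$; $h_i\in\mathfrak h$ corresponds to $\alpha_i$ under $\mathfrak h\cong\mathfrak h^*$; $\varpi_i^\vee\in\mathfrak h$ satisfy $\alpha_j(\varpi_i^\vee)=\delta_{ij}$. $\mathsf Q_+=\bigoplus\mathbb Z_{\ge0}\alpha_i$, $\mathsf Q_-=-\mathsf Q_+$, $\dot{\mathsf Q}_\pm=\mathsf Q_\pm\setminus\{0\}$. $x_\alpha^\pm\in\mathfrak g_{\pm\alpha}$ ($\alpha\in\Phi^+$) are fixed root vectors with $(x_\alpha^+,x_\alpha^-)=1$, and $x_i^\pm=x_{\alpha_i}^\pm$. Put $r=\sum_{\alpha\in\Phi^+}x_\alpha^+\otimes x_\alpha^-+\frac12\sum_{i}\varpi_i^\vee\otimes h_i\in\mathfrak g\otimes\mathfrak g$. $D(\mathfrak b^+)$ is the Drinfeld double of the Borel subalgebra, realized as the Lie algebra direct sum $\mathfrak g\oplus\mathfrak h$. Let $\zeta:\mathfrak h\to\mathfrak g\oplus\mathfrak h$ be the inclusion onto the second (central) summand and $h^\pm=h\pm\zeta(h)$ for $h\in\mathfrak h$. Its Lie cobracket is $\delta(x)=[x\otimes1+1\otimes x,r^D]$ with $r^D=\sum_{\alpha\in\Phi^+}x_\alpha^+\otimes x_\alpha^-+\frac12\sum_i(\varpi_i^\vee)^+\otimes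 h_i^-$. $\omega$ is the Lie algebra involution of $\mathfrak g\oplus\mathfrak h$ given by the Chevalley involution on $\mathfrak g$ ($h\mapsto-h$, $x_i^\pm\mapsto-x_i^\mp$) and by the identity on the central copy of $\mathfrak h$. $\pi:U(\mathfrak g)\to\operatorname{End}(V)$ is the action, extended to $D(\mathfrak b^+)$ by letting the central copy of $\mathfrak h$ act by $0$; $r_\pi=(\pi\otimes\pi)(r)$. $\mathbb L^+=(\pi\otimes\omega)(r^D)$ and $\mathbb L^-=-(\pi\otimes\omega)(r^D_{21})$ in $\operatorname{End}(V)\otimes D(\mathfrak b^+)$. $\mathfrak{gl}(V)=\operatorname{End}(V)$ is a $\mathfrak g$-module under the adjoint action with weight spaces $\mathfrak{gl}(V)_\mu$; for a vector space $W$ and $X\in\operatorname{End}(V)\otimes W$, $X_\mu$ denotes its component in $\mathfrak{gl}(V)_\mu\otimes W$. Subscripts $1,2$ on an element of $\operatorname{End}(V)\otimes\mathfrak a$ indicate the copy of $\operatorname{End}(V)$ in $\operatorname{End}(V)^{\otimes 2}\otimes U(\mathfrak a)$; subscripts $[1],[2]$ indicate the copy of $U(\mathfrak a)$ in $\operatorname{End}(V)\otimes U(\mathfrak a)^{\otimes2}$. Maps such as $\delta$ are applied to matrices coefficientwise. $\mathfrak g_r$ is the complex Lie algebra generated by $\{l_{ij}^\pm\}_{i,j\in\mathcal I}$ ($\mathcal I$ indexing a fixed basis of $V$ with matrix units $E_{ij}$) subject, with $L^\pm=\sum_{i,j}E_{ij}\otimes l^\pm_{ij}$, to: $L^\pm_\lambda=0$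 for all $\lambda\in\dot{\mathsf Q}_\mp$; $[L_1^\pm,L_2^\pm]=-[r_\pi,L_1^\pm+L_2^\pm]$; $[L_1^+,L_2^-]=-[r_\pi,L_1^++L_2^-]$. $\mathfrak z_V^+$ is the Lie bialgebra dual to the Lie algebra $\mathfrak{gl}(V)^{\mathfrak g}=\operatorname{End}_{\mathfrak g}(V)$ equipped with zero cobracket; it is an abelian Lie algebra, and its canonical element $\mathfrak Z^+\in\mathfrak{gl}(V)^{\mathfrak g}\otimes\mathfrak z_V^+$ satisfies $\delta(\mathfrak Z^+)=[\mathfrak Z^+_{[1]},\mathfrak Z^+_{[2]}]$. $\mathfrak z_V^-$ is the same Lie algebra with cobracket $-\delta$, with canonical element $\mathfrak Z^-$ (equal to $\mathfrak Z^+$ viewed in $\mathfrak{gl}(V)^{\mathfrak g}\otimes\mathfrak z_V^-$). *)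

theory Defs
  imports
    "HOL-Analysis.Analysis"
    "HOL-Library.Function_Algebras"
    "HOL-Library.Poly_Mapping"
begin

section \<open>Complex Lie algebras on a type\<close>

definition lie_algebra :: "(complex \<Rightarrow> 'a::ab_group_add \<Rightarrow> 'a) \<Rightarrow> ('a \<Rightarrow> 'a \<Rightarrow> 'a) \<Rightarrow> bool" where
  "lie_algebra s br \<longleftrightarrow>
     vector_space s \<and>
     (\<forall>x. Vector_Spaces.linear s s (\<lambda>y. br x y)) \<and>
     (\<forall>y. Vector_Spaces.linear s s (\<lambda>x. br x y)) \<and>
     (\<forall>x. br x x = 0) \<and>
     (\<forall>x y z. br x (br y z) + br y (br z x) + br z (br x y) = 0)"

definition simple_lie_algebra :: "(complex \<Rightarrow> 'a::ab_group_add \<Rightarrow> 'a) \<Rightarrow> ('a \<Rightarrow> 'a \<Rightarrow> 'a) \<Rightarrow> bool" where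
  "simple_lie_algebra s br \<longleftrightarrow>
     lie_algebra s br \<and>
     (\<exists>B. finite B \<and> module.span s B = UNIV) \<and>
     (\<exists>x y. br x y \<noteq> 0) \<and>
     (\<forall>I. module.subspace s I \<and> (\<forall>x. \<forall>y\<in>I. br x y \<in> I) \<longrightarrow> I = {0} \<or> I = UNIV)"

text \<open>The usual description of Cartan subalgebras of a complex semisimple Lie algebra: abelian,
  self-centralizing, and acting diagonalizably in the adjoint representation.\<close>

definition cartan_subalgebra ::
  "(complex \<Rightarrow> 'a::ab_group_add \<Rightarrow> 'a) \<Rightarrow> ('a \<Rightarrow> 'a \<Rightarrow> 'a) \<Rightarrow> 'a set \<Rightarrow> bool" where
  "cartan_subalgebra s br H \<longleftrightarrow>
     module.subspace s H \<and>
     (\<forall>x\<in>H. \<forall>y\<in>H. br x y = 0) \<and>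
     (\<forall>x. (\<forall>h\<in>H. br h x = 0) \<longrightarrow> x \<in> H) \<and>
     (\<forall>h\<in>H. module.span s {x. \<exists>c. br h x = s c x} = UNIV)"

text \<open>Linear functionals on a subspace are represented by functions vanishing outside of it, so
  that they are closed under the pointwise operations and equal as soon as they agree on the
  subspace.\<close>

definition dual_space :: "(complex \<Rightarrow> 'a::ab_group_add \<Rightarrow> 'a) \<Rightarrow> 'a set \<Rightarrow> ('a \<Rightarrow> complex) set" where
  "dual_space s S = {f. (\<forall>x\<in>S. \<forall>y\<in>S. f (x + y) = f x + f y) \<and>
     (\<forall>c. \<forall>x\<in>S. f (s c x) = c * f x) \<and> (\<forall>x. x \<notin> S \<longrightarrow> f x = 0)}"


section \<open>Lie algebras with a carrier, tensors and cobrackets\<close>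

record 'a lie_struct =
  lie_carrier :: "'a set"
  lie_zero :: 'a
  lie_add :: "'a \<Rightarrow> 'a \<Rightarrow> 'a"
  lie_scale :: "complex \<Rightarrow> 'a \<Rightarrow> 'a"
  lie_bracket :: "'a \<Rightarrow> 'a \<Rightarrow> 'a"

definition lie_on ::
  "'a::ab_group_add set \<Rightarrow> (complex \<Rightarrow> 'a \<Rightarrow> 'a) \<Rightarrow> ('a \<Rightarrow> 'a \<Rightarrow> 'a) \<Rightarrow> 'a lie_struct" where
  "lie_on A s br = \<lparr>lie_carrier = A, lie_zero = 0, lie_add = (+), lie_scale = s, lie_bracket = br\<rparr>"

definition lie_sum :: "'a lie_struct \<Rightarrow> 'b lie_struct \<Rightarrow> ('a \<times> 'b) lie_struct" where
  "lie_sum L M =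
    \<lparr>lie_carrier = lie_carrier L \<times> lie_carrier M,
     lie_zero = (lie_zero L, lie_zero M),
     lie_add = (\<lambda>(x, y) (x', y'). (lie_add L x x', lie_add M y y')),
     lie_scale = (\<lambda>c (x, y). (lie_scale L c x, lie_scale M c y)),
     lie_bracket = (\<lambda>(x, y) (x', y'). (lie_bracket L x x', lie_bracket M y y'))\<rparr>"

definition lie_hom :: "'a lie_struct \<Rightarrow> 'b lie_struct \<Rightarrow> ('a \<Rightarrow> 'b) \<Rightarrow> bool" where
  "lie_hom L M f \<longleftrightarrow>
     f ` lie_carrier L \<subseteq> lie_carrier M \<and>
     (\<forall>x\<in>lie_carrier L. \<forall>y\<in>lie_carrier L. f (lie_add L x y) = lie_add M (f x) (f y)) \<and>
     (\<forall>c. \<forall>x\<in>lie_carrier L. f (lie_scale L c x) = lie_scale M c (f x)) \<and>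
     (\<forall>x\<in>lie_carrier L. \<forall>y\<in>lie_carrier L. f (lie_bracket L x y) = lie_bracket M (f x) (f y))"

definition lie_iso :: "'a lie_struct \<Rightarrow> 'b lie_struct \<Rightarrow> ('a \<Rightarrow> 'b) \<Rightarrow> bool" where
  "lie_iso L M f \<longleftrightarrow> lie_hom L M f \<and> bij_betw f (lie_carrier L) (lie_carrier M)"

text \<open>The tensor square of \<open>L\<close> is realized as the span of the evaluations
  \<open>x \<otimes> y = (\<beta> \<mapsto> \<beta> x y)\<close> inside the dual of the space of bilinear forms on \<open>L\<close> (over a field,
  bilinear forms separate tensors). Evaluations are set to \<open>0\<close> on functions which are not
  bilinear on the carrier. Scalars are absorbed in the first factor. The tensor cube is treated
  in the same way, with trilinear forms.\<close>

definition linear_form :: "'a lie_struct \<Rightarrow> ('a \<Rightarrow> complex) \<Rightarrow> bool" where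
  "linear_form L f \<longleftrightarrow>
     (\<forall>x\<in>lie_carrier L. \<forall>y\<in>lie_carrier L. f (lie_add L x y) = f x + f y) \<and>
     (\<forall>c. \<forall>x\<in>lie_carrier L. f (lie_scale L c x) = c * f x)"

definition bilinear_form :: "'a lie_struct \<Rightarrow> ('a \<Rightarrow> 'a \<Rightarrow> complex) \<Rightarrow> bool" where
  "bilinear_form L \<beta> \<longleftrightarrow>
     (\<forall>x\<in>lie_carrier L. linear_form L (\<lambda>y. \<beta> x y) \<and> linear_form L (\<lambda>y. \<beta> y x))"

definition trilinear_form :: "'a lie_struct \<Rightarrow> ('a \<Rightarrow> 'a \<Rightarrow> 'a \<Rightarrow> complex) \<Rightarrow> bool" where
  "trilinear_form L \<gamma> \<longleftrightarrow>
     (\<forall>x\<in>lie_carrier L. \<forall>y\<in>lie_carrier L.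
        linear_form L (\<lambda>z. \<gamma> x y z) \<and> linear_form L (\<lambda>z. \<gamma> x z y) \<and> linear_form L (\<lambda>z. \<gamma> z x y))"

type_synonym 'a tensor2 = "('a \<Rightarrow> 'a \<Rightarrow> complex) \<Rightarrow> complex"
type_synonym 'a tensor3 = "('a \<Rightarrow> 'a \<Rightarrow> 'a \<Rightarrow> complex) \<Rightarrow> complex"

definition tens :: "'a lie_struct \<Rightarrow> 'a \<Rightarrow> 'a \<Rightarrow> 'a tensor2" where
  "tens L x y = (\<lambda>\<beta>. if bilinear_form L \<beta> then \<beta> x y else 0)"

definition tens3 :: "'a lie_struct \<Rightarrow> 'a \<Rightarrow> 'a \<Rightarrow> 'a \<Rightarrow> 'a tensor3" where
  "tens3 L x y z = (\<lambda>\<gamma>. if trilinear_form L \<gamma> then \<gamma> x y z else 0)"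

definition tensor_square :: "'a lie_struct \<Rightarrow> 'a tensor2 set" where
  "tensor_square L = {\<Sum>k<n. tens L (x k) (y k) | (n::nat) x y.
     \<forall>k<n. x k \<in> lie_carrier L \<and> y k \<in> lie_carrier L}"

text \<open>For a bilinear map \<open>m\<close> with values in tensors, \<open>tlift m\<close> is the induced linear map
  \<open>x \<otimes> y \<mapsto> m x y\<close>.\<close>

definition tlift :: "('a \<Rightarrow> 'a \<Rightarrow> 'c \<Rightarrow> complex) \<Rightarrow> 'a tensor2 \<Rightarrow> 'c \<Rightarrow> complex" where
  "tlift m T = (\<lambda>\<gamma>. T (\<lambda>x y. m x y \<gamma>))"

text \<open>The map \<open>f \<otimes> f\<close>, for linear \<open>f\<close> with values in \<open>M\<close>.\<close>

definition tensor_map :: "'b lie_struct \<Rightarrow> ('a \<Rightarrow> 'b) \<Rightarrow> 'a tensor2 \<Rightarrow> 'b tensor2" where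
  "tensor_map M f = tlift (\<lambda>x y. tens M (f x) (f y))"

definition adjoint2 :: "'a lie_struct \<Rightarrow> 'a \<Rightarrow> 'a tensor2 \<Rightarrow> 'a tensor2" where
  "adjoint2 L x = tlift (\<lambda>a b. tens L (lie_bracket L x a) b + tens L a (lie_bracket L x b))"

text \<open>Lie bialgebra structures \<open>\<delta> : L \<rightarrow> L \<and> L\<close>: linear with skew-symmetric values, satisfying the
  co-Jacobi identity (vanishing of the cyclic sum of \<open>(\<delta> \<otimes> id) (\<delta> x)\<close>) and the cocycle
  identity.\<close>

definition lie_cobracket :: "'a lie_struct \<Rightarrow> ('a \<Rightarrow> 'a tensor2) \<Rightarrow> bool" where
  "lie_cobracket L \<delta> \<longleftrightarrow>
     (\<forall>x\<in>lie_carrier L. \<delta> x \<in> tensor_square L \<and> tlift (\<lambda>a b. tens L b a) (\<delta> x) = - \<delta> x) \<and>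
     (\<forall>x\<in>lie_carrier L. \<forall>y\<in>lie_carrier L. \<delta> (lie_add L x y) = \<delta> x + \<delta> y) \<and>
     (\<forall>c. \<forall>x\<in>lie_carrier L. \<delta> (lie_scale L c x) = (\<lambda>\<beta>. c * \<delta> x \<beta>)) \<and>
     (\<forall>x\<in>lie_carrier L.
        let J = tlift (\<lambda>a b. tlift (\<lambda>a' a''. tens3 L a' a'' b) (\<delta> a)) (\<delta> x)
        in \<forall>\<gamma>. J \<gamma> + J (\<lambda>a b c. \<gamma> b c a) + J (\<lambda>a b c. \<gamma> c a b) = 0) \<and>
     (\<forall>x\<in>lie_carrier L. \<forall>y\<in>lie_carrier L.
        \<delta> (lie_bracket L x y) = adjoint2 L x (\<delta> y) - adjoint2 L y (\<delta> x))"

definition cobracket_sum ::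
  "'a lie_struct \<Rightarrow> 'b lie_struct \<Rightarrow> ('a \<Rightarrow> 'a tensor2) \<Rightarrow> ('b \<Rightarrow> 'b tensor2) \<Rightarrow> 'a \<times> 'b \<Rightarrow> ('a \<times> 'b) tensor2" where
  "cobracket_sum L M \<delta>\<^sub>1 \<delta>\<^sub>2 = (\<lambda>(x, y).
     tensor_map (lie_sum L M) (\<lambda>a. (a, lie_zero M)) (\<delta>\<^sub>1 x) +
     tensor_map (lie_sum L M) (\<lambda>b. (lie_zero L, b)) (\<delta>\<^sub>2 y))"

text \<open>An element \<open>X = \<Sum> E\<^sub>i\<^sub>j \<otimes> x\<^sub>i\<^sub>j\<close> of \<open>End V \<otimes> W\<close> is the function \<open>i j \<mapsto> x\<^sub>i\<^sub>j\<close>. The commutator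
  \<open>[X\<^sub>[\<^sub>1\<^sub>], X\<^sub>[\<^sub>2\<^sub>]]\<close> in \<open>End V \<otimes> U(L) \<otimes> U(L)\<close> has coefficients in \<open>L \<otimes> L\<close>: its two products have
  \<open>E\<^sub>i\<^sub>k\<close>-coefficients \<open>\<Sum>\<^sub>j x\<^sub>i\<^sub>j \<otimes> x\<^sub>j\<^sub>k\<close> and \<open>\<Sum>\<^sub>j x\<^sub>j\<^sub>k \<otimes> x\<^sub>i\<^sub>j\<close>.\<close>

definition leg_commutator ::
  "'a lie_struct \<Rightarrow> ('n::finite \<Rightarrow> 'n \<Rightarrow> 'a) \<Rightarrow> 'n \<Rightarrow> 'n \<Rightarrow> 'a tensor2" where
  "leg_commutator L X i k = (\<Sum>j\<in>UNIV. tens L (X i j) (X j k) - tens L (X j k) (X i j))"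


section \<open>Lie algebras given by generators and relations\<close>

text \<open>The free nonassociative complex algebra on \<open>'x\<close> has the bracketed words as a basis. A
  presented Lie algebra is its quotient by the two-sided ideal generated by the Lie algebra
  axioms and the relators.\<close>

datatype 'x lie_word = Gen 'x | Br "'x lie_word" "'x lie_word"

type_synonym 'x free_alg = "'x lie_word \<Rightarrow>\<^sub>0 complex"

definition free_gen :: "'x \<Rightarrow> 'x free_alg" where
  "free_gen a = Poly_Mapping.single (Gen a) 1"

definition free_scale :: "complex \<Rightarrow> 'x free_alg \<Rightarrow> 'x free_alg" where
  "free_scale c p = Poly_Mapping.map ((*) c) p"

definition free_mult :: "'x free_alg \<Rightarrow> 'x free_alg \<Rightarrow> 'x free_alg" where
  "free_mult p q = (\<Sum>u\<in>Poly_Mapping.keys p. \<Sum>v\<in>Poly_Mapping.keys q.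
     Poly_Mapping.single (Br u v) (Poly_Mapping.lookup p u * Poly_Mapping.lookup q v))"

definition free_ideal :: "'x free_alg set \<Rightarrow> bool" where
  "free_ideal I \<longleftrightarrow> module.subspace free_scale I \<and>
     (\<forall>p. \<forall>q\<in>I. free_mult p q \<in> I \<and> free_mult q p \<in> I)"

definition lie_axiom_relators :: "'x free_alg set" where
  "lie_axiom_relators =
     {free_mult p p | p. True} \<union>
     {free_mult p (free_mult q r) + free_mult q (free_mult r p) + free_mult r (free_mult p q) | p q r. True}"

definition relator_ideal :: "'x free_alg set \<Rightarrow> 'x free_alg set" where
  "relator_ideal R = free_ideal hull (lie_axiom_relators \<union> R)"

definition pres_class :: "'x free_alg set \<Rightarrow> 'x free_alg \<Rightarrow> 'x free_alg set" where
  "pres_class R p = {q. q - p \<in> relator_ideal R}"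

definition presented_lie :: "'x free_alg set \<Rightarrow> 'x free_alg set lie_struct" where
  "presented_lie R =
    \<lparr>lie_carrier = range (pres_class R),
     lie_zero = pres_class R 0,
     lie_add = (\<lambda>A B. \<Union>p\<in>A. \<Union>q\<in>B. pres_class R (p + q)),
     lie_scale = (\<lambda>c A. \<Union>p\<in>A. pres_class R (free_scale c p)),
     lie_bracket = (\<lambda>A B. \<Union>p\<in>A. \<Union>q\<in>B. pres_class R (free_mult p q))\<rparr>"


section \<open>The data attached to a simple Lie algebra and a faithful module\<close>

text \<open>Positive root vectors are indexed by the roots. The module \<open>V\<close>, with its fixed basis indexed
  by \<open>'n\<close>, enters through the matrices \<open>action x\<close>.\<close>

record ('g, 'i, 'n) rmatrix_datum =
  scl :: "complex \<Rightarrow> 'g \<Rightarrow> 'g"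
  brk :: "'g \<Rightarrow> 'g \<Rightarrow> 'g"
  cartan :: "'g set"
  form :: "'g \<Rightarrow> 'g \<Rightarrow> complex"
  simple_root :: "'i \<Rightarrow> 'g \<Rightarrow> complex"
  xpos :: "('g \<Rightarrow> complex) \<Rightarrow> 'g"
  xneg :: "('g \<Rightarrow> complex) \<Rightarrow> 'g"
  chevalley :: "'g \<Rightarrow> 'g"
  action :: "'g \<Rightarrow> complex^'n^'n"

definition mat_scale :: "complex \<Rightarrow> complex^'n^'n \<Rightarrow> complex^'n^'n" where
  "mat_scale c A = (\<chi> i j. c * A $ i $ j)"

definition mat_unit :: "'n \<Rightarrow> 'n \<Rightarrow> complex^'n^'n" where
  "mat_unit i j = (\<chi> k l. if k = i \<and> l = j then 1 else 0)"

context
  fixes \<D> :: "('g::ab_group_add, 'i::finite, 'n::finite) rmatrix_datum"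
begin

definition root_space :: "('g \<Rightarrow> complex) \<Rightarrow> 'g set" where
  "root_space \<mu> = {x. \<forall>h\<in>cartan \<D>. brk \<D> h x = scl \<D> (\<mu> h) x}"

definition roots :: "('g \<Rightarrow> complex) set" where
  "roots = {\<mu> \<in> dual_space (scl \<D>) (cartan \<D>). \<mu> \<noteq> 0 \<and> root_space \<mu> \<noteq> {0}}"

definition Q_plus :: "('g \<Rightarrow> complex) set" where
  "Q_plus = {\<Sum>i\<in>UNIV. (\<lambda>h. of_nat (c i) * simple_root \<D> i h) | c :: 'i \<Rightarrow> nat. True}"

definition Q_minus :: "('g \<Rightarrow> complex) set" where
  "Q_minus = uminus ` Q_plus"

definition positive_roots :: "('g \<Rightarrow> complex) set" where
  "positive_roots = roots \<inter> Q_plus"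

definition is_simple_system :: bool where
  "is_simple_system \<longleftrightarrow>
     range (simple_root \<D>) \<subseteq> roots \<and>
     (\<forall>c. (\<Sum>i\<in>UNIV. (\<lambda>h. c i * simple_root \<D> i h)) = 0 \<longrightarrow> (\<forall>i. c i = 0)) \<and>
     roots \<subseteq> Q_plus \<union> Q_minus"

text \<open>The isomorphism from the dual of the Cartan subalgebra to the Cartan subalgebra, and the
  induced form on the dual.\<close>

definition form_dual :: "('g \<Rightarrow> complex) \<Rightarrow> 'g" where
  "form_dual \<mu> = (THE t. t \<in> cartan \<D> \<and> (\<forall>h\<in>cartan \<D>. form \<D> t h = \<mu> h))"

definition weight_form :: "('g \<Rightarrow> complex) \<Rightarrow> ('g \<Rightarrow> complex) \<Rightarrow> complex" where
  "weight_form \<mu> \<nu> = form \<D> (form_dual \<mu>) (form_dual \<nu>)"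

text \<open>Short roots are those of minimal length (all roots, in the simply laced case). Since the
  invariant form is unique up to a complex factor, lengths are compared by absolute value; the
  last conjunct then fixes the factor.\<close>

definition is_normalized_form :: bool where
  "is_normalized_form \<longleftrightarrow>
     (\<forall>x. Vector_Spaces.linear (scl \<D>) (*) (\<lambda>y. form \<D> x y)) \<and>
     (\<forall>x y. form \<D> x y = form \<D> y x) \<and>
     (\<forall>x y z. form \<D> (brk \<D> x y) z = form \<D> x (brk \<D> y z)) \<and>
     (\<forall>x. (\<forall>y. form \<D> x y = 0) \<longrightarrow> x = 0) \<and>
     (\<forall>\<alpha>\<in>roots. (\<forall>\<beta>\<in>roots. cmod (weight_form \<alpha> \<alpha>) \<le> cmod (weight_form \<beta> \<beta>)) \<longrightarrow>
        weight_form \<alpha> \<alpha> = 2)"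

definition hvec :: "'i \<Rightarrow> 'g" where
  "hvec i = form_dual (simple_root \<D> i)"

definition fund_coweight :: "'i \<Rightarrow> 'g" where
  "fund_coweight i =
     (THE h. h \<in> cartan \<D> \<and> (\<forall>j. simple_root \<D> j h = (if i = j then 1 else 0)))"

definition are_root_vectors :: bool where
  "are_root_vectors \<longleftrightarrow>
     (\<forall>\<alpha>\<in>positive_roots. xpos \<D> \<alpha> \<in> root_space \<alpha> \<and> xneg \<D> \<alpha> \<in> root_space (- \<alpha>) \<and>
        form \<D> (xpos \<D> \<alpha>) (xneg \<D> \<alpha>) = 1)"

definition is_chevalley_involution :: bool where
  "is_chevalley_involution \<longleftrightarrow>
     Vector_Spaces.linear (scl \<D>) (scl \<D>) (chevalley \<D>) \<and>
     (\<forall>x y. chevalley \<D> (brk \<D> x y) = brk \<D> (chevalley \<D> x) (chevalley \<D> y)) \<and>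
     (\<forall>x. chevalley \<D> (chevalley \<D> x) = x) \<and>
     (\<forall>h\<in>cartan \<D>. chevalley \<D> h = - h) \<and>
     (\<forall>i. chevalley \<D> (xpos \<D> (simple_root \<D> i)) = - xneg \<D> (simple_root \<D> i) \<and>
          chevalley \<D> (xneg \<D> (simple_root \<D> i)) = - xpos \<D> (simple_root \<D> i))"

definition is_faithful_module :: bool where
  "is_faithful_module \<longleftrightarrow>
     Vector_Spaces.linear (scl \<D>) mat_scale (action \<D>) \<and>
     (\<forall>x y. action \<D> (brk \<D> x y) = action \<D> x ** action \<D> y - action \<D> y ** action \<D> x) \<and>
     inj (action \<D>)"


subsection \<open>The r-matrix and the double of the Borel subalgebra\<close>

text \<open>\<open>r_sum b\<close> is the image of \<open>r\<close> under the linear map on \<open>\<gg> \<otimes> \<gg>\<close> induced by a bilinear map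
  \<open>b\<close>, i.e. \<open>b\<close> is applied to each summand; \<open>rD_sum b\<close> is the same for \<open>r\<^sup>D\<close>.\<close>

definition r_sum :: "('g \<Rightarrow> 'g \<Rightarrow> 'c::comm_monoid_add) \<Rightarrow> 'c" where
  "r_sum b = (\<Sum>\<alpha>\<in>positive_roots. b (xpos \<D> \<alpha>) (xneg \<D> \<alpha>)) +
     (\<Sum>i\<in>UNIV. b (scl \<D> (1/2) (fund_coweight i)) (hvec i))"

definition double :: "('g \<times> 'g) lie_struct" where
  "double = lie_sum (lie_on UNIV (scl \<D>) (brk \<D>)) (lie_on (cartan \<D>) (scl \<D>) (\<lambda>_ _. 0))"

definition h_plus :: "'g \<Rightarrow> 'g \<times> 'g" where "h_plus h = (h, h)"

definition h_minus :: "'g \<Rightarrow> 'g \<times> 'g" where "h_minus h = (h, - h)"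

definition rD_sum :: "('g \<times> 'g \<Rightarrow> 'g \<times> 'g \<Rightarrow> 'c::comm_monoid_add) \<Rightarrow> 'c" where
  "rD_sum b = (\<Sum>\<alpha>\<in>positive_roots. b (xpos \<D> \<alpha>, 0) (xneg \<D> \<alpha>, 0)) +
     (\<Sum>i\<in>UNIV. b (lie_scale double (1/2) (h_plus (fund_coweight i))) (h_minus (hvec i)))"

definition double_cobracket :: "'g \<times> 'g \<Rightarrow> ('g \<times> 'g) tensor2" where
  "double_cobracket x = adjoint2 double x (rD_sum (tens double))"

definition double_omega :: "'g \<times> 'g \<Rightarrow> 'g \<times> 'g" where
  "double_omega = (\<lambda>(x, h). (chevalley \<D> x, h))"

definition double_action :: "'g \<times> 'g \<Rightarrow> complex^'n^'n" where
  "double_action = (\<lambda>(x, h). action \<D> x)"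

definition LL_plus :: "'n \<Rightarrow> 'n \<Rightarrow> 'g \<times> 'g" where
  "LL_plus i j = rD_sum (\<lambda>a b. lie_scale double (double_action a $ i $ j) (double_omega b))"

definition LL_minus :: "'n \<Rightarrow> 'n \<Rightarrow> 'g \<times> 'g" where
  "LL_minus i j = - rD_sum (\<lambda>a b. lie_scale double (double_action b $ i $ j) (double_omega a))"


subsection \<open>The Lie bialgebra dual to the invariants of the matrix algebra\<close>

definition gl_invariants :: "(complex^'n^'n) set" where
  "gl_invariants = {X. \<forall>x. action \<D> x ** X = X ** action \<D> x}"

definition zV :: "(complex^'n^'n \<Rightarrow> complex) lie_struct" where
  "zV = lie_on (dual_space mat_scale gl_invariants) (\<lambda>c f X. c * f X) (\<lambda>_ _. 0)"

definition zV_cobracket :: "(complex^'n^'n \<Rightarrow> complex) \<Rightarrow> (complex^'n^'n \<Rightarrow> complex) tensor2" where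
  "zV_cobracket f = (THE t. t \<in> tensor_square zV \<and>
     (\<forall>X\<in>gl_invariants. \<forall>Y\<in>gl_invariants. t (\<lambda>g g'. g X * g' Y) = f (X ** Y - Y ** X)))"

text \<open>The canonical element corresponds to the identity map of the invariants: the coefficient of
  \<open>E\<^sub>i\<^sub>j\<close> in \<open>\<Sum> X\<^sub>a \<otimes> X\<^sup>a\<close>, for dual bases, is the functional \<open>X \<mapsto> X\<^sub>i\<^sub>j\<close>.\<close>

definition ZZ :: "'n \<Rightarrow> 'n \<Rightarrow> complex^'n^'n \<Rightarrow> complex" where
  "ZZ i j = (\<lambda>X. if X \<in> gl_invariants then X $ i $ j else 0)"

type_synonym ('h, 'm) target_type =
  "('h \<times> 'h) \<times> (complex^'m^'m \<Rightarrow> complex) \<times> (complex^'m^'m \<Rightarrow> complex)"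

text \<open>The second copy of \<open>zV\<close> carries the opposite cobracket.\<close>

definition target :: "('g, 'n) target_type lie_struct" where
  "target = lie_sum double (lie_sum zV zV)"

definition target_cobracket :: "('g, 'n) target_type \<Rightarrow> ('g, 'n) target_type tensor2" where
  "target_cobracket = cobracket_sum double (lie_sum zV zV) double_cobracket
     (cobracket_sum zV zV zV_cobracket (\<lambda>f. - zV_cobracket f))"

definition target_L_plus :: "'n \<Rightarrow> 'n \<Rightarrow> ('g, 'n) target_type" where
  "target_L_plus i j = (LL_plus i j, ZZ i j, 0)"

definition target_L_minus :: "'n \<Rightarrow> 'n \<Rightarrow> ('g, 'n) target_type" where
  "target_L_minus i j = (LL_minus i j, 0, - ZZ i j)"


subsection \<open>The r-matrix Lie algebra\<close>

definition gl_weight_space :: "('g \<Rightarrow> complex) \<Rightarrow> (complex^'n^'n) set" where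
  "gl_weight_space \<mu> =
     {X. \<forall>h\<in>cartan \<D>. action \<D> h ** X - X ** action \<D> h = mat_scale (\<mu> h) X}"

definition gl_component :: "('g \<Rightarrow> complex) \<Rightarrow> complex^'n^'n \<Rightarrow> complex^'n^'n" where
  "gl_component \<mu> X = (THE Y. Y \<in> gl_weight_space \<mu> \<and>
     X - Y \<in> module.span mat_scale
       (\<Union>\<nu>\<in>dual_space (scl \<D>) (cartan \<D>) - {\<mu>}. gl_weight_space \<nu>))"

end

datatype 'n lgen = Lplus 'n 'n | Lminus 'n 'n

text \<open>Elements of \<open>End V \<otimes> End V \<otimes> W\<close> are \<open>W\<close>-valued matrices with rows and columns indexed by
  pairs; \<open>leg1 X\<close> and \<open>leg2 X\<close> are \<open>X\<^sub>1\<close> and \<open>X\<^sub>2\<close>.\<close>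

definition leg1 :: "('n \<Rightarrow> 'n \<Rightarrow> 'w::zero) \<Rightarrow> 'n \<times> 'n \<Rightarrow> 'n \<times> 'n \<Rightarrow> 'w" where
  "leg1 X = (\<lambda>(i, k) (j, l). if k = l then X i j else 0)"

definition leg2 :: "('n \<Rightarrow> 'n \<Rightarrow> 'w::zero) \<Rightarrow> 'n \<times> 'n \<Rightarrow> 'n \<times> 'n \<Rightarrow> 'w" where
  "leg2 X = (\<lambda>(i, k) (j, l). if i = j then X k l else 0)"

definition kron :: "complex^'n^'n \<Rightarrow> complex^'n^'n \<Rightarrow> 'n \<times> 'n \<Rightarrow> 'n \<times> 'n \<Rightarrow> complex" where
  "kron A B = (\<lambda>(i, k) (j, l). A $ i $ j * B $ k $ l)"

definition scalar_commutator ::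
  "('m::finite \<Rightarrow> 'm \<Rightarrow> complex) \<Rightarrow> ('m \<Rightarrow> 'm \<Rightarrow> 'x free_alg) \<Rightarrow> 'm \<Rightarrow> 'm \<Rightarrow> 'x free_alg" where
  "scalar_commutator A X p q =
     (\<Sum>u\<in>UNIV. free_scale (A p u) (X u q) - free_scale (A u q) (X p u))"

text \<open>\<open>[X\<^sub>1, Y\<^sub>2] = \<Sum> E\<^sub>i\<^sub>j \<otimes> E\<^sub>k\<^sub>l \<otimes> [x\<^sub>i\<^sub>j, y\<^sub>k\<^sub>l]\<close>, the matrix units in different copies of \<open>End V\<close>
  commuting and the commutator in the enveloping algebra of Lie algebra elements being their
  Lie bracket.\<close>

definition leg12_bracket ::
  "('n \<Rightarrow> 'n \<Rightarrow> 'x free_alg) \<Rightarrow> ('n \<Rightarrow> 'n \<Rightarrow> 'x free_alg) \<Rightarrow> 'n \<times> 'n \<Rightarrow> 'n \<times> 'n \<Rightarrow> 'x free_alg" where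
  "leg12_bracket X Y = (\<lambda>(i, k) (j, l). free_mult (X i j) (Y k l))"

definition free_L_plus :: "'n \<Rightarrow> 'n \<Rightarrow> 'n lgen free_alg" where
  "free_L_plus i j = free_gen (Lplus i j)"

definition free_L_minus :: "'n \<Rightarrow> 'n \<Rightarrow> 'n lgen free_alg" where
  "free_L_minus i j = free_gen (Lminus i j)"

context
  fixes \<D> :: "('g::ab_group_add, 'i::finite, 'n::finite) rmatrix_datum"
begin

definition r_pi :: "'n \<times> 'n \<Rightarrow> 'n \<times> 'n \<Rightarrow> complex" where
  "r_pi = r_sum \<D> (\<lambda>a b. kron (action \<D> a) (action \<D> b))"

text \<open>\<open>X\<^sub>\<mu> = \<Sum> (E\<^sub>i\<^sub>j)\<^sub>\<mu> \<otimes> x\<^sub>i\<^sub>j\<close>.\<close>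

definition weight_component ::
  "('g \<Rightarrow> complex) \<Rightarrow> ('n \<Rightarrow> 'n \<Rightarrow> 'x free_alg) \<Rightarrow> 'n \<Rightarrow> 'n \<Rightarrow> 'x free_alg" where
  "weight_component \<mu> X k l =
     (\<Sum>i\<in>UNIV. \<Sum>j\<in>UNIV. free_scale (gl_component \<D> \<mu> (mat_unit i j) $ k $ l) (X i j))"

definition r_relator ::
  "('n \<Rightarrow> 'n \<Rightarrow> 'x free_alg) \<Rightarrow> ('n \<Rightarrow> 'n \<Rightarrow> 'x free_alg) \<Rightarrow> 'n \<times> 'n \<Rightarrow> 'n \<times> 'n \<Rightarrow> 'x free_alg" where
  "r_relator X Y = leg12_bracket X Y + scalar_commutator r_pi (leg1 X + leg2 Y)"

definition g_r_relators :: "'n lgen free_alg set" where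
  "g_r_relators =
     {weight_component \<mu> free_L_plus k l | \<mu> k l. \<mu> \<in> Q_minus \<D> - {0}} \<union>
     {weight_component \<mu> free_L_minus k l | \<mu> k l. \<mu> \<in> Q_plus \<D> - {0}} \<union>
     {r_relator free_L_plus free_L_plus p q | p q. True} \<union>
     {r_relator free_L_minus free_L_minus p q | p q. True} \<union>
     {r_relator free_L_plus free_L_minus p q | p q. True}"

definition g_r :: "'n lgen free_alg set lie_struct" where
  "g_r = presented_lie g_r_relators"

definition L_plus :: "'n \<Rightarrow> 'n \<Rightarrow> 'n lgen free_alg set" where
  "L_plus i j = pres_class g_r_relators (free_L_plus i j)"

definition L_minus :: "'n \<Rightarrow> 'n \<Rightarrow> 'n lgen free_alg set" where
  "L_minus i j = pres_class g_r_relators (free_L_minus i j)"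

definition maps_generators :: "('n lgen free_alg set \<Rightarrow> ('g, 'n) target_type) \<Rightarrow> bool" where
  "maps_generators f \<longleftrightarrow>
     (\<forall>i j. f (L_plus i j) = target_L_plus \<D> i j \<and> f (L_minus i j) = target_L_minus \<D> i j)"

definition transports_cobracket ::
  "('n lgen free_alg set \<Rightarrow> ('g, 'n) target_type) \<Rightarrow>
   ('n lgen free_alg set \<Rightarrow> 'n lgen free_alg set tensor2) \<Rightarrow> bool" where
  "transports_cobracket f \<delta> \<longleftrightarrow>
     (\<forall>x\<in>lie_carrier g_r. tensor_map (target \<D>) f (\<delta> x) = target_cobracket \<D> (f x))"

end

end

theory Submission
  imports Defs "HOL-Computational_Algebra.Fundamental_Theorem_Algebra"
begin

text \<open>
  Write \<open>\<langle>c, X\<rangle>\<close> for the trace pairing of matrices. Skew-symmetry of the bracket turns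
  \<open>[L\<^sub>1, L\<^sub>2] = -[r\<^sub>\<pi>, L\<^sub>1 + L\<^sub>2]\<close> into \<open>[\<Omega>\<^sub>\<pi>, L\<^sub>1 + L\<^sub>2] = 0\<close> for the Casimir tensor \<open>\<Omega>\<close>, so a generating
  matrix has its coefficients in the normalizer of \<open>\<pi>(\<gg>)\<close>, which is \<open>\<pi>(\<gg>) \<oplus> End\<^sub>\<gg>(V)\<close> because derivations
  of \<open>\<gg>\<close> are inner. The triangularity relations then leave \<open>\<pi>(\<bb>\<^sup>\<plusminus>) \<oplus> End\<^sub>\<gg>(V)\<close>. As the relations express all
  brackets linearly in the generators, the coefficients of \<open>L\<^sup>\<plusminus>\<close> span \<open>\<gg>\<^sub>r\<close>, and comparison with the target
  shows that no further collapse occurs.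

  Via the invariant form, \<open>r\<close> becomes a pair of operators \<open>P\<close>, \<open>T\<close> on \<open>\<gg>\<close> with \<open>P + T = 1\<close>, adjoint to each
  other and interchanged by \<open>\<omega>\<close>. The defining relations in the target, and the formula for its cobracket on
  the generating matrices, both reduce to the Rota-Baxter identity for \<open>T\<close>. Skew-symmetry and the
  co-Jacobi identity need only be checked on these matrices, where they are the Lie algebra axioms of
  \<open>\<gg>\<ll>(V)\<close> in dual form; the cocycle identity is automatic, the cobracket of the double being a coboundary.

  Weight components in \<open>\<gg>\<ll>(V)\<close> are defined at all because coroots act diagonalizably on finite-dimensional
  modules.
\<close>

section \<open>Linear algebra\<close>

text \<open>Statements about generating matrices are tested by contraction: applying
  \<open>\<langle>c, _\<rangle>\<close> to the matrix leg leaves a single element of the Lie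
  algebra. In the target this element depends only on \<open>rho c\<close>, which represents the
  functional \<langle>c, \<pi>(x)\<rangle> of x under the invariant form, and on the restriction of
  c to the invariants. These two data can be prescribed independently, because \<pi>(\<gg>) meets
  the invariants in 0; this gives surjectivity. The obstacle is injectivity: a c whose contraction
  vanishes in the target must already contract to zero in the presented algebra. The c that do so
  there form a subspace, so by finite-dimensional duality it is enough to locate the matrices X
  annihilated by that subspace, and that is where the defining relations enter. The two Borel halves
  each contain a Cartan part. The factor 1/2 in r splits the identity of the Cartan subalgebra
  evenly between them, and the central copy of it in the double keeps the two halves apart.\<close>

lemma linear_maps:
  assumes "Vector_Spaces.linear s t f"
  shows "f (x + y) = f x + f y" "f (s c x) = t c (f x)" "f 0 = 0" "f (- x) = - f x"
    "f (x - y) = f x - f y" "f (sum g A) = (\<Sum>a\<in>A. f (g a))"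
proof -
  interpret Vector_Spaces.linear s t f by fact
  show "f (x + y) = f x + f y" "f (s c x) = t c (f x)" "f 0 = 0" "f (- x) = - f x"
    "f (x - y) = f x - f y" "f (sum g A) = (\<Sum>a\<in>A. f (g a))"
    by (rule add scale zero neg diff sum)+
qed

lemma linearI':
  assumes "vector_space s" "vector_space t"
    and "\<And>x y. f (x + y) = f x + f y" "\<And>c x. f (s c x) = t c (f x)"
  shows "Vector_Spaces.linear s t f"
  using assms by (simp add: Vector_Spaces.linear_iff)

section \<open>Common kernels of functionals and simultaneous eigenspaces\<close>

definition joint_eigenspace ::
  "('a \<Rightarrow> 'b \<Rightarrow> 'b) \<Rightarrow> ('h \<Rightarrow> 'b \<Rightarrow> 'b) \<Rightarrow> 'h set \<Rightarrow> ('h \<Rightarrow> 'a) \<Rightarrow> 'b set" where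
  "joint_eigenspace s T S \<mu> = {x. \<forall>h\<in>S. T h x = s (\<mu> h) x}"

context vector_space
begin

text \<open>Induction on the number of functionals: if \<open>f k\<close> vanishes on the common
  kernel of the others, it can be left out; otherwise some \<open>x0\<close> in that kernel has
  \<open>f k x0 = 1\<close>, and \<open>g - g x0 * f k\<close> is handled by the induction
  hypothesis. Linearity is asked only on \<open>S\<close>, as elements of \<open>dual_space\<close>
  are linear only there.\<close>

lemma in_span_of_kernels:
  fixes f :: "'i \<Rightarrow> 'b \<Rightarrow> 'a"
  assumes "finite A" "subspace S"
    and f: "\<And>i x y. i \<in> A \<Longrightarrow> x \<in> S \<Longrightarrow> y \<in> S \<Longrightarrow> f i (x + y) = f i x + f i y"
      "\<And>i c x. i \<in> A \<Longrightarrow> x \<in> S \<Longrightarrow> f i (scale c x) = c * f i x"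
    and g: "\<And>x y. x \<in> S \<Longrightarrow> y \<in> S \<Longrightarrow> g (x + y) = g x + g y"
      "\<And>c x. x \<in> S \<Longrightarrow> g (scale c x) = c * g x"
    and ker: "\<And>x. x \<in> S \<Longrightarrow> (\<And>i. i \<in> A \<Longrightarrow> f i x = 0) \<Longrightarrow> g x = 0"
  shows "\<exists>a. \<forall>x\<in>S. g x = (\<Sum>i\<in>A. a i * f i x)"
  using assms(1) f g ker
proof (induction A arbitrary: g rule: finite_induct)
  case empty
  then show ?case by auto
next
  case (insert k A)
  have diff: "f i (x - y) = f i x - f i y" if "i \<in> insert k A" "x \<in> S" "y \<in> S" for i x y
  proof -
    have "f i ((x - y) + y) = f i (x - y) + f i y"
      using that insert.prems(1) subspace_diff[OF \<open>subspace S\<close>] by blast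
    then show ?thesis by simp
  qed
  show ?case
  proof (cases "\<forall>x\<in>S. (\<forall>i\<in>A. f i x = 0) \<longrightarrow> f k x = 0")
    case True
    have "\<exists>a. \<forall>x\<in>S. g x = (\<Sum>i\<in>A. a i * f i x)"
    proof (rule insert.IH)
      fix x assume x: "x \<in> S" "\<And>i. i \<in> A \<Longrightarrow> f i x = 0"
      then have "f k x = 0" using True by blast
      then show "g x = 0" using x by (intro insert.prems(5)) auto
    qed (use insert.prems(1-4) in simp_all)
    then obtain a where a: "\<forall>x\<in>S. g x = (\<Sum>i\<in>A. a i * f i x)" ..
    have "(\<Sum>i\<in>A. (a(k := 0)) i * f i x) = (\<Sum>i\<in>A. a i * f i x)" for x
      using insert.hyps by (intro sum.cong) auto
    then show ?thesis using a insert.hyps by (intro exI[of _ "a(k := 0)"]) simp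
  next
    case False
    then obtain x1 where x1: "x1 \<in> S" "\<forall>i\<in>A. f i x1 = 0" "f k x1 \<noteq> 0" by blast
    define x0 where "x0 = scale (inverse (f k x1)) x1"
    have x0: "x0 \<in> S" "\<forall>i\<in>A. f i x0 = 0" "f k x0 = 1"
      using x1 insert.prems(2) subspace_scale[OF \<open>subspace S\<close>] by (auto simp: x0_def)
    have "\<exists>a. \<forall>x\<in>S. g x - g x0 * f k x = (\<Sum>i\<in>A. a i * f i x)"
    proof (intro insert.IH)
      fix x assume x: "x \<in> S" "\<And>i. i \<in> A \<Longrightarrow> f i x = 0"
      define y where "y = x - scale (f k x) x0"
      have yS: "y \<in> S" unfolding y_def
        using x x0 \<open>subspace S\<close> by (intro subspace_diff subspace_scale)
      have "f i y = 0" if "i \<in> insert k A" for i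
        using that x x0 diff[OF that x(1) subspace_scale[OF \<open>subspace S\<close> x0(1), of "f k x"]]
          insert.prems(2)[OF that x0(1)] by (auto simp: y_def)
      then have "g y = 0" using insert.prems(5) yS by blast
      moreover have "g x = g (y + scale (f k x) x0)" by (simp add: y_def)
      ultimately show "g x - g x0 * f k x = 0"
        using insert.prems(3,4) yS x0(1) subspace_scale[OF \<open>subspace S\<close> x0(1)] by simp
    qed (use insert.prems(1-4) in \<open>simp_all add: algebra_simps\<close>)
    then obtain a where a: "\<forall>x\<in>S. g x - g x0 * f k x = (\<Sum>i\<in>A. a i * f i x)" ..
    have "(\<Sum>i\<in>A. (a(k := g x0)) i * f i x) = (\<Sum>i\<in>A. a i * f i x)" for x
      using insert.hyps by (intro sum.cong) auto
    then show ?thesis using a insert.hyps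
      by (intro exI[of _ "a(k := g x0)"]) (simp, metis add.commute diff_add_cancel)
  qed
qed

lemma subspace_joint_eigenspace:
  assumes "\<And>h. h \<in> S \<Longrightarrow> Vector_Spaces.linear scale scale (T h)"
  shows "subspace (joint_eigenspace scale T S \<mu>)"
  unfolding joint_eigenspace_def using linear_maps[OF assms]
  by (intro subspaceI) (auto simp: scale_right_distrib scale_left_commute)

text \<open>Applying \<open>T h - \<nu> h\<close> to the relation removes the \<nu>-term and
  multiplies every other term by \<open>\<mu> h - \<nu> h\<close>; by induction all these multiples
  vanish, and some \<open>h\<close> makes the factor nonzero.\<close>

lemma joint_eigenvectors_independent:
  assumes lin: "\<And>h. h \<in> S \<Longrightarrow> Vector_Spaces.linear scale scale (T h)"
    and "finite A"
    and dist: "\<And>\<mu> \<nu>. \<mu> \<in> A \<Longrightarrow> \<nu> \<in> A \<Longrightarrow> \<mu> \<noteq> \<nu> \<Longrightarrow> \<exists>h\<in>S. \<mu> h \<noteq> \<nu> h"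
    and x: "\<And>\<mu>. \<mu> \<in> A \<Longrightarrow> x \<mu> \<in> joint_eigenspace scale T S \<mu>"
    and sum: "(\<Sum>\<mu>\<in>A. x \<mu>) = 0"
  shows "\<forall>\<mu>\<in>A. x \<mu> = 0"
  using \<open>finite A\<close> dist x sum
proof (induction A arbitrary: x rule: finite_induct)
  case empty
  then show ?case by simp
next
  case (insert \<nu> A)
  have *: "scale (\<mu> h - \<nu> h) (x \<mu>) = 0" if "h \<in> S" "\<mu> \<in> A" for h \<mu>
  proof -
    have ev: "T h (x \<mu>) = scale (\<mu> h) (x \<mu>)" if "\<mu> \<in> insert \<nu> A" for \<mu>
      using insert.prems(2)[OF that] \<open>h \<in> S\<close> by (simp add: joint_eigenspace_def)
    have "0 = T h (\<Sum>\<mu>\<in>insert \<nu> A. x \<mu>) - scale (\<nu> h) (\<Sum>\<mu>\<in>insert \<nu> A. x \<mu>)"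
      using insert.prems(3) linear_maps[OF lin[OF that(1)]] by simp
    also have "\<dots> = (\<Sum>\<mu>\<in>insert \<nu> A. scale (\<mu> h - \<nu> h) (x \<mu>))"
      by (simp add: linear_maps[OF lin[OF that(1)]] scale_sum_right ev
          scale_left_diff_distrib sum_subtractf del: sum.insert)
    also have "\<dots> = (\<Sum>\<mu>\<in>A. scale (\<mu> h - \<nu> h) (x \<mu>))"
      using insert.hyps by simp
    finally have "(\<Sum>\<mu>\<in>A. scale (\<mu> h - \<nu> h) (x \<mu>)) = 0" by simp
    moreover have "scale (\<mu> h - \<nu> h) (x \<mu>) \<in> joint_eigenspace scale T S \<mu>" if "\<mu> \<in> A" for \<mu>
      using insert.prems(2)[of \<mu>] that subspace_joint_eigenspace[of S T \<mu>] lin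
      by (simp add: subspace_scale)
    ultimately have "\<forall>\<mu>\<in>A. scale (\<mu> h - \<nu> h) (x \<mu>) = 0"
      using insert.prems(1) by (intro insert.IH) simp_all
    then show ?thesis using that by blast
  qed
  have zero: "\<forall>\<mu>\<in>A. x \<mu> = 0"
  proof
    fix \<mu> assume \<mu>: "\<mu> \<in> A"
    then have "\<mu> \<noteq> \<nu>" using insert.hyps by blast
    then obtain h where "h \<in> S" "\<mu> h \<noteq> \<nu> h" using insert.prems(1) \<mu> by blast
    then show "x \<mu> = 0" using *[OF _ \<mu>] by auto
  qed
  then show ?case using insert.prems(3) insert.hyps by simp
qed

lemma finite_joint_eigenvalues:
  assumes lin: "\<And>h. h \<in> S \<Longrightarrow> Vector_Spaces.linear scale scale (T h)"
    and B: "finite B" "span B = UNIV"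
    and dist: "\<And>\<mu> \<nu>. \<mu> \<in> A \<Longrightarrow> \<nu> \<in> A \<Longrightarrow> \<mu> \<noteq> \<nu> \<Longrightarrow> \<exists>h\<in>S. \<mu> h \<noteq> \<nu> h"
    and x: "\<And>\<mu>. \<mu> \<in> A \<Longrightarrow> \<exists>x\<in>joint_eigenspace scale T S \<mu>. x \<noteq> 0"
  shows "finite A"
proof (rule ccontr)
  assume "infinite A"
  then obtain A' where A': "A' \<subseteq> A" "finite A'" "card A' = Suc (card B)"
    by (meson infinite_arbitrarily_large)
  obtain v where v: "\<And>\<mu>. \<mu> \<in> A \<Longrightarrow> v \<mu> \<in> joint_eigenspace scale T S \<mu>" "\<And>\<mu>. \<mu> \<in> A \<Longrightarrow> v \<mu> \<noteq> 0"
    using x by metis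
  have ind: "\<forall>\<mu>\<in>A'. c \<mu> = 0" if "(\<Sum>\<mu>\<in>A'. scale (c \<mu>) (v \<mu>)) = 0" for c
  proof -
    have "\<forall>\<mu>\<in>A'. scale (c \<mu>) (v \<mu>) = 0"
    proof (rule joint_eigenvectors_independent[OF lin \<open>finite A'\<close>])
      show "\<exists>h\<in>S. \<mu> h \<noteq> \<nu> h" if "\<mu> \<in> A'" "\<nu> \<in> A'" "\<mu> \<noteq> \<nu>" for \<mu> \<nu>
        using dist[of \<mu> \<nu>] that A'(1) by (simp add: subset_iff)
      show "scale (c \<mu>) (v \<mu>) \<in> joint_eigenspace scale T S \<mu>" if "\<mu> \<in> A'" for \<mu>
        using v(1)[of \<mu>] that A'(1) lin
        by (intro subspace_scale subspace_joint_eigenspace) (simp_all add: subset_iff)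
    qed (use that in simp_all)
    then show ?thesis using v A' by auto
  qed
  have inj: "inj_on v A'"
  proof (rule inj_onI, rule ccontr)
    fix \<mu> \<nu> assume h: "\<mu> \<in> A'" "\<nu> \<in> A'" "v \<mu> = v \<nu>" "\<mu> \<noteq> \<nu>"
    define c where "c = (\<lambda>\<kappa>. if \<kappa> = \<mu> then 1 else if \<kappa> = \<nu> then -1 else (0::'a))"
    have "(\<Sum>\<kappa>\<in>A'. scale (c \<kappa>) (v \<kappa>)) = (\<Sum>\<kappa>\<in>{\<mu>, \<nu>}. scale (c \<kappa>) (v \<kappa>))"
      using h A' by (intro sum.mono_neutral_right) (auto simp: c_def)
    also have "\<dots> = 0" using h by (simp add: c_def)
    finally have "c \<mu> = 0" using ind h by blast
    then show False by (simp add: c_def)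
  qed
  have "independent (v ` A')"
  proof (rule independent_if_scalars_zero)
    fix f x assume "(\<Sum>x\<in>v ` A'. scale (f x) x) = 0" "x \<in> v ` A'"
    then show "f x = 0" using ind[of "f \<circ> v"] inj by (auto simp: sum.reindex)
  qed (use A' in simp)
  then have "card (v ` A') \<le> card B"
    using independent_span_bound[OF B(1)] B(2) by simp
  then show False using A' inj by (simp add: card_image)
qed

lemma finite_eigenvalues:
  assumes lin: "Vector_Spaces.linear scale scale T"
    and B: "finite B" "span B = UNIV"
  shows "finite {c. \<exists>x. x \<noteq> 0 \<and> T x = scale c x}"
proof -
  \<comment> \<open>A single operator is a family indexed by \<open>unit\<close>, so a scalar
    eigenvalue is encoded as a constant function.\<close>
  have "finite ((\<lambda>c (_::unit). c) ` {c. \<exists>x. x \<noteq> 0 \<and> T x = scale c x})"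
    using lin by (intro finite_joint_eigenvalues[OF _ B, of UNIV "\<lambda>_. T"])
      (auto simp: joint_eigenspace_def)
  then show ?thesis by (rule finite_imageD) (auto simp: inj_on_def fun_eq_iff)
qed

lemma span_UN_subspaces:
  assumes "\<And>i. i \<in> I \<Longrightarrow> subspace (W i)" and "x \<in> span (\<Union>i\<in>I. W i)"
  shows "\<exists>F y. finite F \<and> F \<subseteq> I \<and> (\<forall>i\<in>F. y i \<in> W i) \<and> x = (\<Sum>i\<in>F. y i)"
  using assms(2)
proof (induction rule: span_induct_alt)
  case base
  then show ?case by (intro exI[of _ "{}"]) simp
next
  case (step c x z)
  then obtain j where j: "j \<in> I" "x \<in> W j" by blast
  obtain F y where F: "finite F" "F \<subseteq> I" "\<forall>i\<in>F. y i \<in> W i" "z = (\<Sum>i\<in>F. y i)"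
    using step by blast
  define y' where "y' = (\<lambda>i. (if i = j then scale c x else 0) + (if i \<in> F then y i else 0))"
  have "y' i \<in> W i" if "i \<in> insert j F" for i
    using that j F assms(1)
    by (auto simp: y'_def intro!: subspace_add subspace_scale subspace_0)
  moreover have "(\<Sum>i\<in>insert j F. y' i) = scale c x + z"
  proof -
    have "(\<Sum>i\<in>insert j F. if i \<in> F then y i else 0) = z"
      unfolding F(4) using F(1) by (intro sum.mono_neutral_cong_right) auto
    then show ?thesis using F(1) by (simp add: y'_def sum.distrib)
  qed
  ultimately show ?case using j F by (intro exI[of _ "insert j F"] exI[of _ y']) auto
qed

text \<open>Split a joint eigenvector for \<open>S\<close> into eigenvectors of the new operator
  \<open>T k\<close>. The components are again joint eigenvectors for \<open>S\<close>:
  \<open>T h - \<mu> h\<close> commutes with \<open>T k\<close>, so it keeps each component in its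
  own eigenspace, and the images sum to zero.\<close>

lemma joint_diagonalization:
  assumes "finite S"
    and "\<And>h. h \<in> S \<Longrightarrow> Vector_Spaces.linear scale scale (T h)"
    and "\<And>h k x. h \<in> S \<Longrightarrow> k \<in> S \<Longrightarrow> T h (T k x) = T k (T h x)"
    and "\<And>h. h \<in> S \<Longrightarrow> span {x. \<exists>c. T h x = scale c x} = UNIV"
  shows "span (\<Union>\<mu>. joint_eigenspace scale T S \<mu>) = UNIV"
  using assms
proof (induction S rule: finite_induct)
  case empty
  then show ?case by (auto simp: joint_eigenspace_def)
next
  case (insert k S)
  let ?J = "\<Union>\<mu>. joint_eigenspace scale T (insert k S) \<mu>"
  note linS = linear_maps[OF insert.prems(1)]
  have "joint_eigenspace scale T S \<mu> \<subseteq> span ?J" for \<mu>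
  proof
    fix x assume x: "x \<in> joint_eigenspace scale T S \<mu>"
    define W where "W = (\<lambda>c. {x. T k x = scale c x})"
    have subW: "subspace (W c)" for c
      unfolding W_def using linS[of k] by (intro subspaceI) (auto simp: scale_right_distrib scale_left_commute)
    have "x \<in> span (\<Union>c\<in>UNIV. W c)"
    proof -
      have "(\<Union>c\<in>UNIV. W c) = {x. \<exists>c. T k x = scale c x}" by (auto simp: W_def)
      then show ?thesis using insert.prems(3)[of k] by simp
    qed
    then obtain F y where F: "finite F" "\<forall>c\<in>F. y c \<in> W c" "x = (\<Sum>c\<in>F. y c)"
      using span_UN_subspaces[of UNIV W] subW by blast
    have "y c \<in> joint_eigenspace scale T S \<mu>" if "c \<in> F" for c
    proof -
      have "T h (y c) = scale (\<mu> h) (y c)" if "h \<in> S" for h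
      proof -
        have "0 = T h x - scale (\<mu> h) x" using x that by (simp add: joint_eigenspace_def)
        also have "\<dots> = (\<Sum>c\<in>F. T h (y c) - scale (\<mu> h) (y c))"
          using that by (simp add: F(3) linS scale_sum_right sum_subtractf)
        finally have z: "(\<Sum>c\<in>F. T h (y c) - scale (\<mu> h) (y c)) = 0" by simp
        have in_W: "T h (y c) - scale (\<mu> h) (y c) \<in> W c" if "c \<in> F" for c
        proof -
          have yc: "T k (y c) = scale c (y c)" using F(2) that by (auto simp: W_def)
          have "T k (T h (y c)) = T h (T k (y c))" using insert.prems(2) \<open>h \<in> S\<close> by blast
          also have "\<dots> = scale c (T h (y c))" using yc \<open>h \<in> S\<close> linS by simp
          finally show ?thesis using yc linS(5)[of k] linS(2)[of k]
            by (simp add: W_def scale_right_diff_distrib scale_left_commute)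
        qed
        define A where "A = (\<lambda>c (_::unit). c) ` F"
        have "(\<Sum>\<nu>\<in>A. T h (y (\<nu> ())) - scale (\<mu> h) (y (\<nu> ()))) =
            (\<Sum>c\<in>F. T h (y c) - scale (\<mu> h) (y c))"
          unfolding A_def by (subst sum.reindex) (auto simp: inj_on_def fun_eq_iff)
        then have "\<forall>\<nu>\<in>A. T h (y (\<nu> ())) - scale (\<mu> h) (y (\<nu> ())) = 0"
          using z in_W F(1) insert.prems(1)[of k]
          by (intro joint_eigenvectors_independent[of UNIV "\<lambda>_. T k"])
            (auto simp: A_def joint_eigenspace_def W_def fun_eq_iff)
        then show ?thesis using \<open>c \<in> F\<close> by (auto simp: A_def)
      qed
      then show ?thesis by (simp add: joint_eigenspace_def)
    qed
    then have "y c \<in> joint_eigenspace scale T (insert k S) (\<mu>(k := c))" if "c \<in> F" for c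
      using that F(2) insert.hyps by (fastforce simp: joint_eigenspace_def W_def)
    then show "x \<in> span ?J" unfolding F(3) by (intro span_sum span_base) blast
  qed
  then have "span (\<Union>\<mu>. joint_eigenspace scale T S \<mu>) \<subseteq> span ?J"
    by (intro span_minimal) auto
  then show ?case using insert.IH insert.prems by auto
qed

end

section \<open>Diagonalizability of an operator over the complex numbers\<close>

locale complex_vector_space = vector_space scale
  for scale :: "complex \<Rightarrow> 'b::ab_group_add \<Rightarrow> 'b"
begin

text \<open>If p(h) v = 0, the complex roots of p serve as the list: for a root m write p = (X - m)
  q; then q(h) annihilates (h - m) v, and the degree has dropped. The last entry of the list is the
  factor applied first.\<close>

lemma annihilating_list:
  assumes lin: "Vector_Spaces.linear scale scale h"
    and "p \<noteq> 0" "(\<Sum>i\<le>degree p. scale (coeff p i) ((h ^^ i) v)) = 0"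
  shows "\<exists>ms. foldr (\<lambda>m w. h w - scale m w) ms v = 0"
  using assms(2,3)
proof (induction "degree p" arbitrary: p v)
  case 0
  then have "coeff p 0 \<noteq> 0" by (metis leading_coeff_0_iff)
  then show ?case using 0 by (intro exI[of _ "[]"]) simp
next
  case (Suc n)
  have pow: "(h ^^ i) (h w - scale c w) = (h ^^ i) (h w) - scale c ((h ^^ i) w)" for i c w
    by (induction i) (simp_all add: linear_maps[OF lin])
  have "\<not> constant (poly p)" using Suc.hyps(2) by (simp add: constant_degree)
  then obtain m where "poly p m = 0" using fundamental_theorem_of_algebra by blast
  then obtain q where q: "p = [:- m, 1:] * q" using poly_eq_0_iff_dvd by (metis dvdE)
  have "q \<noteq> 0" using q \<open>p \<noteq> 0\<close> by auto
  then have deg: "degree q = n" using Suc.hyps(2) q by (simp add: degree_mult_eq del: mult_pCons_left)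
  have p: "p = pCons 0 q - smult m q" unfolding q by simp
  have "coeff q (Suc n) = 0" using deg by (simp add: coeff_eq_0)
  then have "(\<Sum>i\<le>Suc n. scale (coeff p i) ((h ^^ i) v)) =
      (\<Sum>i\<le>n. scale (coeff q i) ((h ^^ i) (h v - scale m v)))"
  proof -
    have "(\<Sum>i\<le>Suc n. scale (coeff p i) ((h ^^ i) v)) =
        (\<Sum>i\<le>Suc n. scale (coeff (pCons 0 q) i) ((h ^^ i) v)) - (\<Sum>i\<le>Suc n. scale (m * coeff q i) ((h ^^ i) v))"
      unfolding p by (simp only: coeff_diff coeff_smult scale_left_diff_distrib sum_subtractf)
    also have "(\<Sum>i\<le>Suc n. scale (coeff (pCons 0 q) i) ((h ^^ i) v)) = (\<Sum>i\<le>n. scale (coeff q i) ((h ^^ i) (h v)))"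
      by (subst sum.atMost_Suc_shift) (simp add: funpow_swap1)
    also have "(\<Sum>i\<le>Suc n. scale (m * coeff q i) ((h ^^ i) v)) = (\<Sum>i\<le>n. scale (coeff q i) (scale m ((h ^^ i) v)))"
      using \<open>coeff q (Suc n) = 0\<close> by (simp add: mult.commute)
    finally show ?thesis by (simp add: pow scale_right_diff_distrib sum_subtractf)
  qed
  then have "(\<Sum>i\<le>degree q. scale (coeff q i) ((h ^^ i) (h v - scale m v))) = 0"
    using Suc.prems(2) Suc.hyps(2) deg by simp
  then obtain ms where "foldr (\<lambda>m w. h w - scale m w) ms (h v - scale m v) = 0"
    using Suc.hyps(1)[OF deg[symmetric] \<open>q \<noteq> 0\<close>] by blast
  then show ?case by (intro exI[of _ "ms @ [m]"]) simp
qed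

text \<open>In dimension at most \<open>N\<close> the \<open>N + 1\<close> vectors v, h v, ...,
  \<open>h ^^ N\<close> v satisfy a nontrivial relation, which is read as a polynomial in h.\<close>

lemma ex_annihilating_list:
  assumes lin: "Vector_Spaces.linear scale scale h"
    and B: "finite B" "span B = UNIV"
  shows "\<exists>ms. foldr (\<lambda>m w. h w - scale m w) ms v = 0"
proof -
  define N where "N = card B"
  have "\<exists>c. (\<exists>i\<le>N. c i \<noteq> 0) \<and> (\<Sum>i\<le>N. scale (c i) ((h ^^ i) v)) = 0"
  proof (cases "inj_on (\<lambda>i. (h ^^ i) v) {..N}")
    case True
    let ?S = "(\<lambda>i. (h ^^ i) v) ` {..N}"
    have "\<not> independent ?S"
      using independent_span_bound[OF B(1), of ?S] B(2) True by (auto simp: card_image N_def)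
    then obtain u where u: "(\<exists>x\<in>?S. u x \<noteq> 0)" "(\<Sum>x\<in>?S. scale (u x) x) = 0"
      using dependent_finite[of ?S] by auto
    then show ?thesis using True by (intro exI[of _ "\<lambda>i. u ((h ^^ i) v)"]) (auto simp: sum.reindex)
  next
    case False
    then obtain i j where ij: "i \<le> N" "j \<le> N" "i \<noteq> j" "(h ^^ i) v = (h ^^ j) v"
      by (auto simp: inj_on_def)
    define c where "c = (\<lambda>k. if k = i then 1 else if k = j then -1 else (0::complex))"
    have "(\<Sum>k\<le>N. scale (c k) ((h ^^ k) v)) = (\<Sum>k\<in>{i, j}. scale (c k) ((h ^^ k) v))"
      using ij by (intro sum.mono_neutral_right) (auto simp: c_def)
    also have "\<dots> = 0" using ij by (simp add: c_def)
    finally show ?thesis using ij(1) by (intro exI[of _ c]) (auto simp: c_def)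
  qed
  then obtain c where c: "\<exists>i\<le>N. c i \<noteq> 0" "(\<Sum>i\<le>N. scale (c i) ((h ^^ i) v)) = 0" by blast
  define p where "p = (\<Sum>i\<le>N. monom (c i) i)"
  have coeff: "coeff p i = (if i \<le> N then c i else 0)" for i
    by (simp add: p_def coeff_sum)
  have "p \<noteq> 0" using c(1) coeff by (metis coeff_0)
  moreover have "degree p \<le> N" using coeff by (intro degree_le) simp
  then have "(\<Sum>i\<le>degree p. scale (coeff p i) ((h ^^ i) v)) = (\<Sum>i\<le>N. scale (c i) ((h ^^ i) v))"
    proof (intro sum.mono_neutral_cong_left ballI)
    fix i assume "i \<in> {..N} - {..degree p}"
    then have "c i = 0" using coeff[of i] by (simp add: coeff_eq_0)
    then show "scale (c i) ((h ^^ i) v) = 0" by simp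
  qed (auto simp: coeff)
  ultimately show ?thesis using annihilating_list[OF lin] c(2) by simp
qed

lemma foldr_minus_scale_commute:
  assumes lin: "Vector_Spaces.linear scale scale h"
  shows "foldr (\<lambda>m w. h w - scale m w) ms (h v - scale c v) =
    h (foldr (\<lambda>m w. h w - scale m w) ms v) - scale c (foldr (\<lambda>m w. h w - scale m w) ms v)"
  by (induction ms) (simp_all add: linear_maps[OF lin] scale_right_diff_distrib scale_left_commute)

lemma diagonalizable_if_no_jordan_blocks:
  assumes lin: "Vector_Spaces.linear scale scale h"
    and B: "finite B" "span B = UNIV"
    and ss: "\<And>m u. h (h u - scale m u) = scale m (h u - scale m u) \<Longrightarrow> h u = scale m u"
  shows "span {x. \<exists>c. h x = scale c x} = UNIV"
proof -
  let ?E = "{x. \<exists>c. h x = scale c x}"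
  let ?F = "foldr (\<lambda>m w. h w - scale m w)"
  have diff: "?F ms (v - scale c w) = ?F ms v - scale c (?F ms w)" for ms v c w
    by (induction ms) (simp_all add: linear_maps[OF lin] scale_right_diff_distrib scale_left_commute)
  have "v \<in> span ?E" if "?F ms v = 0" for ms v
    using that
  proof (induction ms arbitrary: v)
    case Nil
    then show ?case by (simp add: span_zero)
  next
    case (Cons m ms)
    define w where "w = ?F ms v"
    have hw: "h w = scale m w" using Cons.prems by (simp add: w_def)
    show ?case
    proof (cases "m \<in> set ms")
      case True
      then obtain as bs where ms: "ms = as @ m # bs" by (meson split_list)
      have "?F ms v = h (?F (as @ bs) v) - scale m (?F (as @ bs) v)"
        by (simp add: ms foldr_minus_scale_commute[OF lin])
      then have "w = 0" using hw ss[of "?F (as @ bs) v" m] by (simp add: w_def)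
      then show ?thesis using Cons.IH by (simp add: w_def)
    next
      case False
      have "?F ns w = scale (prod_list (map (\<lambda>k. m - k) ns)) w" for ns
        by (induction ns) (simp_all add: linear_maps[OF lin] hw algebra_simps)
      moreover have "prod_list (map (\<lambda>k. m - k) ms) \<noteq> 0" using False by (induction ms) auto
      ultimately have "?F ms (v - scale (inverse (prod_list (map (\<lambda>k. m - k) ms))) w) = 0"
        by (simp add: diff w_def[symmetric])
      then have "v - scale (inverse (prod_list (map (\<lambda>k. m - k) ms))) w \<in> span ?E"
        by (rule Cons.IH)
      moreover have "w \<in> span ?E" using hw by (intro span_base) blast
      ultimately show ?thesis by (metis span_add span_scale diff_add_cancel)
    qed
  qed
  then show ?thesis using ex_annihilating_list[OF lin B] by blast
qed

end

primrec comp_seq :: "(nat \<Rightarrow> 'b \<Rightarrow> 'b) \<Rightarrow> nat \<Rightarrow> 'b \<Rightarrow> 'b" where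
  "comp_seq q 0 u = u"
| "comp_seq q (Suc n) u = comp_seq q n (q n u)"

lemma comp_seq_commute:
  assumes "\<And>j x. j < n \<Longrightarrow> q j (g x) = g (q j x)"
  shows "comp_seq q n (g u) = g (comp_seq q n u)"
  using assms by (induction n arbitrary: u) simp_all

lemma comp_seq_mem:
  assumes "\<And>j x. x \<in> U \<Longrightarrow> q j x \<in> U" "u \<in> U"
  shows "comp_seq q n u \<in> U"
  using assms(2) by (induction n arbitrary: u) (simp_all add: assms(1))

section \<open>Finite-dimensional modules over sl2\<close>

text \<open>Used for two modules: \<gg> itself under the adjoint action of a root triple, and the
  matrices under commutators with the image of that triple.\<close>

locale sl2_module = complex_vector_space scale
  for scale :: "complex \<Rightarrow> 'b::ab_group_add \<Rightarrow> 'b" +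
  fixes e f h :: "'b \<Rightarrow> 'b" and B :: "'b set"
  assumes lin_e: "Vector_Spaces.linear scale scale e"
    and lin_f: "Vector_Spaces.linear scale scale f"
    and lin_h: "Vector_Spaces.linear scale scale h"
    and he: "\<And>x. h (e x) = e (h x) + scale 2 (e x)"
    and hf: "\<And>x. h (f x) = f (h x) - scale 2 (f x)"
    and ef: "\<And>x. e (f x) = f (e x) + h x"
    and finite_B: "finite B" and span_B: "span B = UNIV"
begin

text \<open>Exchanging \<open>e\<close> and \<open>f\<close> and negating \<open>h\<close> lets each
  result about the raising operator be used for the lowering one.\<close>

lemma opposite: "sl2_module scale f e (\<lambda>x. - h x) B"
proof -
  have "Vector_Spaces.linear scale scale (\<lambda>x. - h x)"
    by (intro linearI' vector_space_axioms) (simp_all add: linear_maps[OF lin_h])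
  then show ?thesis
    by (intro sl2_module.intro complex_vector_space_axioms sl2_module_axioms.intro lin_e lin_f finite_B span_B)
      (simp_all add: he hf ef linear_maps(4)[OF lin_e] linear_maps(4)[OF lin_f])
qed

text \<open>With \<open>X = f e\<close>, which commutes with \<open>h\<close>, one has \<open>f\<^sup>n e\<^sup>n = \<Prod>\<^sub>j\<^sub><\<^sub>n (X - j (h + j + 1))\<close>, and likewise
  for \<open>e\<^sup>n f\<^sup>n\<close>. On a generalized eigenspace of \<open>h\<close> both products vanish for large \<open>n\<close>, which rules out
  Jordan blocks and nonintegral eigenvalues.\<close>

definition casimir_factor :: "nat \<Rightarrow> 'b \<Rightarrow> 'b" where
  "casimir_factor n u = f (e u) - scale (of_nat n) (h u) - scale (of_nat n * (of_nat n + 1)) u"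

lemma linear_casimir_factor: "Vector_Spaces.linear scale scale (casimir_factor n)"
  unfolding casimir_factor_def
  by (intro linearI' vector_space_axioms)
    (simp_all add: linear_maps[OF lin_e] linear_maps[OF lin_f] linear_maps[OF lin_h]
      algebra_simps)

lemma f_e_e_pow: "f (e ((e ^^ n) u)) = (e ^^ n) (casimir_factor n u)"
proof (induction n arbitrary: u)
  case 0
  then show ?case by (simp add: casimir_factor_def)
next
  case (Suc n)
  \<comment> \<open>Moving \<open>f e\<close> past \<open>e\<close> costs a term - h e, and h e = e
    (h + 2); together they raise the index of the factor by one.\<close>
  have "casimir_factor n (e u) = e (casimir_factor (Suc n) u)"
    unfolding casimir_factor_def linear_maps[OF lin_e] ef he
    by (simp add: algebra_simps)
      (simp add: scale_left_distrib[symmetric] add.assoc[symmetric] del: scale_left_distrib)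
  then show ?case using Suc[of "e u"] by (simp add: funpow_swap1)
qed

lemma f_pow_e_pow: "(f ^^ n) ((e ^^ n) u) = comp_seq casimir_factor n u"
proof (induction n arbitrary: u)
  case (Suc n)
  have "(f ^^ Suc n) ((e ^^ Suc n) u) = (f ^^ n) (f (e ((e ^^ n) u)))"
    by (simp add: funpow_swap1)
  then show ?case using Suc by (simp add: f_e_e_pow)
qed simp

lemma comp_casimir_factor_eq_0: "(e ^^ n) u = 0 \<Longrightarrow> comp_seq casimir_factor n u = 0"
proof -
  have "(f ^^ n) 0 = 0" by (induction n) (simp_all add: linear_maps[OF lin_f])
  then show "(e ^^ n) u = 0 \<Longrightarrow> comp_seq casimir_factor n u = 0"
    using f_pow_e_pow[of n u] by simp
qed

text \<open>Each \<open>e\<close> shifts a generalized eigenvalue by 2. If no power of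
  \<open>e\<close> killed \<open>u\<close>, every \<open>m + 2 * of_nat n\<close> would be an
  eigenvalue: an eigenvector is either \<open>(e ^^ n) u\<close> itself or its image under
  \<open>h\<close> minus that scalar.\<close>

lemma e_locally_nilpotent:
  assumes "h (h u - scale m u) = scale m (h u - scale m u)"
  shows "\<exists>n. (e ^^ n) u = 0"
proof (rule ccontr)
  assume nz: "\<nexists>n. (e ^^ n) u = 0"
  have shift: "h (e x) - scale (c + 2) (e x) = e (h x - scale c x)" for x c
    by (simp add: he linear_maps[OF lin_e] algebra_simps)
  have gen: "h (h ((e ^^ n) u) - scale (m + 2 * of_nat n) ((e ^^ n) u)) =
      scale (m + 2 * of_nat n) (h ((e ^^ n) u) - scale (m + 2 * of_nat n) ((e ^^ n) u))" for n
  proof (induction n)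
    case (Suc n)
    define c where "c = m + 2 * of_nat n"
    define x where "x = (e ^^ n) u"
    have c: "m + 2 * of_nat (Suc n) = c + 2" by (simp add: c_def)
    have "h (h (e x) - scale (c + 2) (e x)) - scale (c + 2) (h (e x) - scale (c + 2) (e x)) =
        e (h (h x - scale c x) - scale c (h x - scale c x))"
      by (simp only: shift)
    also have "\<dots> = 0" using Suc by (simp add: c_def x_def linear_maps[OF lin_e])
    finally show ?case unfolding c by (simp add: x_def)
  qed (use assms in simp)
  have "\<exists>x. x \<noteq> 0 \<and> h x = scale (m + 2 * of_nat n) x" for n
  proof (cases "h ((e ^^ n) u) = scale (m + 2 * of_nat n) ((e ^^ n) u)")
    case True
    then show ?thesis using nz by blast
  next
    case False
    then show ?thesis
      using gen[of n] by (intro exI[of _ "h ((e ^^ n) u) - scale (m + 2 * of_nat n) ((e ^^ n) u)"]) simp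
  qed
  then have "range (\<lambda>n. m + 2 * of_nat n) \<subseteq> {c. \<exists>x. x \<noteq> 0 \<and> h x = scale c x}" by auto
  then have "finite (range (\<lambda>n::nat. m + 2 * of_nat n))"
    using finite_eigenvalues[OF lin_h finite_B span_B] finite_subset by blast
  then show False by (rule range_inj_infinite[THEN notE, rotated]) (simp add: inj_def)
qed

text \<open>Here \<open>u\<close> is killed by the square of h - m and by a product of distinct
  linear factors in h. Hence their greatest common divisor kills it, and that is h - m or 1.\<close>

lemma no_jordan_block_if_distinct_factors:
  assumes "\<And>i w. w \<in> W \<Longrightarrow> p i w = scale (k i) (h w - scale (a i) w)"
    and "\<And>i. k i \<noteq> 0" "inj a" and "\<And>i w. w \<in> W \<Longrightarrow> p i w \<in> W"
    and "u \<in> W" "h (h u - scale m u) = scale m (h u - scale m u)" "comp_seq p n u = 0"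
  shows "h u = scale m u \<and> (u \<noteq> 0 \<longrightarrow> (\<exists>i<n. m = a i))"
  using assms(5-7)
proof (induction n arbitrary: u)
  case 0
  then show ?case by (simp add: linear_maps[OF lin_h])
next
  case (Suc n)
  define v where "v = p n u"
  have v: "v = scale (k n) (h u - scale (a n) u)" using assms(1) Suc.prems(1) by (simp add: v_def)
  have hhu: "h (h u) = scale m (h u) + scale m (h u) - scale (m * m) u"
    using Suc.prems(2) by (simp add: linear_maps[OF lin_h] algebra_simps)
  have "h (h v - scale m v) = scale m (h v - scale m v)"
    unfolding v by (simp add: linear_maps[OF lin_h] hhu algebra_simps)
  moreover have "v \<in> W" using assms(4) Suc.prems(1) by (simp add: v_def)
  ultimately have IH: "h v = scale m v \<and> (v \<noteq> 0 \<longrightarrow> (\<exists>i<n. m = a i))"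
    using Suc.IH Suc.prems(3) by (simp add: v_def)
  show ?case
  proof (cases "v = 0")
    case True
    then have hu: "h u = scale (a n) u" using v assms(2)[of n] by simp
    have "h (h u - scale m u) = scale (a n) (h u - scale m u)"
      by (simp add: hu linear_maps[OF lin_h] scale_right_diff_distrib mult.commute)
    then have "a n = m \<or> h u = scale m u" using Suc.prems(2) by auto
    then have "u = 0 \<or> a n = m" using hu by auto
    then show ?thesis using hu by (auto simp: linear_maps[OF lin_h])
  next
    case False
    then obtain i where i: "i < n" "m = a i" using IH by blast
    then have "m \<noteq> a n" using \<open>inj a\<close> by (auto dest: injD)
    have "h (h u - scale (a n) u) = scale m (h u - scale (a n) u)"
    proof -
      have "scale (k n) (h (h u - scale (a n) u)) = scale (k n) (scale m (h u - scale (a n) u))"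
        using IH v by (simp add: linear_maps(2)[OF lin_h] scale_left_commute[of m] del: scale_scale)
      then show ?thesis using assms(2)[of n] scale_left_imp_eq by blast
    qed
    then have "scale (m - a n) (h u - scale m u) = 0"
      by (simp add: linear_maps[OF lin_h] hhu algebra_simps)
    then have "h u = scale m u" using \<open>m \<noteq> a n\<close> by simp
    then show ?thesis using i less_SucI by blast
  qed
qed

text \<open>On vectors killed by one factor \<open>casimir_factor j\<close>, the element
  \<open>f e\<close> is a polynomial in \<open>h\<close>, so the opposite factors become distinct
  linear factors in \<open>h\<close>. The general case reduces to this one by peeling off factors;
  the assumption on \<open>m\<close> keeps the scalars met on the way nonzero. Complete reducibility
  is thereby avoided.\<close>

theorem eigenvector_if_generalized:
  assumes gen: "h (h u - scale m u) = scale m (h u - scale m u)"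
    and m: "\<And>k::nat. m \<noteq> - (of_nat k + 1)"
  shows "h u = scale m u \<and> (u \<noteq> 0 \<longrightarrow> m \<in> \<int>)"
proof -
  let ?U = "{u. h (h u - scale m u) = scale m (h u - scale m u)}"
  let ?K = "{u. h u = scale m u \<and> (u \<noteq> 0 \<longrightarrow> m \<in> \<int>)}"
  interpret op: sl2_module scale f e "\<lambda>x. - h x" B by (rule opposite)
  have subU: "subspace ?U"
  proof (intro subspaceI)
    fix c x assume "x \<in> ?U"
    then have "scale c (h (h x - scale m x)) = scale c (scale m (h x - scale m x))" by simp
    then show "scale c x \<in> ?U" by (simp add: linear_maps[OF lin_h] algebra_simps)
  qed (simp_all add: linear_maps[OF lin_h] algebra_simps)
  have subK: "subspace ?K" by (intro subspaceI) (auto simp: linear_maps[OF lin_h] algebra_simps)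
  have hfe: "h (f (e x)) = f (e (h x))" for x
    by (simp add: he hf linear_maps[OF lin_f])
  have h_cas: "h (casimir_factor j x) = casimir_factor j (h x)" for j x
    by (simp add: casimir_factor_def hfe linear_maps[OF lin_h])
  have h_opcas: "h (op.casimir_factor j x) = op.casimir_factor j (h x)" for j x
    by (simp add: op.casimir_factor_def ef hfe linear_maps[OF lin_h])
  have cas_comm: "casimir_factor i (casimir_factor j x) = casimir_factor j (casimir_factor i x)" for i j x
  proof -
    have "casimir_factor i (f (e x)) = f (e (casimir_factor i x))"
      by (simp add: casimir_factor_def hfe linear_maps[OF lin_e] linear_maps[OF lin_f])
    then show ?thesis
      unfolding casimir_factor_def[of j] linear_maps[OF linear_casimir_factor] by (simp add: h_cas)
  qed
  have cas_opcas: "casimir_factor i (op.casimir_factor j x) = op.casimir_factor j (casimir_factor i x)" for i j x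
  proof -
    have "casimir_factor i (e (f x)) = e (f (casimir_factor i x))"
      by (simp add: ef casimir_factor_def hfe linear_maps[OF lin_e] linear_maps[OF lin_f] linear_maps[OF lin_h] algebra_simps)
    then show ?thesis
      unfolding op.casimir_factor_def linear_maps[OF linear_casimir_factor] by (simp add: h_cas)
  qed
  have cas_U: "casimir_factor j w \<in> ?U" if "w \<in> ?U" for j w
  proof -
    have "h (casimir_factor j w) - scale m (casimir_factor j w) = casimir_factor j (h w - scale m w)"
      by (simp add: h_cas linear_maps[OF linear_casimir_factor])
    moreover have "h (casimir_factor j (h w - scale m w)) = scale m (casimir_factor j (h w - scale m w))"
      using that by (simp only: h_cas linear_maps(2)[OF linear_casimir_factor] mem_Collect_eq)
    ultimately show ?thesis by simp
  qed
  \<comment> \<open>On the kernel of \<open>casimir_factor j\<close> one has f e = j h + j (j + 1),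
    so the opposite factor with index i equals (i + j + 1) (h - (i - j)). These roots are distinct
    integers, which gives both conclusions.\<close>
  have base: "w \<in> ?K" if w: "w \<in> ?U" "casimir_factor j w = 0" for j w
  proof -
    have "(- h ((- h w) - scale (- m) w)) = scale (- m) ((- h w) - scale (- m) w)"
      using w(1) by (simp add: linear_maps[OF lin_h] algebra_simps)
    then obtain N where "(f ^^ N) w = 0" using op.e_locally_nilpotent by blast
    then have z: "comp_seq op.casimir_factor N w = 0" by (rule op.comp_casimir_factor_eq_0)
    let ?W = "{w. casimir_factor j w = 0}"
    have opc: "op.casimir_factor i x = scale (of_nat (i + j + 1)) (h x - scale (of_nat i - of_nat j) x)"
      if "x \<in> ?W" for i x
    proof -
      have "f (e x) = scale (of_nat j) (h x) + scale (of_nat j * (of_nat j + 1)) x"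
        using that by (simp add: casimir_factor_def algebra_simps)
      then show ?thesis by (simp add: op.casimir_factor_def ef algebra_simps)
    qed
    have "h w = scale m w \<and> (w \<noteq> 0 \<longrightarrow> (\<exists>i<N. m = of_nat i - of_nat j))"
    proof (rule no_jordan_block_if_distinct_factors[OF opc])
      show "op.casimir_factor i x \<in> ?W" if "x \<in> ?W" for i x
        using that by (simp add: cas_opcas linear_maps[OF op.linear_casimir_factor])
      show "inj (\<lambda>i. of_nat i - of_nat j :: complex)" by (simp add: inj_def)
      show "of_nat (i + j + 1) \<noteq> (0::complex)" for i by (simp only: of_nat_eq_0_iff)
    qed (use w z in auto)
    then show ?thesis by auto
  qed
  have "w \<in> ?K" if "w \<in> ?U" "comp_seq casimir_factor n w = 0" for n w
    using that
  proof (induction n arbitrary: w)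
    case 0
    then show ?case using subspace_0[OF subK] by simp
  next
    case (Suc n)
    define w' where "w' = comp_seq casimir_factor n w"
    \<comment> \<open>The scalar by which \<open>casimir_factor j\<close> acts on \<open>w'\<close>,
      an eigenvector of \<open>h\<close> killed by the factor with index n. It equals (n - j) (m + n
      + j + 1), hence is nonzero for j < n by the assumption on \<open>m\<close>.\<close>
    define c where "c = (\<lambda>j::nat. of_nat n * (m + of_nat n + 1) - of_nat j * (m + of_nat j + 1) :: complex)"
    have "casimir_factor n w' = comp_seq casimir_factor n (casimir_factor n w)"
      unfolding w'_def by (rule comp_seq_commute[symmetric]) (rule cas_comm)
    then have w'0: "casimir_factor n w' = 0" using Suc.prems(2) by simp
    have "w' \<in> ?U" unfolding w'_def using Suc.prems(1) cas_U by (rule comp_seq_mem[rotated])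
    then have w'K: "w' \<in> ?K" using base w'0 by blast
    have cas_w': "casimir_factor j w' = scale (c j) w'" for j
      using w'0 w'K by (simp add: casimir_factor_def c_def algebra_simps)
    have "comp_seq casimir_factor k w' = scale (\<Prod>j<k. c j) w'" for k
    proof (induction k)
      case (Suc k)
      have "comp_seq casimir_factor k (scale (c k) w') = scale (c k) (comp_seq casimir_factor k w')"
        by (rule comp_seq_commute) (rule linear_maps(2)[OF linear_casimir_factor])
      then show ?case using Suc cas_w'[of k] by simp
    qed simp
    moreover have "(\<Prod>j<n. c j) \<noteq> 0"
    proof -
      have "c j \<noteq> 0" if "j < n" for j
      proof -
        have "c j = (of_nat n - of_nat j) * (m + of_nat (n + j) + 1)"
          by (simp add: c_def algebra_simps)
        moreover have "m + of_nat (n + j) + 1 \<noteq> 0"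
          using m[of "n + j"] by (metis add.assoc eq_neg_iff_add_eq_0)
        ultimately show ?thesis using that by simp
      qed
      then show ?thesis by simp
    qed
    moreover have "comp_seq casimir_factor n (x - scale a y) =
        comp_seq casimir_factor n x - scale a (comp_seq casimir_factor n y)" for x y a
      by (induction n arbitrary: x y) (simp_all add: linear_maps[OF linear_casimir_factor])
    ultimately have "comp_seq casimir_factor n (w - scale (inverse (\<Prod>j<n. c j)) w') = 0"
      by (simp add: w'_def[symmetric])
    moreover have "w - scale (inverse (\<Prod>j<n. c j)) w' \<in> ?U"
      using Suc.prems(1) \<open>w' \<in> ?U\<close> subU by (intro subspace_diff subspace_scale)
    ultimately have "w - scale (inverse (\<Prod>j<n. c j)) w' \<in> ?K" by (intro Suc.IH)
    then show ?case
      using subspace_add[OF subK _ subspace_scale[OF subK w'K, of "inverse (\<Prod>j<n. c j)"]]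
      by (metis (no_types, lifting) diff_add_cancel)
  qed
  moreover obtain n where "(e ^^ n) u = 0" using e_locally_nilpotent[OF gen] by blast
  ultimately show ?thesis using gen comp_casimir_factor_eq_0 by blast
qed

text \<open>The eigenvalues left out before are negative integers; in the opposite module they turn
  into positive ones, where the previous theorem applies.\<close>

theorem generalized_eigenvector:
  assumes gen: "h (h u - scale m u) = scale m (h u - scale m u)"
  shows "h u = scale m u" "u \<noteq> 0 \<Longrightarrow> m \<in> \<int>"
proof -
  have "h u = scale m u \<and> (u \<noteq> 0 \<longrightarrow> m \<in> \<int>)"
  proof (cases "\<exists>k::nat. m = - (of_nat k + 1)")
    case False
    then show ?thesis using eigenvector_if_generalized[OF gen] by blast
  next
    case True
    then obtain k :: nat where k: "m = - (of_nat k + 1)" by blast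
    interpret op: sl2_module scale f e "\<lambda>x. - h x" B by (rule opposite)
    have "- m \<noteq> - (of_nat l + 1)" for l :: nat
    proof
      assume "- m = - (of_nat l + 1)"
      then have "of_nat (k + l + 2) = (0::complex)" using k by (simp add: algebra_simps)
      then show False by (simp only: of_nat_eq_0_iff)
    qed
    moreover have "(- h ((- h u) - scale (- m) u)) = scale (- m) ((- h u) - scale (- m) u)"
      using gen by (simp add: linear_maps[OF lin_h] algebra_simps)
    ultimately have "- h u = scale (- m) u" using op.eigenvector_if_generalized[of u "- m"] by blast
    then have "h u = scale m u" by (metis neg_equal_iff_equal scale_minus_left)
    then show ?thesis by (simp add: k)
  qed
  then show "h u = scale m u" "u \<noteq> 0 \<Longrightarrow> m \<in> \<int>" by blast+
qed

lemma h_diagonalizable: "span {x. \<exists>c. h x = scale c x} = UNIV"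
  using generalized_eigenvector(1)
  by (intro diagonalizable_if_no_jordan_blocks[OF lin_h finite_B span_B])

lemma integral_eigenvalue:
  assumes "h u = scale m u" "u \<noteq> 0" shows "m \<in> \<int>"
  using assms by (intro generalized_eigenvector(2)[of u]) (simp_all add: linear_maps[OF lin_h])

text \<open>On such a \<open>u\<close> the factor with index j acts by - (j + 1) (m + j). Some
  \<open>e ^^ n\<close> kills \<open>u\<close>, so the product of these scalars over j < n vanishes,
  which forces m + j = 0 for some j.\<close>

lemma lowest_weight_nonpositive:
  assumes "f u = 0" "h u = scale m u" "u \<noteq> 0"
  shows "\<exists>k::nat. m = - of_nat k"
proof (rule ccontr)
  assume "\<nexists>k::nat. m = - of_nat k"
  then have m: "m + of_nat k \<noteq> 0" for k :: nat by (metis eq_neg_iff_add_eq_0)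
  obtain n where "(e ^^ n) u = 0"
    using e_locally_nilpotent[of u m] assms(2) by (auto simp: linear_maps[OF lin_h])
  then have "comp_seq casimir_factor n u = 0" by (rule comp_casimir_factor_eq_0)
  moreover have "comp_seq casimir_factor n u = scale (\<Prod>j<n. - (of_nat j + 1) * (m + of_nat j)) u" for n
  proof (induction n)
    case (Suc n)
    have "f (e u) = scale (- m) u" using ef[of u] assms by (simp add: linear_maps[OF lin_e] eq_neg_iff_add_eq_0)
    then have c: "casimir_factor n u = scale (- (of_nat n + 1) * (m + of_nat n)) u"
      using assms(2) by (simp add: casimir_factor_def algebra_simps)
    have "comp_seq casimir_factor n (scale a u) = scale a (comp_seq casimir_factor n u)" for a
      by (rule comp_seq_commute) (rule linear_maps(2)[OF linear_casimir_factor])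
    then show ?case using Suc by (simp add: c)
  qed simp
  moreover have "- (of_nat j + 1) * (m + of_nat j) \<noteq> 0" for j :: nat
    using m[of j] of_nat_neq_0[of j, where 'a=complex]
    by (simp only: mult_eq_0_iff neg_equal_0_iff_equal of_nat_Suc add.commute) simp
  ultimately show False using assms(3) by simp
qed

end

section \<open>Weight decompositions\<close>

text \<open>A direct sum over a possibly infinite index set. In both uses the indices are all linear
  functionals on the Cartan subalgebra, and all but finitely many summands are zero.\<close>

locale graded_space = complex_vector_space scale
  for scale :: "complex \<Rightarrow> 'b::ab_group_add \<Rightarrow> 'b" +
  fixes W :: "'k \<Rightarrow> 'b set" and I :: "'k set"
  assumes subspace_W: "\<And>i. i \<in> I \<Longrightarrow> subspace (W i)"
    and W_independent: "\<And>F y. finite F \<Longrightarrow> F \<subseteq> I \<Longrightarrow> (\<And>i. i \<in> F \<Longrightarrow> y i \<in> W i) \<Longrightarrow> (\<Sum>i\<in>F. y i) = 0 \<Longrightarrow> \<forall>i\<in>F. y i = 0"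
    and span_W: "span (\<Union>i\<in>I. W i) = UNIV"
begin

text \<open>Phrased exactly like \<open>gl_component\<close>, so that the two agree by
  unfolding.\<close>

definition component :: "'k \<Rightarrow> 'b \<Rightarrow> 'b" where
  "component i x = (THE y. y \<in> W i \<and> x - y \<in> span (\<Union>j\<in>I - {i}. W j))"

lemma W_inter_complement:
  assumes "i \<in> I" "y \<in> W i" "y \<in> span (\<Union>j\<in>I - {i}. W j)"
  shows "y = 0"
proof -
  obtain F z where F: "finite F" "F \<subseteq> I - {i}" "\<forall>j\<in>F. z j \<in> W j" "y = (\<Sum>j\<in>F. z j)"
    using span_UN_subspaces[of "I - {i}" W y] assms(3) subspace_W by blast
  define z' where "z' = (\<lambda>j. if j = i then - y else z j)"
  have "i \<notin> F" using F(2) by blast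
  then have "(\<Sum>j\<in>F. z' j) = y" unfolding F(4) z'_def by (intro sum.cong) auto
  then have "(\<Sum>j\<in>insert i F. z' j) = 0" using F(1) \<open>i \<notin> F\<close> by (simp add: z'_def)
  then have "\<forall>j\<in>insert i F. z' j = 0"
    using F assms subspace_neg[OF subspace_W[OF assms(1)]] by (intro W_independent) (auto simp: z'_def)
  then show ?thesis by (simp add: z'_def)
qed

lemma component_eqI:
  assumes "i \<in> I" "y \<in> W i" "x - y \<in> span (\<Union>j\<in>I - {i}. W j)"
  shows "component i x = y"
  unfolding component_def
proof (rule the_equality)
  fix z assume z: "z \<in> W i \<and> x - z \<in> span (\<Union>j\<in>I - {i}. W j)"
  have "(x - y) - (x - z) \<in> span (\<Union>j\<in>I - {i}. W j)" using assms z span_diff by blast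
  then have "z - y \<in> span (\<Union>j\<in>I - {i}. W j)" by simp
  then have "z - y = 0"
    using W_inter_complement assms z subspace_diff[OF subspace_W[OF assms(1)]] by blast
  then show "z = y" by simp
qed (use assms in auto)

lemma ex_component:
  assumes "i \<in> I"
  shows "\<exists>y. y \<in> W i \<and> x - y \<in> span (\<Union>j\<in>I - {i}. W j)"
proof -
  have "(\<Union>j\<in>I. W j) = W i \<union> (\<Union>j\<in>I - {i}. W j)" using assms by blast
  then have "x \<in> {a + b |a b. a \<in> span (W i) \<and> b \<in> span (\<Union>j\<in>I - {i}. W j)}"
    using span_W span_Un by (metis UNIV_I)
  then obtain a b where ab: "a \<in> span (W i)" "b \<in> span (\<Union>j\<in>I - {i}. W j)" "x = a + b" by blast
  have "span (W i) \<subseteq> W i" by (intro span_minimal subset_refl subspace_W assms)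
  then show ?thesis using ab by (intro exI[of _ a]) auto
qed

lemma component:
  assumes "i \<in> I"
  shows "component i x \<in> W i" "x - component i x \<in> span (\<Union>j\<in>I - {i}. W j)"
  using ex_component[OF assms, of x] component_eqI[OF assms, of _ x] by auto

lemma component_add: "i \<in> I \<Longrightarrow> component i (x + y) = component i x + component i y"
  using component[of i x] component[of i y]
  by (intro component_eqI) (auto intro: subspace_add[OF subspace_W] simp: add_diff_add span_add)

lemma component_scale: "i \<in> I \<Longrightarrow> component i (scale c x) = scale c (component i x)"
  using component[of i x]
  by (intro component_eqI) (auto intro: subspace_scale[OF subspace_W] span_scale simp: scale_right_diff_distrib[symmetric])

lemma linear_component: "i \<in> I \<Longrightarrow> Vector_Spaces.linear scale scale (component i)"
  by (intro linearI' vector_space_axioms component_add component_scale)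

lemma component_same: "i \<in> I \<Longrightarrow> x \<in> W i \<Longrightarrow> component i x = x"
  by (intro component_eqI) (auto simp: span_zero)

lemma component_other: "i \<in> I \<Longrightarrow> j \<in> I \<Longrightarrow> i \<noteq> j \<Longrightarrow> x \<in> W j \<Longrightarrow> component i x = 0"
  by (intro component_eqI) (auto intro: span_base subspace_0[OF subspace_W])

text \<open>The standard way below to check a linear identity on \<gg>: it is additive, so weight
  vectors suffice.\<close>

lemma induct_homogeneous:
  assumes "\<And>i x. i \<in> I \<Longrightarrow> x \<in> W i \<Longrightarrow> P x" "P 0"
    and "\<And>x y. P x \<Longrightarrow> P y \<Longrightarrow> P (x + y)"
  shows "P x"
proof -
  obtain F y where F: "finite F" "F \<subseteq> I" "\<forall>i\<in>F. y i \<in> W i" "x = (\<Sum>i\<in>F. y i)"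
    using span_UN_subspaces[of I W x] span_W subspace_W by blast
  have "P (\<Sum>i\<in>F. y i)" using F(1-3)
    by (induction F rule: finite_induct) (auto intro!: assms)
  then show ?thesis using F by simp
qed

end

section \<open>Weights as functionals on a space of commuting operators\<close>

lemma dual_space_distinct:
  "\<mu> \<in> dual_space s H \<Longrightarrow> \<nu> \<in> dual_space s H \<Longrightarrow> \<mu> \<noteq> \<nu> \<Longrightarrow> \<exists>h\<in>H. \<mu> h \<noteq> \<nu> h"
  unfolding dual_space_def fun_eq_iff by (metis (mono_tags, lifting) mem_Collect_eq)

lemma dual_space_zero: "0 \<in> dual_space s H"
  by (simp add: dual_space_def)

lemma dual_space_uminus: "\<mu> \<in> dual_space s H \<Longrightarrow> - \<mu> \<in> dual_space s H"
  by (simp add: dual_space_def)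

lemma dual_space_add: "\<mu> \<in> dual_space s H \<Longrightarrow> \<nu> \<in> dual_space s H \<Longrightarrow> \<mu> + \<nu> \<in> dual_space s H"
  by (simp add: dual_space_def algebra_simps)

text \<open>Commutation and diagonalizability are required only on a finite spanning set
  \<open>S\<close>: on matrices they are known for the simple coroots, from sl2 theory, and not at
  once for all of the Cartan subalgebra.\<close>

lemma graded_space_joint_eigenspaces:
  fixes s :: "complex \<Rightarrow> 'b::ab_group_add \<Rightarrow> 'b" and t :: "complex \<Rightarrow> 'h::ab_group_add \<Rightarrow> 'h"
  assumes "vector_space s" "vector_space t"
    and S: "finite S" "S \<subseteq> H" "H \<subseteq> module.span t S" "module.subspace t H"
    and lin: "\<And>h. h \<in> H \<Longrightarrow> Vector_Spaces.linear s s (T h)"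
    and T: "\<And>h k x. h \<in> H \<Longrightarrow> k \<in> H \<Longrightarrow> T (h + k) x = T h x + T k x"
      "\<And>c h x. h \<in> H \<Longrightarrow> T (t c h) x = s c (T h x)"
    and comm: "\<And>h k x. h \<in> S \<Longrightarrow> k \<in> S \<Longrightarrow> T h (T k x) = T k (T h x)"
    and diag: "\<And>h. h \<in> S \<Longrightarrow> module.span s {x. \<exists>c. T h x = s c x} = UNIV"
  shows "graded_space s (joint_eigenspace s T H) (dual_space t H)"
proof -
  interpret V: vector_space s by fact
  interpret U: vector_space t by fact
  have TH0: "T 0 x = 0" for x
    using T(2)[of 0 0 x] U.subspace_0[OF S(4)] by simp
  have ev: "\<exists>\<mu>\<in>dual_space t H. x \<in> joint_eigenspace s T H \<mu>"
    if x: "x \<in> joint_eigenspace s T S \<nu>" for \<nu> x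
  proof (cases "x = 0")
    case True
    then show ?thesis using dual_space_zero
      by (intro bexI[of _ 0]) (auto simp: joint_eigenspace_def linear_maps(3)[OF lin])
  next
    case False
    have ex: "\<exists>c. T h x = s c x" if "h \<in> H" for h
    proof -
      have "h \<in> H \<and> (\<exists>c. T h x = s c x)" if "h \<in> U.span S" for h
        using that
      proof (induction rule: U.span_induct_alt)
        case base
        then show ?case using TH0 U.subspace_0[OF S(4)] by (auto intro: exI[of _ 0])
      next
        case (step c a b)
        then obtain d where d: "b \<in> H" "T b x = s d x" by blast
        have a: "a \<in> H" "T a x = s (\<nu> a) x" using step(1) S(2) x by (auto simp: joint_eigenspace_def)
        have "T (t c a + b) x = s (c * \<nu> a + d) x"
          using a d T U.subspace_scale[OF S(4) a(1)] by (simp add: V.scale_left_distrib)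
        then show ?case
          using a d U.subspace_scale[OF S(4) a(1)] U.subspace_add[OF S(4)] by blast
      qed
      then show ?thesis using that S(3) by blast
    qed
    \<comment> \<open>As \<open>x\<close> is nonzero, the eigenvalue is unique, and uniqueness makes
      it linear in \<open>h\<close>. The value 0 outside \<open>H\<close> is what
      \<open>dual_space\<close> demands.\<close>
    define \<mu> where "\<mu> = (\<lambda>h. if h \<in> H then SOME c. T h x = s c x else 0)"
    have \<mu>: "T h x = s (\<mu> h) x" if "h \<in> H" for h
      using someI_ex[OF ex[OF that]] that by (simp add: \<mu>_def)
    have cancel: "a = b" if "s a x = s b x" for a b
      using that False by simp
    have "\<mu> \<in> dual_space t H"
      unfolding dual_space_def
    proof (intro CollectI conjI ballI allI impI)
      fix h k assume hk: "h \<in> H" "k \<in> H"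
      show "\<mu> (h + k) = \<mu> h + \<mu> k"
        using hk T(1)[OF hk, of x] \<mu> U.subspace_add[OF S(4) hk]
        by (intro cancel) (simp add: V.scale_left_distrib)
    next
      fix c h assume h: "h \<in> H"
      show "\<mu> (t c h) = c * \<mu> h"
        using h T(2)[OF h, of c x] \<mu> U.subspace_scale[OF S(4) h] by (intro cancel) simp
    qed (simp add: \<mu>_def)
    then show ?thesis using \<mu> by (intro bexI[of _ \<mu>]) (simp_all add: joint_eigenspace_def)
  qed
  have "V.span (\<Union>\<mu>. joint_eigenspace s T S \<mu>) = UNIV"
    using S(2) by (intro V.joint_diagonalization S(1) lin comm diag) auto
  moreover have "(\<Union>\<mu>. joint_eigenspace s T S \<mu>) \<subseteq> (\<Union>\<mu>\<in>dual_space t H. joint_eigenspace s T H \<mu>)"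
    using ev by blast
  ultimately have "V.span (\<Union>\<mu>\<in>dual_space t H. joint_eigenspace s T H \<mu>) = UNIV"
    using V.span_mono by blast
  moreover have "\<forall>i\<in>F. y i = 0"
    if "finite F" "F \<subseteq> dual_space t H" "\<And>i. i \<in> F \<Longrightarrow> y i \<in> joint_eigenspace s T H i" "(\<Sum>i\<in>F. y i) = 0" for F y
  proof (rule V.joint_eigenvectors_independent[OF lin that(1) _ that(3,4)])
    show "\<exists>h\<in>H. \<mu> h \<noteq> \<nu> h" if "\<mu> \<in> F" "\<nu> \<in> F" "\<mu> \<noteq> \<nu>" for \<mu> \<nu>
      using that \<open>F \<subseteq> dual_space t H\<close> by (intro dual_space_distinct) auto
  qed
  ultimately show ?thesis
    using V.subspace_joint_eigenspace[of H T, OF lin] by unfold_locales auto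
qed

section \<open>Root decomposition of a simple Lie algebra\<close>

lemma vector_space_complex: "vector_space ((*) :: complex \<Rightarrow> complex \<Rightarrow> complex)"
  by unfold_locales (simp_all add: algebra_simps)

locale rmatrix =
  fixes \<D> :: "('g::ab_group_add, 'i::finite, 'n::finite) rmatrix_datum"
  assumes simple: "simple_lie_algebra (scl \<D>) (brk \<D>)"
    and cartan: "cartan_subalgebra (scl \<D>) (brk \<D>) (cartan \<D>)"
    and form: "is_normalized_form \<D>"
    and simple_system: "is_simple_system \<D>"
    and root_vectors: "are_root_vectors \<D>"
    and chevalley: "is_chevalley_involution \<D>"
    and faithful: "is_faithful_module \<D>"
begin

abbreviation "s \<equiv> scl \<D>"
abbreviation "br \<equiv> brk \<D>"
abbreviation "H \<equiv> cartan \<D>"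
abbreviation "F \<equiv> form \<D>"
abbreviation "dualH \<equiv> dual_space s H"
abbreviation "W \<equiv> root_space \<D>"

sublocale G: complex_vector_space s
  using simple by (simp add: simple_lie_algebra_def lie_algebra_def complex_vector_space_def)

lemma linear_br_right: "Vector_Spaces.linear s s (br x)"
  using simple by (simp add: simple_lie_algebra_def lie_algebra_def)

lemma linear_br_left: "Vector_Spaces.linear s s (\<lambda>x. br x y)"
  using simple by (simp add: simple_lie_algebra_def lie_algebra_def)

lemmas br_right = linear_maps[OF linear_br_right]
lemmas br_left = linear_maps[OF linear_br_left]
lemmas br_linear = br_right br_left

lemma br_self: "br x x = 0"
  using simple by (simp add: simple_lie_algebra_def lie_algebra_def)

lemma br_skew: "br x y = - br y x"
proof -
  have "0 = br (x + y) (x + y)" by (simp only: br_self)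
  also have "\<dots> = br x y + br y x" by (simp only: br_right(1) br_left(1)) (simp add: br_self)
  finally have "br x y + br y x = 0" by simp
  then show ?thesis by (simp add: eq_neg_iff_add_eq_0)
qed

lemma jacobi: "br x (br y z) = br (br x y) z + br y (br x z)"
proof -
  have "br x (br y z) + br y (br z x) + br z (br x y) = 0"
    using simple by (simp add: simple_lie_algebra_def lie_algebra_def)
  moreover have "br y (br z x) = - br y (br x z)" "br z (br x y) = - br (br x y) z"
    using br_skew[of z x] br_skew[of z "br x y"] by (simp_all add: br_linear)
  ultimately show ?thesis by (simp add: algebra_simps)
qed

lemma simple_ideal:
  assumes "G.subspace I" "\<And>x y. y \<in> I \<Longrightarrow> br x y \<in> I" "x \<in> I" "x \<noteq> 0"
  shows "I = UNIV"
  using simple assms unfolding simple_lie_algebra_def by blast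

lemma center_trivial: "(\<And>y. br x y = 0) \<Longrightarrow> x = 0"
proof (rule ccontr)
  assume x: "\<And>y. br x y = 0" "x \<noteq> 0"
  have "{x. \<forall>y. br x y = 0} = UNIV"
  proof (rule simple_ideal)
    show "G.subspace {x. \<forall>y. br x y = 0}"
      by (intro G.subspaceI) (auto simp: br_linear)
    show "br z x \<in> {x. \<forall>y. br x y = 0}" if "x \<in> {x. \<forall>y. br x y = 0}" for z x
      using that br_skew[of z x] by (simp add: br_linear)
  qed (use x in auto)
  moreover have "\<exists>x y. br x y \<noteq> 0" using simple by (simp add: simple_lie_algebra_def)
  ultimately show False by auto
qed

lemma finite_dimensional: "\<exists>B. finite B \<and> G.span B = UNIV"
  using simple by (simp add: simple_lie_algebra_def)

lemma subspace_H: "G.subspace H"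
  and H_abelian: "x \<in> H \<Longrightarrow> y \<in> H \<Longrightarrow> br x y = 0"
  and H_self_centralizing: "(\<And>h. h \<in> H \<Longrightarrow> br h x = 0) \<Longrightarrow> x \<in> H"
  and H_diagonalizable: "h \<in> H \<Longrightarrow> G.span {x. \<exists>c. br h x = s c x} = UNIV"
proof -
  note c = cartan[unfolded cartan_subalgebra_def]
  show "G.subspace H" using c by (elim conjE)
  show "x \<in> H \<Longrightarrow> y \<in> H \<Longrightarrow> br x y = 0" using c by (elim conjE) blast
  show "x \<in> H" if "\<And>h. h \<in> H \<Longrightarrow> br h x = 0"
    using c[THEN conjunct2, THEN conjunct2, THEN conjunct1] that by simp
  show "h \<in> H \<Longrightarrow> G.span {x. \<exists>c. br h x = s c x} = UNIV"
    using c by (elim conjE bspec)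
qed

lemmas H_closed = G.subspace_0[OF subspace_H] G.subspace_add[OF subspace_H]
  G.subspace_scale[OF subspace_H] G.subspace_neg[OF subspace_H] G.subspace_diff[OF subspace_H]
  G.subspace_sum[OF subspace_H]

lemma linear_F: "Vector_Spaces.linear s (*) (F x)"
  and F_sym: "F x y = F y x"
  and F_inv: "F (br x y) z = F x (br y z)"
  and F_nondeg: "(\<And>y. F x y = 0) \<Longrightarrow> x = 0"
proof -
  note c = form[unfolded is_normalized_form_def]
  show "Vector_Spaces.linear s (*) (F x)" using c[THEN conjunct1] by simp
  show "F x y = F y x" by (rule c[THEN conjunct2, THEN conjunct1, rule_format])
  show "F (br x y) z = F x (br y z)"
    by (rule c[THEN conjunct2, THEN conjunct2, THEN conjunct1, rule_format])
  show "x = 0" if "\<And>y. F x y = 0"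
    using c[THEN conjunct2, THEN conjunct2, THEN conjunct2, THEN conjunct1] that by simp
qed

lemmas F_right = linear_maps[OF linear_F]

lemma linear_F': "Vector_Spaces.linear s (*) (\<lambda>x. F x y)"
  using linear_F[of y] by (simp add: F_sym[of _ y])

lemmas F_left = linear_maps[OF linear_F']
lemmas F_linear = F_right F_left

lemma F_ext: "(\<And>z. F x z = F y z) \<Longrightarrow> x = y"
  using F_nondeg[of "x - y"] by (simp add: F_linear)

lemma F_br_skew: "F (br z x) y = - F x (br z y)"
  using F_inv[of x z y] br_skew[of z x] by (simp add: F_linear)

lemma root_space_eq: "W = joint_eigenspace s br H"
  by (auto simp: root_space_def joint_eigenspace_def fun_eq_iff)

sublocale gr: graded_space s W dualH
proof -
  obtain B where B: "finite B" "G.span B = UNIV" using finite_dimensional by blast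
  obtain S where S: "S \<subseteq> H" "G.independent S" "H \<subseteq> G.span S"
    using G.maximal_independent_subset by blast
  have "finite S" using G.independent_span_bound[OF B(1) S(2)] B(2) by simp
  then show "graded_space s W dualH"
    unfolding root_space_eq using S subspace_H linear_br_right H_diagonalizable
  proof (intro graded_space_joint_eigenspaces)
    fix h k x assume "h \<in> S" "k \<in> S"
    then have "br h k = 0" using H_abelian S by blast
    then show "br h (br k x) = br k (br h x)" using jacobi[of h k x] by (simp add: br_linear)
  qed (auto simp: br_linear G.vector_space_axioms)
qed

lemma W_iff: "x \<in> W \<mu> \<longleftrightarrow> (\<forall>h\<in>H. br h x = s (\<mu> h) x)"
  by (simp add: root_space_def)

lemma W_D: "x \<in> W \<mu> \<Longrightarrow> h \<in> H \<Longrightarrow> br h x = s (\<mu> h) x"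
  by (simp add: root_space_def)

lemma W_0: "W 0 = H"
  using H_abelian H_self_centralizing by (auto simp: W_iff)

lemma br_W: "x \<in> W \<mu> \<Longrightarrow> y \<in> W \<nu> \<Longrightarrow> br x y \<in> W (\<mu> + \<nu>)"
  unfolding W_iff by (simp add: jacobi[of _ x y] br_linear G.scale_left_distrib)

lemma F_orthogonal:
  assumes "x \<in> W \<mu>" "y \<in> W \<nu>" "\<mu> \<in> dualH" "\<nu> \<in> dualH" "\<mu> \<noteq> - \<nu>"
  shows "F x y = 0"
proof -
  obtain h where h: "h \<in> H" "\<mu> h \<noteq> (- \<nu>) h"
    using dual_space_distinct[OF assms(3) dual_space_uminus[OF assms(4)] assms(5)] by blast
  have "\<mu> h * F x y = - (\<nu> h * F x y)"
    using F_br_skew[of h x y] W_D[OF assms(1) h(1)] W_D[OF assms(2) h(1)] by (simp add: F_linear)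
  then have "(\<mu> h + \<nu> h) * F x y = 0" by (simp add: algebra_simps)
  then show ?thesis using h(2) by (auto simp: add_eq_0_iff)
qed

lemma F_nondeg_W:
  assumes "x \<in> W \<mu>" "\<mu> \<in> dualH" "\<And>y. y \<in> W (- \<mu>) \<Longrightarrow> F x y = 0"
  shows "x = 0"
proof (rule F_nondeg)
  show "F x y = 0" for y
  proof (induction y rule: gr.induct_homogeneous)
    case (1 \<nu> y)
    then show ?case using assms(3)[of y] F_orthogonal[OF assms(1) 1(2) assms(2) 1(1)]
      by (cases "\<mu> = - \<nu>") auto
  qed (simp_all add: F_linear)
qed

lemma F_nondeg_H: "x \<in> H \<Longrightarrow> (\<And>h. h \<in> H \<Longrightarrow> F x h = 0) \<Longrightarrow> x = 0"
  using F_nondeg_W[of x 0] by (simp add: W_0 dual_space_zero)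

lemma form_dual_eqI:
  assumes "t \<in> H" "\<And>h. h \<in> H \<Longrightarrow> F t h = \<mu> h"
  shows "form_dual \<D> \<mu> = t"
  unfolding form_dual_def
proof (rule the_equality)
  fix u assume "u \<in> H \<and> (\<forall>h\<in>H. F u h = \<mu> h)"
  then have "u - t = 0" using assms by (intro F_nondeg_H) (auto simp: F_linear intro: H_closed)
  then show "u = t" by simp
qed (use assms in auto)

section \<open>Roots, coroots and one-dimensional root spaces\<close>

lemma roots_dualH: "\<alpha> \<in> roots \<D> \<Longrightarrow> \<alpha> \<in> dualH"
  by (simp add: roots_def)

lemma zero_notin_roots: "0 \<notin> roots \<D>"
  by (simp add: roots_def)

lemma W_trivial: "\<mu> \<in> dualH \<Longrightarrow> \<mu> \<noteq> 0 \<Longrightarrow> \<mu> \<notin> roots \<D> \<Longrightarrow> x \<in> W \<mu> \<Longrightarrow> x = 0"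
  by (auto simp: roots_def)

lemma root_nonzero_vector:
  assumes "\<alpha> \<in> roots \<D>" shows "\<exists>x\<in>W \<alpha>. x \<noteq> 0"
proof -
  have "0 \<in> W \<alpha>" by (simp add: W_iff br_linear)
  then show ?thesis using assms by (auto simp: roots_def)
qed

lemma root_pair:
  assumes "\<alpha> \<in> roots \<D>"
  shows "\<exists>x\<in>W \<alpha>. \<exists>y\<in>W (- \<alpha>). F x y = 1"
proof -
  obtain x where x: "x \<in> W \<alpha>" "x \<noteq> 0" using root_nonzero_vector[OF assms] by blast
  then obtain y where y: "y \<in> W (- \<alpha>)" "F x y \<noteq> 0"
    using F_nondeg_W[of x \<alpha>] roots_dualH[OF assms] by blast
  have "s (inverse (F x y)) y \<in> W (- \<alpha>)"
    using y(1) by (simp add: W_iff br_linear mult.commute)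
  then show ?thesis using x y by (intro bexI[of _ x] bexI[of _ "s (inverse (F x y)) y"]) (auto simp: F_linear)
qed

lemma roots_uminus: "\<alpha> \<in> roots \<D> \<Longrightarrow> - \<alpha> \<in> roots \<D>"
proof -
  assume a: "\<alpha> \<in> roots \<D>"
  obtain x y where "y \<in> W (- \<alpha>)" "F x y = 1" using root_pair[OF a] by blast
  then have "y \<noteq> 0" by (auto simp: F_linear)
  moreover have "- \<alpha> \<noteq> 0" using a zero_notin_roots by auto
  ultimately show ?thesis using \<open>y \<in> W (- \<alpha>)\<close> dual_space_uminus[OF roots_dualH[OF a]]
    unfolding roots_def by blast
qed

lemma F_br_opposite:
  assumes "x \<in> W \<alpha>" "y \<in> W (- \<alpha>)" "h \<in> H"
  shows "F (br x y) h = F x y * \<alpha> h"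
  using W_D[OF assms(2,3)] br_skew[of y h] by (simp add: F_inv F_linear)

lemma br_opposite_H: "x \<in> W \<alpha> \<Longrightarrow> y \<in> W (- \<alpha>) \<Longrightarrow> br x y \<in> H"
  using br_W[of x \<alpha> y "- \<alpha>"] W_0 by simp

text \<open>\<open>form_dual\<close> is a definite description, so its existence has to be
  established. For root vectors with \<open>F x y = 1\<close> the bracket \<open>br x y\<close>
  represents \<alpha>, by invariance of the form.\<close>

lemma form_dual_root:
  assumes "\<alpha> \<in> roots \<D>"
  shows "form_dual \<D> \<alpha> \<in> H" "h \<in> H \<Longrightarrow> F (form_dual \<D> \<alpha>) h = \<alpha> h"
proof -
  obtain x y where xy: "x \<in> W \<alpha>" "y \<in> W (- \<alpha>)" "F x y = 1" using root_pair[OF assms] by blast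
  have "form_dual \<D> \<alpha> = br x y"
    using xy by (intro form_dual_eqI) (auto simp: F_br_opposite intro: br_opposite_H)
  then show "form_dual \<D> \<alpha> \<in> H" "h \<in> H \<Longrightarrow> F (form_dual \<D> \<alpha>) h = \<alpha> h"
    using xy by (simp_all add: F_br_opposite br_opposite_H)
qed

lemma br_opposite:
  assumes "\<alpha> \<in> roots \<D>" "x \<in> W \<alpha>" "y \<in> W (- \<alpha>)"
  shows "br x y = s (F x y) (form_dual \<D> \<alpha>)"
proof -
  have "br x y - s (F x y) (form_dual \<D> \<alpha>) = 0"
    using assms form_dual_root[OF assms(1)]
    by (intro F_nondeg_H) (auto simp: F_linear F_br_opposite intro!: H_closed br_opposite_H)
  then show ?thesis by simp
qed

lemma finite_roots: "finite (roots \<D>)"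
proof -
  obtain B where "finite B" "G.span B = UNIV" using finite_dimensional by blast
  then show ?thesis
    using root_nonzero_vector dual_space_distinct roots_dualH
    unfolding root_space_eq
    by (intro G.finite_joint_eigenvalues[OF linear_br_right]) blast+
qed

text \<open>The normalization of the form is what excludes isotropic roots here.\<close>

lemma root_length_nonzero:
  assumes "\<alpha> \<in> roots \<D>" shows "\<alpha> (form_dual \<D> \<alpha>) \<noteq> 0"
proof -
  let ?l = "\<lambda>\<alpha>. cmod (weight_form \<D> \<alpha> \<alpha>)"
  have "\<exists>\<beta>. is_arg_min ?l (\<lambda>\<alpha>. \<alpha> \<in> roots \<D>) \<beta>"
    using ex_is_arg_min_if_finite[OF finite_roots, of ?l] assms by blast
  then obtain \<beta> where \<beta>: "\<beta> \<in> roots \<D>" "\<forall>\<gamma>\<in>roots \<D>. ?l \<beta> \<le> ?l \<gamma>"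
    by (auto simp: is_arg_min_linorder)
  then have "weight_form \<D> \<beta> \<beta> = 2" using form by (simp add: is_normalized_form_def)
  then have "2 \<le> ?l \<alpha>" using \<beta>(2) assms by force
  then show ?thesis
    using form_dual_root[OF assms] by (auto simp: weight_form_def)
qed

definition coroot :: "('g \<Rightarrow> complex) \<Rightarrow> 'g" where
  "coroot \<alpha> = s (2 / \<alpha> (form_dual \<D> \<alpha>)) (form_dual \<D> \<alpha>)"

lemma dualH_scale: "\<mu> \<in> dualH \<Longrightarrow> h \<in> H \<Longrightarrow> \<mu> (s c h) = c * \<mu> h"
  by (simp add: dual_space_def)

lemma coroot_H: "\<alpha> \<in> roots \<D> \<Longrightarrow> coroot \<alpha> \<in> H"
  unfolding coroot_def using form_dual_root by (intro H_closed)

lemma root_coroot: "\<alpha> \<in> roots \<D> \<Longrightarrow> \<alpha> (coroot \<alpha>) = 2"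
  unfolding coroot_def by (simp add: form_dual_root root_length_nonzero dualH_scale[OF roots_dualH])

lemma sl2_triple:
  assumes a: "\<alpha> \<in> roots \<D>"
    and "x \<in> W \<alpha>" "y \<in> W (- \<alpha>)" "F x y = 1" "z = s (2 / \<alpha> (form_dual \<D> \<alpha>)) y"
  shows "br (coroot \<alpha>) x = s 2 x" "br (coroot \<alpha>) z = - s 2 z" "br x z = coroot \<alpha>"
proof -
  show "br (coroot \<alpha>) x = s 2 x" using W_D[OF assms(2) coroot_H[OF a]] by (simp add: root_coroot[OF a])
  show "br (coroot \<alpha>) z = - s 2 z"
    using W_D[OF assms(3) coroot_H[OF a]] by (simp add: root_coroot[OF a] assms(5) br_linear mult.commute)
  show "br x z = coroot \<alpha>" using br_opposite[OF assms(1-3)] assms(4,5) by (simp add: br_linear coroot_def)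
qed

lemma ex_sl2_module:
  assumes a: "\<alpha> \<in> roots \<D>" and "x \<in> W \<alpha>" "y \<in> W (- \<alpha>)" "F x y = 1"
  shows "\<exists>B. sl2_module s (br x) (br (s (2 / \<alpha> (form_dual \<D> \<alpha>)) y)) (br (coroot \<alpha>)) B"
proof -
  obtain B where B: "finite B" "G.span B = UNIV" using finite_dimensional by blast
  define z where "z = s (2 / \<alpha> (form_dual \<D> \<alpha>)) y"
  note t = sl2_triple[OF assms z_def]
  have "sl2_module s (br x) (br z) (br (coroot \<alpha>)) B"
  proof (intro sl2_module.intro G.complex_vector_space_axioms sl2_module_axioms.intro linear_br_right B)
    show "br (coroot \<alpha>) (br x u) = br x (br (coroot \<alpha>) u) + s 2 (br x u)" for u
      using jacobi[of "coroot \<alpha>" x u] t by (simp add: br_linear)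
    show "br (coroot \<alpha>) (br z u) = br z (br (coroot \<alpha>) u) - s 2 (br z u)" for u
      using jacobi[of "coroot \<alpha>" z u] t by (simp add: br_linear)
    show "br x (br z u) = br z (br x u) + br (coroot \<alpha>) u" for u
      using jacobi[of x z u] t by simp
  qed
  then show ?thesis unfolding z_def by blast
qed

text \<open>The part of \<open>u\<close> orthogonal to \<open>y\<close> commutes with
  \<open>y\<close>, because brackets of opposite root vectors are governed by the form. It is then a
  lowest weight vector on which the coroot acts by 2, so it vanishes by
  \<open>lowest_weight_nonpositive\<close>.\<close>

lemma root_space_one_dimensional:
  assumes a: "\<alpha> \<in> roots \<D>" and x: "x \<in> W \<alpha>" and y: "y \<in> W (- \<alpha>)" "F x y = 1" and u: "u \<in> W \<alpha>"
  shows "u = s (F u y) x"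
proof -
  define v where "v = u - s (F u y) x"
  have v: "v \<in> W \<alpha>" "F v y = 0"
    using x u y by (auto simp: v_def W_iff br_linear G.scale_right_diff_distrib mult.commute F_linear)
  obtain B where "sl2_module s (br x) (br (s (2 / \<alpha> (form_dual \<D> \<alpha>)) y)) (br (coroot \<alpha>)) B"
    using ex_sl2_module[OF a x y] by blast
  then interpret sl: sl2_module s "br x" "br (s (2 / \<alpha> (form_dual \<D> \<alpha>)) y)" "br (coroot \<alpha>)" B .
  have "br (s (2 / \<alpha> (form_dual \<D> \<alpha>)) y) v = 0"
    using br_opposite[OF a v(1) y(1)] br_skew[of y v] by (simp add: br_linear v(2))
  moreover have "br (coroot \<alpha>) v = s 2 v"
    using W_D[OF v(1) coroot_H[OF a]] by (simp add: root_coroot[OF a])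
  ultimately have "\<exists>k::nat. (2::complex) = - of_nat k" if "v \<noteq> 0"
    using sl.lowest_weight_nonpositive that by blast
  moreover have "(2::complex) \<noteq> - of_nat k" for k :: nat
  proof
    assume "(2::complex) = - of_nat k"
    then have "of_nat (2 + k) = (0::complex)" by (simp only: of_nat_add of_nat_numeral eq_neg_iff_add_eq_0)
    then show False by (simp only: of_nat_eq_0_iff)
  qed
  ultimately have "v = 0" by blast
  then show ?thesis by (simp add: v_def)
qed

lemma root_coroot_integral:
  assumes "\<alpha> \<in> roots \<D>" "\<beta> \<in> roots \<D>" shows "\<beta> (coroot \<alpha>) \<in> \<int>"
proof -
  obtain x y where xy: "x \<in> W \<alpha>" "y \<in> W (- \<alpha>)" "F x y = 1" using root_pair[OF assms(1)] by blast
  obtain B where "sl2_module s (br x) (br (s (2 / \<alpha> (form_dual \<D> \<alpha>)) y)) (br (coroot \<alpha>)) B"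
    using ex_sl2_module[OF assms(1) xy] by blast
  then interpret sl: sl2_module s "br x" "br (s (2 / \<alpha> (form_dual \<D> \<alpha>)) y)" "br (coroot \<alpha>)" B .
  obtain u where "u \<in> W \<beta>" "u \<noteq> 0" using root_nonzero_vector[OF assms(2)] by blast
  then show ?thesis using W_D[OF _ coroot_H[OF assms(1)]] sl.integral_eigenvalue by blast
qed

end

lemma sum_fun_apply: "(\<Sum>i\<in>A. f i) x = (\<Sum>i\<in>A. f i x)"
  by (induction A rule: infinite_finite_induct) auto

section \<open>Positive roots, the root cone and fundamental coweights\<close>

context rmatrix
begin

abbreviation "\<Delta> \<equiv> positive_roots \<D>"
abbreviation "sr \<equiv> simple_root \<D>"

lemma simple_root_root: "sr i \<in> roots \<D>"
  and simple_roots_independent: "(\<Sum>i\<in>UNIV. (\<lambda>h. c i * sr i h)) = 0 \<Longrightarrow> c j = 0"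
  and roots_Q: "\<alpha> \<in> roots \<D> \<Longrightarrow> \<alpha> \<in> Q_plus \<D> \<or> \<alpha> \<in> Q_minus \<D>"
  using simple_system unfolding is_simple_system_def by blast+

lemma Q_plus_iff: "\<mu> \<in> Q_plus \<D> \<longleftrightarrow> (\<exists>c::'i \<Rightarrow> nat. \<forall>h. \<mu> h = (\<Sum>i\<in>UNIV. of_nat (c i) * sr i h))"
  by (auto simp: Q_plus_def fun_eq_iff sum_fun_apply)

lemma Q_minus_iff: "\<mu> \<in> Q_minus \<D> \<longleftrightarrow> - \<mu> \<in> Q_plus \<D>"
  unfolding Q_minus_def by (metis add.inverse_inverse image_iff)

lemma Q_plus_add: "\<mu> \<in> Q_plus \<D> \<Longrightarrow> \<nu> \<in> Q_plus \<D> \<Longrightarrow> \<mu> + \<nu> \<in> Q_plus \<D>"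
proof -
  assume "\<mu> \<in> Q_plus \<D>" "\<nu> \<in> Q_plus \<D>"
  then obtain c d :: "'i \<Rightarrow> nat" where
    "\<forall>h. \<mu> h = (\<Sum>i\<in>UNIV. of_nat (c i) * sr i h)" "\<forall>h. \<nu> h = (\<Sum>i\<in>UNIV. of_nat (d i) * sr i h)"
    unfolding Q_plus_iff by blast
  then show ?thesis
    unfolding Q_plus_iff by (intro exI[of _ "\<lambda>i. c i + d i"]) (simp add: algebra_simps sum.distrib)
qed

lemma Q_plus_dualH: "\<mu> \<in> Q_plus \<D> \<Longrightarrow> \<mu> \<in> dualH"
proof -
  assume "\<mu> \<in> Q_plus \<D>"
  then obtain c :: "'i \<Rightarrow> nat" where c: "\<mu> = (\<lambda>h. \<Sum>i\<in>UNIV. of_nat (c i) * sr i h)"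
    unfolding Q_plus_iff fun_eq_iff by blast
  have "sr i (x + y) = sr i x + sr i y" "sr i (s a x) = a * sr i x" if "x \<in> H" "y \<in> H" for i x y a
    using that roots_dualH[OF simple_root_root[of i]] by (simp_all add: dual_space_def)
  moreover have "sr i x = 0" if "x \<notin> H" for i x
    using that roots_dualH[OF simple_root_root[of i]] by (simp add: dual_space_def)
  ultimately show ?thesis
    unfolding c dual_space_def by (simp add: algebra_simps sum.distrib sum_distrib_left)
qed

lemma Q_plus_Q_minus: "\<mu> \<in> Q_plus \<D> \<Longrightarrow> - \<mu> \<in> Q_plus \<D> \<Longrightarrow> \<mu> = 0"
proof -
  assume "\<mu> \<in> Q_plus \<D>" "- \<mu> \<in> Q_plus \<D>"
  then obtain c d :: "'i \<Rightarrow> nat" where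
    c: "\<forall>h. \<mu> h = (\<Sum>i\<in>UNIV. of_nat (c i) * sr i h)" and d: "\<forall>h. (- \<mu>) h = (\<Sum>i\<in>UNIV. of_nat (d i) * sr i h)"
    unfolding Q_plus_iff by blast
  have "(\<Sum>i\<in>UNIV. (\<lambda>h. of_nat (c i + d i) * sr i h)) h = 0 h" for h
  proof -
    have "\<mu> h + (- \<mu>) h = 0" by simp
    then have "(\<Sum>i\<in>UNIV. of_nat (c i) * sr i h) + (\<Sum>i\<in>UNIV. of_nat (d i) * sr i h) = 0"
      using c d by metis
    then show ?thesis by (simp add: algebra_simps sum.distrib sum_fun_apply)
  qed
  then have "of_nat (c j + d j) = (0::complex)" for j
    using simple_roots_independent[of "\<lambda>i. of_nat (c i + d i)"] by blast
  then have "c j = 0" for j by (simp only: of_nat_eq_0_iff) simp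
  then show "\<mu> = 0" using c by (simp add: fun_eq_iff)
qed

lemma positive_root_D: "\<alpha> \<in> \<Delta> \<Longrightarrow> \<alpha> \<in> roots \<D>" "\<alpha> \<in> \<Delta> \<Longrightarrow> \<alpha> \<in> Q_plus \<D>"
  "\<alpha> \<in> \<Delta> \<Longrightarrow> \<alpha> \<in> dualH" "\<alpha> \<in> \<Delta> \<Longrightarrow> - \<alpha> \<in> roots \<D>" "\<alpha> \<in> \<Delta> \<Longrightarrow> - \<alpha> \<in> dualH"
  by (auto simp: positive_roots_def roots_dualH roots_uminus)

lemma positive_root_nonzero: "\<alpha> \<in> \<Delta> \<Longrightarrow> \<alpha> \<noteq> 0"
  using zero_notin_roots positive_root_D(1) by blast

lemma uminus_positive: "\<alpha> \<in> \<Delta> \<Longrightarrow> - \<alpha> \<notin> \<Delta>"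
  using Q_plus_Q_minus positive_root_D(2) positive_root_nonzero by blast

lemma root_cases: "\<alpha> \<in> roots \<D> \<Longrightarrow> \<alpha> \<in> \<Delta> \<or> - \<alpha> \<in> \<Delta>"
  using roots_Q roots_uminus by (auto simp: positive_roots_def Q_minus_iff)

lemma finite_positive: "finite \<Delta>"
  using finite_roots by (simp add: positive_roots_def)

lemma root_vectors_D:
  assumes "\<alpha> \<in> \<Delta>"
  shows "xpos \<D> \<alpha> \<in> W \<alpha>" "xneg \<D> \<alpha> \<in> W (- \<alpha>)" "F (xpos \<D> \<alpha>) (xneg \<D> \<alpha>) = 1"
  using root_vectors assms by (auto simp: are_root_vectors_def)

text \<open>All roots are integral combinations of simple ones, so such an \<open>h\<close> acts by
  zero on every root space and is central.\<close>

lemma H_eq_0_if_simple_roots_vanish: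
  assumes "h \<in> H" "\<And>i. sr i h = 0"
  shows "h = 0"
proof (rule center_trivial)
  have Q: "\<mu> h = 0" if "\<mu> \<in> Q_plus \<D>" for \<mu> using that assms(2) by (auto simp: Q_plus_iff)
  have r: "\<mu> h = 0" if "\<mu> \<in> roots \<D>" for \<mu>
    using roots_Q[OF that] Q[of \<mu>] Q[of "- \<mu>"] by (auto simp: Q_minus_iff)
  show "br h x = 0" for x
  proof (induction x rule: gr.induct_homogeneous)
    case (1 \<mu> x)
    then show ?case
      using W_D[OF 1(2) assms(1)] r[of \<mu>] W_trivial[OF 1(1) _ _ 1(2)] by (cases "\<mu> \<in> roots \<D>"; cases "\<mu> = 0") (auto simp: br_linear)
  qed (simp_all add: br_linear)
qed

abbreviation "fund \<equiv> fund_coweight \<D>"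

lemma sr_linear:
  assumes "x \<in> H" "y \<in> H"
  shows "sr i (x + y) = sr i x + sr i y" "sr i (s a x) = a * sr i x" "sr i (x - y) = sr i x - sr i y"
proof -
  have a: "sr i (x + y) = sr i x + sr i y" if "x \<in> H" "y \<in> H" for x y
    using that roots_dualH[OF simple_root_root[of i]] by (simp add: dual_space_def)
  show "sr i (x + y) = sr i x + sr i y" using a assms by simp
  show "sr i (s a x) = a * sr i x"
    using assms roots_dualH[OF simple_root_root[of i]] by (simp add: dual_space_def)
  show "sr i (x - y) = sr i x - sr i y" using a[of "x - y" y] assms by (simp add: H_closed)
qed

text \<open>If no such element existed, the i-th simple root would vanish on the common kernel of
  the others and hence be a combination of them, contradicting independence.\<close>

lemma ex_fund_coweight: "\<exists>h. h \<in> H \<and> (\<forall>j. sr j h = (if i = j then 1 else 0))"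
proof -
  have "\<exists>h\<in>H. (\<forall>j. j \<noteq> i \<longrightarrow> sr j h = 0) \<and> sr i h \<noteq> 0"
  proof (rule ccontr)
    assume neg: "\<not> ?thesis"
    have "\<exists>a. \<forall>x\<in>H. sr i x = (\<Sum>j\<in>UNIV - {i}. a j * sr j x)"
      by (rule G.in_span_of_kernels[OF _ subspace_H]) (use neg in \<open>auto simp: sr_linear\<close>)
    then obtain a where a: "\<forall>x\<in>H. sr i x = (\<Sum>j\<in>UNIV - {i}. a j * sr j x)" by blast
    define c where "c = a(i := - 1)"
    have z: "sr j x = 0" if "x \<notin> H" for j x
      using that roots_dualH[OF simple_root_root[of j]] by (simp add: dual_space_def)
    have "(\<Sum>j\<in>UNIV. (\<lambda>h. c j * sr j h)) x = 0 x" for x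
    proof (cases "x \<in> H")
      case True
      have "(\<Sum>j\<in>UNIV. c j * sr j x) = c i * sr i x + (\<Sum>j\<in>UNIV - {i}. c j * sr j x)"
        by (simp add: sum.remove)
      also have "(\<Sum>j\<in>UNIV - {i}. c j * sr j x) = (\<Sum>j\<in>UNIV - {i}. a j * sr j x)"
        by (intro sum.cong) (auto simp: c_def)
      finally show ?thesis using a True by (simp add: c_def sum_fun_apply)
    qed (simp add: z sum_fun_apply)
    then have "c i = 0" using simple_roots_independent[of c] by blast
    then show False by (simp add: c_def)
  qed
  then obtain h where h: "h \<in> H" "\<forall>j. j \<noteq> i \<longrightarrow> sr j h = 0" "sr i h \<noteq> 0" by blast
  then show ?thesis
    by (intro exI[of _ "s (inverse (sr i h)) h"]) (auto simp: sr_linear[OF h(1) h(1)] H_closed)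
qed

lemma fund_coweight: "fund i \<in> H" "sr j (fund i) = (if i = j then 1 else 0)"
proof -
  have "\<exists>!h. h \<in> H \<and> (\<forall>j. sr j h = (if i = j then 1 else 0))"
  proof (rule ex_ex1I[OF ex_fund_coweight])
    fix x y assume xy: "x \<in> H \<and> (\<forall>j. sr j x = (if i = j then 1 else 0))"
      "y \<in> H \<and> (\<forall>j. sr j y = (if i = j then 1 else 0))"
    then have "x - y = 0"
      by (intro H_eq_0_if_simple_roots_vanish) (auto simp: sr_linear H_closed)
    then show "x = y" by simp
  qed
  from theI'[OF this] show "fund i \<in> H" "sr j (fund i) = (if i = j then 1 else 0)"
    by (simp_all add: fund_coweight_def)
qed

abbreviation "hv \<equiv> hvec \<D>"

lemma hvec: "hv i \<in> H" "h \<in> H \<Longrightarrow> F (hv i) h = sr i h" "h \<in> H \<Longrightarrow> F h (hv i) = sr i h"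
  using form_dual_root[OF simple_root_root[of i]] by (simp_all add: hvec_def F_sym[of _ "form_dual \<D> (sr i)"])

lemma sr_sum: "(\<And>x. x \<in> A \<Longrightarrow> f x \<in> H) \<Longrightarrow> sr i (sum f A) = (\<Sum>x\<in>A. sr i (f x))"
proof -
  have "sr i (s 0 0) = 0 * sr i 0" by (rule sr_linear(2)) (rule H_closed(1))+
  then have "sr i 0 = 0" by simp
  then show "(\<And>x. x \<in> A \<Longrightarrow> f x \<in> H) \<Longrightarrow> ?thesis"
    by (induction A rule: infinite_finite_induct) (simp_all add: sr_linear H_closed)
qed

text \<open>The families \<open>fund\<close> and \<open>hv\<close> are dual bases of the Cartan
  subalgebra under the form; this and the next lemma are the two resulting expansions.\<close>

lemma H_expand: assumes "h \<in> H" shows "(\<Sum>i\<in>UNIV. s (F h (hv i)) (fund i)) = h"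
proof -
  have "(\<Sum>i\<in>UNIV. s (F h (hv i)) (fund i)) - h = 0"
  proof (rule H_eq_0_if_simple_roots_vanish)
    fix j
    have "sr j (s (F h (hv i)) (fund i)) = (if i = j then sr i h else 0)" for i
      using assms by (simp add: sr_linear[OF fund_coweight(1) fund_coweight(1)] fund_coweight hvec)
    then have "sr j (\<Sum>i\<in>UNIV. s (F h (hv i)) (fund i)) = sr j h"
      by (subst sr_sum) (simp_all add: H_closed fund_coweight)
    then show "sr j ((\<Sum>i\<in>UNIV. s (F h (hv i)) (fund i)) - h) = 0"
      using assms by (simp add: sr_linear H_closed fund_coweight)
  qed (use assms in \<open>auto intro!: H_closed fund_coweight\<close>)
  then show ?thesis by simp
qed

lemma H_expand': assumes "h \<in> H" shows "(\<Sum>i\<in>UNIV. s (F h (fund i)) (hv i)) = h"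
proof -
  have "(\<Sum>i\<in>UNIV. s (F h (fund i)) (hv i)) - h = 0"
  proof (rule F_nondeg_H)
    fix k assume k: "k \<in> H"
    have "F h k = F h (\<Sum>i\<in>UNIV. s (F k (hv i)) (fund i))" by (simp add: H_expand[OF k])
    also have "\<dots> = F (\<Sum>i\<in>UNIV. s (F h (fund i)) (hv i)) k"
      by (simp add: F_linear F_sym[of k] mult.commute)
    finally show "F ((\<Sum>i\<in>UNIV. s (F h (fund i)) (hv i)) - h) k = 0" by (simp add: F_linear)
  qed (use assms in \<open>auto intro!: H_closed hvec\<close>)
  then show ?thesis by simp
qed

section \<open>The operators attached to the r-matrix\<close>

lemma F_H_root_vector:
  assumes "x \<in> W \<mu>" "\<mu> \<in> dualH" "\<mu> \<noteq> 0" "h \<in> H"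
  shows "F x h = 0" "F h x = 0"
  using F_orthogonal[OF assms(1) _ assms(2) dual_space_zero] assms W_0 F_sym[of x h] by auto

definition r_index :: "(('g \<Rightarrow> complex) + 'i) set" where "r_index = \<Delta> <+> UNIV"
definition r_left :: "('g \<Rightarrow> complex) + 'i \<Rightarrow> 'g" where "r_left = case_sum (xpos \<D>) (\<lambda>i. s (1/2) (fund i))"
definition r_right :: "('g \<Rightarrow> complex) + 'i \<Rightarrow> 'g" where "r_right = case_sum (xneg \<D>) hv"

lemma sum_r_index: "(\<Sum>k\<in>r_index. f k) = (\<Sum>\<alpha>\<in>\<Delta>. f (Inl \<alpha>)) + (\<Sum>i\<in>UNIV. f (Inr i))"
  unfolding r_index_def by (simp add: sum.Plus finite_positive comp_def)

lemma r_sum_eq: "r_sum \<D> b = (\<Sum>k\<in>r_index. b (r_left k) (r_right k))"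
  by (simp add: sum_r_index r_left_def r_right_def r_sum_def)

text \<open>The two linear operators of the tensor \<open>r\<close>: up to halving the Cartan part, the projections
  to the Borel subalgebras.\<close>

definition P :: "'g \<Rightarrow> 'g" where "P x = (\<Sum>k\<in>r_index. s (F x (r_right k)) (r_left k))"
definition T :: "'g \<Rightarrow> 'g" where "T x = (\<Sum>k\<in>r_index. s (F x (r_left k)) (r_right k))"
text \<open>The orthogonal projection onto the Cartan subalgebra, on which \<open>P\<close> and
  \<open>T\<close> are both 1/2. It also describes the components of the generating matrices in the
  central copy of the Cartan subalgebra.\<close>

definition Z :: "'g \<Rightarrow> 'g" where "Z x = (\<Sum>i\<in>UNIV. s (F x (hv i)) (fund i))"

lemma linear_PTZ: "Vector_Spaces.linear s s P" "Vector_Spaces.linear s s T" "Vector_Spaces.linear s s Z"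
  unfolding P_def T_def Z_def
  by (auto intro!: linearI' G.vector_space_axioms
      simp: F_linear G.scale_left_distrib sum.distrib G.scale_sum_right)

lemmas P_linear = linear_maps[OF linear_PTZ(1)]
lemmas T_linear = linear_maps[OF linear_PTZ(2)]
lemmas Z_linear = linear_maps[OF linear_PTZ(3)]

lemma F_P: "F (P x) y = F x (T y)"
  unfolding P_def T_def by (simp add: F_linear F_sym[of y] mult.commute)

lemma F_T: "F (T x) y = F x (P y)"
  using F_P[of y x] by (simp add: F_sym)

definition P_weight :: "('g \<Rightarrow> complex) \<Rightarrow> complex" where
  "P_weight \<mu> = (if \<mu> \<in> \<Delta> then 1 else if \<mu> = 0 then 1/2 else 0)"

lemma F_pos_neg:
  assumes "x \<in> W \<mu>" "\<mu> \<in> dualH" "\<alpha> \<in> \<Delta>"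
  shows "\<mu> \<noteq> \<alpha> \<Longrightarrow> F x (xneg \<D> \<alpha>) = 0" "\<mu> \<noteq> - \<alpha> \<Longrightarrow> F x (xpos \<D> \<alpha>) = 0"
  using F_orthogonal[OF assms(1) root_vectors_D(2)[OF assms(3)] assms(2)]
    F_orthogonal[OF assms(1) root_vectors_D(1)[OF assms(3)] assms(2)] positive_root_D[OF assms(3)] by auto

lemma P_W:
  assumes "x \<in> W \<mu>" "\<mu> \<in> dualH" shows "P x = s (P_weight \<mu>) x"
proof -
  have P: "P x = (\<Sum>\<alpha>\<in>\<Delta>. s (F x (xneg \<D> \<alpha>)) (xpos \<D> \<alpha>)) + (\<Sum>i\<in>UNIV. s (F x (hv i)) (s (1/2) (fund i)))"
    by (simp add: P_def sum_r_index r_left_def r_right_def)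
  consider "\<mu> \<in> \<Delta>" | "\<mu> = 0" | "\<mu> \<notin> \<Delta>" "\<mu> \<noteq> 0" by blast
  then show ?thesis
  proof cases
    case 1
    have "(\<Sum>\<alpha>\<in>\<Delta>. s (F x (xneg \<D> \<alpha>)) (xpos \<D> \<alpha>)) = (\<Sum>\<alpha>\<in>{\<mu>}. s (F x (xneg \<D> \<alpha>)) (xpos \<D> \<alpha>))"
      using 1 F_pos_neg[OF assms] by (intro sum.mono_neutral_right finite_positive) auto
    also have "\<dots> = x"
      using root_space_one_dimensional[OF positive_root_D(1)[OF 1] root_vectors_D(1)[OF 1] root_vectors_D(2,3)[OF 1] assms(1)] by simp
    finally show ?thesis
      using 1 F_H_root_vector[OF assms positive_root_nonzero[OF 1] hvec(1)] by (simp add: P P_weight_def)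
  next
    case 2
    then have "x \<in> H" using assms W_0 by simp
    have "(\<Sum>i\<in>UNIV. s (F x (hv i)) (s (1/2) (fund i))) = s (1/2) (\<Sum>i\<in>UNIV. s (F x (hv i)) (fund i))"
      by (simp add: G.scale_sum_right G.scale_left_commute)
    moreover have "F x (xneg \<D> \<alpha>) = 0" if "\<alpha> \<in> \<Delta>" for \<alpha>
      using F_pos_neg(1)[OF assms that] positive_root_nonzero[OF that] 2 by simp
    ultimately show ?thesis using 2 positive_root_nonzero
      by (auto simp: P P_weight_def H_expand[OF \<open>x \<in> H\<close>])
  next
    case 3
    then have "F x (xneg \<D> \<alpha>) = 0" if "\<alpha> \<in> \<Delta>" for \<alpha>
      using F_pos_neg(1)[OF assms that] that by auto
    then show ?thesis using 3 F_H_root_vector[OF assms _ hvec(1)] by (simp add: P P_weight_def)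
  qed
qed

lemma T_W:
  assumes "x \<in> W \<mu>" "\<mu> \<in> dualH" shows "T x = s (1 - P_weight \<mu>) x"
proof -
  have T: "T x = (\<Sum>\<alpha>\<in>\<Delta>. s (F x (xpos \<D> \<alpha>)) (xneg \<D> \<alpha>)) + (\<Sum>i\<in>UNIV. s (F x (s (1/2) (fund i))) (hv i))"
    by (simp add: T_def sum_r_index r_left_def r_right_def)
  consider "\<mu> \<in> \<Delta>" | "\<mu> = 0" | "- \<mu> \<in> \<Delta>" "\<mu> \<notin> \<Delta>" "\<mu> \<noteq> 0" | "\<mu> \<notin> roots \<D>" "\<mu> \<noteq> 0"
    using root_cases by blast
  then show ?thesis
  proof cases
    case 1
    have "F x (xpos \<D> \<alpha>) = 0" if "\<alpha> \<in> \<Delta>" for \<alpha>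
      using F_pos_neg(2)[OF assms that] uminus_positive[OF that] 1 by auto
    then show ?thesis
      using 1 F_H_root_vector[OF assms positive_root_nonzero[OF 1] fund_coweight(1)] by (simp add: T P_weight_def F_linear)
  next
    case 2
    then have "x \<in> H" using assms W_0 by simp
    have "(\<Sum>i\<in>UNIV. s (F x (s (1/2) (fund i))) (hv i)) = s (1/2) (\<Sum>i\<in>UNIV. s (F x (fund i)) (hv i))"
      by (simp add: G.scale_sum_right F_linear)
    moreover have "F x (xpos \<D> \<alpha>) = 0" if "\<alpha> \<in> \<Delta>" for \<alpha>
      using F_pos_neg(2)[OF assms that] positive_root_nonzero[OF that] 2 by simp
    ultimately show ?thesis using 2 positive_root_nonzero
      by (auto simp: T P_weight_def H_expand'[OF \<open>x \<in> H\<close>])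
  next
    case 3
    have "(\<Sum>\<alpha>\<in>\<Delta>. s (F x (xpos \<D> \<alpha>)) (xneg \<D> \<alpha>)) = (\<Sum>\<alpha>\<in>{- \<mu>}. s (F x (xpos \<D> \<alpha>)) (xneg \<D> \<alpha>))"
    proof (intro sum.mono_neutral_right finite_positive ballI)
      fix \<alpha> assume a: "\<alpha> \<in> \<Delta> - {- \<mu>}"
      then have "\<mu> \<noteq> - \<alpha>" by auto
      then show "s (F x (xpos \<D> \<alpha>)) (xneg \<D> \<alpha>) = 0" using F_pos_neg(2)[OF assms] a by simp
    qed (use 3 in simp)
    also have "\<dots> = x"
      using root_space_one_dimensional[OF positive_root_D(4)[OF 3(1)], of "xneg \<D> (- \<mu>)" "xpos \<D> (- \<mu>)" x]
        root_vectors_D[OF 3(1)] F_sym[of "xpos \<D> (- \<mu>)"] assms(1) by simp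
    finally show ?thesis
      using 3 F_H_root_vector[OF assms _ fund_coweight(1)] by (simp add: T P_weight_def F_linear)
  next
    case 4
    then have "x = 0" using W_trivial assms by blast
    then show ?thesis by (simp add: T_linear)
  qed
qed

lemma Z_W:
  assumes "x \<in> W \<mu>" "\<mu> \<in> dualH" shows "Z x = (if \<mu> = 0 then x else 0)"
  using assms H_expand W_0 F_H_root_vector[OF assms _ hvec(1)] by (auto simp: Z_def)

lemma P_plus_T: "P x + T x = x"
proof (induction x rule: gr.induct_homogeneous)
  case (1 \<mu> x)
  then show ?case using P_W T_W by (simp add: G.scale_left_distrib[symmetric])
next
  case (3 x y)
  then show ?case by (simp add: P_linear T_linear) (metis add.commute add.left_commute)
qed (simp add: P_linear T_linear)

lemma Z_H: "Z x \<in> H"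
  unfolding Z_def by (intro H_closed fund_coweight)

lemma Z_eq: "Z x = (\<Sum>i\<in>UNIV. s (F x (fund i)) (hv i))"
proof -
  have "F (Z x) (fund i) = F x (fund i)" for i
  proof (induction x rule: gr.induct_homogeneous)
    case (1 \<mu> x)
    then show ?case using Z_W F_H_root_vector[OF 1(2,1) _ fund_coweight(1)] by (auto simp: F_linear)
  qed (simp_all add: Z_linear F_linear)
  then show ?thesis using H_expand'[OF Z_H, of x] by simp
qed

lemma F_Z: "F (Z x) y = F x (Z y)"
  by (subst (2) Z_eq) (simp add: Z_def F_linear F_sym[of y] mult.commute)

lemma Z_idem: "h \<in> H \<Longrightarrow> Z h = h"
  using Z_W[of h 0] by (simp add: W_0 dual_space_zero)

lemma P_H: "h \<in> H \<Longrightarrow> P h = s (1/2) h"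
  using P_W[of h 0] positive_root_nonzero by (auto simp: P_weight_def W_0 dual_space_zero)

text \<open>The Rota-Baxter identity read on eigenvalues, \<open>T\<close> acting on a weight space
  by \<open>1 - P_weight\<close>. Closure of positive roots under addition settles equal signs; in
  the mixed cases a common factor vanishes or both sides agree numerically.\<close>

lemma P_weight_br:
  assumes "x \<in> W \<mu>" "y \<in> W \<nu>" "\<mu> \<in> dualH" "\<nu> \<in> dualH" "br x y \<noteq> 0"
  shows "(1 - P_weight \<mu>) * (1 - P_weight \<nu>) = (1 - P_weight (\<mu> + \<nu>)) * (1 - P_weight \<mu> - P_weight \<nu>)"
proof -
  have x: "x \<noteq> 0" "y \<noteq> 0" using assms(5) by (auto simp: br_linear)
  have \<mu>: "\<mu> \<in> \<Delta> \<or> \<mu> = 0 \<or> - \<mu> \<in> \<Delta>" using W_trivial[OF assms(3) _ _ assms(1)] x root_cases by blast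
  have \<nu>: "\<nu> \<in> \<Delta> \<or> \<nu> = 0 \<or> - \<nu> \<in> \<Delta>" using W_trivial[OF assms(4) _ _ assms(2)] x root_cases by blast
  have s: "\<mu> + \<nu> \<in> roots \<D>" if "\<mu> + \<nu> \<noteq> 0"
    using W_trivial[OF dual_space_add[OF assms(3,4)] that _ br_W[OF assms(1,2)]] assms(5) by blast
  have add: "\<alpha> + \<beta> \<in> \<Delta>" if "\<alpha> \<in> \<Delta>" "\<beta> \<in> \<Delta>" "\<alpha> + \<beta> \<noteq> 0 \<longrightarrow> \<alpha> + \<beta> \<in> roots \<D>" for \<alpha> \<beta>
  proof -
    have "\<alpha> + \<beta> \<noteq> 0"
    proof
      assume "\<alpha> + \<beta> = 0"
      then have "\<beta> = - \<alpha>" by (simp add: add_eq_0_iff)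
      then show False using uminus_positive that by blast
    qed
    then have "\<alpha> + \<beta> \<in> roots \<D>" using that(3) by simp
    then show ?thesis
      using Q_plus_add[OF positive_root_D(2)[OF that(1)] positive_root_D(2)[OF that(2)]]
      by (simp add: positive_roots_def)
  qed
  have neg: "P_weight \<mu> = 0" if "- \<mu> \<in> \<Delta>" for \<mu>
    using uminus_positive[OF that] positive_root_nonzero[OF that] by (auto simp: P_weight_def)
  have pos: "P_weight \<mu> = 1" if "\<mu> \<in> \<Delta>" for \<mu> using that by (simp add: P_weight_def)
  have zero: "P_weight 0 = 1/2" using positive_root_nonzero by (auto simp: P_weight_def)
  have nn: "- \<mu> - \<nu> \<in> \<Delta>" if "- \<mu> \<in> \<Delta>" "- \<nu> \<in> \<Delta>"
  proof -
    have "- \<mu> + - \<nu> \<in> \<Delta>"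
      using that s roots_uminus[of "\<mu> + \<nu>"] by (intro add) (auto simp: add_eq_0_iff)
    then show ?thesis by simp
  qed
  \<comment> \<open>For two zero weights the identity would read 1/4 = 0. This is the price of
    halving the Cartan part, and it is avoided because the Cartan subalgebra is abelian.\<close>
  have "\<mu> \<noteq> 0 \<or> \<nu> \<noteq> 0"
    using assms(1,2,5) H_abelian[of x y] by (auto simp: W_0)
  then consider "\<mu> \<in> \<Delta>" "\<nu> \<in> \<Delta>" | "\<mu> \<in> \<Delta>" "\<nu> = 0" | "\<mu> \<in> \<Delta>" "- \<nu> \<in> \<Delta>" | "\<mu> = 0" "\<nu> \<in> \<Delta>"
    | "\<mu> = 0" "- \<nu> \<in> \<Delta>" | "- \<mu> \<in> \<Delta>" "\<nu> \<in> \<Delta>" | "- \<mu> \<in> \<Delta>" "\<nu> = 0" | "- \<mu> \<in> \<Delta>" "- \<nu> \<in> \<Delta>"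
    using \<mu> \<nu> by blast
  then show ?thesis
  proof cases
    case 1
    then have "\<mu> + \<nu> \<in> \<Delta>" using add s by blast
    then show ?thesis using 1 by (simp add: pos)
  next
    case 8
    then have "- (\<mu> + \<nu>) \<in> \<Delta>" using nn by simp
    then show ?thesis using 8 by (simp add: neg)
  qed (simp_all add: pos neg zero)
qed

text \<open>For a projection onto a subalgebra along a complementary subalgebra this identity is
  immediate. \<open>T\<close> is not a projection, but the defect sits in brackets of Cartan
  elements, which vanish.\<close>

lemma rota_baxter: "br (T x) (T y) = T (br (T x) y + br x (T y) - br x y)"
proof (induction x arbitrary: y rule: gr.induct_homogeneous)
  case (1 \<mu> x)
  show ?case
  proof (induction y rule: gr.induct_homogeneous)
    case (1 \<nu> y)
    note \<mu> = \<open>\<mu> \<in> dualH\<close> \<open>x \<in> W \<mu>\<close> and \<nu> = 1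
    have "T (br x y) = s (1 - P_weight (\<mu> + \<nu>)) (br x y)"
      by (intro T_W br_W dual_space_add \<mu> \<nu>)
    then have "T (br (T x) y + br x (T y) - br x y) =
        s ((1 - P_weight (\<mu> + \<nu>)) * (1 - P_weight \<mu> - P_weight \<nu>)) (br x y)"
    proof -
      have "br (T x) y + br x (T y) - br x y = s (1 - P_weight \<mu> - P_weight \<nu>) (br x y)"
        unfolding T_W[OF \<mu>(2,1)] T_W[OF \<nu>(2,1)] by (simp add: br_linear algebra_simps)
      then show ?thesis by (simp only: T_linear(2) \<open>T (br x y) = _\<close> G.scale_scale mult.commute)
    qed
    moreover have "br (T x) (T y) = s ((1 - P_weight \<mu>) * (1 - P_weight \<nu>)) (br x y)"
      unfolding T_W[OF \<mu>(2,1)] T_W[OF \<nu>(2,1)] by (simp add: br_linear mult.commute)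
    ultimately show ?case using P_weight_br[OF \<mu>(2) \<nu>(2) \<mu>(1) \<nu>(1)] by (cases "br x y = 0") auto
  qed (simp_all add: br_linear T_linear)
qed (simp_all add: br_linear T_linear)

lemma br_H_PT:
  assumes "h \<in> H" shows "br h (P x) = P (br h x)" "br h (T x) = T (br h x)"
proof -
  show "br h (P x) = P (br h x)"
  proof (induction x rule: gr.induct_homogeneous)
    case (1 \<mu> x)
    then show ?case by (simp add: W_D[OF 1(2) assms] P_W br_linear P_linear G.scale_left_commute)
  qed (simp_all add: br_linear P_linear)
  then show "br h (T x) = T (br h x)"
    using P_plus_T[of x] P_plus_T[of "br h x"] by (metis add_left_cancel br_right(1))
qed

section \<open>The Casimir tensor and the Casimir operator\<close>

definition casimir_left :: "(('g \<Rightarrow> complex) + 'i) \<times> bool \<Rightarrow> 'g" where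
  "casimir_left = (\<lambda>(k, b). if b then r_left k else r_right k)"
definition casimir_right :: "(('g \<Rightarrow> complex) + 'i) \<times> bool \<Rightarrow> 'g" where
  "casimir_right = (\<lambda>(k, b). if b then r_right k else r_left k)"
text \<open>The flag selects r or its flip, so the two families together list the symmetric tensor
  obtained from r by adding its flip. By \<open>complete\<close>, that is by
  \<open>P + T = 1\<close>, this tensor is inverse to the form.\<close>

definition casimir_index :: "((('g \<Rightarrow> complex) + 'i) \<times> bool) set" where "casimir_index = r_index \<times> UNIV"

lemma sum_casimir_index: "(\<Sum>k\<in>casimir_index. f (casimir_left k) (casimir_right k)) = (\<Sum>k\<in>r_index. f (r_left k) (r_right k)) + (\<Sum>k\<in>r_index. f (r_right k) (r_left k))"
proof -
  have "(\<Sum>k\<in>casimir_index. f (casimir_left k) (casimir_right k)) = (\<Sum>k\<in>r_index. \<Sum>b\<in>UNIV. f (casimir_left (k, b)) (casimir_right (k, b)))"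
    unfolding casimir_index_def by (simp add: sum.cartesian_product case_prod_unfold)
  then show ?thesis by (simp add: UNIV_bool casimir_left_def casimir_right_def sum.distrib add.commute)
qed

lemma sum_casimir_sym: "(\<Sum>k\<in>casimir_index. f (casimir_right k) (casimir_left k)) = (\<Sum>k\<in>casimir_index. f (casimir_left k) (casimir_right k))"
  using sum_casimir_index[of "\<lambda>a b. f b a"] sum_casimir_index[of f] by (simp add: add.commute)

lemma complete: "(\<Sum>k\<in>casimir_index. s (F x (casimir_left k)) (casimir_right k)) = x"
  unfolding sum_casimir_index[of "\<lambda>a b. s (F x a) b"] using P_plus_T[of x]
  by (simp add: P_def T_def add.commute)

text \<open>Expand \<open>br z (casimir_left k)\<close> by completeness. The coefficients are skew
  in the two indices since the form is invariant, so exchanging the summations moves the bracket to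
  the other factor with a sign.\<close>

lemma invariance:
  assumes lin: "\<And>y. Vector_Spaces.linear s s (\<lambda>x. \<beta> x y)" "\<And>x. Vector_Spaces.linear s s (\<beta> x)"
  shows "(\<Sum>k\<in>casimir_index. \<beta> (br z (casimir_left k)) (casimir_right k)) + (\<Sum>k\<in>casimir_index. \<beta> (casimir_left k) (br z (casimir_right k))) = 0"
proof -
  have "(\<Sum>k\<in>casimir_index. \<beta> (br z (casimir_left k)) (casimir_right k)) =
      (\<Sum>k\<in>casimir_index. \<beta> (\<Sum>l\<in>casimir_index. s (F (br z (casimir_left k)) (casimir_left l)) (casimir_right l)) (casimir_right k))"
    by (simp only: complete)
  also have "\<dots> = (\<Sum>k\<in>casimir_index. \<Sum>l\<in>casimir_index. s (F (br z (casimir_left k)) (casimir_left l)) (\<beta> (casimir_right l) (casimir_right k)))"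
    by (simp only: linear_maps(2,6)[OF lin(1)])
  also have "\<dots> = (\<Sum>k\<in>casimir_index. \<Sum>l\<in>casimir_index. s (- F (br z (casimir_left l)) (casimir_left k)) (\<beta> (casimir_right l) (casimir_right k)))"
  proof -
    have "F (br z a) b = - F (br z b) a" for a b
      using F_br_skew[of z a b] F_sym[of a "br z b"] by simp
    then show ?thesis by (intro sum.cong refl arg_cong2[of _ _ _ _ s])
  qed
  also have "\<dots> = (\<Sum>l\<in>casimir_index. \<Sum>k\<in>casimir_index. s (- F (br z (casimir_left l)) (casimir_left k)) (\<beta> (casimir_right l) (casimir_right k)))"
    by (rule sum.swap)
  also have "\<dots> = - (\<Sum>l\<in>casimir_index. \<beta> (casimir_right l) (\<Sum>k\<in>casimir_index. s (F (br z (casimir_left l)) (casimir_left k)) (casimir_right k)))"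
    by (simp add: linear_maps(2,6)[OF lin(2)] sum_negf)
  also have "\<dots> = - (\<Sum>l\<in>casimir_index. \<beta> (casimir_left l) (br z (casimir_right l)))"
    using sum_casimir_sym[of "\<lambda>a b. \<beta> a (br z b)"] by (simp add: complete)
  finally show ?thesis by simp
qed

definition casimir :: "'g \<Rightarrow> 'g" where "casimir x = (\<Sum>k\<in>casimir_index. br (casimir_left k) (br (casimir_right k) x))"

lemma linear_casimir: "Vector_Spaces.linear s s casimir"
  unfolding casimir_def
  by (auto intro!: linearI' G.vector_space_axioms simp: br_linear sum.distrib G.scale_sum_right)

lemmas casimir_linear = linear_maps[OF linear_casimir]

lemma casimir_br: "casimir (br z x) = br z (casimir x)"
proof -
  have "br z (br a (br b x)) = br (br z a) (br b x) + br a (br (br z b) x) + br a (br b (br z x))" for a b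
    by (simp add: jacobi[of z] br_linear)
  then have "br z (casimir x) = (\<Sum>k\<in>casimir_index. br (br z (casimir_left k)) (br (casimir_right k) x)) + (\<Sum>k\<in>casimir_index. br (casimir_left k) (br (br z (casimir_right k)) x)) + casimir (br z x)"
    by (simp add: casimir_def br_linear sum.distrib)
  moreover have "Vector_Spaces.linear s s (\<lambda>b. br a (br b x))" for a
    by (intro linearI' G.vector_space_axioms) (simp_all add: br_linear)
  ultimately show ?thesis
    using invariance[of "\<lambda>a b. br a (br b x)" z, OF linear_br_left] by simp
qed

text \<open>For a coroot h one finds \<open>F (casimir h) h\<close> equal to the sum of
  \<open>2 * \<alpha> h * \<alpha> h\<close> over positive roots. The values are integers and one of
  them is 2, so the sum is positive. This stands in for the nondegeneracy of the Killing
  form.\<close>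

lemma casimir_nonzero: "\<exists>x. casimir x \<noteq> 0"
proof (rule ccontr)
  assume "\<not> ?thesis"
  then have Cas0: "casimir x = 0" for x by blast
  have "\<exists>\<gamma>. \<gamma> \<in> \<Delta>"
  proof (rule ccontr)
    assume "\<not> ?thesis"
    then have no: "\<mu> \<notin> roots \<D>" for \<mu> using root_cases by blast
    have "x \<in> H" for x
    proof (induction x rule: gr.induct_homogeneous)
      case (1 \<mu> x)
      then show ?case using W_trivial[OF 1(1) _ no 1(2)] W_0 H_closed(1) by (cases "\<mu> = 0") auto
    qed (auto intro: H_closed)
    then have "br x y = 0" for x y using H_abelian by blast
    then show False using simple by (simp add: simple_lie_algebra_def)
  qed
  then obtain \<gamma> where \<gamma>: "\<gamma> \<in> \<Delta>" by blast
  define h where "h = coroot \<gamma>"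
  have h: "h \<in> H" using coroot_H positive_root_D(1)[OF \<gamma>] by (simp add: h_def)
  \<comment> \<open>The integer behind the complex number \<open>\<alpha> h\<close>; positivity of
    squares is then used over the integers.\<close>
  define n where "n = (\<lambda>\<alpha>. \<lfloor>Re (\<alpha> h)\<rfloor>)"
  have n: "\<alpha> h = of_int (n \<alpha>)" if "\<alpha> \<in> \<Delta>" for \<alpha>
    using root_coroot_integral[OF positive_root_D(1)[OF \<gamma>] positive_root_D(1)[OF that]]
    by (auto simp: n_def h_def elim!: Ints_cases)
  have "casimir h = (\<Sum>\<alpha>\<in>\<Delta>. s (2 * \<alpha> h) (form_dual \<D> \<alpha>))"
  proof -
    have "br (xpos \<D> \<alpha>) (br (xneg \<D> \<alpha>) h) = s (\<alpha> h) (form_dual \<D> \<alpha>)"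
      "br (xneg \<D> \<alpha>) (br (xpos \<D> \<alpha>) h) = s (\<alpha> h) (form_dual \<D> \<alpha>)" if a: "\<alpha> \<in> \<Delta>" for \<alpha>
      using br_opposite[OF positive_root_D(1)[OF a] root_vectors_D(1,2)[OF a]] root_vectors_D(3)[OF a]
        br_skew[of _ h] br_skew[of "xneg \<D> \<alpha>" "xpos \<D> \<alpha>"]
        W_D[OF root_vectors_D(1)[OF a] h] W_D[OF root_vectors_D(2)[OF a] h] by (simp_all add: br_linear)
    moreover have "br (fund i) h = 0" "br (hv i) h = 0" for i
      using H_abelian fund_coweight(1) hvec(1) h by auto
    ultimately show ?thesis
      unfolding casimir_def sum_casimir_index[of "\<lambda>a b. br a (br b h)"] sum_r_index
      by (simp add: r_left_def r_right_def br_linear sum.distrib[symmetric] G.scale_left_distrib[symmetric])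
  qed
  then have "F (casimir h) h = (\<Sum>\<alpha>\<in>\<Delta>. 2 * \<alpha> h * \<alpha> h)"
    using form_dual_root(2)[OF positive_root_D(1) h] by (simp add: F_linear)
  also have "\<dots> = of_int (\<Sum>\<alpha>\<in>\<Delta>. 2 * n \<alpha> * n \<alpha>)" using n by simp
  finally have "(\<Sum>\<alpha>\<in>\<Delta>. 2 * n \<alpha> * n \<alpha>) = 0"
    using Cas0 by (simp only: F_linear of_int_eq_0_iff) (metis of_int_eq_0_iff)
  moreover have "2 * n \<gamma> * n \<gamma> \<le> (\<Sum>\<alpha>\<in>\<Delta>. 2 * n \<alpha> * n \<alpha>)"
    using \<gamma> finite_positive by (intro member_le_sum) auto
  moreover have "n \<gamma> = 2" using root_coroot[OF positive_root_D(1)[OF \<gamma>]] by (simp add: n_def h_def)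
  ultimately show False by simp
qed

text \<open>Whitehead's argument: for a derivation \<open>d\<close>, the Casimir operator maps \<open>d y\<close> to \<open>-[z\<^sub>0, y]\<close>
  with \<open>z\<^sub>0 = \<Sum> [x\<^sub>a, d x\<^sup>a]\<close>.\<close>

lemma derivation_inner:
  assumes lin: "Vector_Spaces.linear s s d"
    and der: "\<And>x y. d (br x y) = br (d x) y + br x (d y)"
  shows "\<exists>z. \<forall>y. d y = br z y"
proof -
  define z0 where "z0 = (\<Sum>k\<in>casimir_index. br (casimir_left k) (d (casimir_right k)))"
  have 1: "casimir (d y) = - br z0 y" for y
  proof -
    have "br a (br b (d y)) = - br a (d (br y b)) - br (br a (d b)) y - br (br y a) (d b)" for a b
    proof -
      have "br a (br b (d y)) = br a (d (br b y)) - br a (br (d b) y)" by (simp add: der br_linear)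
      moreover have "br a (br (d b) y) = br (br a (d b)) y + br (br y a) (d b)"
        using jacobi[of a "d b" y] br_skew[of "d b" "br a y"] br_skew[of a y] by (simp add: br_linear)
      moreover have "br a (d (br b y)) = - br a (d (br y b))"
        using br_skew[of b y] by (simp add: linear_maps[OF lin] br_linear)
      ultimately show ?thesis by simp
    qed
    then have "casimir (d y) = - ((\<Sum>k\<in>casimir_index. br (br y (casimir_left k)) (d (casimir_right k))) + (\<Sum>k\<in>casimir_index. br (casimir_left k) (d (br y (casimir_right k))))) - br z0 y"
      by (simp add: casimir_def z0_def br_linear sum_subtractf sum_negf)
    moreover have "Vector_Spaces.linear s s (\<lambda>b. br a (d b))" for a
      by (intro linearI' G.vector_space_axioms) (simp_all add: br_linear linear_maps[OF lin])
    ultimately show ?thesis using invariance[of "\<lambda>a b. br a (d b)" y, OF linear_br_left] by simp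
  qed
  \<comment> \<open>\<open>casimir\<close> commutes with the adjoint action, so its kernel and its
    range are ideals; as it is nonzero, simplicity makes it bijective.\<close>
  have inj: "x = 0" if "casimir x = 0" for x
  proof (rule ccontr)
    assume "x \<noteq> 0"
    have "{x. casimir x = 0} = UNIV"
      using that \<open>x \<noteq> 0\<close> by (intro simple_ideal[of _ x] G.subspaceI) (auto simp: casimir_linear casimir_br br_linear)
    then show False using casimir_nonzero by blast
  qed
  obtain x where "casimir x \<noteq> 0" using casimir_nonzero by blast
  then have "range casimir = UNIV"
  proof (intro simple_ideal[of _ "casimir x"])
    show "G.subspace (range casimir)"
    proof (rule G.subspaceI)
      show "0 \<in> range casimir" by (rule range_eqI[where x = 0]) (simp add: casimir_linear)
    qed (auto simp: casimir_linear(1,2)[symmetric])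
    show "br z y \<in> range casimir" if "y \<in> range casimir" for z y
      using that casimir_br by (metis rangeE rangeI)
  qed auto
  then obtain w where w: "casimir w = - z0" by (metis UNIV_I rangeE)
  have "d y = br w y" for y
  proof -
    have "br (casimir w) y = casimir (br w y)" using casimir_br[of y w] br_skew[of y] by (simp add: casimir_linear)
    then have "casimir (d y - br w y) = 0" using 1 w by (simp add: casimir_linear br_linear)
    then show ?thesis using inj by fastforce
  qed
  then show ?thesis by blast
qed

section \<open>The Chevalley involution\<close>

abbreviation "\<omega> \<equiv> Defs.chevalley \<D>"

lemma linear_\<omega>: "Vector_Spaces.linear s s \<omega>"
  and \<omega>_br: "\<omega> (br x y) = br (\<omega> x) (\<omega> y)"
  and \<omega>_invol: "\<omega> (\<omega> x) = x"
  and \<omega>_H: "h \<in> H \<Longrightarrow> \<omega> h = - h"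
  using chevalley by (simp_all add: is_chevalley_involution_def)

lemmas \<omega>_linear = linear_maps[OF linear_\<omega>]

lemma \<omega>_W: assumes "x \<in> W \<mu>" shows "\<omega> x \<in> W (- \<mu>)"
  unfolding W_iff
proof
  fix h assume h: "h \<in> H"
  have "\<omega> (br (- h) x) = br (\<omega> (- h)) (\<omega> x)" by (rule \<omega>_br)
  then show "br h (\<omega> x) = s ((- \<mu>) h) (\<omega> x)"
    using W_D[OF assms h] \<omega>_H[OF h] by (simp add: br_linear \<omega>_linear)
qed

lemma form_dual_uminus: "\<alpha> \<in> roots \<D> \<Longrightarrow> form_dual \<D> (- \<alpha>) = - form_dual \<D> \<alpha>"
  using form_dual_root[of \<alpha>] by (intro form_dual_eqI) (auto simp: H_closed F_linear)

text \<open>On opposite root spaces the form can be read off from the bracket: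
  \<open>br x y = s (F x y) (form_dual \<D> \<alpha>)\<close>. Apply \<omega> and use that it
  negates \<alpha> as well as \<open>form_dual \<D> \<alpha>\<close>. All other pairs of weight
  spaces are orthogonal or Cartan.\<close>

lemma F_\<omega>: "F (\<omega> x) (\<omega> y) = F x y"
proof (induction x arbitrary: y rule: gr.induct_homogeneous)
  case (1 \<mu> x)
  show ?case
  proof (induction y rule: gr.induct_homogeneous)
    case (1 \<nu> y)
    note \<mu> = \<open>\<mu> \<in> dualH\<close> \<open>x \<in> W \<mu>\<close> and \<nu> = 1
    consider "\<mu> \<noteq> - \<nu>" | "\<mu> = 0" "\<nu> = 0" | "\<mu> = - \<nu>" "\<mu> \<noteq> 0" "\<mu> \<notin> roots \<D>" | "\<nu> = - \<mu>" "\<mu> \<in> roots \<D>"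
      by fastforce
    then show ?case
    proof cases
      case 1
      then have "- \<mu> \<noteq> - (- \<nu>)" by auto
      then show ?thesis
        using F_orthogonal[OF \<mu>(2) \<nu>(2) \<mu>(1) \<nu>(1) 1]
          F_orthogonal[OF \<omega>_W[OF \<mu>(2)] \<omega>_W[OF \<nu>(2)] dual_space_uminus[OF \<mu>(1)] dual_space_uminus[OF \<nu>(1)]] by simp
    next
      case 2
      then show ?thesis using \<mu> \<nu> W_0 by (simp add: \<omega>_H F_linear)
    next
      case 3
      then show ?thesis using W_trivial \<mu> by (metis F_left(3) \<omega>_linear(3))
    next
      case 4
      have "br (\<omega> x) (\<omega> y) = s (F (\<omega> x) (\<omega> y)) (form_dual \<D> (- \<mu>))"
        using \<omega>_W[OF \<mu>(2)] \<omega>_W[OF \<nu>(2)] 4 by (intro br_opposite roots_uminus) simp_all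
      moreover have "br (\<omega> x) (\<omega> y) = s (F x y) (- form_dual \<D> \<mu>)"
        using br_opposite[OF 4(2) \<mu>(2)] \<nu>(2) 4(1) \<omega>_H[OF form_dual_root(1)[OF 4(2)]]
        by (simp add: \<omega>_br[symmetric] \<omega>_linear)
      ultimately have "s (F (\<omega> x) (\<omega> y)) (- form_dual \<D> \<mu>) = s (F x y) (- form_dual \<D> \<mu>)"
        by (simp only: form_dual_uminus[OF 4(2)])
      moreover have "form_dual \<D> \<mu> \<noteq> 0"
        using root_coroot[OF 4(2)] dualH_scale[OF \<mu>(1) H_closed(1), of 0] by (auto simp: coroot_def)
      ultimately show ?thesis by (metis G.scale_cancel_right neg_equal_0_iff_equal)
    qed
  qed (simp_all add: F_linear \<omega>_linear)
qed (simp_all add: F_linear \<omega>_linear)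

lemma F_\<omega>': "F (\<omega> x) y = F x (\<omega> y)"
  using F_\<omega>[of x "\<omega> y"] by (simp add: \<omega>_invol)

lemma \<omega>_P: "\<omega> (P x) = T (\<omega> x)"
proof (induction x rule: gr.induct_homogeneous)
  case (1 \<mu> x)
  show ?case
  proof (cases "\<mu> \<in> roots \<D> \<or> \<mu> = 0")
    case True
    then have "P_weight \<mu> = 1 - P_weight (- \<mu>)"
      using root_cases[of \<mu>] uminus_positive[of \<mu>] uminus_positive[of "- \<mu>"] zero_notin_roots positive_root_nonzero
      by (auto simp: P_weight_def)
    then show ?thesis
      using P_W[OF 1(2,1)] T_W[OF \<omega>_W[OF 1(2)] dual_space_uminus[OF 1(1)]] by (simp add: \<omega>_linear)
  next
    case False
    then have "x = 0" using W_trivial[OF 1(1) _ _ 1(2)] by blast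
    then show ?thesis by (simp add: P_linear T_linear \<omega>_linear)
  qed
qed (simp_all add: P_linear T_linear \<omega>_linear)

lemma \<omega>_T: "\<omega> (T x) = P (\<omega> x)"
  using \<omega>_P[of "\<omega> x"] by (metis \<omega>_invol)

end

section \<open>Matrices\<close>

lemma vector_space_mat_scale: "vector_space (mat_scale :: complex \<Rightarrow> complex^'n^'n \<Rightarrow> complex^'n^'n)"
  by unfold_locales (simp_all add: mat_scale_def vec_eq_iff algebra_simps)

text \<open>This is the trace of c-transpose times X, chosen so that pairing with
  \<open>mat_unit i j\<close> reads off the entry at i, j.\<close>

definition pairing :: "complex^'n^'n \<Rightarrow> complex^'n^'n \<Rightarrow> complex" where
  "pairing c X = (\<Sum>i\<in>UNIV. \<Sum>j\<in>UNIV. c $ i $ j * X $ i $ j)"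

definition commutator :: "complex^'n^'n \<Rightarrow> complex^'n^'n \<Rightarrow> complex^'n^'n" where
  "commutator A X = A ** X - X ** A"

text \<open>The adjoint of \<open>commutator A\<close> under \<open>pairing\<close>, see
  \<open>pairing_commutator\<close>.\<close>

definition transposed_commutator :: "complex^'n^'n \<Rightarrow> complex^'n^'n \<Rightarrow> complex^'n^'n" where
  "transposed_commutator A c = transpose A ** c - c ** transpose A"

lemma mat_scale_nth: "mat_scale a X $ i $ j = a * X $ i $ j"
  by (simp add: mat_scale_def)

lemma pairing_linear:
  "pairing (c + d) X = pairing c X + pairing d X" "pairing c (X + Y) = pairing c X + pairing c Y"
  "pairing (mat_scale a c) X = a * pairing c X" "pairing c (mat_scale a X) = a * pairing c X"
  by (simp_all add: pairing_def mat_scale_def algebra_simps sum.distrib sum_distrib_left)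

lemma pairing_linear_map:
  "Vector_Spaces.linear mat_scale (*) (pairing c)" "Vector_Spaces.linear mat_scale (*) (\<lambda>c. pairing c X)"
  by (intro linearI' vector_space_mat_scale vector_space_complex; simp add: pairing_linear)+

lemma sum_Kronecker:
  fixes g :: "'a::finite \<Rightarrow> 'b::semiring_1"
  shows "(\<Sum>i\<in>UNIV. (if i = a then 1 else 0) * g i) = g a" "(\<Sum>i\<in>UNIV. g i * (if i = a then 1 else 0)) = g a"
  by (simp_all add: if_distrib[of "\<lambda>x. x * _"] if_distrib[of "(*) _"] cong: if_cong)

lemma pairing_mat_unit: "pairing (mat_unit i j) X = X $ i $ j" "pairing X (mat_unit i j) = X $ i $ j"
proof -
  have e: "mat_unit i j $ k $ l = (if k = i then 1 else 0) * (if l = j then 1 else (0::complex))" for k l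
    by (simp add: mat_unit_def)
  show "pairing (mat_unit i j) X = X $ i $ j"
    unfolding pairing_def e by (simp only: mult.assoc sum_distrib_left[symmetric] sum_Kronecker)
  then show "pairing X (mat_unit i j) = X $ i $ j"
    by (simp add: pairing_def mult.commute)
qed

lemma pairing_nondeg: "(\<And>X. pairing c X = pairing d X) \<Longrightarrow> c = d"
  by (metis pairing_mat_unit(2) vec_eq_iff)

lemma mat_expand: "(\<Sum>i\<in>UNIV. \<Sum>j\<in>UNIV. mat_scale (X $ i $ j) (mat_unit i j)) = X"
proof -
  have "pairing c (\<Sum>i\<in>UNIV. \<Sum>j\<in>UNIV. mat_scale (X $ i $ j) (mat_unit i j)) = pairing c X" for c
    by (simp only: linear_maps(2,6)[OF pairing_linear_map(1)] pairing_mat_unit(2)) (simp add: pairing_def mult.commute)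
  then have "(\<Sum>i\<in>UNIV. \<Sum>j\<in>UNIV. mat_scale (X $ i $ j) (mat_unit i j)) $ k $ l = X $ k $ l" for k l
    by (simp only: pairing_mat_unit(1)[symmetric])
  then show ?thesis unfolding vec_eq_iff by blast
qed

lemma mat_scale_mult: "mat_scale a A ** B = mat_scale a (A ** B)" "A ** mat_scale a B = mat_scale a (A ** B)"
  by (simp_all add: mat_scale_def matrix_matrix_mult_def vec_eq_iff sum_distrib_left mult.assoc mult.left_commute)

lemma mat_scale_linear: "mat_scale a (X + Y) = mat_scale a X + mat_scale a Y"
  "mat_scale a (X - Y) = mat_scale a X - mat_scale a Y"
  by (simp_all add: mat_scale_def vec_eq_iff algebra_simps)

lemma matrix_mult_distribs:
  fixes A B C :: "complex^'n^'n"
  shows "A ** (B + C) = A ** B + A ** C" "(A + B) ** C = A ** C + B ** C"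
    "A ** (B - C) = A ** B - A ** C" "(A - B) ** C = A ** C - B ** C"
  by (simp_all add: matrix_matrix_mult_def vec_eq_iff algebra_simps sum.distrib sum_subtractf)

lemma commutator_linear_map:
  "Vector_Spaces.linear mat_scale mat_scale (commutator A)" "Vector_Spaces.linear mat_scale mat_scale (\<lambda>A. commutator A X)"
  by (intro linearI' vector_space_mat_scale;
      simp add: commutator_def matrix_mult_distribs mat_scale_mult mat_scale_linear)+

lemmas commutator_linear = linear_maps[OF commutator_linear_map(1)] linear_maps[OF commutator_linear_map(2)]

lemma commutator_skew: "commutator A B = - commutator B A"
  by (simp add: commutator_def)

lemma commutator_jacobi: "commutator A (commutator B X) = commutator (commutator A B) X + commutator B (commutator A X)"
  by (simp add: commutator_def matrix_mult_distribs matrix_mul_assoc algebra_simps)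

lemma pairing_commutator: "pairing c (commutator A X) = pairing (transposed_commutator A c) X"
proof -
  have 1: "pairing c (A ** X) = pairing (transpose A ** c) X"
  proof -
    have "pairing c (A ** X) = (\<Sum>i\<in>UNIV. \<Sum>j\<in>UNIV. \<Sum>k\<in>UNIV. c $ i $ j * A $ i $ k * X $ k $ j)"
      by (simp add: pairing_def matrix_matrix_mult_def sum_distrib_left mult.assoc)
    also have "\<dots> = (\<Sum>j\<in>UNIV. \<Sum>k\<in>UNIV. \<Sum>i\<in>UNIV. c $ i $ j * A $ i $ k * X $ k $ j)"
      by (subst sum.swap) (intro sum.cong refl sum.swap)
    also have "\<dots> = (\<Sum>k\<in>UNIV. \<Sum>j\<in>UNIV. \<Sum>i\<in>UNIV. c $ i $ j * A $ i $ k * X $ k $ j)"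
      by (rule sum.swap)
    finally show ?thesis
      by (simp add: pairing_def matrix_matrix_mult_def transpose_def sum_distrib_left sum_distrib_right mult.commute mult.left_commute)
  qed
  have 2: "pairing c (X ** A) = pairing (c ** transpose A) X"
  proof -
    have "pairing c (X ** A) = (\<Sum>i\<in>UNIV. \<Sum>j\<in>UNIV. \<Sum>k\<in>UNIV. c $ i $ j * A $ k $ j * X $ i $ k)"
      by (simp add: pairing_def matrix_matrix_mult_def sum_distrib_left mult.assoc mult.left_commute mult.commute)
    also have "\<dots> = (\<Sum>i\<in>UNIV. \<Sum>k\<in>UNIV. \<Sum>j\<in>UNIV. c $ i $ j * A $ k $ j * X $ i $ k)"
      by (intro sum.cong refl sum.swap)
    finally show ?thesis
      by (simp add: pairing_def matrix_matrix_mult_def transpose_def sum_distrib_right)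
  qed
  show ?thesis
    by (simp add: commutator_def transposed_commutator_def linear_maps(5)[OF pairing_linear_map(1)]
        linear_maps(5)[OF pairing_linear_map(2)] 1 2)
qed

lemma transposed_commutator_linear_map:
  "Vector_Spaces.linear mat_scale mat_scale (\<lambda>A. transposed_commutator A c)"
proof -
  have "transpose (A + B) = transpose A + transpose B" "transpose (mat_scale a A) = mat_scale a (transpose A)"
    for A B :: "complex^'a^'a" and a
    by (simp_all add: transpose_def mat_scale_def vec_eq_iff)
  then show ?thesis
    by (intro linearI' vector_space_mat_scale)
      (simp_all add: transposed_commutator_def matrix_mult_distribs mat_scale_mult mat_scale_linear)
qed

interpretation M: complex_vector_space "mat_scale :: complex \<Rightarrow> complex^'n^'n \<Rightarrow> complex^'n^'n"
  by (simp add: complex_vector_space_def vector_space_mat_scale)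

lemma mat_finite_dimensional: "finite (range (case_prod mat_unit) :: (complex^'n^'n) set)"
  "M.span (range (case_prod mat_unit)) = (UNIV :: (complex^'n::finite^'n) set)"
proof -
  show "finite (range (case_prod mat_unit) :: (complex^'n^'n) set)" by simp
  have "X \<in> M.span (range (case_prod mat_unit))" for X :: "complex^'n^'n"
    by (subst mat_expand[of X, symmetric])
      (intro M.span_sum M.span_scale M.span_base, metis case_prod_conv rangeI)
  then show "M.span (range (case_prod mat_unit)) = (UNIV :: (complex^'n^'n) set)" by blast
qed

text \<open>If \<langle>e, _\<rangle> vanishes on the common kernel of a basis of \<open>K\<close>,
  it is a combination of that basis. Membership in the relator ideal and in the image of \<pi> is
  shown this way.\<close>

lemma double_annihilator:
  fixes K :: "(complex^'n::finite^'n) set"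
  assumes K: "M.subspace K" and e: "\<And>X. (\<And>k. k \<in> K \<Longrightarrow> pairing k X = 0) \<Longrightarrow> pairing e X = 0"
  shows "e \<in> K"
proof -
  obtain B where B: "B \<subseteq> K" "M.independent B" "K \<subseteq> M.span B"
    using M.maximal_independent_subset by blast
  have "B \<subseteq> M.span (range (case_prod mat_unit))" by (simp only: mat_finite_dimensional(2) subset_UNIV)
  then have "finite B"
    using M.independent_span_bound[OF mat_finite_dimensional(1) B(2)] by blast
  have "pairing e X = 0" if X: "\<And>b. b \<in> B \<Longrightarrow> pairing b X = 0" for X
  proof (rule e)
    have "pairing k X = 0" if "k \<in> M.span B" for k
      using that by (induction rule: M.span_induct_alt)
        (simp_all add: linear_maps[OF pairing_linear_map(2)] X)
    then show "pairing k X = 0" if "k \<in> K" for k using that B(3) by blast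
  qed
  then have "\<exists>a. \<forall>X\<in>UNIV. pairing e X = (\<Sum>b\<in>B. a b * pairing b X)"
    by (intro M.in_span_of_kernels \<open>finite B\<close> M.subspace_UNIV) (auto simp: pairing_linear)
  then obtain a where "\<forall>X. pairing e X = (\<Sum>b\<in>B. a b * pairing b X)" by blast
  then have "pairing e X = pairing (\<Sum>b\<in>B. mat_scale (a b) b) X" for X
    by (simp add: linear_maps[OF pairing_linear_map(2)])
  then have "e = (\<Sum>b\<in>B. mat_scale (a b) b)" by (rule pairing_nondeg)
  then show ?thesis using B(1) by (auto intro!: M.subspace_sum[OF K] M.subspace_scale[OF K])
qed

section \<open>The faithful module\<close>

context rmatrix
begin

abbreviation "act \<equiv> action \<D>"
abbreviation "glinv \<equiv> gl_invariants \<D>"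
abbreviation "glW \<equiv> gl_weight_space \<D>"

lemma linear_act: "Vector_Spaces.linear s mat_scale act"
  and act_br: "act (br x y) = commutator (act x) (act y)"
  and inj_act: "inj act"
  using faithful by (simp_all add: is_faithful_module_def commutator_def)

lemmas act_linear = linear_maps[OF linear_act]

lemma act_eq_iff: "act x = act y \<longleftrightarrow> x = y"
  using inj_act by (auto dest: injD)

lemma act_eq_0_iff: "act x = 0 \<longleftrightarrow> x = 0"
  using act_eq_iff[of x 0] by (simp add: act_linear)

lemma inv_iff: "X \<in> glinv \<longleftrightarrow> (\<forall>x. commutator (act x) X = 0)"
  by (simp add: gl_invariants_def commutator_def)

lemma subspace_inv: "M.subspace glinv"
  by (intro M.subspaceI) (auto simp: inv_iff commutator_linear)

text \<open>By faithfulness such a \<open>z\<close> is central. Hence the sum of \<pi>(\<gg>) and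
  the invariants is direct.\<close>

lemma act_inv: "act z \<in> glinv \<Longrightarrow> z = 0"
proof (rule center_trivial)
  fix y assume "act z \<in> glinv"
  then have "act (br y z) = 0" by (simp add: inv_iff act_br)
  then show "br z y = 0" using br_skew[of z y] by (simp add: act_eq_0_iff)
qed

lemma glW_iff: "X \<in> glW \<mu> \<longleftrightarrow> (\<forall>h\<in>H. commutator (act h) X = mat_scale (\<mu> h) X)"
  by (simp add: gl_weight_space_def commutator_def)

lemma glW_eq: "glW = joint_eigenspace mat_scale (\<lambda>h. commutator (act h)) H"
  by (auto simp: glW_iff joint_eigenspace_def fun_eq_iff)

lemma coroot_diagonalizable_on_gl:
  assumes a: "\<alpha> \<in> roots \<D>"
  shows "M.span {X. \<exists>c. commutator (act (coroot \<alpha>)) X = mat_scale c X} = UNIV"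
proof -
  obtain x y where xy: "x \<in> W \<alpha>" "y \<in> W (- \<alpha>)" "F x y = 1" using root_pair[OF a] by blast
  define z where "z = s (2 / \<alpha> (form_dual \<D> \<alpha>)) y"
  note t = sl2_triple[OF a xy z_def]
  have j: "commutator (act u) (commutator (act v) X) =
      commutator (act (br u v)) X + commutator (act v) (commutator (act u) X)" for u v X
    by (simp add: act_br commutator_jacobi[of "act u"])
  interpret sl: sl2_module mat_scale "commutator (act x)" "commutator (act z)" "commutator (act (coroot \<alpha>))"
    "range (case_prod mat_unit)"
  proof (intro sl2_module.intro M.complex_vector_space_axioms sl2_module_axioms.intro
      commutator_linear_map mat_finite_dimensional)
    fix X
    show "commutator (act (coroot \<alpha>)) (commutator (act x) X) =
        commutator (act x) (commutator (act (coroot \<alpha>)) X) + mat_scale 2 (commutator (act x) X)"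
      using j[of "coroot \<alpha>" x X] t by (simp add: act_linear commutator_linear)
    show "commutator (act (coroot \<alpha>)) (commutator (act z) X) =
        commutator (act z) (commutator (act (coroot \<alpha>)) X) - mat_scale 2 (commutator (act z) X)"
      using j[of "coroot \<alpha>" z X] t by (simp add: act_linear commutator_linear)
    show "commutator (act x) (commutator (act z) X) =
        commutator (act z) (commutator (act x) X) + commutator (act (coroot \<alpha>)) X"
      using j[of x z X] t by (simp add: act_linear commutator_linear)
  qed
  show ?thesis by (rule sl.h_diagonalizable)
qed

sublocale gl: graded_space mat_scale glW dualH
  unfolding glW_eq
proof (rule graded_space_joint_eigenspaces[where S = "range (\<lambda>i. coroot (sr i))"])
  show "range (\<lambda>i. coroot (sr i)) \<subseteq> H" using coroot_H simple_root_root by blast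
  show "H \<subseteq> G.span (range (\<lambda>i. coroot (sr i)))"
  proof
    fix h assume h: "h \<in> H"
    have "hv i = s (sr i (form_dual \<D> (sr i)) / 2) (coroot (sr i))" for i
      using root_length_nonzero[OF simple_root_root, of i] by (simp add: hvec_def coroot_def)
    then have "hv i \<in> G.span (range (\<lambda>i. coroot (sr i)))" for i
      by (metis G.span_base G.span_scale rangeI)
    then show "h \<in> G.span (range (\<lambda>i. coroot (sr i)))"
      using H_expand'[OF h] by (metis (no_types, lifting) G.span_scale G.span_sum)
  qed
  show "commutator (act h) (commutator (act k) X) = commutator (act k) (commutator (act h) X)"
    if "h \<in> range (\<lambda>i. coroot (sr i))" "k \<in> range (\<lambda>i. coroot (sr i))" for h k X
  proof -
    have "h \<in> H" "k \<in> H" using that coroot_H simple_root_root by blast+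
    then show ?thesis
      using commutator_jacobi[of "act h" "act k" X] H_abelian
      by (simp add: act_br[symmetric] act_linear commutator_linear)
  qed
  show "M.span {X. \<exists>c. commutator (act h) X = mat_scale c X} = UNIV"
    if "h \<in> range (\<lambda>i. coroot (sr i))" for h
    using that coroot_diagonalizable_on_gl simple_root_root by blast
qed (simp_all add: G.vector_space_axioms M.vector_space_axioms subspace_H commutator_linear_map
    act_linear commutator_linear)

lemma gl_component_eq: "gl_component \<D> \<mu> X = gl.component \<mu> X"
  by (simp add: gl_component_def gl.component_def)

lemma act_W: "x \<in> W \<mu> \<Longrightarrow> act x \<in> glW \<mu>"
  unfolding glW_iff by (simp add: act_br[symmetric] W_D act_linear)

lemma inv_glW: "X \<in> glinv \<Longrightarrow> X \<in> glW 0"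
  by (auto simp: glW_iff inv_iff)

text \<open>An element normalizing \<open>\<pi>(\<gg>)\<close> acts on it by a derivation of \<open>\<gg>\<close>, which is inner.\<close>

lemma normalizer:
  assumes X: "\<And>y. commutator (act y) X \<in> range act"
  shows "\<exists>z. X - act z \<in> glinv"
proof -
  have "\<forall>y. \<exists>w. act w = commutator X (act y)"
  proof
    fix y
    obtain w where "commutator (act y) X = act w" using X by blast
    then have "act (- w) = commutator X (act y)" using commutator_skew[of X] by (simp add: act_linear)
    then show "\<exists>w. act w = commutator X (act y)" by blast
  qed
  then obtain d where d: "act (d y) = commutator X (act y)" for y by metis
  have "Vector_Spaces.linear s s d"
  proof (intro linearI' G.vector_space_axioms)
    show "d (x + y) = d x + d y" for x y
      by (subst act_eq_iff[symmetric]) (simp add: d act_linear commutator_linear)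
    show "d (s c x) = s c (d x)" for c x
      by (subst act_eq_iff[symmetric]) (simp add: d act_linear commutator_linear)
  qed
  moreover have "d (br x y) = br (d x) y + br x (d y)" for x y
    by (subst act_eq_iff[symmetric]) (simp add: d act_linear act_br commutator_jacobi[of X])
  ultimately obtain z where z: "\<forall>y. d y = br z y" using derivation_inner by blast
  have "commutator (act y) (X - act z) = 0" for y
  proof -
    have "commutator X (act y) = commutator (act z) (act y)" using z d by (metis act_br)
    then show ?thesis using commutator_skew[of "act y"] by (simp add: commutator_linear)
  qed
  then show ?thesis by (auto simp: inv_iff)
qed

lemma component_act:
  assumes "\<alpha> \<in> \<Delta>"
  shows "gl.component (- \<alpha>) (act z) = act (s (F z (xpos \<D> \<alpha>)) (xneg \<D> \<alpha>))"
    "gl.component \<alpha> (act z) = act (s (F z (xneg \<D> \<alpha>)) (xpos \<D> \<alpha>))"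
proof -
  note D = positive_root_D[OF assms] and v = root_vectors_D[OF assms]
  define \<beta> where "\<beta> = - \<alpha>"
  have \<beta>: "\<beta> \<in> roots \<D>" "\<beta> \<in> dualH" "xneg \<D> \<alpha> \<in> W \<beta>" "xpos \<D> \<alpha> \<in> W (- \<beta>)"
    using D v by (simp_all add: \<beta>_def)
  have "gl.component \<beta> (act z) = act (s (F z (xpos \<D> \<alpha>)) (xneg \<D> \<alpha>))"
  proof (induction z rule: gr.induct_homogeneous)
    case (1 \<mu> x)
    show ?case
    proof (cases "\<mu> = \<beta>")
      case True
      then show ?thesis
        using gl.component_same[OF \<beta>(2)] act_W[OF 1(2)] 1(2) v \<beta> F_sym[of "xpos \<D> \<alpha>"]
          root_space_one_dimensional[OF \<beta>(1), of "xneg \<D> \<alpha>" "xpos \<D> \<alpha>" x] by simp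
    next
      case False
      then have z: "F x (xpos \<D> \<alpha>) = 0" using F_pos_neg(2)[OF 1(2,1) assms] by (simp add: \<beta>_def)
      from False show ?thesis
        using gl.component_other[OF \<beta>(2) 1(1) _ act_W[OF 1(2)]] by (simp add: act_linear z)
    qed
  qed (simp_all add: act_linear linear_maps[OF gl.linear_component[OF \<beta>(2)]] F_linear G.scale_left_distrib)
  then show "gl.component (- \<alpha>) (act z) = act (s (F z (xpos \<D> \<alpha>)) (xneg \<D> \<alpha>))"
    by (simp only: \<beta>_def)
  show "gl.component \<alpha> (act z) = act (s (F z (xneg \<D> \<alpha>)) (xpos \<D> \<alpha>))"
  proof (induction z rule: gr.induct_homogeneous)
    case (1 \<mu> x)
    show ?case
    proof (cases "\<mu> = \<alpha>")
      case True
      then show ?thesis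
        using gl.component_same[OF D(3)] act_W[OF 1(2)] 1(2) v
          root_space_one_dimensional[OF D(1), of "xpos \<D> \<alpha>" "xneg \<D> \<alpha>" x] by simp
    next
      case False
      then show ?thesis
        using gl.component_other[OF D(3) 1(1) _ act_W[OF 1(2)]] F_pos_neg(1)[OF 1(2,1) assms]
        by (simp add: act_linear)
    qed
  qed (simp_all add: act_linear linear_maps[OF gl.linear_component[OF D(3)]] F_linear G.scale_left_distrib)
qed

text \<open>The transpose of \<pi> after \<gg> is identified with its dual by the form;
  \<open>F_rho\<close> is its characterization.\<close>

definition rho :: "complex^'n^'n \<Rightarrow> 'g" where
  "rho c = (\<Sum>k\<in>casimir_index. s (pairing c (act (casimir_left k))) (casimir_right k))"

lemma complete': "(\<Sum>k\<in>casimir_index. s (F x (casimir_right k)) (casimir_left k)) = x"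
  using sum_casimir_sym[of "\<lambda>a b. s (F x a) b"] complete by simp

lemma F_rho: "F (rho c) x = pairing c (act x)"
proof -
  have "F (rho c) x = (\<Sum>k\<in>casimir_index. pairing c (act (s (F x (casimir_right k)) (casimir_left k))))"
    by (simp add: rho_def F_linear F_sym[of _ x] act_linear pairing_linear mult.commute)
  also have "\<dots> = pairing c (act x)"
    by (simp only: linear_maps(6)[OF pairing_linear_map(1), symmetric] act_linear(6)[symmetric] complete')
  finally show ?thesis .
qed

lemma rho_eqI: "(\<And>x. pairing c (act x) = F u x) \<Longrightarrow> rho c = u"
  by (rule F_ext) (simp add: F_rho)

lemma rho_transposed_commutator: "rho (transposed_commutator (act x) c) = br (rho c) x"
  by (rule rho_eqI) (simp only: pairing_commutator[symmetric] act_br[symmetric] F_rho F_inv)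

text \<open>A pair of an element of \<gg> and an invariant matrix is determined by the sum of
  \<pi>(x) and X, by \<open>act_inv\<close>. So every functional on such pairs is a combination of
  the entries of this sum, and the coefficients form the required matrix.\<close>

lemma ex_functional:
  assumes f: "f \<in> dual_space mat_scale glinv"
  shows "\<exists>c. rho c = u \<and> (\<forall>X\<in>glinv. pairing c X = f X)"
proof -
  define t where "t = (\<lambda>a (x, X). (s a x, mat_scale a X :: complex^'n^'n))"
  interpret V: vector_space t
    by unfold_locales (auto simp: t_def algebra_simps G.scale_right_distrib G.scale_left_distrib M.scale_right_distrib M.scale_left_distrib)
  have f_lin: "f (X + Y) = f X + f Y" "f (mat_scale a X) = a * f X" if "X \<in> glinv" "Y \<in> glinv" for X Y a
    using f that by (simp_all add: dual_space_def)
  have f0: "f 0 = 0" using f_lin(2)[of 0 0 0] M.subspace_0[OF subspace_inv] by simp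
  have "\<exists>a. \<forall>p\<in>UNIV \<times> glinv. (case p of (x, X) \<Rightarrow> F u x + f X) =
      (\<Sum>ij\<in>UNIV. a ij * (case p of (x, X) \<Rightarrow> (act x + X) $ fst ij $ snd ij))"
  proof (rule V.in_span_of_kernels)
    show "V.subspace (UNIV \<times> glinv)"
      using M.subspace_0[OF subspace_inv] M.subspace_add[OF subspace_inv] M.subspace_scale[OF subspace_inv]
      by (intro V.subspaceI) (auto simp: t_def zero_prod_def)
    fix p assume p: "p \<in> UNIV \<times> glinv" "\<And>ij. ij \<in> UNIV \<Longrightarrow> (case p of (x, X) \<Rightarrow> (act x + X) $ fst ij $ snd ij) = 0"
    obtain x X where pX: "p = (x, X)" by (cases p)
    then have "(act x + X) $ i $ j = 0" for i j using p(2)[of "(i, j)"] by simp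
    then have "act x + X = 0" by (simp add: vec_eq_iff)
    then have "act (- x) = X" by (simp add: act_linear minus_unique)
    moreover from this have "x = 0" using act_inv[of "- x"] p(1) pX by simp
    ultimately show "(case p of (x, X) \<Rightarrow> F u x + f X) = 0"
      using f0 by (auto simp: pX act_linear F_linear)
  qed (auto simp: t_def act_linear F_linear f_lin algebra_simps mat_scale_nth)
  then obtain a where a: "\<And>x X. X \<in> glinv \<Longrightarrow> F u x + f X = (\<Sum>ij\<in>UNIV. a ij * (act x + X) $ fst ij $ snd ij)"
    by auto
  define c :: "complex^'n^'n" where "c = (\<chi> i j. a (i, j))"
  have c: "F u x + f X = pairing c (act x + X)" if "X \<in> glinv" for x X
    using a[OF that, of x]
    by (simp add: c_def pairing_def sum.cartesian_product UNIV_Times_UNIV case_prod_unfold)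
  have "pairing c (act x) = F u x" for x using c[of 0 x] f0 M.subspace_0[OF subspace_inv] by simp
  moreover have "pairing c X = f X" if "X \<in> glinv" for X using c[OF that, of 0] by (simp add: act_linear F_linear)
  ultimately show ?thesis using rho_eqI by blast
qed

lemma rho_surj: "\<exists>c. rho c = u"
  using ex_functional[of 0 u] dual_space_zero by blast

text \<open>\<open>P\<close> and \<open>T\<close> overlap only on the Cartan subalgebra, where each
  of them is 1/2.\<close>

lemma P_T: "P (T x) = s (1/4) (Z x)" "T (P x) = s (1/4) (Z x)" "Z (T x) = s (1/2) (Z x)" "Z (P x) = s (1/2) (Z x)"
proof -
  have "P (T x) = s (1/4) (Z x) \<and> T (P x) = s (1/4) (Z x) \<and> Z (T x) = s (1/2) (Z x) \<and> Z (P x) = s (1/2) (Z x)"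
  proof (induction x rule: gr.induct_homogeneous)
    case (1 \<mu> x)
    then show ?case
      using P_W[OF 1(2,1)] T_W[OF 1(2,1)] Z_W[OF 1(2,1)] positive_root_nonzero
      by (auto simp: P_linear T_linear Z_linear P_weight_def)
  qed (simp_all add: P_linear T_linear Z_linear G.scale_right_distrib)
  then show "P (T x) = s (1/4) (Z x)" "T (P x) = s (1/4) (Z x)" "Z (T x) = s (1/2) (Z x)" "Z (P x) = s (1/2) (Z x)"
    by blast+
qed

text \<open>The hypothesis says that \<open>z\<close> has no negative root components, so
  \<open>z\<close> lies in the positive Borel subalgebra. Doubling the Cartan part makes up for the
  1/2 in \<open>P\<close> and exhibits \<open>z\<close> in the range of \<open>P\<close>.\<close>

lemma borel_plus: "(\<And>\<alpha>. \<alpha> \<in> \<Delta> \<Longrightarrow> F z (xpos \<D> \<alpha>) = 0) \<Longrightarrow> z = P (z + Z z)"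
proof -
  assume z: "\<And>\<alpha>. \<alpha> \<in> \<Delta> \<Longrightarrow> F z (xpos \<D> \<alpha>) = 0"
  have "T z = s (1/2) (Z z)"
    using z by (simp add: T_def sum_r_index r_left_def r_right_def F_linear Z_eq G.scale_sum_right)
  then show ?thesis using P_plus_T[of z] P_H[OF Z_H] by (simp add: P_linear)
qed

lemma borel_minus: "(\<And>\<alpha>. \<alpha> \<in> \<Delta> \<Longrightarrow> F z (xneg \<D> \<alpha>) = 0) \<Longrightarrow> z = T (z + Z z)"
proof -
  assume z: "\<And>\<alpha>. \<alpha> \<in> \<Delta> \<Longrightarrow> F z (xneg \<D> \<alpha>) = 0"
  have "P z = s (1/2) (Z z)"
    using z by (simp add: P_def sum_r_index r_left_def r_right_def F_linear Z_def G.scale_sum_right G.scale_left_commute)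
  moreover have "T (Z z) = s (1/2) (Z z)"
    using T_W[of "Z z" 0] Z_H[of z] positive_root_nonzero by (auto simp: P_weight_def W_0 dual_space_zero)
  ultimately show ?thesis using P_plus_T[of z] by (simp add: T_linear add.commute)
qed

end

section \<open>Free algebras and presentations\<close>

lemma lookup_free_scale: "Poly_Mapping.lookup (free_scale c p) u = c * Poly_Mapping.lookup p u"
  by (simp add: free_scale_def Poly_Mapping.map.rep_eq when_def)

lemma vector_space_free_scale: "vector_space (free_scale :: complex \<Rightarrow> 'x free_alg \<Rightarrow> 'x free_alg)"
  by unfold_locales (auto intro!: poly_mapping_eqI simp: lookup_free_scale lookup_add algebra_simps)

interpretation Fr: complex_vector_space "free_scale :: complex \<Rightarrow> 'x free_alg \<Rightarrow> 'x free_alg"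
  by (simp add: complex_vector_space_def vector_space_free_scale)

definition linear_extension ::
  "(complex \<Rightarrow> 'b::ab_group_add \<Rightarrow> 'b) \<Rightarrow> ('x lie_word \<Rightarrow> 'b) \<Rightarrow> 'x free_alg \<Rightarrow> 'b" where
  "linear_extension t g p = (\<Sum>u\<in>Poly_Mapping.keys p. t (Poly_Mapping.lookup p u) (g u))"

lemma linear_extension_superset:
  assumes "vector_space t" "finite A" "Poly_Mapping.keys p \<subseteq> A"
  shows "linear_extension t g p = (\<Sum>u\<in>A. t (Poly_Mapping.lookup p u) (g u))"
proof -
  interpret vector_space t by fact
  show ?thesis
    unfolding linear_extension_def using assms(2,3)
    by (intro sum.mono_neutral_left) (auto simp: in_keys_iff)
qed

lemma linear_linear_extension:
  fixes g :: "'x lie_word \<Rightarrow> 'b::ab_group_add"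
  assumes t: "vector_space t"
  shows "Vector_Spaces.linear free_scale t (linear_extension t g)"
proof (rule linearI'[OF vector_space_free_scale t])
  interpret vector_space t by fact
  fix p q :: "'x free_alg" and c
  let ?A = "Poly_Mapping.keys p \<union> Poly_Mapping.keys q"
  have A: "finite ?A" by simp
  have "linear_extension t g (p + q) = (\<Sum>u\<in>?A. t (Poly_Mapping.lookup (p + q) u) (g u))"
    using Poly_Mapping.keys_add[of p q] by (intro linear_extension_superset t A)
  also have "\<dots> = (\<Sum>u\<in>?A. t (Poly_Mapping.lookup p u) (g u)) + (\<Sum>u\<in>?A. t (Poly_Mapping.lookup q u) (g u))"
    by (simp add: lookup_add scale_left_distrib sum.distrib)
  finally show "linear_extension t g (p + q) = linear_extension t g p + linear_extension t g q"
    using linear_extension_superset[OF t A, of p g] linear_extension_superset[OF t A, of q g] by simp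
  have "Poly_Mapping.keys (free_scale c p) \<subseteq> Poly_Mapping.keys p"
    by (auto simp: in_keys_iff lookup_free_scale)
  then show "linear_extension t g (free_scale c p) = t c (linear_extension t g p)"
    using linear_extension_superset[OF t finite_keys, of "free_scale c p" p g]
    by (simp add: linear_extension_def lookup_free_scale scale_sum_right)
qed

lemma linear_extension_single:
  assumes "vector_space t"
  shows "linear_extension t g (Poly_Mapping.single w c) = t c (g w)"
proof -
  interpret vector_space t by fact
  show ?thesis using linear_extension_superset[OF assms, of "{w}" "Poly_Mapping.single w c" g] by simp
qed

lemma linear_extension_single_1:
  assumes "vector_space t"
  shows "linear_extension t g (Poly_Mapping.single w 1) = g w"
proof -
  interpret vector_space t by fact
  show ?thesis by (simp add: linear_extension_single[OF assms])
qed

lemma free_alg_expand: "p = (\<Sum>u\<in>Poly_Mapping.keys p. free_scale (Poly_Mapping.lookup p u) (Poly_Mapping.single u 1))"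
proof (rule poly_mapping_eqI)
  fix w
  have "Poly_Mapping.lookup (\<Sum>u\<in>Poly_Mapping.keys p. free_scale (Poly_Mapping.lookup p u) (Poly_Mapping.single u 1)) w
      = (\<Sum>u\<in>Poly_Mapping.keys p. if u = w then Poly_Mapping.lookup p u else 0)"
    by (simp add: Poly_Mapping.lookup_sum lookup_free_scale lookup_single when_def if_distrib[of "(*) _"] cong: if_cong)
  then show "Poly_Mapping.lookup p w = Poly_Mapping.lookup
      (\<Sum>u\<in>Poly_Mapping.keys p. free_scale (Poly_Mapping.lookup p u) (Poly_Mapping.single u 1)) w"
    by (simp add: in_keys_iff)
qed

lemma free_alg_subspace_UNIV:
  assumes "Fr.subspace S" "\<And>w. Poly_Mapping.single w 1 \<in> S"
  shows "p \<in> S"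
  by (subst free_alg_expand) (intro Fr.subspace_sum Fr.subspace_scale assms)

lemma linear_ext_eq:
  assumes "Vector_Spaces.linear free_scale t f" "Vector_Spaces.linear free_scale t g"
    and "\<And>w. f (Poly_Mapping.single w 1) = g (Poly_Mapping.single w 1)"
  shows "f p = g p"
proof -
  have "p \<in> {p. f p = g p}"
  proof (rule free_alg_subspace_UNIV)
    show "Fr.subspace {p. f p = g p}"
      using linear_maps[OF assms(1)] linear_maps[OF assms(2)] by (intro Fr.subspaceI) auto
  qed (use assms(3) in simp)
  then show ?thesis by simp
qed

lemma free_mult_eq: "free_mult p q =
    linear_extension free_scale (\<lambda>u. linear_extension free_scale (\<lambda>v. Poly_Mapping.single (Br u v) 1) q) p"
proof -
  have "Poly_Mapping.single w (a * b) = free_scale a (free_scale b (Poly_Mapping.single w 1))"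
    for w :: "'a lie_word" and a b
    by (auto intro!: poly_mapping_eqI simp: lookup_free_scale lookup_single when_def)
  then show ?thesis
    by (simp add: free_mult_def linear_extension_def Fr.scale_sum_right del: Fr.scale_scale)
qed

lemma linear_free_mult_left: "Vector_Spaces.linear free_scale free_scale (\<lambda>p. free_mult p q)"
  unfolding free_mult_eq by (rule linear_linear_extension[OF vector_space_free_scale])

lemma linear_free_mult_right: "Vector_Spaces.linear free_scale free_scale (free_mult p)"
  unfolding free_mult_eq
  by (intro linearI' vector_space_free_scale)
    (simp_all add: linear_maps[OF linear_linear_extension[OF vector_space_free_scale]]
      linear_extension_def[of free_scale _ p] Fr.scale_right_distrib sum.distrib Fr.scale_sum_right mult.commute)

lemmas free_mult_linear = linear_maps[OF linear_free_mult_left] linear_maps[OF linear_free_mult_right]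

lemma free_mult_single: "free_mult (Poly_Mapping.single u 1) (Poly_Mapping.single v 1) = Poly_Mapping.single (Br u v) 1"
  by (simp add: free_mult_eq linear_extension_single_1[OF vector_space_free_scale])

section \<open>Evaluation of words in a Lie algebra and the relator ideal\<close>

primrec eval_word :: "('b \<Rightarrow> 'b \<Rightarrow> 'b) \<Rightarrow> ('x \<Rightarrow> 'b) \<Rightarrow> 'x lie_word \<Rightarrow> 'b" where
  "eval_word lb g (Gen a) = g a"
| "eval_word lb g (Br u v) = lb (eval_word lb g u) (eval_word lb g v)"

definition eval_free ::
  "(complex \<Rightarrow> 'b::ab_group_add \<Rightarrow> 'b) \<Rightarrow> ('b \<Rightarrow> 'b \<Rightarrow> 'b) \<Rightarrow> ('x \<Rightarrow> 'b) \<Rightarrow> 'x free_alg \<Rightarrow> 'b" where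
  "eval_free t lb g = linear_extension t (eval_word lb g)"

lemma lie_algebra_D:
  assumes "lie_algebra t lb"
  shows "vector_space t" "Vector_Spaces.linear t t (lb x)" "Vector_Spaces.linear t t (\<lambda>x. lb x y)"
    "lb x x = 0" "lb x (lb y z) + lb y (lb z x) + lb z (lb x y) = 0"
  using assms by (simp_all add: lie_algebra_def)

lemma linear_eval_free: "lie_algebra t lb \<Longrightarrow> Vector_Spaces.linear free_scale t (eval_free t lb g)"
  unfolding eval_free_def by (intro linear_linear_extension lie_algebra_D(1))

lemma eval_free_single: "lie_algebra t lb \<Longrightarrow> eval_free t lb g (Poly_Mapping.single w 1) = eval_word lb g w"
  unfolding eval_free_def by (intro linear_extension_single_1 lie_algebra_D(1))

lemma eval_free_gen: "lie_algebra t lb \<Longrightarrow> eval_free t lb g (free_gen a) = g a"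
  by (simp add: free_gen_def eval_free_single)

lemma linear_compose':
  "Vector_Spaces.linear r s f \<Longrightarrow> Vector_Spaces.linear s t g \<Longrightarrow> Vector_Spaces.linear r t (\<lambda>x. g (f x))"
  using Vector_Spaces.linear_compose[of r s f t g] by (simp add: comp_def)

lemma eval_free_mult:
  assumes L: "lie_algebra t lb"
  shows "eval_free t lb g (free_mult p q) = lb (eval_free t lb g p) (eval_free t lb g q)"
proof -
  note lin = linear_eval_free[OF L]
  have 1: "eval_free t lb g (free_mult (Poly_Mapping.single u 1) q) =
      lb (eval_free t lb g (Poly_Mapping.single u 1)) (eval_free t lb g q)" for u q
  proof (rule linear_ext_eq[where f = "\<lambda>q. eval_free t lb g (free_mult (Poly_Mapping.single u 1) q)"
        and g = "\<lambda>q. lb (eval_free t lb g (Poly_Mapping.single u 1)) (eval_free t lb g q)"])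
    show "Vector_Spaces.linear free_scale t (\<lambda>q. eval_free t lb g (free_mult (Poly_Mapping.single u 1) q))"
      by (rule linear_compose'[OF linear_free_mult_right lin])
    show "Vector_Spaces.linear free_scale t (\<lambda>q. lb (eval_free t lb g (Poly_Mapping.single u 1)) (eval_free t lb g q))"
      by (rule linear_compose'[OF lin lie_algebra_D(2)[OF L]])
  qed (simp add: free_mult_single eval_free_single[OF L])
  show ?thesis
  proof (rule linear_ext_eq[where f = "\<lambda>p. eval_free t lb g (free_mult p q)"
        and g = "\<lambda>p. lb (eval_free t lb g p) (eval_free t lb g q)"])
    show "Vector_Spaces.linear free_scale t (\<lambda>p. eval_free t lb g (free_mult p q))"
      by (rule linear_compose'[OF linear_free_mult_left lin])
    show "Vector_Spaces.linear free_scale t (\<lambda>p. lb (eval_free t lb g p) (eval_free t lb g q))"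
      by (rule linear_compose'[OF lin lie_algebra_D(3)[OF L]])
  qed (rule 1)
qed

lemma free_ideal_relator_ideal: "free_ideal (relator_ideal R)"
  unfolding relator_ideal_def
proof (rule hull_in)
  fix Ts :: "'a free_alg set set"
  assume "\<forall>I\<in>Ts. free_ideal I"
  then show "free_ideal (\<Inter>Ts)"
    unfolding free_ideal_def by (auto intro!: Fr.subspace_Inter)
qed

lemma relator_ideal_subspace: "Fr.subspace (relator_ideal R)"
  and relator_ideal_mult: "q \<in> relator_ideal R \<Longrightarrow> free_mult p q \<in> relator_ideal R"
    "q \<in> relator_ideal R \<Longrightarrow> free_mult q p \<in> relator_ideal R"
  using free_ideal_relator_ideal[of R] by (auto simp: free_ideal_def)

lemmas relator_ideal_closed = Fr.subspace_0[OF relator_ideal_subspace] Fr.subspace_add[OF relator_ideal_subspace]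
  Fr.subspace_scale[OF relator_ideal_subspace] Fr.subspace_neg[OF relator_ideal_subspace]
  Fr.subspace_diff[OF relator_ideal_subspace] Fr.subspace_sum[OF relator_ideal_subspace]

lemma relators_in_ideal: "lie_axiom_relators \<subseteq> relator_ideal R" "R \<subseteq> relator_ideal R"
  unfolding relator_ideal_def using hull_subset[of "lie_axiom_relators \<union> R" free_ideal] by auto

text \<open>Polarization of the relator \<open>free_mult p p\<close>.\<close>

lemma free_mult_skew: "free_mult p q + free_mult q p \<in> relator_ideal R"
proof -
  have sq: "free_mult p p \<in> relator_ideal R" for p
    using relators_in_ideal(1) by (auto simp: lie_axiom_relators_def)
  have "free_mult (p + q) (p + q) - free_mult p p - free_mult q q \<in> relator_ideal R"
    by (intro relator_ideal_closed sq)
  then show ?thesis by (simp add: free_mult_linear algebra_simps)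
qed

text \<open>Universal property of the presentation: the kernel of an evaluation in a Lie algebra is
  an ideal containing the Lie axioms, so killing the given relators is enough.\<close>

lemma eval_free_relator_ideal:
  assumes L: "lie_algebra t lb" and R: "\<And>p. p \<in> R \<Longrightarrow> eval_free t lb g p = 0"
    and p: "p \<in> relator_ideal R"
  shows "eval_free t lb g p = 0"
proof -
  note lin = linear_maps[OF linear_eval_free[OF L, of g]]
  note lb = linear_maps[OF lie_algebra_D(2)[OF L]] linear_maps[OF lie_algebra_D(3)[OF L]]
  interpret vector_space t by (rule lie_algebra_D(1)[OF L])
  have "relator_ideal R \<subseteq> {p. eval_free t lb g p = 0}"
    unfolding relator_ideal_def
  proof (rule hull_minimal)
    show "lie_axiom_relators \<union> R \<subseteq> {p. eval_free t lb g p = 0}"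
      using R lie_algebra_D(4,5)[OF L] by (auto simp: lie_axiom_relators_def lin eval_free_mult[OF L])
    show "free_ideal {p. eval_free t lb g p = 0}"
      unfolding free_ideal_def by (auto intro!: Fr.subspaceI simp: lin eval_free_mult[OF L] lb)
  qed
  then show ?thesis using p by blast
qed

lemma pres_class_eq_iff: "pres_class R p = pres_class R q \<longleftrightarrow> p - q \<in> relator_ideal R"
proof
  assume "pres_class R p = pres_class R q"
  moreover have "p \<in> pres_class R p" using relator_ideal_closed(1) by (simp add: pres_class_def)
  ultimately show "p - q \<in> relator_ideal R" by (auto simp: pres_class_def)
next
  assume pq: "p - q \<in> relator_ideal R"
  have "x - p \<in> relator_ideal R \<longleftrightarrow> x - q \<in> relator_ideal R" for x
    using relator_ideal_closed(2)[OF _ pq, of "x - p"] relator_ideal_closed(5)[OF _ pq, of "x - q"] by auto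
  then show "pres_class R p = pres_class R q" by (auto simp: pres_class_def)
qed

lemma pres_class_self: "p \<in> pres_class R p"
  using relator_ideal_closed(1) by (simp add: pres_class_def)

lemma UN_constant_eq': "A \<noteq> {} \<Longrightarrow> (\<And>x. x \<in> A \<Longrightarrow> f x = c) \<Longrightarrow> (\<Union>x\<in>A. f x) = c"
  by auto

text \<open>The operations are unions over all representatives; since the relators generate an
  ideal, each member of such a union is the same class.\<close>

lemma presented_lie_simps:
  "lie_carrier (presented_lie R) = range (pres_class R)"
  "lie_zero (presented_lie R) = pres_class R 0"
  "lie_add (presented_lie R) (pres_class R p) (pres_class R q) = pres_class R (p + q)"
  "lie_scale (presented_lie R) c (pres_class R p) = pres_class R (free_scale c p)"
  "lie_bracket (presented_lie R) (pres_class R p) (pres_class R q) = pres_class R (free_mult p q)"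
proof -
  have ne: "pres_class R p \<noteq> {}" for p using pres_class_self by blast
  have mem: "x - p \<in> relator_ideal R" if "x \<in> pres_class R p" for x p
    using that by (simp add: pres_class_def)
  show "lie_add (presented_lie R) (pres_class R p) (pres_class R q) = pres_class R (p + q)"
    unfolding presented_lie_def lie_struct.simps
  proof (intro UN_constant_eq' ne)
    fix x y assume "x \<in> pres_class R p" "y \<in> pres_class R q"
    then have "(x - p) + (y - q) \<in> relator_ideal R" by (intro relator_ideal_closed mem)
    then show "pres_class R (x + y) = pres_class R (p + q)" unfolding pres_class_eq_iff by (simp add: algebra_simps)
  qed
  show "lie_scale (presented_lie R) c (pres_class R p) = pres_class R (free_scale c p)"
    unfolding presented_lie_def lie_struct.simps
  proof (intro UN_constant_eq' ne)
    fix x assume "x \<in> pres_class R p"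
    then have "free_scale c (x - p) \<in> relator_ideal R" by (intro relator_ideal_closed mem)
    then show "pres_class R (free_scale c x) = pres_class R (free_scale c p)"
      unfolding pres_class_eq_iff by (simp add: Fr.scale_right_diff_distrib)
  qed
  show "lie_bracket (presented_lie R) (pres_class R p) (pres_class R q) = pres_class R (free_mult p q)"
    unfolding presented_lie_def lie_struct.simps
  proof (intro UN_constant_eq' ne)
    fix x y assume "x \<in> pres_class R p" "y \<in> pres_class R q"
    then have "free_mult (x - p) y + free_mult p (y - q) \<in> relator_ideal R"
      by (intro relator_ideal_closed relator_ideal_mult mem)
    then show "pres_class R (free_mult x y) = pres_class R (free_mult p q)"
      unfolding pres_class_eq_iff by (simp add: free_mult_linear)
  qed
qed (simp_all add: presented_lie_def)

section \<open>Contraction of matrices with coefficients\<close>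

definition contract :: "(complex \<Rightarrow> 'w::ab_group_add \<Rightarrow> 'w) \<Rightarrow> complex^'n^'n \<Rightarrow> ('n::finite \<Rightarrow> 'n \<Rightarrow> 'w) \<Rightarrow> 'w" where
  "contract t c L = (\<Sum>i\<in>UNIV. \<Sum>j\<in>UNIV. t (c $ i $ j) (L i j))"

text \<open>The commutator of the scalar matrix \<open>A\<close> with a matrix \<open>X\<close>
  having coefficients in a vector space.\<close>

definition matrix_ad :: "(complex \<Rightarrow> 'w::ab_group_add \<Rightarrow> 'w) \<Rightarrow> complex^'n^'n \<Rightarrow> ('n::finite \<Rightarrow> 'n \<Rightarrow> 'w) \<Rightarrow> 'n \<Rightarrow> 'n \<Rightarrow> 'w" where
  "matrix_ad t A X i j = (\<Sum>a\<in>UNIV. t (A $ i $ a) (X a j) - t (A $ a $ j) (X i a))"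

text \<open>\<open>scalar_commutator\<close> with the free algebra replaced by any vector space, so
  that the relations can be stated alike in the presented algebra and in the target.\<close>

definition scalar_matrix_commutator ::
  "(complex \<Rightarrow> 'w::ab_group_add \<Rightarrow> 'w) \<Rightarrow> ('m::finite \<Rightarrow> 'm \<Rightarrow> complex) \<Rightarrow> ('m \<Rightarrow> 'm \<Rightarrow> 'w) \<Rightarrow> 'm \<Rightarrow> 'm \<Rightarrow> 'w" where
  "scalar_matrix_commutator t A X p q = (\<Sum>u\<in>UNIV. t (A p u) (X u q) - t (A u q) (X p u))"

lemma contract_linear_image:
  assumes "Vector_Spaces.linear s t f"
  shows "contract t c (\<lambda>i j. f (L i j)) = f (contract s c L)"
  by (simp add: contract_def linear_maps[OF assms])

context complex_vector_space
begin

lemma linear_contract: "Vector_Spaces.linear mat_scale scale (\<lambda>c. contract scale c L)"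
  by (intro linearI' vector_space_mat_scale vector_space_axioms)
    (simp_all add: contract_def scale_left_distrib sum.distrib mat_scale_nth scale_sum_right)

lemma contract_simps:
  "contract scale c (\<lambda>i j. L i j + L' i j) = contract scale c L + contract scale c L'"
  "contract scale c (\<lambda>i j. \<Sum>k\<in>A. M k i j) = (\<Sum>k\<in>A. contract scale c (M k))"
  "contract scale c (\<lambda>i j. scale a (L i j)) = scale a (contract scale c L)"
  "contract scale c (\<lambda>i j. scale (X $ i $ j) v) = scale (pairing c X) v"
proof -
  show "contract scale c (\<lambda>i j. L i j + L' i j) = contract scale c L + contract scale c L'"
    by (simp add: contract_def scale_right_distrib sum.distrib)
  show "contract scale c (\<lambda>i j. scale a (L i j)) = scale a (contract scale c L)"
    by (simp add: contract_def scale_sum_right mult.commute)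
  show "contract scale c (\<lambda>i j. scale (X $ i $ j) v) = scale (pairing c X) v"
    by (simp add: contract_def pairing_def scale_sum_left)
  have "(\<Sum>j\<in>UNIV. scale (c $ i $ j) (\<Sum>k\<in>A. M k i j)) = (\<Sum>k\<in>A. \<Sum>j\<in>UNIV. scale (c $ i $ j) (M k i j))" for i
    unfolding scale_sum_right by (rule sum.swap)
  then have "contract scale c (\<lambda>i j. \<Sum>k\<in>A. M k i j) = (\<Sum>i\<in>UNIV. \<Sum>k\<in>A. \<Sum>j\<in>UNIV. scale (c $ i $ j) (M k i j))"
    by (simp add: contract_def)
  also have "\<dots> = (\<Sum>k\<in>A. contract scale c (M k))" unfolding contract_def by (rule sum.swap)
  finally show "contract scale c (\<lambda>i j. \<Sum>k\<in>A. M k i j) = (\<Sum>k\<in>A. contract scale c (M k))" .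
qed

lemma contract_mat_unit: "contract scale (mat_unit i j) L = L i j"
proof -
  have "contract scale (mat_unit i j) L = (\<Sum>k\<in>UNIV. if k = i then (\<Sum>l\<in>UNIV. if l = j then L k l else 0) else 0)"
    unfolding contract_def by (intro sum.cong refl) (auto simp: mat_unit_def if_distrib[of "\<lambda>x. scale x _"] cong: if_cong)
  then show ?thesis by simp
qed

lemma contract_matrix_ad: "contract scale c (matrix_ad scale A X) = contract scale (transposed_commutator A c) X"
proof -
  have "contract scale c (matrix_ad scale A X) =
      (\<Sum>i\<in>UNIV. \<Sum>j\<in>UNIV. \<Sum>a\<in>UNIV. scale (c $ i $ j * A $ i $ a) (X a j)) -
      (\<Sum>i\<in>UNIV. \<Sum>j\<in>UNIV. \<Sum>a\<in>UNIV. scale (c $ i $ j * A $ a $ j) (X i a))"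
    by (simp add: contract_def matrix_ad_def scale_sum_right scale_right_diff_distrib sum_subtractf)
  also have "(\<Sum>i\<in>UNIV. \<Sum>j\<in>UNIV. \<Sum>a\<in>UNIV. scale (c $ i $ j * A $ i $ a) (X a j)) = contract scale (transpose A ** c) X"
  proof -
    have "(\<Sum>i\<in>UNIV. \<Sum>j\<in>UNIV. \<Sum>a\<in>UNIV. scale (c $ i $ j * A $ i $ a) (X a j)) =
        (\<Sum>j\<in>UNIV. \<Sum>a\<in>UNIV. \<Sum>i\<in>UNIV. scale (c $ i $ j * A $ i $ a) (X a j))"
      by (subst sum.swap) (intro sum.cong refl sum.swap)
    also have "\<dots> = (\<Sum>a\<in>UNIV. \<Sum>j\<in>UNIV. \<Sum>i\<in>UNIV. scale (c $ i $ j * A $ i $ a) (X a j))"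
      by (rule sum.swap)
    finally show ?thesis
      by (simp add: contract_def matrix_matrix_mult_def transpose_def scale_sum_left mult.commute)
  qed
  also have "(\<Sum>i\<in>UNIV. \<Sum>j\<in>UNIV. \<Sum>a\<in>UNIV. scale (c $ i $ j * A $ a $ j) (X i a)) = contract scale (c ** transpose A) X"
  proof -
    have "(\<Sum>i\<in>UNIV. \<Sum>j\<in>UNIV. \<Sum>a\<in>UNIV. scale (c $ i $ j * A $ a $ j) (X i a)) =
        (\<Sum>i\<in>UNIV. \<Sum>a\<in>UNIV. \<Sum>j\<in>UNIV. scale (c $ i $ j * A $ a $ j) (X i a))"
      by (intro sum.cong refl sum.swap)
    then show ?thesis
      by (simp add: contract_def matrix_matrix_mult_def transpose_def scale_sum_left)
  qed
  finally show ?thesis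
    by (simp add: transposed_commutator_def linear_maps(5)[OF linear_contract])
qed

text \<open>Matrices in different legs commute, so the commutator of A in leg 1 times B in leg 2
  with \<open>X\<close> in leg 1 leaves B untouched, and symmetrically for \<open>Y\<close> in leg
  2.\<close>

lemma scalar_matrix_commutator_kron:
  fixes A B :: "complex^'n::finite^'n" and X Y :: "'n \<Rightarrow> 'n \<Rightarrow> 'b"
  shows "scalar_matrix_commutator scale (kron A B) (leg1 X + leg2 Y) (i, k) (j, l) =
    scale (B $ k $ l) (matrix_ad scale A X i j) + scale (A $ i $ j) (matrix_ad scale B Y k l)"
proof -
  have pairs: "(\<Sum>u\<in>UNIV. f u) = (\<Sum>a\<in>UNIV. \<Sum>b\<in>UNIV. f (a, b))" for f :: "'n \<times> 'n \<Rightarrow> 'b"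
    by (simp add: sum.cartesian_product UNIV_Times_UNIV case_prod_unfold)
  have d: "(\<Sum>b\<in>UNIV. if b = l then f b else 0) = f l" "(\<Sum>b\<in>UNIV. if l = b then f b else 0) = f l"
    for f :: "'n \<Rightarrow> 'b" and l by simp_all
  have "(\<Sum>u\<in>UNIV. scale (kron A B (i, k) u) ((leg1 X + leg2 Y) u (j, l))) =
      (\<Sum>a\<in>UNIV. scale (B $ k $ l) (scale (A $ i $ a) (X a j))) + (\<Sum>b\<in>UNIV. scale (A $ i $ j) (scale (B $ k $ b) (Y b l)))"
  proof -
    have "(\<Sum>u\<in>UNIV. scale (kron A B (i, k) u) ((leg1 X + leg2 Y) u (j, l))) =
        (\<Sum>a\<in>UNIV. \<Sum>b\<in>UNIV. if b = l then scale (A $ i $ a * B $ k $ b) (X a j) else 0) +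
        (\<Sum>a\<in>UNIV. \<Sum>b\<in>UNIV. if a = j then scale (A $ i $ a * B $ k $ b) (Y b l) else 0)"
      unfolding pairs sum.distrib[symmetric]
      by (intro sum.cong refl) (simp add: kron_def leg1_def leg2_def scale_right_distrib)
    also have "(\<Sum>a\<in>UNIV. \<Sum>b\<in>UNIV. if a = j then scale (A $ i $ a * B $ k $ b) (Y b l) else 0) =
        (\<Sum>b\<in>UNIV. \<Sum>a\<in>UNIV. if a = j then scale (A $ i $ a * B $ k $ b) (Y b l) else 0)"
      by (rule sum.swap)
    finally show ?thesis by (simp only: d scale_scale mult.commute)
  qed
  moreover have "(\<Sum>u\<in>UNIV. scale (kron A B u (j, l)) ((leg1 X + leg2 Y) (i, k) u)) =
      (\<Sum>a\<in>UNIV. scale (B $ k $ l) (scale (A $ a $ j) (X i a))) + (\<Sum>b\<in>UNIV. scale (A $ i $ j) (scale (B $ b $ l) (Y k b)))"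
  proof -
    have "(\<Sum>u\<in>UNIV. scale (kron A B u (j, l)) ((leg1 X + leg2 Y) (i, k) u)) =
        (\<Sum>a\<in>UNIV. \<Sum>b\<in>UNIV. if k = b then scale (A $ a $ j * B $ b $ l) (X i a) else 0) +
        (\<Sum>a\<in>UNIV. \<Sum>b\<in>UNIV. if i = a then scale (A $ a $ j * B $ b $ l) (Y k b) else 0)"
      unfolding pairs sum.distrib[symmetric]
      by (intro sum.cong refl) (simp add: kron_def leg1_def leg2_def scale_right_distrib)
    also have "(\<Sum>a\<in>UNIV. \<Sum>b\<in>UNIV. if i = a then scale (A $ a $ j * B $ b $ l) (Y k b) else 0) =
        (\<Sum>b\<in>UNIV. \<Sum>a\<in>UNIV. if i = a then scale (A $ a $ j * B $ b $ l) (Y k b) else 0)"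
      by (rule sum.swap)
    finally show ?thesis by (simp only: d scale_scale mult.commute)
  qed
  ultimately show ?thesis
    by (simp add: scalar_matrix_commutator_def sum_subtractf matrix_ad_def scale_sum_right scale_right_diff_distrib)
qed

lemma scalar_matrix_commutator_sum:
  "scalar_matrix_commutator scale (\<Sum>k\<in>K. A k) X p q = (\<Sum>k\<in>K. scalar_matrix_commutator scale (A k) X p q)"
proof -
  have "(\<Sum>u\<in>UNIV. scale (\<Sum>k\<in>K. A k p u) (X u q)) = (\<Sum>k\<in>K. \<Sum>u\<in>UNIV. scale (A k p u) (X u q))"
    unfolding scale_sum_left by (rule sum.swap)
  moreover have "(\<Sum>u\<in>UNIV. scale (\<Sum>k\<in>K. A k u q) (X p u)) = (\<Sum>k\<in>K. \<Sum>u\<in>UNIV. scale (A k u q) (X p u))"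
    unfolding scale_sum_left by (rule sum.swap)
  ultimately show ?thesis
    by (simp add: scalar_matrix_commutator_def sum_fun_apply sum_subtractf)
qed

end

lemma scalar_commutator_eq: "scalar_commutator = scalar_matrix_commutator free_scale"
  by (intro ext) (simp add: scalar_commutator_def scalar_matrix_commutator_def)

section \<open>The target Lie algebra\<close>

context rmatrix
begin

abbreviation "dsc \<equiv> lie_scale (double \<D>)"
abbreviation "zsc \<equiv> lie_scale (zV \<D>)"
abbreviation "tsc \<equiv> lie_scale (target \<D>)"
abbreviation "tbr \<equiv> lie_bracket (target \<D>)"
abbreviation "dualZ \<equiv> dual_space mat_scale glinv"
abbreviation "tLP \<equiv> target_L_plus \<D>"
abbreviation "tLM \<equiv> target_L_minus \<D>"

lemma double_simps:
  "lie_carrier (double \<D>) = UNIV \<times> H" "lie_zero (double \<D>) = 0" "lie_add (double \<D>) = (+)"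
  "dsc c (x, h) = (s c x, s c h)" "lie_bracket (double \<D>) (x, h) (y, k) = (br x y, 0)"
  by (auto simp: double_def lie_sum_def lie_on_def zero_prod_def fun_eq_iff)

lemma zV_simps:
  "lie_carrier (zV \<D>) = dualZ" "lie_zero (zV \<D>) = 0" "lie_add (zV \<D>) = (+)"
  "zsc c f = (\<lambda>X. c * f X)" "lie_bracket (zV \<D>) f g = 0"
  by (auto simp: zV_def lie_on_def)

lemma target_simps:
  "lie_carrier (target \<D>) = (UNIV \<times> H) \<times> dualZ \<times> dualZ" "lie_zero (target \<D>) = 0"
  "lie_add (target \<D>) = (+)"
  "tsc c (d, f, g) = (dsc c d, zsc c f, zsc c g)" "tbr ((x, h), f, g) ((y, k), f', g') = ((br x y, 0), 0, 0)"
  by (auto simp: target_def lie_sum_def zero_prod_def fun_eq_iff double_simps zV_simps)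

sublocale D2: complex_vector_space dsc
  by unfold_locales (auto simp: double_simps G.scale_right_distrib G.scale_left_distrib)

sublocale Z2: complex_vector_space zsc
  by unfold_locales (auto simp: zV_simps fun_eq_iff algebra_simps)

sublocale Tg: complex_vector_space tsc
  by unfold_locales (auto simp: target_simps double_simps zV_simps G.scale_right_distrib G.scale_left_distrib
      fun_eq_iff algebra_simps)

lemma target_lie_algebra: "lie_algebra tsc tbr"
  unfolding lie_algebra_def
proof (intro conjI allI)
  show "Vector_Spaces.linear tsc tsc (tbr x)" for x
    by (intro linearI' Tg.vector_space_axioms; cases x)
      (auto simp: target_simps double_simps zV_simps br_linear fun_eq_iff)
  show "Vector_Spaces.linear tsc tsc (\<lambda>x. tbr x y)" for y
    by (intro linearI' Tg.vector_space_axioms; cases y)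
      (auto simp: target_simps double_simps zV_simps br_linear fun_eq_iff)
  show "tbr x x = 0" for x by (cases x) (auto simp: target_simps br_self zero_prod_def)
  show "tbr x (tbr y z) + tbr y (tbr z x) + tbr z (tbr x y) = 0" for x y z
  proof -
    have "br a (br b c) + br b (br c a) + br c (br a b) = 0" for a b c
      using simple by (simp add: simple_lie_algebra_def lie_algebra_def)
    then show ?thesis by (cases x; cases y; cases z) (auto simp: target_simps zero_prod_def br_linear)
  qed
qed (rule Tg.vector_space_axioms)

lemma contract_triple:
  "contract tsc c (\<lambda>i j. (A i j, B i j, C i j)) = (contract dsc c A, contract zsc c B, contract zsc c C)"
  by (simp add: contract_def target_simps prod_eq_iff fst_sum snd_sum)

lemma contract_uminus:
  assumes "vector_space t" shows "contract t c (\<lambda>i j. - L i j) = - contract t c L"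
proof -
  interpret vector_space t by fact
  show ?thesis by (simp add: contract_def sum_negf)
qed

section \<open>Contractions of the generating matrices of the target\<close>

definition rD_left :: "('g \<Rightarrow> complex) + 'i \<Rightarrow> 'g \<times> 'g" where
  "rD_left = case_sum (\<lambda>\<alpha>. (xpos \<D> \<alpha>, 0)) (\<lambda>i. (s (1/2) (fund i), s (1/2) (fund i)))"
definition rD_right :: "('g \<Rightarrow> complex) + 'i \<Rightarrow> 'g \<times> 'g" where
  "rD_right = case_sum (\<lambda>\<alpha>. (xneg \<D> \<alpha>, 0)) (\<lambda>i. (hv i, - hv i))"

lemma rD_sum_eq: "rD_sum \<D> b = (\<Sum>k\<in>r_index. b (rD_left k) (rD_right k))"
  by (simp add: rD_sum_def sum_r_index rD_left_def rD_right_def h_plus_def h_minus_def double_simps)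

lemma fst_rD: "fst (rD_left k) = r_left k" "fst (rD_right k) = r_right k"
  by (cases k; simp add: rD_left_def rD_right_def r_left_def r_right_def)+

lemma rD_carrier: "rD_left k \<in> UNIV \<times> H" "rD_right k \<in> UNIV \<times> H"
  by (cases k; auto simp: rD_left_def rD_right_def intro!: H_closed fund_coweight hvec)+

text \<open>Pairing the left factors of r with \<open>rho c\<close> produces \<open>T\<close>,
  followed by \<omega> on \<gg>. In the central component \<omega> is the identity, and the factor -
  1/2 combines the 1/2 of r with the sign in \<open>h_minus\<close>.\<close>

lemma contract_LL_plus: "contract dsc c (LL_plus \<D>) = (\<omega> (T (rho c)), s (- 1/2) (Z (rho c)))"
proof -
  have "LL_plus \<D> = (\<lambda>i j. \<Sum>k\<in>r_index. dsc (act (r_left k) $ i $ j) (double_omega \<D> (rD_right k)))"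
    by (intro ext) (simp add: LL_plus_def rD_sum_eq double_action_def case_prod_unfold fst_rD)
  then have "contract dsc c (LL_plus \<D>) = (\<Sum>k\<in>r_index. dsc (pairing c (act (r_left k))) (double_omega \<D> (rD_right k)))"
    by (simp add: D2.contract_simps)
  also have "\<dots> = (\<Sum>k\<in>r_index. (s (F (rho c) (r_left k)) (\<omega> (r_right k)), s (F (rho c) (r_left k)) (snd (rD_right k))))"
    by (simp add: F_rho double_omega_def case_prod_unfold fst_rD double_simps)
  finally have *: "contract dsc c (LL_plus \<D>) = \<dots>" .
  have "snd (contract dsc c (LL_plus \<D>)) = s (- 1/2) (Z (rho c))"
    unfolding * by (simp add: snd_sum sum_r_index r_left_def rD_right_def F_linear Z_eq G.scale_sum_right sum_negf)
  moreover have "fst (contract dsc c (LL_plus \<D>)) = \<omega> (T (rho c))"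
    unfolding * by (simp add: fst_sum T_def \<omega>_linear)
  ultimately show ?thesis by (simp add: prod_eq_iff)
qed

lemma contract_LL_minus: "contract dsc c (LL_minus \<D>) = (- \<omega> (P (rho c)), s (- 1/2) (Z (rho c)))"
proof -
  have "LL_minus \<D> = (\<lambda>i j. - (\<Sum>k\<in>r_index. dsc (act (r_right k) $ i $ j) (double_omega \<D> (rD_left k))))"
    by (intro ext) (simp add: LL_minus_def rD_sum_eq double_action_def case_prod_unfold fst_rD)
  then have "contract dsc c (LL_minus \<D>) = - (\<Sum>k\<in>r_index. dsc (pairing c (act (r_right k))) (double_omega \<D> (rD_left k)))"
    by (simp add: D2.contract_simps contract_uminus[OF D2.vector_space_axioms])
  also have "\<dots> = - (\<Sum>k\<in>r_index. (s (F (rho c) (r_right k)) (\<omega> (r_left k)), s (F (rho c) (r_right k)) (snd (rD_left k))))"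
    by (simp add: F_rho double_omega_def case_prod_unfold fst_rD double_simps)
  finally have *: "contract dsc c (LL_minus \<D>) = \<dots>" .
  have "snd (contract dsc c (LL_minus \<D>)) = s (- 1/2) (Z (rho c))"
    unfolding * by (simp add: snd_sum sum_r_index r_right_def rD_left_def F_linear Z_def G.scale_sum_right mult.commute sum_negf)
  moreover have "fst (contract dsc c (LL_minus \<D>)) = - \<omega> (P (rho c))"
    unfolding * by (simp add: fst_sum P_def \<omega>_linear)
  ultimately show ?thesis by (simp add: prod_eq_iff)
qed

text \<open>The functional of \<open>c\<close> on the invariants, extended by zero as an element of
  \<open>dual_space\<close>.\<close>

definition zfun :: "complex^'n^'n \<Rightarrow> complex^'n^'n \<Rightarrow> complex" where
  "zfun c = (\<lambda>X. if X \<in> glinv then pairing c X else 0)"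

lemma contract_ZZ: "contract zsc c (ZZ \<D>) = zfun c"
proof -
  have "ZZ \<D> i j = (\<lambda>X. X $ i $ j * (if X \<in> glinv then 1 else 0))" for i j
    by (auto simp: ZZ_def)
  then show ?thesis
    by (auto simp: contract_def zV_simps zfun_def pairing_def fun_eq_iff sum_fun_apply)
qed

text \<open>On a Cartan element u, \<open>lamP\<close> has the components -u/2, -u/2 and
  \<open>lamM\<close> the components u/2, -u/2. Together they fill both copies of the Cartan
  subalgebra, which is why the two Borel halves stay independent.\<close>

definition lamP :: "'g \<Rightarrow> ('g, 'n) target_type" where "lamP u = ((\<omega> (T u), s (- 1/2) (Z u)), 0, 0)"
definition lamM :: "'g \<Rightarrow> ('g, 'n) target_type" where "lamM u = ((- \<omega> (P u), s (- 1/2) (Z u)), 0, 0)"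

lemma linear_lam: "Vector_Spaces.linear s tsc lamP" "Vector_Spaces.linear s tsc lamM"
  unfolding lamP_def lamM_def
  by (intro linearI' G.vector_space_axioms Tg.vector_space_axioms;
      simp add: target_simps double_simps zV_simps T_linear P_linear Z_linear \<omega>_linear G.scale_right_distrib
        mult.commute zero_fun_def)+

lemma contract_tLP: "contract tsc c tLP = lamP (rho c) + (0, zfun c, 0)"
proof -
  have "tLP = (\<lambda>i j. (LL_plus \<D> i j, ZZ \<D> i j, 0))" by (intro ext) (simp add: target_L_plus_def)
  then show ?thesis
    by (simp add: contract_triple contract_LL_plus contract_ZZ lamP_def) (simp add: contract_def)
qed

lemma contract_tLM: "contract tsc c tLM = lamM (rho c) + (0, 0, - zfun c)"
proof -
  have "tLM = (\<lambda>i j. (LL_minus \<D> i j, 0, - ZZ \<D> i j))" by (intro ext) (simp add: target_L_minus_def)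
  then show ?thesis
    by (simp add: contract_triple contract_LL_minus contract_ZZ contract_uminus[OF Z2.vector_space_axioms] lamM_def)
      (simp add: contract_def)
qed

lemma zfun_transposed_commutator: "zfun (transposed_commutator (act x) c) = 0"
  by (auto simp: zfun_def pairing_commutator[symmetric] inv_iff linear_maps(3)[OF pairing_linear_map(1)])

text \<open>This lemma and the next two are \<open>rota_baxter\<close> rewritten with P = 1 - T.
  They are the mixed, the minus and the plus relation of the target, seen on \<gg>.\<close>

lemma T_br_P: "br (T u) (P v) = T (br u (P v)) + P (br (T u) v)"
proof -
  have v: "P v = v - T v" "P (br (T u) v) = br (T u) v - T (br (T u) v)"
    using P_plus_T[of v] P_plus_T[of "br (T u) v"] by (simp_all add: eq_diff_eq)
  show ?thesis unfolding v using rota_baxter[of u v] by (simp add: br_linear T_linear)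
qed

lemma rota_baxter_P: "br (P u) (P v) = P (br u (P v) - br (T u) v)"
proof -
  have "P u = u - T u" using P_plus_T[of u] by (simp add: eq_diff_eq)
  then have "br (P u) (P v) = br u (P v) - T (br u (P v)) - P (br (T u) v)"
    using T_br_P[of u v] by (simp add: br_linear)
  moreover have "P (br u (P v)) = br u (P v) - T (br u (P v))"
    using P_plus_T[of "br u (P v)"] by (simp add: eq_diff_eq)
  ultimately show ?thesis by (simp add: P_linear)
qed

lemma rota_baxter_T: "br (T u) (T v) = - T (br u (P v) - br (T u) v)"
proof -
  have "P v = v - T v" using P_plus_T[of v] by (simp add: eq_diff_eq)
  then show ?thesis using rota_baxter[of u v] by (simp add: br_linear T_linear)
qed

text \<open>Brackets in the target have no central component, so the central components on the other
  side of the relations must cancel. Against a Cartan element this is the adjointness of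
  \<open>P\<close> and \<open>T\<close>, as both commute with its adjoint action.\<close>

lemma Z_br: "Z (br u (P v)) = Z (br (T u) v)"
proof (rule F_ext)
  fix y
  have "F (br u (P v)) (Z y) = F u (P (br v (Z y)))"
    using br_H_PT(1)[OF Z_H, of y v] br_skew[of "P v"] br_skew[of v] by (simp add: F_inv P_linear)
  also have "\<dots> = F (br (T u) v) (Z y)" by (simp add: F_T[symmetric] F_inv)
  finally show "F (Z (br u (P v))) y = F (Z (br (T u) v)) y" by (simp add: F_Z)
qed

lemma tbr_lam:
  "tbr (lamP u + (0, f, f')) (lamP v + (0, g, g')) = - (lamP (br u (P v)) + lamP (br v (T u)))"
  "tbr (lamM u + (0, f, f')) (lamM v + (0, g, g')) = - (lamM (br u (P v)) + lamM (br v (T u)))"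
  "tbr (lamP u + (0, f, f')) (lamM v + (0, g, g')) = - (lamP (br u (P v)) + lamM (br v (T u)))"
proof -
  have sk: "br v (T u) = - br (T u) v" by (rule br_skew)
  have z: "s (1/2) (Z (br u (P v))) = s (1/2) (Z (br (T u) v))" by (simp add: Z_br)
  have "br (\<omega> (T u)) (\<omega> (T v)) = - (\<omega> (T (br u (P v))) + \<omega> (T (br v (T u))))"
    unfolding sk by (simp add: \<omega>_br[symmetric] rota_baxter_T T_linear \<omega>_linear)
  then show "tbr (lamP u + (0, f, f')) (lamP v + (0, g, g')) = - (lamP (br u (P v)) + lamP (br v (T u)))"
    using z by (simp add: lamP_def zero_prod_def target_simps uminus_prod_def sk Z_linear)
  have "br (- \<omega> (P u)) (- \<omega> (P v)) = \<omega> (P (br u (P v))) + \<omega> (P (br v (T u)))"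
    unfolding sk by (simp add: br_linear \<omega>_br[symmetric] rota_baxter_P P_linear \<omega>_linear)
  then show "tbr (lamM u + (0, f, f')) (lamM v + (0, g, g')) = - (lamM (br u (P v)) + lamM (br v (T u)))"
    using z by (simp add: lamM_def zero_prod_def target_simps uminus_prod_def sk Z_linear)
  have "br (\<omega> (T u)) (- \<omega> (P v)) = - (\<omega> (T (br u (P v))) - \<omega> (P (br v (T u))))"
    unfolding sk by (simp add: br_linear \<omega>_br[symmetric] T_br_P P_linear \<omega>_linear)
  then show "tbr (lamP u + (0, f, f')) (lamM v + (0, g, g')) = - (lamP (br u (P v)) + lamM (br v (T u)))"
    using z by (simp add: lamM_def lamP_def zero_prod_def target_simps uminus_prod_def sk Z_linear)
qed

lemma r_pi_eq: "r_pi \<D> = (\<Sum>k\<in>r_index. kron (act (r_left k)) (act (r_right k)))"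
  by (simp add: r_pi_def r_sum_eq)

text \<open>One argument for all three relations. With u and v the elements \<open>rho\<close> of
  the two matrix units, pairing the right factors of r with v gives \<open>P v\<close> and pairing
  the left ones with u gives \<open>T u\<close>; the central terms \<open>zX\<close>,
  \<open>zY\<close> are insensitive to commutators with \<pi>(\<gg>).\<close>

lemma relation_in_target:
  fixes X Y :: "'n \<Rightarrow> 'n \<Rightarrow> ('g, 'n) target_type"
  assumes X: "\<And>c. contract tsc c X = lX (rho c) + zX c" "\<And>x c. zX (transposed_commutator (act x) c) = 0"
      "Vector_Spaces.linear s tsc lX"
    and Y: "\<And>c. contract tsc c Y = lY (rho c) + zY c" "\<And>x c. zY (transposed_commutator (act x) c) = 0"
      "Vector_Spaces.linear s tsc lY"
    and XY: "\<And>u v c d. tbr (lX u + zX c) (lY v + zY d) = - (lX (br u (P v)) + lY (br v (T u)))"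
  shows "tbr (X i j) (Y k l) + scalar_matrix_commutator tsc (r_pi \<D>) (leg1 X + leg2 Y) (i, k) (j, l) = 0"
proof -
  define u where "u = rho (mat_unit i j)"
  define v where "v = rho (mat_unit k l)"
  have adX: "matrix_ad tsc (act x) X i j = lX (br u x)" for x
    using Tg.contract_matrix_ad[of "mat_unit i j" "act x" X]
    by (simp add: Tg.contract_mat_unit X rho_transposed_commutator u_def)
  have adY: "matrix_ad tsc (act x) Y k l = lY (br v x)" for x
    using Tg.contract_matrix_ad[of "mat_unit k l" "act x" Y]
    by (simp add: Tg.contract_mat_unit Y rho_transposed_commutator v_def)
  have "scalar_matrix_commutator tsc (r_pi \<D>) (leg1 X + leg2 Y) (i, k) (j, l) =
      (\<Sum>\<kappa>\<in>r_index. tsc (F v (r_right \<kappa>)) (lX (br u (r_left \<kappa>)))) + (\<Sum>\<kappa>\<in>r_index. tsc (F u (r_left \<kappa>)) (lY (br v (r_right \<kappa>))))"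
    by (simp add: r_pi_eq Tg.scalar_matrix_commutator_sum Tg.scalar_matrix_commutator_kron adX adY
        sum.distrib u_def v_def F_rho pairing_mat_unit)
  also have "\<dots> = lX (br u (P v)) + lY (br v (T u))"
    by (simp add: P_def T_def br_linear linear_maps[OF X(3)] linear_maps[OF Y(3)])
  also have "tbr (X i j) (Y k l) = - (lX (br u (P v)) + lY (br v (T u)))"
  proof -
    have "X i j = lX u + zX (mat_unit i j)" "Y k l = lY v + zY (mat_unit k l)"
      using X(1)[of "mat_unit i j"] Y(1)[of "mat_unit k l"] by (simp_all add: Tg.contract_mat_unit u_def v_def)
    then show ?thesis by (simp only: XY)
  qed
  ultimately show ?thesis by simp
qed

section \<open>The homomorphism\<close>

abbreviation "fLP \<equiv> (free_L_plus :: 'n \<Rightarrow> 'n \<Rightarrow> 'n lgen free_alg)"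
abbreviation "fLM \<equiv> (free_L_minus :: 'n \<Rightarrow> 'n \<Rightarrow> 'n lgen free_alg)"
abbreviation "I \<equiv> relator_ideal (g_r_relators \<D>)"

primrec generator_image :: "'n lgen \<Rightarrow> ('g, 'n) target_type" where
  "generator_image (Lplus i j) = tLP i j"
| "generator_image (Lminus i j) = tLM i j"

definition ev :: "'n lgen free_alg \<Rightarrow> ('g, 'n) target_type" where
  "ev = eval_free tsc tbr generator_image"

lemma linear_ev: "Vector_Spaces.linear free_scale tsc ev"
  unfolding ev_def by (rule linear_eval_free[OF target_lie_algebra])

lemmas ev_linear = linear_maps[OF linear_ev]

lemma ev_mult: "ev (free_mult p q) = tbr (ev p) (ev q)"
  unfolding ev_def by (rule eval_free_mult[OF target_lie_algebra])

lemma ev_L: "ev (fLP i j) = tLP i j" "ev (fLM i j) = tLM i j"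
  by (simp_all add: ev_def free_L_plus_def free_L_minus_def eval_free_gen[OF target_lie_algebra])

lemma ev_contract: "ev (contract free_scale c fLP) = contract tsc c tLP" "ev (contract free_scale c fLM) = contract tsc c tLM"
  by (simp_all add: contract_linear_image[OF linear_ev, symmetric] ev_L)

lemma ev_r_relator:
  assumes "\<And>i j. ev (X i j) = X' i j" "\<And>i j. ev (Y i j) = Y' i j"
  shows "ev (r_relator \<D> X Y (i, k) (j, l)) =
    tbr (X' i j) (Y' k l) + scalar_matrix_commutator tsc (r_pi \<D>) (leg1 X' + leg2 Y') (i, k) (j, l)"
proof -
  have "ev ((leg1 X + leg2 Y) p q) = (leg1 X' + leg2 Y') p q" for p q
    by (cases p; cases q) (simp add: leg1_def leg2_def ev_linear assms)
  then show ?thesis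
    by (simp add: r_relator_def leg12_bracket_def ev_linear ev_mult assms scalar_commutator_eq scalar_matrix_commutator_def)
qed

text \<open>The displayed matrix represents the functional "entry k, l of the \<mu>-component".
  Hence the triangularity relators are contractions.\<close>

lemma pairing_component:
  assumes "\<mu> \<in> dualH"
  shows "pairing (\<chi> i j. gl_component \<D> \<mu> (mat_unit i j) $ k $ l) X = gl.component \<mu> X $ k $ l"
proof -
  note lin = linear_maps[OF gl.linear_component[OF assms]]
  have "gl.component \<mu> X = gl.component \<mu> (\<Sum>i\<in>UNIV. \<Sum>j\<in>UNIV. mat_scale (X $ i $ j) (mat_unit i j))"
    by (simp only: mat_expand)
  also have "\<dots> = (\<Sum>i\<in>UNIV. \<Sum>j\<in>UNIV. mat_scale (X $ i $ j) (gl.component \<mu> (mat_unit i j)))"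
    by (simp only: lin(2,6))
  finally have "gl.component \<mu> X $ k $ l = (\<Sum>i\<in>UNIV. \<Sum>j\<in>UNIV. X $ i $ j * gl.component \<mu> (mat_unit i j) $ k $ l)"
    by (simp add: mat_scale_nth)
  then show ?thesis by (simp add: pairing_def gl_component_eq mult.commute)
qed

lemma weight_component_contract:
  "weight_component \<D> \<mu> X k l = contract free_scale (\<chi> i j. gl_component \<D> \<mu> (mat_unit i j) $ k $ l) X"
  by (simp add: weight_component_def contract_def)

lemma Q_minus_dualH: "\<mu> \<in> Q_minus \<D> \<Longrightarrow> \<mu> \<in> dualH"
  using Q_plus_dualH[of "- \<mu>"] dual_space_uminus[of "- \<mu>"] by (simp add: Q_minus_iff)

lemma component_inv: "\<mu> \<in> dualH \<Longrightarrow> \<mu> \<noteq> 0 \<Longrightarrow> X \<in> glinv \<Longrightarrow> gl.component \<mu> X = 0"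
  using gl.component_other[of \<mu> 0 X] dual_space_zero inv_glW by blast

lemma zfun_component:
  "\<mu> \<in> dualH \<Longrightarrow> \<mu> \<noteq> 0 \<Longrightarrow> zfun (\<chi> i j. gl_component \<D> \<mu> (mat_unit i j) $ k $ l) = 0"
  by (auto simp: zfun_def fun_eq_iff pairing_component component_inv)

lemma weight_zero_P:
  assumes "\<mu> \<in> Q_minus \<D>" "\<mu> \<noteq> 0"
  shows "gl.component \<mu> (act (P y)) = 0" "gl.component \<mu> (act (Z y)) = 0"
proof -
  note m = Q_minus_dualH[OF assms(1)]
  show "gl.component \<mu> (act (P y)) = 0"
  proof (induction y rule: gr.induct_homogeneous)
    case (1 \<nu> y)
    show ?case
    proof (cases "\<nu> \<in> \<Delta> \<or> \<nu> = 0")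
      case True
      then have "\<mu> \<noteq> \<nu>" using assms Q_plus_Q_minus positive_root_D(2) by (auto simp: Q_minus_iff)
      then show ?thesis
        using gl.component_other[OF m 1(1) _ act_W[OF 1(2)]] P_W[OF 1(2,1)]
        by (simp add: act_linear linear_maps[OF gl.linear_component[OF m]])
    next
      case False
      then have "P y = 0" using P_W[OF 1(2,1)] by (simp add: P_weight_def)
      then show ?thesis by (simp add: act_linear linear_maps[OF gl.linear_component[OF m]])
    qed
  qed (simp_all add: P_linear act_linear linear_maps[OF gl.linear_component[OF m]])
  show "gl.component \<mu> (act (Z y)) = 0"
    using gl.component_other[OF m dual_space_zero assms(2)] act_W[of "Z y" 0] Z_H W_0 by simp
qed

lemma weight_zero_T:
  assumes "\<mu> \<in> Q_plus \<D>" "\<mu> \<noteq> 0"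
  shows "gl.component \<mu> (act (T y)) = 0" "gl.component \<mu> (act (Z y)) = 0"
proof -
  note m = Q_plus_dualH[OF assms(1)]
  show "gl.component \<mu> (act (T y)) = 0"
  proof (induction y rule: gr.induct_homogeneous)
    case (1 \<nu> y)
    show ?case
    proof (cases "\<mu> = \<nu>")
      case True
      have "T y = 0"
      proof (cases "\<nu> \<in> \<Delta>")
        case True
        then show ?thesis using T_W[OF 1(2,1)] by (simp add: P_weight_def)
      next
        case False
        then have "\<nu> \<notin> roots \<D>" using assms True by (simp add: positive_roots_def)
        then have "y = 0" using W_trivial[OF 1(1) _ _ 1(2)] True assms by simp
        then show ?thesis by (simp add: T_linear)
      qed
      then show ?thesis by (simp add: act_linear linear_maps[OF gl.linear_component[OF m]])
    next
      case False
      then show ?thesis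
        using gl.component_other[OF m 1(1) _ act_W[OF 1(2)]] T_W[OF 1(2,1)]
        by (simp add: act_linear linear_maps[OF gl.linear_component[OF m]])
    qed
  qed (simp_all add: T_linear act_linear linear_maps[OF gl.linear_component[OF m]])
  show "gl.component \<mu> (act (Z y)) = 0"
    using gl.component_other[OF m dual_space_zero assms(2)] act_W[of "Z y" 0] Z_H W_0 by simp
qed

lemma Z_rho_eq_0: "(\<And>y. pairing c (act (Z y)) = 0) \<Longrightarrow> Z (rho c) = 0"
  by (rule F_nondeg) (simp add: F_Z F_rho)

text \<open>The range of \<open>P\<close> is the positive Borel subalgebra, so the condition says
  that \<open>c\<close> annihilates its image under \<pi>.\<close>

lemma T_rho_eq_0: "(\<forall>y. pairing c (act (P y)) = 0) \<longleftrightarrow> T (rho c) = 0"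
proof
  assume "\<forall>y. pairing c (act (P y)) = 0"
  then show "T (rho c) = 0" by (intro F_nondeg) (simp add: F_T F_rho)
next
  assume "T (rho c) = 0"
  then show "\<forall>y. pairing c (act (P y)) = 0" by (metis F_T F_left(3) F_rho)
qed

lemma P_rho_eq_0: "(\<forall>y. pairing c (act (T y)) = 0) \<longleftrightarrow> P (rho c) = 0"
proof
  assume "\<forall>y. pairing c (act (T y)) = 0"
  then show "P (rho c) = 0" by (intro F_nondeg) (simp add: F_P F_rho)
next
  assume "P (rho c) = 0"
  then show "\<forall>y. pairing c (act (T y)) = 0" by (metis F_P F_left(3) F_rho)
qed

lemma ev_relators: "p \<in> g_r_relators \<D> \<Longrightarrow> ev p = 0"
proof -
  note PP = relation_in_target[where X = tLP and Y = tLP and lX = lamP and lY = lamP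
      and zX = "\<lambda>c. (0, zfun c, 0)" and zY = "\<lambda>c. (0, zfun c, 0)"]
  note MM = relation_in_target[where X = tLM and Y = tLM and lX = lamM and lY = lamM
      and zX = "\<lambda>c. (0, 0, - zfun c)" and zY = "\<lambda>c. (0, 0, - zfun c)"]
  note PM = relation_in_target[where X = tLP and Y = tLM and lX = lamP and lY = lamM
      and zX = "\<lambda>c. (0, zfun c, 0)" and zY = "\<lambda>c. (0, 0, - zfun c)"]
  assume "p \<in> g_r_relators \<D>"
  then consider \<mu> k l where "p = weight_component \<D> \<mu> fLP k l" "\<mu> \<in> Q_minus \<D>" "\<mu> \<noteq> 0"
    | \<mu> k l where "p = weight_component \<D> \<mu> fLM k l" "\<mu> \<in> Q_plus \<D>" "\<mu> \<noteq> 0"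
    | i j k l where "p = r_relator \<D> fLP fLP (i, k) (j, l)"
    | i j k l where "p = r_relator \<D> fLM fLM (i, k) (j, l)"
    | i j k l where "p = r_relator \<D> fLP fLM (i, k) (j, l)"
    unfolding g_r_relators_def by auto
  then show "ev p = 0"
  proof cases
    case 1
    note m = Q_minus_dualH[OF 1(2)]
    let ?c = "(\<chi> i j. gl_component \<D> \<mu> (mat_unit i j) $ k $ l) :: complex^'n^'n"
    have "T (rho ?c) = 0"
      by (subst T_rho_eq_0[symmetric]) (simp add: pairing_component[OF m] weight_zero_P[OF 1(2,3)])
    moreover have "Z (rho ?c) = 0"
      by (rule Z_rho_eq_0) (simp add: pairing_component[OF m] weight_zero_P[OF 1(2,3)])
    ultimately show ?thesis
      by (simp add: 1(1) weight_component_contract ev_contract contract_tLP lamP_def zfun_component[OF m 1(3)] \<omega>_linear zero_prod_def)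
  next
    case 2
    note m = Q_plus_dualH[OF 2(2)]
    let ?c = "(\<chi> i j. gl_component \<D> \<mu> (mat_unit i j) $ k $ l) :: complex^'n^'n"
    have "P (rho ?c) = 0"
      by (subst P_rho_eq_0[symmetric]) (simp add: pairing_component[OF m] weight_zero_T[OF 2(2,3)])
    moreover have "Z (rho ?c) = 0"
      by (rule Z_rho_eq_0) (simp add: pairing_component[OF m] weight_zero_T[OF 2(2,3)])
    ultimately show ?thesis
      by (simp add: 2(1) weight_component_contract ev_contract contract_tLM lamM_def zfun_component[OF m 2(3)] \<omega>_linear zero_prod_def)
  next
    case 3
    show ?thesis unfolding 3 ev_r_relator[of fLP tLP fLP tLP, OF ev_L(1) ev_L(1)]
      by (rule PP) (rule contract_tLP contract_tLM tbr_lam linear_lam | simp add: zfun_transposed_commutator zero_prod_def)+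
  next
    case 4
    show ?thesis unfolding 4 ev_r_relator[of fLM tLM fLM tLM, OF ev_L(2) ev_L(2)]
      by (rule MM) (rule contract_tLP contract_tLM tbr_lam linear_lam | simp add: zfun_transposed_commutator zero_prod_def)+
  next
    case 5
    show ?thesis unfolding 5 ev_r_relator[of fLP tLP fLM tLM, OF ev_L(1) ev_L(2)]
      by (rule PM) (rule contract_tLP contract_tLM tbr_lam linear_lam | simp add: zfun_transposed_commutator zero_prod_def)+
  qed
qed

lemma ev_ideal: "p \<in> I \<Longrightarrow> ev p = 0"
  using eval_free_relator_ideal[OF target_lie_algebra, of "g_r_relators \<D>" generator_image p] ev_relators
  by (simp add: ev_def)

end

section \<open>The isomorphism\<close>

lemma pairing_sym: "pairing X Y = pairing Y X"
  by (simp add: pairing_def mult.commute)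

context rmatrix
begin

abbreviation "fP c \<equiv> contract free_scale c fLP"
abbreviation "fM c \<equiv> contract free_scale c fLM"

lemma relators_mem:
  "\<mu> \<in> Q_minus \<D> \<Longrightarrow> \<mu> \<noteq> 0 \<Longrightarrow> weight_component \<D> \<mu> fLP k l \<in> I"
  "\<mu> \<in> Q_plus \<D> \<Longrightarrow> \<mu> \<noteq> 0 \<Longrightarrow> weight_component \<D> \<mu> fLM k l \<in> I"
  "r_relator \<D> fLP fLP p q \<in> I" "r_relator \<D> fLM fLM p q \<in> I" "r_relator \<D> fLP fLM p q \<in> I"
proof -
  have Un: "A \<subseteq> A \<union> B \<union> C \<union> D \<union> E" "B \<subseteq> A \<union> B \<union> C \<union> D \<union> E" "C \<subseteq> A \<union> B \<union> C \<union> D \<union> E"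
    "D \<subseteq> A \<union> B \<union> C \<union> D \<union> E" "E \<subseteq> A \<union> B \<union> C \<union> D \<union> E" for A B C D E :: "'n lgen free_alg set"
    by blast+
  note sub = Un[where A = "{weight_component \<D> \<mu> fLP k l | \<mu> k l. \<mu> \<in> Q_minus \<D> - {0}}"
      and B = "{weight_component \<D> \<mu> fLM k l | \<mu> k l. \<mu> \<in> Q_plus \<D> - {0}}"
      and C = "{r_relator \<D> fLP fLP p q | p q. True}" and D = "{r_relator \<D> fLM fLM p q | p q. True}"
      and E = "{r_relator \<D> fLP fLM p q | p q. True}", folded g_r_relators_def,
      THEN subset_trans[OF _ relators_in_ideal(2)]]
  show "\<mu> \<in> Q_minus \<D> \<Longrightarrow> \<mu> \<noteq> 0 \<Longrightarrow> weight_component \<D> \<mu> fLP k l \<in> I"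
    by (rule subsetD[OF sub(1)]) blast
  show "\<mu> \<in> Q_plus \<D> \<Longrightarrow> \<mu> \<noteq> 0 \<Longrightarrow> weight_component \<D> \<mu> fLM k l \<in> I"
    by (rule subsetD[OF sub(2)]) blast
  show "r_relator \<D> fLP fLP p q \<in> I" by (rule subsetD[OF sub(3)]) blast
  show "r_relator \<D> fLM fLM p q \<in> I" by (rule subsetD[OF sub(4)]) blast
  show "r_relator \<D> fLP fLM p q \<in> I" by (rule subsetD[OF sub(5)]) blast
qed

lemma contract_mem: "(\<And>i j. L i j \<in> I) \<Longrightarrow> contract free_scale c L \<in> I"
  unfolding contract_def by (intro relator_ideal_closed)

abbreviation "tc \<equiv> transposed_commutator"

text \<open>The relation after pairing both matrix legs: a bracket of two contractions is, modulo
  the ideal, a sum of contractions. It serves both to bound the generators and to show that they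
  span.\<close>

lemma relator_contract:
  assumes "\<And>p q. r_relator \<D> X Y p q \<in> I"
  shows "free_mult (contract free_scale c X) (contract free_scale d Y) +
    ((\<Sum>\<kappa>\<in>r_index. free_scale (pairing d (act (r_right \<kappa>))) (contract free_scale (tc (act (r_left \<kappa>)) c) X)) +
     (\<Sum>\<kappa>\<in>r_index. free_scale (pairing c (act (r_left \<kappa>))) (contract free_scale (tc (act (r_right \<kappa>)) d) Y))) \<in> I"
proof -
  have r: "r_relator \<D> X Y (i, k) (j, l) = free_mult (X i j) (Y k l) +
      ((\<Sum>\<kappa>\<in>r_index. free_scale (act (r_right \<kappa>) $ k $ l) (matrix_ad free_scale (act (r_left \<kappa>)) X i j)) +
       (\<Sum>\<kappa>\<in>r_index. free_scale (act (r_left \<kappa>) $ i $ j) (matrix_ad free_scale (act (r_right \<kappa>)) Y k l)))" for i j k l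
    by (simp add: r_relator_def leg12_bracket_def scalar_commutator_eq r_pi_eq Fr.scalar_matrix_commutator_sum
        Fr.scalar_matrix_commutator_kron sum.distrib)
  have "contract free_scale c (\<lambda>i j. contract free_scale d (\<lambda>k l. r_relator \<D> X Y (i, k) (j, l))) \<in> I"
    by (intro contract_mem assms)
  then show ?thesis
    by (simp add: r Fr.contract_simps contract_linear_image[OF linear_free_mult_right]
        contract_linear_image[OF linear_free_mult_left] Fr.contract_matrix_ad)
qed

lemma subspace_contract_ideal: "M.subspace {c. contract free_scale c L \<in> I}"
  using linear_maps[OF Fr.linear_contract[of L]]
  by (intro M.subspaceI) (auto intro: relator_ideal_closed)

lemma linear_tc_act: "Vector_Spaces.linear s mat_scale (\<lambda>y. tc (act y) d)"
  by (rule linear_compose'[OF linear_act transposed_commutator_linear_map])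

text \<open>Skew-symmetry of the bracket of a generating matrix with itself forces it into the
  normalizer of \<open>\<pi>(\<gg>)\<close>.\<close>

lemma annihilated_in_normalizer:
  assumes rel: "\<And>p q. r_relator \<D> L L p q \<in> I"
    and X: "\<And>k. contract free_scale k L \<in> I \<Longrightarrow> pairing k X = 0"
  shows "\<exists>z. X - act z \<in> glinv"
proof (rule normalizer)
  fix y
  have "tc (act y) d \<in> {k. contract free_scale k L \<in> I}" if d: "\<And>x. pairing d (act x) = 0" for d
  proof -
    obtain c where c: "rho c = y" using rho_surj by blast
    define g where "g = (\<lambda>y. contract free_scale (tc (act y) d) L)"
    have g: "Vector_Spaces.linear s free_scale g"
      unfolding g_def by (rule linear_compose'[OF linear_tc_act Fr.linear_contract])
    let ?c = "contract free_scale c L" and ?d = "contract free_scale d L"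
    \<comment> \<open>Since \<open>d\<close> annihilates \<pi>(\<gg>), the sum with coefficients
      \<open>pairing d\<close> drops out. Adding the relations for both orders cancels the brackets
      and assembles the remaining sums to \<open>g (rho c)\<close>.\<close>
    have A: "free_mult ?c ?d + (\<Sum>\<kappa>\<in>r_index. free_scale (pairing c (act (r_left \<kappa>))) (g (r_right \<kappa>))) \<in> I"
      using relator_contract[OF rel, of c d] by (simp add: d g_def)
    have B: "free_mult ?d ?c + (\<Sum>\<kappa>\<in>r_index. free_scale (pairing c (act (r_right \<kappa>))) (g (r_left \<kappa>))) \<in> I"
      using relator_contract[OF rel, of d c] by (simp add: d g_def)
    have "(free_mult ?c ?d + (\<Sum>\<kappa>\<in>r_index. free_scale (pairing c (act (r_left \<kappa>))) (g (r_right \<kappa>)))) +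
        (free_mult ?d ?c + (\<Sum>\<kappa>\<in>r_index. free_scale (pairing c (act (r_right \<kappa>))) (g (r_left \<kappa>)))) -
        (free_mult ?c ?d + free_mult ?d ?c) \<in> I"
      by (rule relator_ideal_closed(5)[OF relator_ideal_closed(2)[OF A B] free_mult_skew])
    moreover have "g (rho c) = (\<Sum>\<kappa>\<in>r_index. free_scale (pairing c (act (r_left \<kappa>))) (g (r_right \<kappa>))) +
        (\<Sum>\<kappa>\<in>r_index. free_scale (pairing c (act (r_right \<kappa>))) (g (r_left \<kappa>)))"
      using sum_casimir_index[of "\<lambda>a b. free_scale (pairing c (act a)) (g b)"]
      by (simp add: rho_def linear_maps[OF g])
    ultimately have "g (rho c) \<in> I" by (simp add: algebra_simps)
    then show ?thesis by (simp add: g_def c)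
  qed
  then have tcX: "pairing d (commutator (act y) X) = 0" if "\<And>x. pairing d (act x) = 0" for d
    using that X by (simp add: pairing_commutator)
  show "commutator (act y) X \<in> range act"
  proof (rule double_annihilator)
    show "M.subspace (range act)"
    proof (rule M.subspaceI)
      show "0 \<in> range act" by (rule range_eqI[where x = 0]) (simp add: act_linear)
    qed (auto simp: act_linear(1,2)[symmetric])
    fix d assume d: "\<And>k. k \<in> range act \<Longrightarrow> pairing k d = 0"
    have "pairing d (act x) = 0" for x using d[OF rangeI] by (simp add: pairing_sym[of d])
    then show "pairing (commutator (act y) X) d = 0" using tcX by (simp add: pairing_sym[of _ d])
  qed
qed

lemma component_eq_0:
  assumes "\<mu> \<in> dualH" "\<mu> \<noteq> 0" "X - act z \<in> glinv"
    and "\<And>k l. pairing (\<chi> i j. gl_component \<D> \<mu> (mat_unit i j) $ k $ l) X = 0"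
  shows "gl.component \<mu> (act z) = 0"
proof -
  have "gl.component \<mu> X = 0" using assms(4) by (simp add: pairing_component[OF assms(1)] vec_eq_iff)
  moreover have "gl.component \<mu> (X - act z) = 0" by (rule component_inv[OF assms(1-3)])
  ultimately show ?thesis by (simp add: linear_maps[OF gl.linear_component[OF assms(1)]])
qed

lemma uminus_positive_Q: "\<alpha> \<in> \<Delta> \<Longrightarrow> - \<alpha> \<in> Q_minus \<D>" "\<alpha> \<in> \<Delta> \<Longrightarrow> - \<alpha> \<noteq> 0"
  using positive_root_D(2) positive_root_nonzero by (auto simp: Q_minus_iff)

text \<open>The assumptions say that \<open>c\<close> annihilates the image of the positive Borel
  subalgebra and the invariants. A matrix annihilated by every \<open>k\<close> whose contraction
  lies in the ideal belongs to the sum of these two spaces, so duality applies.\<close>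

lemma fP_in_ideal:
  assumes c: "T (rho c) = 0" "\<And>X. X \<in> glinv \<Longrightarrow> pairing c X = 0"
  shows "fP c \<in> I"
proof -
  have "c \<in> {c. fP c \<in> I}"
  proof (rule double_annihilator[OF subspace_contract_ideal])
    fix X assume "\<And>k. k \<in> {c. fP c \<in> I} \<Longrightarrow> pairing k X = 0"
    then have X: "\<And>k. fP k \<in> I \<Longrightarrow> pairing k X = 0" by simp
    obtain z where z: "X - act z \<in> glinv"
      using annihilated_in_normalizer[OF relators_mem(3) X] by blast
    have "F z (xpos \<D> \<alpha>) = 0" if a: "\<alpha> \<in> \<Delta>" for \<alpha>
    proof -
      have "gl.component (- \<alpha>) (act z) = 0"
        using relators_mem(1)[OF uminus_positive_Q[OF a]]
        by (intro component_eq_0[OF positive_root_D(5)[OF a] uminus_positive_Q(2)[OF a] z] X)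
          (simp only: weight_component_contract)
      then have "s (F z (xpos \<D> \<alpha>)) (xneg \<D> \<alpha>) = 0" by (simp only: component_act[OF a] act_eq_0_iff)
      moreover have "xneg \<D> \<alpha> \<noteq> 0" using root_vectors_D(3)[OF a] by (auto simp: F_linear)
      ultimately show ?thesis by simp
    qed
    then have "z = P (z + Z z)" by (rule borel_plus)
    then have "pairing c (act z) = 0" using T_rho_eq_0[of c] c(1) by metis
    moreover have "pairing c (X - act z) = 0" by (rule c(2)[OF z])
    ultimately show "pairing c X = 0" by (simp add: linear_maps[OF pairing_linear_map(1)])
  qed
  then show ?thesis by simp
qed

lemma fM_in_ideal:
  assumes c: "P (rho c) = 0" "\<And>X. X \<in> glinv \<Longrightarrow> pairing c X = 0"
  shows "fM c \<in> I"
proof -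
  have "c \<in> {c. fM c \<in> I}"
  proof (rule double_annihilator[OF subspace_contract_ideal])
    fix X assume "\<And>k. k \<in> {c. fM c \<in> I} \<Longrightarrow> pairing k X = 0"
    then have X: "\<And>k. fM k \<in> I \<Longrightarrow> pairing k X = 0" by simp
    obtain z where z: "X - act z \<in> glinv"
      using annihilated_in_normalizer[OF relators_mem(4) X] by blast
    have "F z (xneg \<D> \<alpha>) = 0" if a: "\<alpha> \<in> \<Delta>" for \<alpha>
    proof -
      have "gl.component \<alpha> (act z) = 0"
        using relators_mem(2)[OF positive_root_D(2)[OF a] positive_root_nonzero[OF a]]
        by (intro component_eq_0[OF positive_root_D(3)[OF a] positive_root_nonzero[OF a] z] X)
          (simp only: weight_component_contract)
      then have "s (F z (xneg \<D> \<alpha>)) (xpos \<D> \<alpha>) = 0" by (simp only: component_act[OF a] act_eq_0_iff)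
      moreover have "xpos \<D> \<alpha> \<noteq> 0" using root_vectors_D(3)[OF a] by (auto simp: F_linear)
      ultimately show ?thesis by simp
    qed
    then have "z = T (z + Z z)" by (rule borel_minus)
    then have "pairing c (act z) = 0" using P_rho_eq_0[of c] c(1) by metis
    moreover have "pairing c (X - act z) = 0" by (rule c(2)[OF z])
    ultimately show "pairing c X = 0" by (simp add: linear_maps[OF pairing_linear_map(1)])
  qed
  then show ?thesis by simp
qed

text \<open>\<open>a\<close> and \<open>b\<close> collect, with sign, the matrices that the
  contracted relation produces in the two legs.\<close>

lemma bracket_reduces:
  assumes "\<And>p q. r_relator \<D> X Y p q \<in> I"
  shows "\<exists>a b. free_mult (contract free_scale c X) (contract free_scale d Y) -
    (contract free_scale a X + contract free_scale b Y) \<in> I"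
proof -
  define a where "a = - (\<Sum>\<kappa>\<in>r_index. mat_scale (pairing d (act (r_right \<kappa>))) (tc (act (r_left \<kappa>)) c))"
  define b where "b = - (\<Sum>\<kappa>\<in>r_index. mat_scale (pairing c (act (r_left \<kappa>))) (tc (act (r_right \<kappa>)) d))"
  have "free_mult (contract free_scale c X) (contract free_scale d Y) -
      (contract free_scale a X + contract free_scale b Y) \<in> I"
  proof -
    have e: "contract free_scale a X = - (\<Sum>\<kappa>\<in>r_index. free_scale (pairing d (act (r_right \<kappa>))) (contract free_scale (tc (act (r_left \<kappa>)) c) X))"
      "contract free_scale b Y = - (\<Sum>\<kappa>\<in>r_index. free_scale (pairing c (act (r_left \<kappa>))) (contract free_scale (tc (act (r_right \<kappa>)) d) Y))"
      by (simp_all add: a_def b_def linear_maps[OF Fr.linear_contract])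
    show ?thesis
      using relator_contract[OF assms, of c d] unfolding e by (simp only: minus_add_distrib[symmetric] diff_minus_eq_add)
  qed
  then show ?thesis by blast
qed

lemma generators_span: "\<exists>c d. p - (fP c + fM d) \<in> I"
proof -
  let ?S = "{p. \<exists>c d. p - (fP c + fM d) \<in> I}"
  note lc = linear_maps[OF Fr.linear_contract]
  have S_I: "p \<in> ?S" if "p \<in> I" for p
    using that by (auto intro!: exI[of _ 0] simp: lc)
  have subspace: "Fr.subspace ?S"
  proof (rule Fr.subspaceI)
    fix p q assume "p \<in> ?S" "q \<in> ?S"
    then obtain c d c' d' where "p - (fP c + fM d) \<in> I" "q - (fP c' + fM d') \<in> I" by blast
    then have "(p - (fP c + fM d)) + (q - (fP c' + fM d')) \<in> I" by (rule relator_ideal_closed)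
    then have "p + q - (fP (c + c') + fM (d + d')) \<in> I" by (simp add: lc algebra_simps)
    then show "p + q \<in> ?S" by blast
  next
    fix a p assume "p \<in> ?S"
    then obtain c d where "p - (fP c + fM d) \<in> I" by blast
    then have "free_scale a (p - (fP c + fM d)) \<in> I" by (rule relator_ideal_closed)
    then have "free_scale a p - (fP (mat_scale a c) + fM (mat_scale a d)) \<in> I"
      by (simp add: lc Fr.scale_right_diff_distrib Fr.scale_right_distrib)
    then show "free_scale a p \<in> ?S" by blast
  qed (intro S_I relator_ideal_closed)
  have cong: "p \<in> ?S" if "p - q \<in> I" "q \<in> ?S" for p q
    using Fr.subspace_add[OF subspace S_I[OF that(1)] that(2)] by simp
  have PP: "free_mult (fP c) (fP d) \<in> ?S" for c d
  proof -
    obtain a b where "free_mult (fP c) (fP d) - (fP a + fP b) \<in> I"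
      using bracket_reduces[OF relators_mem(3)] by blast
    then have "free_mult (fP c) (fP d) - (fP (a + b) + fM 0) \<in> I" by (simp add: lc)
    then show ?thesis by blast
  qed
  have MM: "free_mult (fM c) (fM d) \<in> ?S" for c d
  proof -
    obtain a b where "free_mult (fM c) (fM d) - (fM a + fM b) \<in> I"
      using bracket_reduces[OF relators_mem(4)] by blast
    then have "free_mult (fM c) (fM d) - (fP 0 + fM (a + b)) \<in> I" by (simp add: lc)
    then show ?thesis by blast
  qed
  have PM: "free_mult (fP c) (fM d) \<in> ?S" for c d
    using bracket_reduces[OF relators_mem(5), of c d] by blast
  \<comment> \<open>The presentation relates plus and minus in one order only; skew-symmetry yields
    the other.\<close>
  have MP: "free_mult (fM c) (fP d) \<in> ?S" for c d
    using Fr.subspace_diff[OF subspace S_I[OF free_mult_skew[of "fM c" "fP d"]] PM[of d c]] by simp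
  have mult: "free_mult p q \<in> ?S" if "p \<in> ?S" "q \<in> ?S" for p q
  proof -
    from that obtain c d c' d' where pq: "p - (fP c + fM d) \<in> I" "q - (fP c' + fM d') \<in> I" by blast
    define r r' where "r = fP c + fM d" and "r' = fP c' + fM d'"
    have "free_mult (fP c) (fP c') + free_mult (fP c) (fM d') + (free_mult (fM d) (fP c') + free_mult (fM d) (fM d')) \<in> ?S"
      by (intro Fr.subspace_add[OF subspace] PP PM MP MM)
    then have "free_mult r r' \<in> ?S" by (simp only: r_def r'_def free_mult_linear(1,7) add_ac)
    moreover have "free_mult (p - r) q + free_mult r (q - r') \<in> I"
      unfolding r_def r'_def by (intro relator_ideal_closed(2) relator_ideal_mult pq)
    then have "free_mult p q - free_mult r r' \<in> I" by (simp add: free_mult_linear(5,11))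
    ultimately show ?thesis using cong by blast
  qed
  have "Poly_Mapping.single w 1 \<in> ?S" for w :: "'n lgen lie_word"
  proof (induction w)
    case (Gen x)
    show ?case
    proof (cases x)
      case (Lplus i j)
      then have "Poly_Mapping.single (Gen x) 1 - (fP (mat_unit i j) + fM 0) \<in> I"
        using relator_ideal_closed(1)
        by (simp add: Fr.contract_mat_unit lc free_L_plus_def free_gen_def)
      then show ?thesis by blast
    next
      case (Lminus i j)
      then have "Poly_Mapping.single (Gen x) 1 - (fP 0 + fM (mat_unit i j)) \<in> I"
        using relator_ideal_closed(1)
        by (simp add: Fr.contract_mat_unit lc free_L_minus_def free_gen_def)
      then show ?thesis by blast
    qed
  next
    case (Br u v)
    then have "free_mult (Poly_Mapping.single u 1) (Poly_Mapping.single v 1) \<in> ?S" by (rule mult)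
    then show ?case by (simp only: free_mult_single)
  qed
  then have "p \<in> ?S" by (rule free_alg_subspace_UNIV[OF subspace])
  then show ?thesis by simp
qed

lemma zfun_eq_0: "zfun c = 0 \<Longrightarrow> X \<in> glinv \<Longrightarrow> pairing c X = 0"
  unfolding zfun_def fun_eq_iff by (metis zero_fun_def)

lemma ev_eq_0_iff: "ev p = 0 \<longleftrightarrow> p \<in> I"
proof
  assume 0: "ev p = 0"
  obtain c d where cd: "p - (fP c + fM d) \<in> I" using generators_span by blast
  then have "ev p = contract tsc c tLP + contract tsc d tLM"
    using ev_ideal[OF cd] by (simp add: ev_linear ev_contract)
  then have e: "lamP (rho c) + (0, zfun c, 0) + (lamM (rho d) + (0, 0, - zfun d)) = 0"
    using 0 by (simp add: contract_tLP contract_tLM)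
  then have z: "zfun c = 0" "zfun d = 0" by (simp_all add: lamP_def lamM_def zero_prod_def)
  from e have w: "\<omega> (T (rho c)) = \<omega> (P (rho d))" and Z: "s (- 1/2) (Z (rho c)) + s (- 1/2) (Z (rho d)) = 0"
    by (simp_all add: lamP_def lamM_def zero_prod_def)
  have TP: "T (rho c) = P (rho d)" using arg_cong[OF w, of \<omega>] by (simp add: \<omega>_invol)
  have "s (- 1/2) (Z (rho c) + Z (rho d)) = 0" using Z by (simp add: G.scale_right_distrib)
  then have "Z (rho c) = - Z (rho d)" by (simp add: eq_neg_iff_add_eq_0)
  \<comment> \<open>The two Cartan parts obey opposite equations: the \<gg>-component makes them
    equal, the central component makes them negatives of each other. So both vanish.\<close>
  moreover have "s (1/2) (Z (rho c)) = s (1/2) (Z (rho d))" using arg_cong[OF TP, of Z] by (simp add: P_T)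
  then have "Z (rho c) = Z (rho d)" by simp
  ultimately have "s 2 (Z (rho d)) = 0"
    using G.scale_left_distrib[of 1 1 "Z (rho d)"] by (simp add: eq_neg_iff_add_eq_0)
  then have Zd: "Z (rho d) = 0" by simp
  then have Zc: "Z (rho c) = 0" using \<open>Z (rho c) = Z (rho d)\<close> by simp
  \<comment> \<open>With the Cartan parts gone, \<open>T P\<close> and \<open>P T\<close> vanish
    here, so \<open>T (rho c)\<close> is killed by \<open>T\<close> as well as by \<open>P\<close>
    and is zero because P + T = 1.\<close>
  have "T (T (rho c)) = 0" using arg_cong[OF TP, of T] by (simp add: P_T Zd)
  then have "T (rho c) = 0" using P_plus_T[of "T (rho c)"] by (simp add: P_T Zc)
  moreover from this have "P (rho d) = 0" using TP by simp
  ultimately have "fP c + fM d \<in> I"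
    using z zfun_eq_0 by (intro relator_ideal_closed(2) fP_in_ideal fM_in_ideal) auto
  then show "p \<in> I" using relator_ideal_closed(2)[OF cd] by fastforce
qed (rule ev_ideal)

lemma zfun_dualZ: "zfun c \<in> dualZ"
  using M.subspace_add[OF subspace_inv] M.subspace_scale[OF subspace_inv]
  by (auto simp: dual_space_def zfun_def pairing_linear)

lemma dualZ_closed: "f \<in> dualZ \<Longrightarrow> g \<in> dualZ \<Longrightarrow> f + g \<in> dualZ" "f \<in> dualZ \<Longrightarrow> - f \<in> dualZ"
  "f \<in> dualZ \<Longrightarrow> (\<lambda>X. c * f X) \<in> dualZ" "0 \<in> dualZ"
  by (simp_all add: dual_space_def algebra_simps)

lemma contract_target_carrier:
  "contract tsc c tLP \<in> lie_carrier (target \<D>)" "contract tsc c tLM \<in> lie_carrier (target \<D>)"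
  unfolding contract_tLP contract_tLM
  by (auto simp: lamP_def lamM_def target_simps zero_prod_def zfun_dualZ dualZ_closed intro!: H_closed Z_H)

lemma target_carrier_add: "x \<in> lie_carrier (target \<D>) \<Longrightarrow> y \<in> lie_carrier (target \<D>) \<Longrightarrow> x + y \<in> lie_carrier (target \<D>)"
  by (auto simp: target_simps dualZ_closed H_closed)

lemma target_generated:
  assumes "x \<in> lie_carrier (target \<D>)"
  shows "\<exists>c d. x = contract tsc c tLP + contract tsc d tLM"
proof -
  obtain a h f g where x: "x = ((a, h), f, g)" "h \<in> H" "f \<in> dualZ" "g \<in> dualZ"
    using assms by (auto simp: target_simps)
  define y where "y = \<omega> a"
  \<comment> \<open>Chosen to solve T u - P v = y and - (Z u + Z v)/2 = h. The terms with
    \<open>Z y\<close> repair the Cartan part lost in \<open>T (T y)\<close> and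
    \<open>P (P y)\<close>; the terms - h cancel in the first equation and add up in the
    second.\<close>
  define u where "u = T y + s (1/2) (Z y) - h"
  define v where "v = - P y - s (1/2) (Z y) - h"
  obtain c where c: "rho c = u" "\<forall>X\<in>glinv. pairing c X = f X" using ex_functional[OF x(3)] by blast
  obtain d where d: "rho d = v" "\<forall>X\<in>glinv. pairing d X = (- g) X"
    using ex_functional[OF dualZ_closed(2)[OF x(4)]] by blast
  have z: "zfun c = f" "- zfun d = g"
    using c(2) d(2) x(3,4) by (auto simp: zfun_def dual_space_def fun_eq_iff)
  have TT: "T (T y) = T y - s (1/4) (Z y)" using P_plus_T[of "T y"] by (simp add: P_T eq_diff_eq add.commute)
  have PP: "P (P y) = P y - s (1/4) (Z y)" using P_plus_T[of "P y"] by (simp add: P_T eq_diff_eq)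
  have TH: "T h = s (1/2) h" if "h \<in> H" for h
    using T_W[of h 0] that positive_root_nonzero by (auto simp: P_weight_def W_0 dual_space_zero)
  have "T u = T y - s (1/2) h"
    using TT by (simp add: u_def T_linear TH[OF Z_H] TH[OF x(2)])
  moreover have "P v = - P y - s (1/2) h"
    using PP by (simp add: v_def P_linear P_H[OF Z_H] P_H[OF x(2)])
  ultimately have 1: "\<omega> (T u) - \<omega> (P v) = a"
    using P_plus_T[of y] by (simp add: \<omega>_linear(5)[symmetric] y_def \<omega>_invol add.commute)
  have half: "s (1/2) w + s (1/2) w = w" for w by (simp add: G.scale_left_distrib[symmetric])
  have "Z u = Z y - h" "Z v = - Z y - h"
    using half[of "Z y"] by (simp_all add: u_def v_def Z_linear P_T Z_idem[OF Z_H] Z_idem[OF x(2)] algebra_simps)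
  then have 2: "s (- 1/2) (Z u) + s (- 1/2) (Z v) = h"
    using half[of h] by (simp add: G.scale_right_diff_distrib)
  have "x = contract tsc c tLP + contract tsc d tLM"
    unfolding contract_tLP contract_tLM c(1) d(1) z x(1) lamP_def lamM_def
    using 1 2 by (simp add: zero_prod_def z)
  then show ?thesis by blast
qed

lemma range_ev: "range ev = lie_carrier (target \<D>)"
proof
  show "range ev \<subseteq> lie_carrier (target \<D>)"
  proof
    fix x assume "x \<in> range ev"
    then obtain p where p: "x = ev p" by blast
    obtain c d where cd: "p - (fP c + fM d) \<in> I" using generators_span by blast
    then have "x = contract tsc c tLP + contract tsc d tLM"
      using ev_ideal[OF cd] by (simp add: p ev_linear ev_contract)
    then show "x \<in> lie_carrier (target \<D>)" by (simp add: target_carrier_add contract_target_carrier)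
  qed
  show "lie_carrier (target \<D>) \<subseteq> range ev"
  proof
    fix x assume "x \<in> lie_carrier (target \<D>)"
    then obtain c d where "x = ev (fP c + fM d)"
      using target_generated[of x] by (auto simp: ev_linear ev_contract)
    then show "x \<in> range ev" by blast
  qed
qed

abbreviation "cls \<equiv> pres_class (g_r_relators \<D>)"

lemma g_r_simps:
  "lie_carrier (g_r \<D>) = range cls" "lie_zero (g_r \<D>) = cls 0"
  "lie_add (g_r \<D>) (cls p) (cls q) = cls (p + q)" "lie_scale (g_r \<D>) c (cls p) = cls (free_scale c p)"
  "lie_bracket (g_r \<D>) (cls p) (cls q) = cls (free_mult p q)"
  by (simp_all add: g_r_def presented_lie_simps)

definition Phi :: "'n lgen free_alg set \<Rightarrow> ('g, 'n) target_type" where "Phi A = ev (SOME p. p \<in> A)"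

lemma Phi_cls: "Phi (cls p) = ev p"
proof -
  have "(SOME q. q \<in> cls p) \<in> cls p" using pres_class_self by (rule someI)
  then have "(SOME q. q \<in> cls p) - p \<in> I" by (simp add: pres_class_def)
  then have "ev ((SOME q. q \<in> cls p) - p) = 0" by (rule ev_ideal)
  then show ?thesis by (simp add: Phi_def ev_linear)
qed

lemma Phi_iso: "lie_iso (g_r \<D>) (target \<D>) Phi"
  unfolding lie_iso_def
proof
  show "lie_hom (g_r \<D>) (target \<D>) Phi"
    unfolding lie_hom_def using range_ev
    by (auto simp: g_r_simps Phi_cls ev_linear ev_mult target_simps(3))
  show "bij_betw Phi (lie_carrier (g_r \<D>)) (lie_carrier (target \<D>))"
    unfolding bij_betw_def
  proof
    show "inj_on Phi (lie_carrier (g_r \<D>))"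
    proof (rule inj_onI)
      fix A B assume "A \<in> lie_carrier (g_r \<D>)" "B \<in> lie_carrier (g_r \<D>)" "Phi A = Phi B"
      then obtain p q where "A = cls p" "B = cls q" "ev p = ev q" by (auto simp: g_r_simps Phi_cls)
      moreover from this have "ev (p - q) = 0" by (simp add: ev_linear)
      ultimately show "A = B" by (simp add: ev_eq_0_iff pres_class_eq_iff)
    qed
    show "Phi ` lie_carrier (g_r \<D>) = lie_carrier (target \<D>)"
      unfolding range_ev[symmetric] by (simp add: g_r_simps image_image Phi_cls)
  qed
qed

lemma Phi_generators: "maps_generators \<D> Phi"
  by (simp add: maps_generators_def L_plus_def L_minus_def Phi_cls ev_L)

lemma Phi_unique:
  assumes "lie_hom (g_r \<D>) (target \<D>) \<Psi>" "maps_generators \<D> \<Psi>" "x \<in> lie_carrier (g_r \<D>)"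
  shows "\<Psi> x = Phi x"
proof -
  have hom: "\<Psi> (cls (p + q)) = \<Psi> (cls p) + \<Psi> (cls q)" "\<Psi> (cls (free_scale c p)) = tsc c (\<Psi> (cls p))"
    "\<Psi> (cls (free_mult p q)) = tbr (\<Psi> (cls p)) (\<Psi> (cls q))" for p q c
    using assms(1) unfolding lie_hom_def by (metis g_r_simps rangeI target_simps(3))+
  have zero: "\<Psi> (cls 0) = 0" using hom(2)[of 0 0] by simp
  have "Poly_Mapping.single w 1 \<in> {p. \<Psi> (cls p) = ev p}" for w :: "'n lgen lie_word"
  proof (induction w)
    case (Gen a)
    show ?case
      using assms(2) ev_L
      by (cases a) (simp_all add: maps_generators_def L_plus_def L_minus_def free_L_plus_def free_L_minus_def free_gen_def)
  next
    case (Br u v)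
    then show ?case using hom(3)[of "Poly_Mapping.single u 1" "Poly_Mapping.single v 1"]
        ev_mult[of "Poly_Mapping.single u 1" "Poly_Mapping.single v 1"] by (simp add: free_mult_single)
  qed
  then have "p \<in> {p. \<Psi> (cls p) = ev p}" for p
    by (rule free_alg_subspace_UNIV[rotated]) (auto intro!: Fr.subspaceI simp: hom zero ev_linear)
  then show ?thesis using assms(3) by (auto simp: g_r_simps Phi_cls)
qed

end

section \<open>Tensor squares\<close>

lemma bilinear_form_D:
  assumes "bilinear_form L \<beta>" "x \<in> lie_carrier L" "y \<in> lie_carrier L" "z \<in> lie_carrier L"
  shows "\<beta> (lie_add L x y) z = \<beta> x z + \<beta> y z" "\<beta> z (lie_add L x y) = \<beta> z x + \<beta> z y"
    "\<beta> (lie_scale L c x) z = c * \<beta> x z" "\<beta> z (lie_scale L c x) = c * \<beta> z x"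
  using assms by (auto simp: bilinear_form_def linear_form_def)

lemma bilinear_formI:
  assumes "\<And>x y z. x \<in> lie_carrier L \<Longrightarrow> y \<in> lie_carrier L \<Longrightarrow> z \<in> lie_carrier L \<Longrightarrow>
      \<beta> (lie_add L x y) z = \<beta> x z + \<beta> y z \<and> \<beta> z (lie_add L x y) = \<beta> z x + \<beta> z y"
    and "\<And>c x z. x \<in> lie_carrier L \<Longrightarrow> z \<in> lie_carrier L \<Longrightarrow>
      \<beta> (lie_scale L c x) z = c * \<beta> x z \<and> \<beta> z (lie_scale L c x) = c * \<beta> z x"
  shows "bilinear_form L \<beta>"
  using assms by (auto simp: bilinear_form_def linear_form_def)

lemma trilinear_form_D:
  assumes "trilinear_form L \<gamma>" "x \<in> lie_carrier L" "y \<in> lie_carrier L" "z \<in> lie_carrier L" "w \<in> lie_carrier L"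
  shows "\<gamma> (lie_add L x y) z w = \<gamma> x z w + \<gamma> y z w" "\<gamma> z (lie_add L x y) w = \<gamma> z x w + \<gamma> z y w"
    "\<gamma> z w (lie_add L x y) = \<gamma> z w x + \<gamma> z w y"
    "\<gamma> (lie_scale L c x) z w = c * \<gamma> x z w" "\<gamma> z (lie_scale L c x) w = c * \<gamma> z x w"
    "\<gamma> z w (lie_scale L c x) = c * \<gamma> z w x"
  using assms by (auto simp: trilinear_form_def linear_form_def)

lemma trilinear_form_rotate: "trilinear_form L (\<lambda>a b c. \<gamma> b c a) \<longleftrightarrow> trilinear_form L \<gamma>"
  unfolding trilinear_form_def by blast

lemma trilinear_form_rotate': "trilinear_form L (\<lambda>a b c. \<gamma> c a b) \<longleftrightarrow> trilinear_form L \<gamma>"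
  unfolding trilinear_form_def by blast

lemma bilinear_form_zero: "bilinear_form L (\<lambda>_ _. 0)"
  by (simp add: bilinear_form_def linear_form_def)

lemma bilinear_form_flip: "bilinear_form L (\<lambda>a b. \<beta> b a) \<longleftrightarrow> bilinear_form L \<beta>"
  unfolding bilinear_form_def by blast

lemma bilinear_form_slice: "trilinear_form L \<gamma> \<Longrightarrow> c \<in> lie_carrier L \<Longrightarrow> bilinear_form L (\<lambda>a b. \<gamma> a b c)"
  unfolding trilinear_form_def bilinear_form_def by blast

lemma bilinear_form_lincomb:
  "bilinear_form L \<beta> \<Longrightarrow> bilinear_form L \<beta>' \<Longrightarrow> bilinear_form L (\<lambda>a b. p * \<beta> a b + q * \<beta>' a b)"
  by (auto simp: bilinear_form_def linear_form_def algebra_simps)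

lemma tens_apply: "tens L x y \<beta> = (if bilinear_form L \<beta> then \<beta> x y else 0)"
  by (simp add: tens_def)

lemma tensor_square_cases:
  assumes "T \<in> tensor_square L"
  obtains n :: nat and x y where "\<And>k. k < n \<Longrightarrow> x k \<in> lie_carrier L" "\<And>k. k < n \<Longrightarrow> y k \<in> lie_carrier L"
    "\<And>\<beta>. T \<beta> = (if bilinear_form L \<beta> then (\<Sum>k<n. \<beta> (x k) (y k)) else 0)"
proof -
  obtain n x y where T: "T = (\<Sum>k<(n::nat). tens L (x k) (y k))"
    "\<forall>k<n. x k \<in> lie_carrier L \<and> y k \<in> lie_carrier L"
    using assms by (auto simp: tensor_square_def)
  show ?thesis using T(2) by (intro that[where n = n and x = x and y = y]) (auto simp: T(1) sum_fun_apply tens_apply)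
qed

lemma tensor_squareI:
  "T = (\<Sum>k<(n::nat). tens L (x k) (y k)) \<Longrightarrow> \<forall>k<n. x k \<in> lie_carrier L \<and> y k \<in> lie_carrier L \<Longrightarrow> T \<in> tensor_square L"
  unfolding tensor_square_def by blast

lemma tensor_square_tens: "x \<in> lie_carrier L \<Longrightarrow> y \<in> lie_carrier L \<Longrightarrow> tens L x y \<in> tensor_square L"
  unfolding tensor_square_def by (intro CollectI exI[of _ "1::nat"] exI[of _ "\<lambda>_. x"] exI[of _ "\<lambda>_. y"]) simp

lemma tensor_square_zero: "0 \<in> tensor_square L"
  unfolding tensor_square_def by (intro CollectI exI[of _ "0::nat"]) simp

lemma tensor_square_add:
  assumes "S \<in> tensor_square L" "T \<in> tensor_square L"
  shows "S + T \<in> tensor_square L"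
proof -
  obtain m x y where S: "S = (\<Sum>k<(m::nat). tens L (x k) (y k))"
    "\<forall>k<m. x k \<in> lie_carrier L \<and> y k \<in> lie_carrier L"
    using assms(1) by (auto simp: tensor_square_def)
  obtain n x' y' where T: "T = (\<Sum>k<(n::nat). tens L (x' k) (y' k))"
    "\<forall>k<n. x' k \<in> lie_carrier L \<and> y' k \<in> lie_carrier L"
    using assms(2) by (auto simp: tensor_square_def)
  define X where "X = (\<lambda>k. if k < m then x k else x' (k - m))"
  define Y where "Y = (\<lambda>k. if k < m then y k else y' (k - m))"
  have "(\<Sum>k<m + n. tens L (X k) (Y k)) = S + T"
  proof -
    have "(\<Sum>k<m + n. tens L (X k) (Y k)) = (\<Sum>k<m. tens L (X k) (Y k)) + (\<Sum>k<n. tens L (X (m + k)) (Y (m + k)))"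
      by (induction n) (simp_all add: add.assoc)
    then show ?thesis by (simp add: S T X_def Y_def)
  qed
  moreover have "\<forall>k<m + n. X k \<in> lie_carrier L \<and> Y k \<in> lie_carrier L"
    using S(2) T(2) by (auto simp: X_def Y_def)
  ultimately show ?thesis by (intro tensor_squareI[OF sym])
qed

lemma tensor_square_scale:
  assumes "\<And>c x. x \<in> lie_carrier L \<Longrightarrow> lie_scale L c x \<in> lie_carrier L" "T \<in> tensor_square L"
  shows "(\<lambda>\<beta>. c * T \<beta>) \<in> tensor_square L"
proof -
  obtain n x y where T: "T = (\<Sum>k<(n::nat). tens L (x k) (y k))"
    "\<forall>k<n. x k \<in> lie_carrier L \<and> y k \<in> lie_carrier L"
    using assms(2) by (auto simp: tensor_square_def)
  have "(\<lambda>\<beta>. c * T \<beta>) = (\<Sum>k<n. tens L (lie_scale L c (x k)) (y k))"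
    using T by (auto simp: fun_eq_iff sum_fun_apply tens_apply sum_distrib_left bilinear_form_D(3) intro!: sum.cong)
  then show ?thesis using T(2) assms(1) by (intro tensor_squareI[where n = n and x = "\<lambda>k. lie_scale L c (x k)" and y = y]) auto
qed

lemma tensor_square_diff:
  assumes "\<And>c x. x \<in> lie_carrier L \<Longrightarrow> lie_scale L c x \<in> lie_carrier L" "S \<in> tensor_square L" "T \<in> tensor_square L"
  shows "S - T \<in> tensor_square L"
proof -
  have e: "S - T = S + (\<lambda>\<beta>. (- 1) * T \<beta>)" by (simp add: fun_eq_iff)
  show ?thesis unfolding e by (rule tensor_square_add[OF assms(2) tensor_square_scale[OF assms(1,3)]])
qed

lemma tensor_square_sum: "(\<And>k. k \<in> A \<Longrightarrow> T k \<in> tensor_square L) \<Longrightarrow> (\<Sum>k\<in>A. T k) \<in> tensor_square L"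
  by (induction A rule: infinite_finite_induct) (simp_all add: tensor_square_zero tensor_square_add)

lemma tensor_square_not_bilinear: "T \<in> tensor_square L \<Longrightarrow> \<not> bilinear_form L \<beta> \<Longrightarrow> T \<beta> = 0"
  by (erule tensor_square_cases) simp

text \<open>Forms are total functions and may differ outside the carrier. Tensors do not see this,
  since bilinearity is also a condition on the carrier only.\<close>

lemma tensor_square_cong:
  assumes "T \<in> tensor_square L" "bilinear_form L \<beta>"
    and "\<And>x y. x \<in> lie_carrier L \<Longrightarrow> y \<in> lie_carrier L \<Longrightarrow> \<beta> x y = \<beta>' x y"
    and "\<And>x y. x \<in> lie_carrier L \<Longrightarrow> y \<in> lie_carrier L \<Longrightarrow> lie_add L x y \<in> lie_carrier L"
    and "\<And>c x. x \<in> lie_carrier L \<Longrightarrow> lie_scale L c x \<in> lie_carrier L"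
  shows "T \<beta> = T \<beta>'"
proof -
  have \<beta>': "bilinear_form L \<beta>'"
  proof (rule bilinear_formI; intro conjI)
    fix x y z c assume c: "x \<in> lie_carrier L" "z \<in> lie_carrier L"
    note b = bilinear_form_D[OF assms(2) c(1) _ c(2)]
    show "\<beta>' (lie_scale L c x) z = c * \<beta>' x z" "\<beta>' z (lie_scale L c x) = c * \<beta>' z x"
      using b(3,4)[OF c(1)] assms(3)[OF assms(5)[OF c(1)] c(2)] assms(3)[OF c(2) assms(5)[OF c(1)]]
        assms(3)[OF c] assms(3)[OF c(2,1)] by simp_all
    assume y: "y \<in> lie_carrier L"
    show "\<beta>' (lie_add L x y) z = \<beta>' x z + \<beta>' y z" "\<beta>' z (lie_add L x y) = \<beta>' z x + \<beta>' z y"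
      using b(1,2)[OF y] assms(3)[OF assms(4)[OF c(1) y] c(2)] assms(3)[OF c(2) assms(4)[OF c(1) y]]
        assms(3)[OF c] assms(3)[OF c(2,1)] assms(3)[OF y c(2)] assms(3)[OF c(2) y] by simp_all
  qed
  obtain n x y where T: "\<And>k. k < n \<Longrightarrow> x k \<in> lie_carrier L" "\<And>k. k < n \<Longrightarrow> y k \<in> lie_carrier L"
    "\<And>\<beta>. T \<beta> = (if bilinear_form L \<beta> then (\<Sum>k<(n::nat). \<beta> (x k) (y k)) else 0)"
    using tensor_square_cases[OF assms(1)] by blast
  have "T \<beta> = (\<Sum>k<n. \<beta> (x k) (y k))" using T(3)[of \<beta>] assms(2) by simp
  also have "\<dots> = (\<Sum>k<n. \<beta>' (x k) (y k))" using T(1,2) assms(3) by (intro sum.cong) auto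
  also have "\<dots> = T \<beta>'" using T(3)[of \<beta>'] \<beta>' by simp
  finally show ?thesis .
qed

lemma tensor_square_lincomb:
  assumes "T \<in> tensor_square L" "bilinear_form L \<beta>" "bilinear_form L \<beta>'"
  shows "T (\<lambda>a b. p * \<beta> a b + q * \<beta>' a b) = p * T \<beta> + q * T \<beta>'"
proof -
  obtain n x y where "\<And>k. k < n \<Longrightarrow> x k \<in> lie_carrier L" "\<And>k. k < n \<Longrightarrow> y k \<in> lie_carrier L"
    and T: "\<And>\<beta>. T \<beta> = (if bilinear_form L \<beta> then (\<Sum>k<(n::nat). \<beta> (x k) (y k)) else 0)"
    using tensor_square_cases[OF assms(1)] by blast
  have "T (\<lambda>a b. p * \<beta> a b + q * \<beta>' a b) = (\<Sum>k<n. p * \<beta> (x k) (y k) + q * \<beta>' (x k) (y k))"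
    by (simp only: T bilinear_form_lincomb[OF assms(2,3)] if_True)
  also have "\<dots> = p * (\<Sum>k<n. \<beta> (x k) (y k)) + q * (\<Sum>k<n. \<beta>' (x k) (y k))"
    by (simp only: sum.distrib sum_distrib_left)
  also have "\<dots> = p * T \<beta> + q * T \<beta>'" by (simp only: T assms(2,3) if_True)
  finally show ?thesis .
qed

lemma tensor_square_vanish:
  assumes "T \<in> tensor_square L" "\<And>x y. x \<in> lie_carrier L \<Longrightarrow> y \<in> lie_carrier L \<Longrightarrow> \<beta> x y = 0"
  shows "T \<beta> = 0"
proof -
  obtain n x y where "\<And>k. k < n \<Longrightarrow> x k \<in> lie_carrier L" "\<And>k. k < n \<Longrightarrow> y k \<in> lie_carrier L"
    "\<And>\<beta>. T \<beta> = (if bilinear_form L \<beta> then (\<Sum>k<(n::nat). \<beta> (x k) (y k)) else 0)"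
    using tensor_square_cases[OF assms(1)] by blast
  then show ?thesis using assms(2) by simp
qed

lemma tensor_square_zero_form:
  assumes "T \<in> tensor_square L"
  shows "T (\<lambda>_ _. 0) = 0"
  by (rule tensor_square_vanish[OF assms refl])

lemma tensor_square_form_sum:
  assumes "T \<in> tensor_square L" "\<And>k. k \<in> A \<Longrightarrow> bilinear_form L (\<beta> k)"
  shows "bilinear_form L (\<lambda>a b. \<Sum>k\<in>A. c k * \<beta> k a b) \<and> T (\<lambda>a b. \<Sum>k\<in>A. c k * \<beta> k a b) = (\<Sum>k\<in>A. c k * T (\<beta> k))"
  using assms(2)
proof (induction A rule: infinite_finite_induct)
  case (insert k A)
  then show ?case
    using bilinear_form_lincomb[of L "\<beta> k" "\<lambda>a b. \<Sum>k\<in>A. c k * \<beta> k a b" "c k" 1]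
      tensor_square_lincomb[OF assms(1), of "\<beta> k" "\<lambda>a b. \<Sum>k\<in>A. c k * \<beta> k a b" "c k" 1] by simp
qed (simp_all add: bilinear_form_zero tensor_square_zero_form[OF assms(1)])

text \<open>On the carrier every bilinear form agrees with a combination of products of the
  coordinate functionals \<open>\<phi>\<close>, so a tensor is determined by its values on these
  products. The vectors \<open>e\<close> need only span.\<close>

lemma tensor_square_eqI:
  fixes L :: "'a::ab_group_add lie_struct"
  assumes "S \<in> tensor_square L" "T \<in> tensor_square L"
    and add: "lie_add L = (+)" and closed: "0 \<in> lie_carrier L"
      "\<And>x y. x \<in> lie_carrier L \<Longrightarrow> y \<in> lie_carrier L \<Longrightarrow> x + y \<in> lie_carrier L"
      "\<And>c x. x \<in> lie_carrier L \<Longrightarrow> lie_scale L c x \<in> lie_carrier L"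
    and "finite A" and e: "\<And>k. k \<in> A \<Longrightarrow> e k \<in> lie_carrier L"
    and \<phi>: "\<And>k. k \<in> A \<Longrightarrow> linear_form L (\<phi> k)"
    and expand: "\<And>x. x \<in> lie_carrier L \<Longrightarrow> x = (\<Sum>k\<in>A. lie_scale L (\<phi> k x) (e k))"
    and eq: "\<And>k l. k \<in> A \<Longrightarrow> l \<in> A \<Longrightarrow> S (\<lambda>a b. \<phi> k a * \<phi> l b) = T (\<lambda>a b. \<phi> k a * \<phi> l b)"
  shows "S = T"
proof
  fix \<beta>
  show "S \<beta> = T \<beta>"
  proof (cases "bilinear_form L \<beta>")
    case True
    have bil: "bilinear_form L (\<lambda>a b. \<phi> k a * \<phi> l b)" if "k \<in> A" "l \<in> A" for k l
      using \<phi>[OF that(1)] \<phi>[OF that(2)] by (auto simp: bilinear_form_def linear_form_def algebra_simps)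
    have z: "\<beta> 0 x = 0" "\<beta> x 0 = 0" if "x \<in> lie_carrier L" for x
      using bilinear_form_D(1,2)[OF True closed(1) closed(1) that] by (simp_all add: add)
    have s1: "(\<Sum>k\<in>B. lie_scale L (c k) (e k)) \<in> lie_carrier L" if "B \<subseteq> A" for B c
      using that closed e by (induction B rule: infinite_finite_induct) auto
    have s2: "\<beta> (\<Sum>k\<in>B. lie_scale L (c k) (e k)) y = (\<Sum>k\<in>B. c k * \<beta> (e k) y)"
      if "y \<in> lie_carrier L" "B \<subseteq> A" for B c y
      using finite_subset[OF that(2) \<open>finite A\<close>] that(2)
    proof (induction B rule: finite_induct)
      case (insert k B)
      then have "lie_scale L (c k) (e k) \<in> lie_carrier L" "(\<Sum>k\<in>B. lie_scale L (c k) (e k)) \<in> lie_carrier L" "e k \<in> lie_carrier L"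
        using s1[of B] closed(3) e by auto
      then show ?case
        using insert bilinear_form_D(1)[OF True _ _ that(1)] bilinear_form_D(3)[OF True _ that(1) that(1)] by (simp add: add)
    qed (use z that in simp)
    have s3: "\<beta> y (\<Sum>k\<in>B. lie_scale L (c k) (e k)) = (\<Sum>k\<in>B. c k * \<beta> y (e k))"
      if "y \<in> lie_carrier L" "B \<subseteq> A" for B c y
      using finite_subset[OF that(2) \<open>finite A\<close>] that(2)
    proof (induction B rule: finite_induct)
      case (insert k B)
      then have "lie_scale L (c k) (e k) \<in> lie_carrier L" "(\<Sum>k\<in>B. lie_scale L (c k) (e k)) \<in> lie_carrier L" "e k \<in> lie_carrier L"
        using s1[of B] closed(3) e by auto
      then show ?case
        using insert bilinear_form_D(2)[OF True _ _ that(1)] bilinear_form_D(4)[OF True _ that(1) that(1)] by (simp add: add)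
    qed (use z that in simp)
    define \<beta>' where "\<beta>' = (\<lambda>a b. \<Sum>kl\<in>A \<times> A. \<beta> (e (fst kl)) (e (snd kl)) * (\<phi> (fst kl) a * \<phi> (snd kl) b))"
    have agree: "\<beta> a b = \<beta>' a b" if "a \<in> lie_carrier L" "b \<in> lie_carrier L" for a b
    proof -
      have "\<beta> a b = (\<Sum>k\<in>A. \<phi> k a * \<beta> (e k) b)"
        using s2[OF that(2) order_refl, of "\<lambda>k. \<phi> k a"] expand[OF that(1)] by simp
      also have "\<dots> = (\<Sum>k\<in>A. \<phi> k a * (\<Sum>l\<in>A. \<phi> l b * \<beta> (e k) (e l)))"
        using s3[OF e order_refl, of _ "\<lambda>l. \<phi> l b"] expand[OF that(2)] by (intro sum.cong) auto
      finally show ?thesis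
        by (simp add: \<beta>'_def sum_distrib_left sum.cartesian_product case_prod_unfold algebra_simps)
    qed
    have val: "R \<beta> = (\<Sum>kl\<in>A \<times> A. \<beta> (e (fst kl)) (e (snd kl)) * R (\<lambda>a b. \<phi> (fst kl) a * \<phi> (snd kl) b))"
      if R: "R \<in> tensor_square L" for R
    proof -
      have "R \<beta> = R \<beta>'" by (rule tensor_square_cong[OF R True agree]) (simp_all add: add closed)
      also have "\<dots> = (\<Sum>kl\<in>A \<times> A. \<beta> (e (fst kl)) (e (snd kl)) * R (\<lambda>a b. \<phi> (fst kl) a * \<phi> (snd kl) b))"
        unfolding \<beta>'_def
        using tensor_square_form_sum[OF R, of "A \<times> A" "\<lambda>kl a b. \<phi> (fst kl) a * \<phi> (snd kl) b"
            "\<lambda>kl. \<beta> (e (fst kl)) (e (snd kl))"] bil by auto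
      finally show ?thesis .
    qed
    show ?thesis unfolding val[OF assms(1)] val[OF assms(2)] using eq by (intro sum.cong) auto
  qed (simp add: tensor_square_not_bilinear[OF assms(1)] tensor_square_not_bilinear[OF assms(2)])
qed

section \<open>Transport of tensors along linear maps of carriers\<close>

definition linear_between :: "'a lie_struct \<Rightarrow> 'b lie_struct \<Rightarrow> ('a \<Rightarrow> 'b) \<Rightarrow> bool" where
  "linear_between L M f \<longleftrightarrow> (\<forall>x\<in>lie_carrier L. f x \<in> lie_carrier M) \<and>
     (\<forall>x\<in>lie_carrier L. \<forall>y\<in>lie_carrier L. f (lie_add L x y) = lie_add M (f x) (f y)) \<and>
     (\<forall>c. \<forall>x\<in>lie_carrier L. f (lie_scale L c x) = lie_scale M c (f x))"

lemma linear_between_hom: "lie_hom L M f \<Longrightarrow> linear_between L M f"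
  by (auto simp: lie_hom_def linear_between_def)

lemma bilinear_form_pullback:
  "linear_between L M f \<Longrightarrow> bilinear_form M \<beta> \<Longrightarrow> bilinear_form L (\<lambda>a b. \<beta> (f a) (f b))"
  unfolding linear_between_def bilinear_form_def linear_form_def by auto

lemma tensor_map_apply:
  assumes "T \<in> tensor_square L"
  shows "tensor_map M f T \<beta> = (if bilinear_form M \<beta> then T (\<lambda>a b. \<beta> (f a) (f b)) else 0)"
  using tensor_square_zero_form[OF assms] by (simp add: tensor_map_def tlift_def tens_apply)

lemma tensor_map_tensor_square:
  assumes f: "linear_between L M f" and "T \<in> tensor_square L"
  shows "tensor_map M f T \<in> tensor_square M"
proof -
  obtain n x y where T: "\<And>k. k < n \<Longrightarrow> x k \<in> lie_carrier L" "\<And>k. k < n \<Longrightarrow> y k \<in> lie_carrier L"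
    "\<And>\<beta>. T \<beta> = (if bilinear_form L \<beta> then (\<Sum>k<(n::nat). \<beta> (x k) (y k)) else 0)"
    using tensor_square_cases[OF assms(2)] by blast
  have "tensor_map M f T = (\<Sum>k<n. tens M (f (x k)) (f (y k)))"
    using bilinear_form_pullback[OF f]
    by (auto simp: fun_eq_iff tensor_map_apply[OF assms(2)] T(3) sum_fun_apply tens_apply)
  moreover have "\<forall>k<n. f (x k) \<in> lie_carrier M \<and> f (y k) \<in> lie_carrier M"
    using T(1,2) f by (auto simp: linear_between_def)
  ultimately show ?thesis by (rule tensor_squareI)
qed

lemma leg_commutator_apply:
  "leg_commutator L X i k \<beta> = (if bilinear_form L \<beta> then (\<Sum>j\<in>UNIV. \<beta> (X i j) (X j k) - \<beta> (X j k) (X i j)) else 0)"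
  by (simp add: leg_commutator_def sum_fun_apply tens_apply)

lemma leg_commutator_tensor_square:
  assumes "\<And>c x. x \<in> lie_carrier L \<Longrightarrow> lie_scale L c x \<in> lie_carrier L" "\<And>i j. X i j \<in> lie_carrier L"
  shows "leg_commutator L X i k \<in> tensor_square L"
  unfolding leg_commutator_def
  by (intro tensor_square_sum tensor_square_diff tensor_square_tens assms)

lemma linear_form_sum:
  assumes "linear_form L \<phi>" and add: "lie_add L = (+)" and "0 \<in> lie_carrier L"
    and "\<And>x y. x \<in> lie_carrier L \<Longrightarrow> y \<in> lie_carrier L \<Longrightarrow> x + y \<in> lie_carrier L"
    and "\<And>c x. x \<in> lie_carrier L \<Longrightarrow> lie_scale L c x \<in> lie_carrier L"
    and e: "\<And>k. k \<in> A \<Longrightarrow> e k \<in> lie_carrier L"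
  shows "\<phi> (\<Sum>k\<in>A. lie_scale L (c k) (e k)) = (\<Sum>k\<in>A. c k * \<phi> (e k))"
proof -
  have lin: "x \<in> lie_carrier L \<Longrightarrow> y \<in> lie_carrier L \<Longrightarrow> \<phi> (x + y) = \<phi> x + \<phi> y"
    "x \<in> lie_carrier L \<Longrightarrow> \<phi> (lie_scale L a x) = a * \<phi> x" for x y a
    using assms(1) by (simp_all add: linear_form_def add)
  have "\<phi> 0 = 0" using lin(1)[OF assms(3,3)] by simp
  then have "(\<Sum>k\<in>A. lie_scale L (c k) (e k)) \<in> lie_carrier L \<and>
      \<phi> (\<Sum>k\<in>A. lie_scale L (c k) (e k)) = (\<Sum>k\<in>A. c k * \<phi> (e k))"
    using e by (induction A rule: infinite_finite_induct) (simp_all add: assms(3-5) lin)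
  then show ?thesis by blast
qed

section \<open>The cobracket of the double\<close>

context rmatrix
begin

abbreviation "dc \<equiv> double_cobracket \<D>"
abbreviation "zc \<equiv> zV_cobracket \<D>"
abbreviation "tcb \<equiv> target_cobracket \<D>"

lemma double_closed: "0 \<in> lie_carrier (double \<D>)"
  "x \<in> lie_carrier (double \<D>) \<Longrightarrow> y \<in> lie_carrier (double \<D>) \<Longrightarrow> x + y \<in> lie_carrier (double \<D>)"
  "x \<in> lie_carrier (double \<D>) \<Longrightarrow> dsc c x \<in> lie_carrier (double \<D>)"
  by (auto simp: double_simps zero_prod_def intro: H_closed)

lemma zV_closed: "0 \<in> lie_carrier (zV \<D>)"
  "f \<in> lie_carrier (zV \<D>) \<Longrightarrow> g \<in> lie_carrier (zV \<D>) \<Longrightarrow> f + g \<in> lie_carrier (zV \<D>)"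
  "f \<in> lie_carrier (zV \<D>) \<Longrightarrow> zsc c f \<in> lie_carrier (zV \<D>)"
  by (auto simp: zV_simps dualZ_closed)

lemma target_closed: "0 \<in> lie_carrier (target \<D>)"
  "x \<in> lie_carrier (target \<D>) \<Longrightarrow> y \<in> lie_carrier (target \<D>) \<Longrightarrow> x + y \<in> lie_carrier (target \<D>)"
  "x \<in> lie_carrier (target \<D>) \<Longrightarrow> tsc c x \<in> lie_carrier (target \<D>)"
  by (auto simp: target_simps double_simps zV_simps zero_prod_def dualZ_closed intro: H_closed)

lemma double_bracket: "lie_bracket (double \<D>) l d = (br (fst l) (fst d), 0)"
  by (cases l; cases d) (simp add: double_simps)

lemma rD_mem: "rD_left k \<in> lie_carrier (double \<D>)" "rD_right k \<in> lie_carrier (double \<D>)"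
  using rD_carrier by (simp_all add: double_simps)

lemma double_bracket_mem: "lie_bracket (double \<D>) l d \<in> lie_carrier (double \<D>)"
  by (simp add: double_bracket double_simps H_closed)

lemma double_bracket_linear:
  "lie_bracket (double \<D>) l (x + y) = lie_bracket (double \<D>) l x + lie_bracket (double \<D>) l y"
  "lie_bracket (double \<D>) (x + y) l = lie_bracket (double \<D>) x l + lie_bracket (double \<D>) y l"
  "lie_bracket (double \<D>) l (dsc c x) = dsc c (lie_bracket (double \<D>) l x)"
  "lie_bracket (double \<D>) (dsc c x) l = dsc c (lie_bracket (double \<D>) x l)"
  by (cases x; cases y; simp add: double_bracket double_simps br_linear)+

lemma bilinear_form_ad:
  assumes "bilinear_form (double \<D>) \<beta>"
  shows "bilinear_form (double \<D>) (\<lambda>a b. \<beta> (lie_bracket (double \<D>) l a) b + \<beta> a (lie_bracket (double \<D>) l b))"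
  using bilinear_form_D[OF assms] double_bracket_mem
  by (intro bilinear_formI) (simp_all add: double_simps(3) double_bracket_linear algebra_simps)

lemma dc_apply:
  "dc l \<beta> = (if bilinear_form (double \<D>) \<beta> then
     (\<Sum>k\<in>r_index. \<beta> (lie_bracket (double \<D>) l (rD_left k)) (rD_right k) + \<beta> (rD_left k) (lie_bracket (double \<D>) l (rD_right k))) else 0)"
  using bilinear_form_ad[of \<beta> l]
  by (simp add: double_cobracket_def adjoint2_def tlift_def rD_sum_eq sum_fun_apply tens_apply bilinear_form_zero)

lemma dc_tensor_square: "dc l \<in> tensor_square (double \<D>)"
proof -
  have "dc l = (\<Sum>k\<in>r_index. tens (double \<D>) (lie_bracket (double \<D>) l (rD_left k)) (rD_right k) +
      tens (double \<D>) (rD_left k) (lie_bracket (double \<D>) l (rD_right k)))"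
    by (auto simp: fun_eq_iff dc_apply sum_fun_apply tens_apply)
  then show ?thesis
    by (auto intro!: tensor_square_sum tensor_square_add tensor_square_tens rD_mem double_bracket_mem)
qed

text \<open>The linear form \<open>\<langle>(x, h), \<cdot>\<rangle>\<close> for the invariant form \<open>\<langle>(x, h), (y, k)\<rangle> = (x, y) - (h, k)\<close> on the double.\<close>

definition dform :: "'g \<Rightarrow> 'g \<Rightarrow> 'g \<times> 'g \<Rightarrow> complex" where
  "dform x h = (\<lambda>d. F x (fst d) - F h (snd d))"

lemma dform_linear: "dform x h (d + e) = dform x h d + dform x h e" "dform x h (dsc c d) = c * dform x h d"
  "dform x h 0 = 0" "dform x h (sum g A) = (\<Sum>a\<in>A. dform x h (g a))"
proof -
  show add: "dform x h (d + e) = dform x h d + dform x h e" for d e by (simp add: dform_def F_linear)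
  show "dform x h (dsc c d) = c * dform x h d" by (cases d) (simp add: dform_def F_linear double_simps algebra_simps)
  show z: "dform x h 0 = 0" by (simp add: dform_def F_linear)
  show "dform x h (sum g A) = (\<Sum>a\<in>A. dform x h (g a))"
    by (induction A rule: infinite_finite_induct) (simp_all add: add z)
qed

lemma double_tensor_eqI:
  assumes "S \<in> tensor_square (double \<D>)" "T' \<in> tensor_square (double \<D>)"
    and eq: "\<And>x h y k. h \<in> H \<Longrightarrow> k \<in> H \<Longrightarrow> S (\<lambda>a b. dform x h a * dform y k b) = T' (\<lambda>a b. dform x h a * dform y k b)"
  shows "S = T'"
proof -
  \<comment> \<open>Coordinates from the completeness of the Casimir families and from
    \<open>H_expand\<close>. The minus sign before \<open>hv i\<close> undoes the one in
    \<open>dform\<close>; the Casimir families list Cartan directions twice, which an expansion may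
    do.\<close>
  define \<phi> where "\<phi> = case_sum (\<lambda>k. dform (casimir_left k) 0) (\<lambda>i. dform 0 (- hv i))"
  define e where "e = case_sum (\<lambda>k. (casimir_right k, 0)) (\<lambda>i. (0, fund i))"
  let ?A = "casimir_index <+> (UNIV :: 'i set)"
  have fin: "finite casimir_index" by (simp add: casimir_index_def r_index_def finite_positive)
  show ?thesis
  proof (rule tensor_square_eqI[where A = ?A and \<phi> = \<phi> and e = e, OF assms(1,2)])
    show "e k \<in> lie_carrier (double \<D>)" if "k \<in> ?A" for k
      by (cases k) (auto simp: e_def double_simps fund_coweight H_closed)
    show "linear_form (double \<D>) (\<phi> k)" if "k \<in> ?A" for k
      by (cases k) (simp_all add: \<phi>_def linear_form_def double_simps(3) dform_linear)
    show "S (\<lambda>a b. \<phi> k a * \<phi> l b) = T' (\<lambda>a b. \<phi> k a * \<phi> l b)" if "k \<in> ?A" "l \<in> ?A" for k l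
      by (cases k; cases l) (simp_all add: \<phi>_def eq H_closed hvec)
    fix d assume "d \<in> lie_carrier (double \<D>)"
    then obtain x m where d: "d = (x, m)" "m \<in> H" by (auto simp: double_simps)
    have "(\<Sum>k\<in>?A. dsc (\<phi> k d) (e k)) = (\<Sum>k\<in>casimir_index. dsc (\<phi> (Inl k) d) (e (Inl k))) + (\<Sum>i\<in>UNIV. dsc (\<phi> (Inr i) d) (e (Inr i)))"
      using fin by (simp add: sum.Plus)
    also have "\<dots> = (\<Sum>k\<in>casimir_index. (s (F x (casimir_left k)) (casimir_right k), 0)) + (\<Sum>i\<in>UNIV. (0, s (F m (hv i)) (fund i)))"
      by (simp add: \<phi>_def e_def dform_def d double_simps F_linear F_sym[of _ x] F_sym[of _ m])
    also have "\<dots> = d"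
      using complete[of x] H_expand[OF d(2)] by (simp add: prod_eq_iff fst_sum snd_sum d(1))
    finally show "d = (\<Sum>k\<in>?A. dsc (\<phi> k d) (e k))" by simp
  qed (use fin in \<open>simp_all add: double_simps(3) double_closed\<close>)
qed

lemma sum_cartan_rD_right: "k \<in> H \<Longrightarrow> (\<Sum>\<kappa>\<in>r_index. s (F k (snd (rD_right \<kappa>))) (r_left \<kappa>)) = s (- 1/2) k"
proof -
  assume k: "k \<in> H"
  have "(\<Sum>\<kappa>\<in>r_index. s (F k (snd (rD_right \<kappa>))) (r_left \<kappa>)) = s (- 1/2) (\<Sum>i\<in>UNIV. s (F k (hv i)) (fund i))"
    by (simp add: sum_r_index rD_right_def r_left_def F_linear G.scale_sum_right sum_negf mult.commute)
  then show ?thesis by (simp only: H_expand[OF k])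
qed

lemma sum_cartan_rD_left: "h \<in> H \<Longrightarrow> (\<Sum>\<kappa>\<in>r_index. s (F h (snd (rD_left \<kappa>))) (r_right \<kappa>)) = s (1/2) h"
proof -
  assume h: "h \<in> H"
  have "(\<Sum>\<kappa>\<in>r_index. s (F h (snd (rD_left \<kappa>))) (r_right \<kappa>)) = s (1/2) (\<Sum>i\<in>UNIV. s (F h (fund i)) (hv i))"
    by (simp add: sum_r_index rD_left_def r_right_def F_linear G.scale_sum_right)
  then show ?thesis by (simp only: H_expand'[OF h])
qed

lemma bilinear_dform: "bilinear_form (double \<D>) (\<lambda>a b. dform x h a * dform y k b)"
  by (intro bilinear_formI) (simp_all add: double_simps(3) dform_linear algebra_simps)

text \<open>Contracting the right leg of the r-matrix of the double with \<open>dform y k\<close>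
  leaves \<open>P y + s (1/2) k\<close>, and contracting the left leg with \<open>dform x h\<close>
  leaves \<open>T x - s (1/2) h\<close>. Invariance of the form then isolates
  \<open>fst l\<close>.\<close>

lemma dc_dform:
  assumes "h \<in> H" "k \<in> H"
  shows "dc l (\<lambda>a b. dform x h a * dform y k b) =
    F (fst l) (br (P y + s (1/2) k) x + br (T x - s (1/2) h) y)"
proof -
  let ?a = "fst l"
  have 1: "(\<Sum>\<kappa>\<in>r_index. F x (br ?a (r_left \<kappa>)) * (F y (r_right \<kappa>) - F k (snd (rD_right \<kappa>)))) = F ?a (br (P y + s (1/2) k) x)"
  proof -
    have "(\<Sum>\<kappa>\<in>r_index. F x (br ?a (r_left \<kappa>)) * (F y (r_right \<kappa>) - F k (snd (rD_right \<kappa>)))) =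
        F x (br ?a ((\<Sum>\<kappa>\<in>r_index. s (F y (r_right \<kappa>)) (r_left \<kappa>)) - (\<Sum>\<kappa>\<in>r_index. s (F k (snd (rD_right \<kappa>))) (r_left \<kappa>))))"
      by (simp add: br_linear F_linear sum_subtractf algebra_simps)
    also have "\<dots> = F x (br ?a (P y + s (1/2) k))"
      by (simp add: sum_cartan_rD_right[OF assms(2)] P_def[symmetric])
    finally show ?thesis by (simp only: F_sym[of x] F_inv)
  qed
  have 2: "(\<Sum>\<kappa>\<in>r_index. (F x (r_left \<kappa>) - F h (snd (rD_left \<kappa>))) * F y (br ?a (r_right \<kappa>))) = F ?a (br (T x - s (1/2) h) y)"
  proof -
    have "(\<Sum>\<kappa>\<in>r_index. (F x (r_left \<kappa>) - F h (snd (rD_left \<kappa>))) * F y (br ?a (r_right \<kappa>))) =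
        F y (br ?a ((\<Sum>\<kappa>\<in>r_index. s (F x (r_left \<kappa>)) (r_right \<kappa>)) - (\<Sum>\<kappa>\<in>r_index. s (F h (snd (rD_left \<kappa>))) (r_right \<kappa>))))"
      by (simp add: br_linear F_linear sum_subtractf algebra_simps)
    also have "\<dots> = F y (br ?a (T x - s (1/2) h))"
      by (simp add: sum_cartan_rD_left[OF assms(1)] T_def[symmetric])
    finally show ?thesis by (simp only: F_sym[of y] F_inv)
  qed
  have "dc l (\<lambda>a b. dform x h a * dform y k b) =
      (\<Sum>\<kappa>\<in>r_index. F x (br ?a (r_left \<kappa>)) * (F y (r_right \<kappa>) - F k (snd (rD_right \<kappa>)))) +
      (\<Sum>\<kappa>\<in>r_index. (F x (r_left \<kappa>) - F h (snd (rD_left \<kappa>))) * F y (br ?a (r_right \<kappa>)))"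
    by (simp only: dc_apply bilinear_dform if_True) (simp add: double_bracket dform_def fst_rD F_linear sum.distrib)
  then show ?thesis by (simp only: 1 2 F_linear)
qed

text \<open>Common to both generating matrices. A coordinate functional turns \<open>LL\<close> into
  the scalar matrix of \<open>Y x h\<close> under \<pi>, so on products of such functionals the leg
  commutator becomes \<pi> of \<open>br (Y x h) (Y y k)\<close>; only the identity
  \<open>key\<close> in \<gg> remains.\<close>

lemma double_generator_cobracket:
  assumes LL: "\<And>i j. LL i j = (\<Sum>\<kappa>\<in>r_index. dsc (act (p \<kappa>) $ i $ j) (w \<kappa>))" "\<And>\<kappa>. w \<kappa> \<in> lie_carrier (double \<D>)"
    and Y: "\<And>x h. h \<in> H \<Longrightarrow> (\<Sum>\<kappa>\<in>r_index. s (dform x h (w \<kappa>)) (p \<kappa>)) = Y x h"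
    and key: "\<And>x h y k. h \<in> H \<Longrightarrow> k \<in> H \<Longrightarrow>
      F (fst (LL i l)) (br (P y + s (1/2) k) x + br (T x - s (1/2) h) y) = F (rho (mat_unit i l)) (br (Y x h) (Y y k))"
  shows "dc (LL i l) = leg_commutator (double \<D>) LL i l"
proof (rule double_tensor_eqI)
  have LL_mem: "LL i j \<in> lie_carrier (double \<D>)" for i j
  proof -
    have "D2.subspace (lie_carrier (double \<D>))" by (intro D2.subspaceI double_closed)
    then show ?thesis unfolding LL(1) using LL(2) double_closed(3) by (intro D2.subspace_sum) auto
  qed
  then show "leg_commutator (double \<D>) LL i l \<in> tensor_square (double \<D>)"
    by (intro leg_commutator_tensor_square double_closed)
  fix x h y k assume hk: "h \<in> H" "k \<in> H"
  have ev: "dform x h (LL i j) = act (Y x h) $ i $ j" if "h \<in> H" for x h i j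
    unfolding LL(1) Y[OF that, symmetric] by (simp add: dform_linear act_linear mat_scale_nth mult.commute)
  have "leg_commutator (double \<D>) LL i l (\<lambda>a b. dform x h a * dform y k b) =
      (act (Y x h) ** act (Y y k) - act (Y y k) ** act (Y x h)) $ i $ l"
    by (simp add: leg_commutator_apply bilinear_dform ev hk matrix_matrix_mult_def sum_subtractf mult.commute)
  also have "\<dots> = pairing (mat_unit i l) (act (br (Y x h) (Y y k)))"
    by (simp only: pairing_mat_unit act_br commutator_def)
  also have "\<dots> = F (rho (mat_unit i l)) (br (Y x h) (Y y k))" by (simp only: F_rho)
  finally show "dc (LL i l) (\<lambda>a b. dform x h a * dform y k b) =
      leg_commutator (double \<D>) LL i l (\<lambda>a b. dform x h a * dform y k b)"
    by (simp only: dc_dform[OF hk] key[OF hk])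
qed (rule dc_tensor_square)

text \<open>The Rota-Baxter identity shifted by Cartan elements. The shifts are harmless because
  \<open>P\<close> commutes with the adjoint action of the Cartan subalgebra and \<open>h\<close>,
  \<open>k\<close> commute.\<close>

lemma key_P:
  assumes "h \<in> H" "k \<in> H"
  shows "P (br (T Y - s (1/2) k) X + br (P X + s (1/2) h) Y) = br (P X + s (1/2) h) (P Y + s (1/2) k)"
proof -
  have 1: "P (br (T Y) X + br (P X) Y) = br (P X) (P Y)"
  proof -
    have "br (T Y) X = - br X (T Y)" by (rule br_skew)
    moreover have "T Y = Y - P Y" "P X = X - T X" using P_plus_T[of Y] P_plus_T[of X] by (simp_all add: eq_diff_eq add.commute)
    ultimately have "br (T Y) X + br (P X) Y = br X (P Y) - br (T X) Y" by (simp add: br_linear)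
    then show ?thesis by (simp only: rota_baxter_P)
  qed
  have "P (br k X) = - br (P X) k" "P (br h Y) = br h (P Y)" "br h k = 0"
    using br_H_PT(1)[OF assms(2), of X] br_H_PT(1)[OF assms(1), of Y] br_skew[of k "P X"] H_abelian[OF assms] by simp_all
  then show ?thesis using 1 by (simp add: br_linear P_linear algebra_simps)
qed

lemma key_T:
  assumes "h \<in> H" "k \<in> H"
  shows "T (br (T Y - s (1/2) k) X + br (P X + s (1/2) h) Y) = - br (- T X + s (1/2) h) (- T Y + s (1/2) k)"
proof -
  have 1: "T (br (T Y) X + br (P X) Y) = - br (T X) (T Y)"
  proof -
    have "br (T Y) X = - br X (T Y)" by (rule br_skew)
    moreover have "T Y = Y - P Y" "P X = X - T X" using P_plus_T[of Y] P_plus_T[of X] by (simp_all add: eq_diff_eq add.commute)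
    ultimately have "br (T Y) X + br (P X) Y = br X (P Y) - br (T X) Y" by (simp add: br_linear)
    then show ?thesis by (simp add: rota_baxter_T)
  qed
  have "T (br k X) = - br (T X) k" "T (br h Y) = br h (T Y)" "br h k = 0"
    using br_H_PT(2)[OF assms(2), of X] br_H_PT(2)[OF assms(1), of Y] br_skew[of k "T X"] H_abelian[OF assms] by simp_all
  note 2 = this
  have "T (br (T Y - s (1/2) k) X + br (P X + s (1/2) h) Y) =
      T (br (T Y) X + br (P X) Y) - s (1/2) (T (br k X)) + s (1/2) (T (br h Y))"
    by (simp add: br_linear T_linear algebra_simps)
  also have "\<dots> = - br (T X) (T Y) + s (1/2) (br (T X) k) + s (1/2) (br h (T Y))"
    by (simp only: 1 2) simp
  also have "\<dots> = - br (- T X + s (1/2) h) (- T Y + s (1/2) k)"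
    by (simp add: br_linear 2(3) algebra_simps)
  finally show ?thesis .
qed

lemma LL_plus_eq: "LL_plus \<D> i j = (\<Sum>\<kappa>\<in>r_index. dsc (act (r_left \<kappa>) $ i $ j) (double_omega \<D> (rD_right \<kappa>)))"
  by (simp add: LL_plus_def rD_sum_eq double_action_def case_prod_unfold fst_rD)

lemma LL_minus_eq: "LL_minus \<D> i j = (\<Sum>\<kappa>\<in>r_index. dsc (act (r_right \<kappa>) $ i $ j) (- double_omega \<D> (rD_left \<kappa>)))"
  by (simp add: LL_minus_def rD_sum_eq double_action_def case_prod_unfold fst_rD sum_negf)

lemma double_omega_mem: "double_omega \<D> (rD_right \<kappa>) \<in> lie_carrier (double \<D>)"
  "- double_omega \<D> (rD_left \<kappa>) \<in> lie_carrier (double \<D>)"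
  using rD_carrier[of \<kappa>] by (auto simp: double_omega_def double_simps intro: H_closed)

lemma fst_LL: "fst (LL_plus \<D> i l) = \<omega> (T (rho (mat_unit i l)))" "fst (LL_minus \<D> i l) = - \<omega> (P (rho (mat_unit i l)))"
  using contract_LL_plus[of "mat_unit i l"] contract_LL_minus[of "mat_unit i l"] by (simp_all add: D2.contract_mat_unit)

lemma \<omega>_bracket_sum:
  assumes "h \<in> H" "k \<in> H"
  shows "\<omega> (br (P y + s (1/2) k) x + br (T x - s (1/2) h) y) =
    br (T (\<omega> y) - s (1/2) k) (\<omega> x) + br (P (\<omega> x) + s (1/2) h) (\<omega> y)"
  using assms by (simp add: \<omega>_linear \<omega>_br \<omega>_P \<omega>_T \<omega>_H)

lemma dc_LL_plus: "dc (LL_plus \<D> i l) = leg_commutator (double \<D>) (LL_plus \<D>) i l"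
proof (rule double_generator_cobracket[OF LL_plus_eq double_omega_mem(1)])
  show "(\<Sum>\<kappa>\<in>r_index. s (dform x h (double_omega \<D> (rD_right \<kappa>))) (r_left \<kappa>)) = P (\<omega> x) + s (1/2) h" if "h \<in> H" for x h
    using sum_cartan_rD_right[OF that]
    by (simp add: dform_def double_omega_def case_prod_unfold fst_rD P_def F_\<omega>' G.scale_left_diff_distrib sum_subtractf)
  show "F (fst (LL_plus \<D> i l)) (br (P y + s (1/2) k) x + br (T x - s (1/2) h) y) =
      F (rho (mat_unit i l)) (br (P (\<omega> x) + s (1/2) h) (P (\<omega> y) + s (1/2) k))" if "h \<in> H" "k \<in> H" for x h y k
    by (simp only: fst_LL F_\<omega>' \<omega>_bracket_sum[OF that] F_T key_P[OF that])
qed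

lemma dc_LL_minus: "dc (LL_minus \<D> i l) = leg_commutator (double \<D>) (LL_minus \<D>) i l"
proof (rule double_generator_cobracket[OF LL_minus_eq double_omega_mem(2)])
  show "(\<Sum>\<kappa>\<in>r_index. s (dform x h (- double_omega \<D> (rD_left \<kappa>))) (r_right \<kappa>)) = - T (\<omega> x) + s (1/2) h" if "h \<in> H" for x h
    using sum_cartan_rD_left[OF that]
    by (simp add: dform_def double_omega_def case_prod_unfold fst_rD T_def F_\<omega>' F_linear G.scale_left_diff_distrib
        G.scale_left_distrib sum_subtractf sum.distrib sum_negf)
  show "F (fst (LL_minus \<D> i l)) (br (P y + s (1/2) k) x + br (T x - s (1/2) h) y) =
      F (rho (mat_unit i l)) (br (- T (\<omega> x) + s (1/2) h) (- T (\<omega> y) + s (1/2) k))" if "h \<in> H" "k \<in> H" for x h y k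
  proof -
    have "F (fst (LL_minus \<D> i l)) (br (P y + s (1/2) k) x + br (T x - s (1/2) h) y) =
        - F (rho (mat_unit i l)) (T (br (T (\<omega> y) - s (1/2) k) (\<omega> x) + br (P (\<omega> x) + s (1/2) h) (\<omega> y)))"
      by (simp only: fst_LL F_left(4) F_\<omega>' \<omega>_bracket_sum[OF that] F_P)
    then show ?thesis by (simp only: key_T[OF that] F_right(4) minus_minus)
  qed
qed

section \<open>The cobracket of the dual of the invariants\<close>

lemma zV_tensor_eqI:
  assumes "S \<in> tensor_square (zV \<D>)" "T' \<in> tensor_square (zV \<D>)"
    and eq: "\<And>X Y. X \<in> glinv \<Longrightarrow> Y \<in> glinv \<Longrightarrow> S (\<lambda>g g'. g X * g' Y) = T' (\<lambda>g g'. g X * g' Y)"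
  shows "S = T'"
proof -
  obtain B where B: "B \<subseteq> glinv" "M.independent B" "glinv \<subseteq> M.span B"
    using M.maximal_independent_subset by blast
  have "B \<subseteq> M.span (range (case_prod mat_unit))" by (simp only: mat_finite_dimensional(2) subset_UNIV)
  then have fin: "finite B"
    using M.independent_span_bound[OF mat_finite_dimensional(1) B(2)] by blast
  define e where "e = (\<lambda>b X. if X \<in> glinv then M.representation B X b else 0)"
  have rep: "X = (\<Sum>b\<in>B. mat_scale (M.representation B X b) b)" if "X \<in> glinv" for X
    using M.sum_representation_eq[OF B(2) _ fin subset_refl] B(3) that by auto
  show ?thesis
  proof (rule tensor_square_eqI[where A = B and \<phi> = "\<lambda>b f. f b" and e = e, OF assms(1,2)])
    show "e b \<in> lie_carrier (zV \<D>)" for b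
      using B(3) M.subspace_add[OF subspace_inv] M.subspace_scale[OF subspace_inv]
        M.representation_add[OF B(2)] M.representation_scale[OF B(2)]
      by (auto simp: zV_simps dual_space_def e_def subset_iff)
    show "linear_form (zV \<D>) (\<lambda>f. f b)" for b
      by (simp add: linear_form_def zV_simps)
    show "S (\<lambda>f g. f k * g l) = T' (\<lambda>f g. f k * g l)" if "k \<in> B" "l \<in> B" for k l
      using eq B(1) that by blast
    fix f assume "f \<in> lie_carrier (zV \<D>)"
    then have f: "f \<in> dualZ" by (simp add: zV_simps)
    have lin: "f (\<Sum>b\<in>A. mat_scale (c b) b) = (\<Sum>b\<in>A. c b * f b)" if "A \<subseteq> B" for A c
    proof -
      have l: "f (X + Y) = f X + f Y" "f (mat_scale a X) = a * f X" if "X \<in> glinv" "Y \<in> glinv" for X Y a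
        using f that by (simp_all add: dual_space_def)
      have z: "0 \<in> glinv" by (rule M.subspace_0[OF subspace_inv])
      then have f0: "f 0 = 0" using l(1)[of 0 0] by simp
      have "(\<Sum>b\<in>A. mat_scale (c b) b) \<in> glinv \<and> ?thesis"
        using finite_subset[OF that fin] that
      proof (induction A rule: finite_induct)
        case (insert b A)
        then have "b \<in> glinv" "(\<Sum>b\<in>A. mat_scale (c b) b) \<in> glinv" using B(1) by auto
        then show ?case
          using insert l M.subspace_add[OF subspace_inv] M.subspace_scale[OF subspace_inv] by simp
      qed (use z f0 in simp)
      then show ?thesis by blast
    qed
    show "f = (\<Sum>b\<in>B. zsc (f b) (e b))"
    proof
      fix X
      show "f X = (\<Sum>b\<in>B. zsc (f b) (e b)) X"
      proof (cases "X \<in> glinv")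
        case True
        have "f X = f (\<Sum>b\<in>B. mat_scale (M.representation B X b) b)" using rep[OF True] by simp
        also have "\<dots> = (\<Sum>b\<in>B. M.representation B X b * f b)" by (rule lin[OF subset_refl])
        finally show ?thesis using True by (simp add: sum_fun_apply zV_simps e_def mult.commute)
      next
        case False
        then have "f X = 0" using f by (simp add: dual_space_def)
        then show ?thesis using False by (simp add: sum_fun_apply zV_simps e_def)
      qed
    qed
  qed (use fin in \<open>simp_all add: zV_simps(3) zV_closed\<close>)
qed

lemma ZZ_mem: "ZZ \<D> i j \<in> lie_carrier (zV \<D>)" "ZZ \<D> i j = zfun (mat_unit i j)"
  using contract_ZZ[of "mat_unit i j"] zfun_dualZ by (simp_all add: Z2.contract_mat_unit zV_simps)

lemma bilinear_evaluation: "bilinear_form (zV \<D>) (\<lambda>g g'. g X * g' Y)"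
  by (intro bilinear_formI) (simp_all add: zV_simps algebra_simps)

lemma inv_commutator: "X \<in> glinv \<Longrightarrow> Y \<in> glinv \<Longrightarrow> X ** Y - Y ** X \<in> glinv"
  using commutator_jacobi[of _ X Y] by (simp add: inv_iff commutator_linear flip: commutator_def)

text \<open>\<open>zV_cobracket\<close> is a definite description. Its value at
  \<open>zfun c\<close> is the contraction of the leg commutator of the canonical element with
  \<open>c\<close>; uniqueness is \<open>zV_tensor_eqI\<close>.\<close>

lemma zc_zfun: "zc (zfun c) \<in> tensor_square (zV \<D>)"
  "zc (zfun c) \<beta> = (\<Sum>i\<in>UNIV. \<Sum>k\<in>UNIV. c $ i $ k * leg_commutator (zV \<D>) (ZZ \<D>) i k \<beta>)"
proof -
  define t where "t = (\<lambda>\<beta>. \<Sum>i\<in>UNIV. \<Sum>k\<in>UNIV. c $ i $ k * leg_commutator (zV \<D>) (ZZ \<D>) i k \<beta>)"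
  have "t = (\<Sum>i\<in>UNIV. \<Sum>k\<in>UNIV. (\<lambda>\<beta>. c $ i $ k * leg_commutator (zV \<D>) (ZZ \<D>) i k \<beta>))"
    by (simp add: fun_eq_iff t_def sum_fun_apply)
  also have "\<dots> \<in> tensor_square (zV \<D>)"
    by (intro tensor_square_sum tensor_square_scale zV_closed leg_commutator_tensor_square ZZ_mem)
  finally have t: "t \<in> tensor_square (zV \<D>)" .
  have val: "t (\<lambda>g g'. g X * g' Y) = zfun c (X ** Y - Y ** X)" if "X \<in> glinv" "Y \<in> glinv" for X Y
  proof -
    have "leg_commutator (zV \<D>) (ZZ \<D>) i k (\<lambda>g g'. g X * g' Y) = (X ** Y - Y ** X) $ i $ k" for i k
      using that by (simp add: leg_commutator_apply bilinear_evaluation ZZ_def matrix_matrix_mult_def sum_subtractf mult.commute)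
    then show ?thesis by (simp add: t_def zfun_def inv_commutator[OF that] pairing_def)
  qed
  have "zc (zfun c) = t"
    unfolding zV_cobracket_def
  proof (rule the_equality)
    show "t \<in> tensor_square (zV \<D>) \<and> (\<forall>X\<in>glinv. \<forall>Y\<in>glinv. t (\<lambda>g g'. g X * g' Y) = zfun c (X ** Y - Y ** X))"
      using t val by blast
    fix u assume "u \<in> tensor_square (zV \<D>) \<and> (\<forall>X\<in>glinv. \<forall>Y\<in>glinv. u (\<lambda>g g'. g X * g' Y) = zfun c (X ** Y - Y ** X))"
    then show "u = t" using t val by (intro zV_tensor_eqI) auto
  qed
  then show "zc (zfun c) \<in> tensor_square (zV \<D>)"
    "zc (zfun c) \<beta> = (\<Sum>i\<in>UNIV. \<Sum>k\<in>UNIV. c $ i $ k * leg_commutator (zV \<D>) (ZZ \<D>) i k \<beta>)"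
    using t by (simp_all add: t_def)
qed

lemma dualZ_zfun: "f \<in> dualZ \<Longrightarrow> \<exists>c. f = zfun c"
proof -
  assume f: "f \<in> dualZ"
  obtain c where c: "\<forall>X\<in>glinv. pairing c X = f X" using ex_functional[OF f] by blast
  have "f X = zfun c X" for X using c f by (auto simp: zfun_def dual_space_def)
  then show ?thesis by blast
qed

lemma zc_tensor_square: "f \<in> dualZ \<Longrightarrow> zc f \<in> tensor_square (zV \<D>)"
  using dualZ_zfun zc_zfun(1) by blast

lemma zfun_linear: "zfun (c + d) = zfun c + zfun d" "zfun (mat_scale a c) = (\<lambda>X. a * zfun c X)"
  by (auto simp: zfun_def fun_eq_iff pairing_linear)

lemma zc_linear: "f \<in> dualZ \<Longrightarrow> g \<in> dualZ \<Longrightarrow> zc (f + g) \<beta> = zc f \<beta> + zc g \<beta>"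
  "f \<in> dualZ \<Longrightarrow> zc (\<lambda>X. a * f X) \<beta> = a * zc f \<beta>"
proof -
  show "zc (f + g) \<beta> = zc f \<beta> + zc g \<beta>" if fg: "f \<in> dualZ" "g \<in> dualZ"
  proof -
    obtain c d where "f = zfun c" "g = zfun d" using dualZ_zfun fg by blast
    then show ?thesis by (simp only: zfun_linear[symmetric] zc_zfun(2)) (simp add: algebra_simps sum.distrib)
  qed
  show "zc (\<lambda>X. a * f X) \<beta> = a * zc f \<beta>" if f: "f \<in> dualZ"
  proof -
    obtain c where "f = zfun c" using dualZ_zfun f by blast
    then show ?thesis by (simp only: zfun_linear[symmetric] zc_zfun(2)) (simp add: mat_scale_nth sum_distrib_left mult.assoc)
  qed
qed

lemma zc_ZZ: "zc (ZZ \<D> i k) = leg_commutator (zV \<D>) (ZZ \<D>) i k"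
proof
  fix \<beta>
  define L :: "complex^'n^'n" where "L = (\<chi> i k. leg_commutator (zV \<D>) (ZZ \<D>) i k \<beta>)"
  have "zc (zfun c) \<beta> = pairing c L" for c by (simp add: zc_zfun(2) pairing_def L_def)
  then show "zc (ZZ \<D> i k) \<beta> = leg_commutator (zV \<D>) (ZZ \<D>) i k \<beta>"
    by (simp add: ZZ_mem(2) pairing_mat_unit L_def)
qed

end

section \<open>The Lie bialgebra structures\<close>

lemma bilinear_form_scaleD:
  assumes "bilinear_form L \<beta>" "x \<in> lie_carrier L" "z \<in> lie_carrier L"
  shows "\<beta> (lie_scale L c x) z = c * \<beta> x z" "\<beta> z (lie_scale L c x) = c * \<beta> z x"
  using bilinear_form_D(3,4)[OF assms(1,2,2,3)] by blast+

lemma tensor_square_uminus: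
  assumes "\<And>c x. x \<in> lie_carrier L \<Longrightarrow> lie_scale L c x \<in> lie_carrier L" "S \<in> tensor_square L"
  shows "- S \<in> tensor_square L"
  using tensor_square_diff[OF assms(1) tensor_square_zero assms(2)] by simp

context rmatrix
begin

abbreviation "zz \<equiv> lie_sum (zV \<D>) (zV \<D>)"

lemma zz_simps: "lie_carrier zz = dualZ \<times> dualZ" "lie_zero zz = 0" "lie_add zz = (+)"
  "lie_scale zz c (f, g) = (zsc c f, zsc c g)"
  by (auto simp: lie_sum_def zV_simps zero_prod_def fun_eq_iff)

lemma target_eq: "target \<D> = lie_sum (double \<D>) zz"
  by (simp add: target_def)

lemma embeddings:
  "linear_between (double \<D>) (target \<D>) (\<lambda>d. (d, 0))"
  "linear_between zz (target \<D>) (\<lambda>f. (0, f))"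
  "linear_between (zV \<D>) zz (\<lambda>f. (f, 0))" "linear_between (zV \<D>) zz (\<lambda>f. (0, f))"
  "linear_between (zV \<D>) (target \<D>) (\<lambda>f. (0, f, 0))" "linear_between (zV \<D>) (target \<D>) (\<lambda>f. (0, 0, f))"
  by (auto simp: linear_between_def target_simps double_simps zV_simps zz_simps dualZ_closed dualZ_closed(4)[unfolded zero_fun_def]
      zero_prod_def zero_fun_def intro: H_closed)

lemma tcb_eq:
  "tcb (d, f, g) = tensor_map (target \<D>) (\<lambda>d. (d, 0)) (dc d) +
    tensor_map (target \<D>) (\<lambda>f. (0, f)) (tensor_map zz (\<lambda>f. (f, 0)) (zc f) + tensor_map zz (\<lambda>f. (0, f)) (- zc g))"
  by (simp add: target_cobracket_def cobracket_sum_def target_eq[symmetric] double_simps zV_simps zz_simps)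

lemma tcb_inner:
  assumes "f \<in> dualZ" "g \<in> dualZ"
  shows "tensor_map zz (\<lambda>f. (f, 0)) (zc f) + tensor_map zz (\<lambda>f. (0, f)) (- zc g) \<in> tensor_square zz"
  by (intro tensor_square_add tensor_map_tensor_square[OF embeddings(3)] tensor_map_tensor_square[OF embeddings(4)]
      tensor_square_uminus zc_tensor_square zV_closed assms)

lemma tcb_tensor_square:
  assumes "x \<in> lie_carrier (target \<D>)"
  shows "tcb x \<in> tensor_square (target \<D>)"
proof -
  obtain d f g where x: "x = (d, f, g)" "f \<in> dualZ" "g \<in> dualZ" using assms by (auto simp: target_simps)
  show ?thesis
    unfolding x(1) tcb_eq
    by (intro tensor_square_add tensor_map_tensor_square[OF embeddings(1)] tensor_map_tensor_square[OF embeddings(2)]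
        dc_tensor_square tcb_inner x)
qed

lemma tcb_apply:
  assumes "f \<in> dualZ" "g \<in> dualZ"
  shows "tcb (d, f, g) \<beta> = (if bilinear_form (target \<D>) \<beta> then
    dc d (\<lambda>a b. \<beta> (a, 0) (b, 0)) + zc f (\<lambda>a b. \<beta> (0, a, 0) (0, b, 0)) - zc g (\<lambda>a b. \<beta> (0, 0, a) (0, 0, b)) else 0)"
proof -
  have "- zc g \<in> tensor_square (zV \<D>)"
    by (intro tensor_square_uminus zc_tensor_square zV_closed assms)
  then show ?thesis
    using bilinear_form_pullback[OF embeddings(2), of \<beta>]
    by (simp add: tcb_eq tensor_map_apply[OF dc_tensor_square] tensor_map_apply[OF tcb_inner[OF assms]]
        tensor_map_apply[OF zc_tensor_square[OF assms(1)]] tensor_map_apply)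
qed

lemma dc_linear: "dc (d + e) \<beta> = dc d \<beta> + dc e \<beta>" "dc (dsc c d) \<beta> = c * dc d \<beta>"
  by (auto simp: dc_apply double_bracket_linear sum.distrib sum_distrib_left algebra_simps rD_mem double_bracket_mem
      bilinear_form_scaleD bilinear_form_D(1,2)[of "double \<D>", unfolded double_simps(3)])

lemma tcb_linear:
  assumes "x \<in> lie_carrier (target \<D>)" "y \<in> lie_carrier (target \<D>)"
  shows "tcb (x + y) = tcb x + tcb y" "tcb (tsc c x) = (\<lambda>\<beta>. c * tcb x \<beta>)"
proof -
  obtain d f g where x: "x = (d, f, g)" "f \<in> dualZ" "g \<in> dualZ" using assms(1) by (auto simp: target_simps)
  obtain d' f' g' where y: "y = (d', f', g')" "f' \<in> dualZ" "g' \<in> dualZ" using assms(2) by (auto simp: target_simps)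
  have "tcb (d + d', f + f', g + g') \<beta> = tcb x \<beta> + tcb y \<beta>" for \<beta>
    unfolding x(1) y(1)
    by (subst tcb_apply) (auto simp: tcb_apply x y dualZ_closed dc_linear zc_linear)
  then show "tcb (x + y) = tcb x + tcb y" by (simp add: x y fun_eq_iff)
  have "tcb (dsc c d, (\<lambda>X. c * f X), (\<lambda>X. c * g X)) \<beta> = c * tcb x \<beta>" for \<beta>
    unfolding x(1)
    by (subst tcb_apply) (auto simp: tcb_apply x dualZ_closed dc_linear zc_linear algebra_simps)
  then show "tcb (tsc c x) = (\<lambda>\<beta>. c * tcb x \<beta>)" by (simp add: x target_simps zV_simps fun_eq_iff)
qed

text \<open>The sum is an entry of the commutator of matrices from \<pi>(\<gg>) with the canonical
  element, whose matrix leg consists of invariants; so it vanishes.\<close>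

lemma cross_terms_vanish:
  assumes LL: "\<And>i j. LL i j = (\<Sum>\<kappa>\<in>r_index. dsc (act (p \<kappa>) $ i $ j) (w \<kappa>))" "\<And>\<kappa>. w \<kappa> \<in> lie_carrier (double \<D>)"
    and 1: "\<And>f. f \<in> lie_carrier (zV \<D>) \<Longrightarrow> linear_form (double \<D>) (\<lambda>d. \<gamma> d f)"
    and 2: "\<And>d. d \<in> lie_carrier (double \<D>) \<Longrightarrow> linear_form (zV \<D>) (\<gamma> d)"
  shows "(\<Sum>j\<in>UNIV. \<gamma> (LL i j) (ZZ \<D> j k) - \<gamma> (LL j k) (ZZ \<D> i j)) = 0"
proof -
  have L: "\<gamma> (LL i j) f = (\<Sum>\<kappa>\<in>r_index. act (p \<kappa>) $ i $ j * \<gamma> (w \<kappa>) f)" if "f \<in> lie_carrier (zV \<D>)" for i j f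
    unfolding LL(1)
    by (rule linear_form_sum[OF 1[OF that]]) (simp_all add: double_simps(3) double_closed LL(2))
  have "(\<Sum>j\<in>UNIV. act (p \<kappa>) $ i $ j * \<gamma> (w \<kappa>) (ZZ \<D> j k) - act (p \<kappa>) $ j $ k * \<gamma> (w \<kappa>) (ZZ \<D> i j)) = 0" for \<kappa>
  proof -
    let ?A = "act (p \<kappa>)"
    have ad: "matrix_ad zsc ?A (ZZ \<D>) i k = 0"
      using Z2.contract_matrix_ad[of "mat_unit i k" ?A "ZZ \<D>"]
      by (simp add: Z2.contract_mat_unit contract_ZZ zfun_transposed_commutator)
    \<comment> \<open>The flag merges the two products of the commutator into one linear
      combination, to which linearity of \<open>\<gamma>\<close> applies directly.\<close>
    define c where "c = (\<lambda>(j, b). if b then ?A $ i $ j else - ?A $ j $ k)"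
    define e where "e = (\<lambda>(j, b). if b then ZZ \<D> j k else ZZ \<D> i j)"
    have pairs: "(\<Sum>jb\<in>UNIV. g jb) = (\<Sum>j\<in>UNIV. g (j, True) + g (j, False))" for g :: "'n \<times> bool \<Rightarrow> 'c::comm_monoid_add"
    proof -
      have "(\<Sum>jb\<in>UNIV. g jb) = (\<Sum>j\<in>UNIV. \<Sum>b\<in>UNIV. g (j, b))"
        by (simp add: sum.cartesian_product UNIV_Times_UNIV case_prod_unfold)
      then show ?thesis by (simp add: UNIV_bool add.commute)
    qed
    have "\<gamma> (w \<kappa>) (\<Sum>jb\<in>UNIV. zsc (c jb) (e jb)) = (\<Sum>jb\<in>UNIV. c jb * \<gamma> (w \<kappa>) (e jb))"
      by (rule linear_form_sum[OF 2[OF LL(2)]])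
        (auto simp: zV_simps(3) zV_closed e_def ZZ_mem(1) split: prod.split)
    moreover have "(\<Sum>jb\<in>UNIV. zsc (c jb) (e jb)) = matrix_ad zsc ?A (ZZ \<D>) i k"
      unfolding pairs by (simp add: matrix_ad_def c_def e_def)
    moreover have "\<gamma> (w \<kappa>) 0 = 0"
      using 2[OF LL(2)[of \<kappa>]] zV_closed(1) zV_simps(3) unfolding linear_form_def by (metis add_0 add_cancel_right_right)
    ultimately show ?thesis unfolding pairs ad by (simp add: c_def e_def)
  qed
  then have "(\<Sum>\<kappa>\<in>r_index. \<Sum>j\<in>UNIV. act (p \<kappa>) $ i $ j * \<gamma> (w \<kappa>) (ZZ \<D> j k) - act (p \<kappa>) $ j $ k * \<gamma> (w \<kappa>) (ZZ \<D> i j)) = 0"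
    by simp
  then have "(\<Sum>j\<in>UNIV. \<Sum>\<kappa>\<in>r_index. act (p \<kappa>) $ i $ j * \<gamma> (w \<kappa>) (ZZ \<D> j k) - act (p \<kappa>) $ j $ k * \<gamma> (w \<kappa>) (ZZ \<D> i j)) = 0"
    by (subst sum.swap)
  then show ?thesis by (simp add: L ZZ_mem(1) sum_subtractf)
qed

text \<open>The map \<open>e\<close> places the canonical element in one of the two copies of
  \<open>zV\<close>, and may carry a sign. Only the mixed terms need an argument, and they cancel by
  \<open>cross_terms_vanish\<close>.\<close>

lemma target_leg_commutator:
  assumes LL: "\<And>i j. LL i j = (\<Sum>\<kappa>\<in>r_index. dsc (act (p \<kappa>) $ i $ j) (w \<kappa>))" "\<And>\<kappa>. w \<kappa> \<in> lie_carrier (double \<D>)"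
    and e: "linear_between (zV \<D>) (target \<D>) e"
    and X: "\<And>i j. X i j = (LL i j, 0) + e (ZZ \<D> i j)"
    and \<beta>: "bilinear_form (target \<D>) \<beta>"
  shows "leg_commutator (target \<D>) X i k \<beta> = leg_commutator (double \<D>) LL i k (\<lambda>a b. \<beta> (a, 0) (b, 0)) +
    leg_commutator (zV \<D>) (ZZ \<D>) i k (\<lambda>a b. \<beta> (e a) (e b))"
proof -
  have LL_mem: "LL i j \<in> lie_carrier (double \<D>)" for i j
  proof -
    have "D2.subspace (lie_carrier (double \<D>))" by (intro D2.subspaceI double_closed)
    then show ?thesis unfolding LL(1) using LL(2) double_closed(3) by (intro D2.subspace_sum) auto
  qed
  have mem: "(LL i j, 0) \<in> lie_carrier (target \<D>)" "e (ZZ \<D> i j) \<in> lie_carrier (target \<D>)" for i j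
    using embeddings(1) e LL_mem ZZ_mem(1) by (auto simp: linear_between_def)
  have expand: "\<beta> (X i j) (X k l) = \<beta> (LL i j, 0) (LL k l, 0) + \<beta> (LL i j, 0) (e (ZZ \<D> k l)) +
      \<beta> (e (ZZ \<D> i j)) (LL k l, 0) + \<beta> (e (ZZ \<D> i j)) (e (ZZ \<D> k l))" for i j k l
    using bilinear_form_D(1,2)[OF \<beta>] mem target_closed(2)
    by (simp add: X target_simps(3))
  have lf: "linear_form (double \<D>) (\<lambda>d. \<beta> (d, 0) t)" "linear_form (double \<D>) (\<lambda>d. \<beta> t (d, 0))"
    "linear_form (zV \<D>) (\<lambda>f. \<beta> (e f) t)" "linear_form (zV \<D>) (\<lambda>f. \<beta> t (e f))" if "t \<in> lie_carrier (target \<D>)" for t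
    using that embeddings(1) e \<beta> by (simp_all add: linear_form_def linear_between_def bilinear_form_def)
  have et: "e f \<in> lie_carrier (target \<D>)" if "f \<in> lie_carrier (zV \<D>)" for f
    using e that by (simp add: linear_between_def)
  have dt: "(d, 0) \<in> lie_carrier (target \<D>)" if "d \<in> lie_carrier (double \<D>)" for d
    using embeddings(1) that by (simp add: linear_between_def)
  have c1: "(\<Sum>j\<in>UNIV. \<beta> (LL i j, 0) (e (ZZ \<D> j k)) - \<beta> (LL j k, 0) (e (ZZ \<D> i j))) = 0"
    by (rule cross_terms_vanish[OF LL, where \<gamma> = "\<lambda>d f. \<beta> (d, 0) (e f)"]) (auto intro: lf et dt)
  have c2: "(\<Sum>j\<in>UNIV. \<beta> (e (ZZ \<D> j k)) (LL i j, 0) - \<beta> (e (ZZ \<D> i j)) (LL j k, 0)) = 0"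
    by (rule cross_terms_vanish[OF LL, where \<gamma> = "\<lambda>d f. \<beta> (e f) (d, 0)"]) (auto intro: lf et dt)
  have "(\<Sum>j\<in>UNIV. \<beta> (X i j) (X j k) - \<beta> (X j k) (X i j)) =
      (\<Sum>j\<in>UNIV. \<beta> (LL i j, 0) (LL j k, 0) - \<beta> (LL j k, 0) (LL i j, 0)) +
      (\<Sum>j\<in>UNIV. \<beta> (e (ZZ \<D> i j)) (e (ZZ \<D> j k)) - \<beta> (e (ZZ \<D> j k)) (e (ZZ \<D> i j))) +
      (\<Sum>j\<in>UNIV. \<beta> (LL i j, 0) (e (ZZ \<D> j k)) - \<beta> (LL j k, 0) (e (ZZ \<D> i j))) -
      (\<Sum>j\<in>UNIV. \<beta> (e (ZZ \<D> j k)) (LL i j, 0) - \<beta> (e (ZZ \<D> i j)) (LL j k, 0))"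
    unfolding expand sum.distrib[symmetric] sum_subtractf[symmetric] by (intro sum.cong refl) simp
  then show ?thesis
    using bilinear_form_pullback[OF embeddings(1) \<beta>] bilinear_form_pullback[OF e \<beta>]
    by (simp add: leg_commutator_apply \<beta> c1 c2)
qed

lemma dualZ_ZZ: "ZZ \<D> i j \<in> dualZ"
  using ZZ_mem(1) by (simp add: zV_simps)

lemma zc_zero: "zc 0 \<beta> = 0"
  using zc_linear(2)[OF dualZ_closed(4), of 0 \<beta>] by (simp add: zero_fun_def)

lemma tL_mem: "tLP i j \<in> lie_carrier (target \<D>)" "tLM i j \<in> lie_carrier (target \<D>)"
  using contract_target_carrier(1)[of "mat_unit i j"] contract_target_carrier(2)[of "mat_unit i j"]
  by (simp_all add: Tg.contract_mat_unit)

lemma tcb_tLP: "tcb (tLP i k) = leg_commutator (target \<D>) tLP i k"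
proof
  fix \<beta>
  show "tcb (tLP i k) \<beta> = leg_commutator (target \<D>) tLP i k \<beta>"
  proof (cases "bilinear_form (target \<D>) \<beta>")
    case True
    have "tcb (tLP i k) \<beta> = leg_commutator (double \<D>) (LL_plus \<D>) i k (\<lambda>a b. \<beta> (a, 0) (b, 0)) +
        leg_commutator (zV \<D>) (ZZ \<D>) i k (\<lambda>a b. \<beta> (0, a, 0) (0, b, 0))"
      by (simp add: target_L_plus_def tcb_apply dualZ_ZZ dualZ_closed True dc_LL_plus zc_ZZ zc_zero)
    also have "\<dots> = leg_commutator (target \<D>) tLP i k \<beta>"
      by (rule target_leg_commutator[OF LL_plus_eq double_omega_mem(1) embeddings(5) _ True, symmetric])
        (simp add: target_L_plus_def zero_prod_def)
    finally show ?thesis .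
  next
    case False
    then show ?thesis
      using tensor_square_not_bilinear[OF tcb_tensor_square[OF tL_mem(1)]] by (simp add: leg_commutator_apply)
  qed
qed

text \<open>The leg commutator is quadratic, so the sign of \<open>- ZZ\<close> disappears from it;
  on the left this sign is absorbed by the opposite cobracket of the second copy.\<close>

lemma tcb_tLM: "tcb (tLM i k) = leg_commutator (target \<D>) tLM i k"
proof
  fix \<beta>
  show "tcb (tLM i k) \<beta> = leg_commutator (target \<D>) tLM i k \<beta>"
  proof (cases "bilinear_form (target \<D>) \<beta>")
    case True
    let ?e = "\<lambda>f. (0, 0, - f) :: ('g, 'n) target_type"
    have e: "linear_between (zV \<D>) (target \<D>) ?e"
      by (auto simp: linear_between_def target_simps double_simps zV_simps dualZ_closed zero_prod_def fun_eq_iff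
          intro: H_closed)
    have neg: "\<beta> (?e f) (?e g) = \<beta> (0, 0, f) (0, 0, g)" if "f \<in> dualZ" "g \<in> dualZ" for f g
    proof -
      have m: "(0, 0, f) \<in> lie_carrier (target \<D>)" "(0, 0, g) \<in> lie_carrier (target \<D>)"
        using that by (auto simp: target_simps zero_prod_def dualZ_closed intro: H_closed)
      have n: "?e h = tsc (- 1) (0, 0, h)" for h
        by (simp add: target_simps double_simps zV_simps zero_prod_def fun_eq_iff)
      show ?thesis
        unfolding n using bilinear_form_D(3)[OF True m(1) m(1) target_closed(3)[OF m(2)], of "- 1" "- 1"]
          bilinear_form_D(4)[OF True m(2) m(2) m(1), of "- 1"] by simp
    qed
    have ne: "zc (- ZZ \<D> i k) \<beta>' = - zc (ZZ \<D> i k) \<beta>'" for \<beta>'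
    proof -
      have "- ZZ \<D> i k = (\<lambda>X. - 1 * ZZ \<D> i k X)" by (simp add: fun_eq_iff)
      then show ?thesis using zc_linear(2)[OF dualZ_ZZ[of i k], of "- 1" \<beta>'] by simp
    qed
    have "tcb (tLM i k) \<beta> = leg_commutator (double \<D>) (LL_minus \<D>) i k (\<lambda>a b. \<beta> (a, 0) (b, 0)) +
        leg_commutator (zV \<D>) (ZZ \<D>) i k (\<lambda>a b. \<beta> (0, 0, a) (0, 0, b))"
      by (simp add: target_L_minus_def tcb_apply dualZ_ZZ dualZ_closed True dc_LL_minus ne zc_ZZ zc_zero)
    also have "leg_commutator (zV \<D>) (ZZ \<D>) i k (\<lambda>a b. \<beta> (0, 0, a) (0, 0, b)) =
        leg_commutator (zV \<D>) (ZZ \<D>) i k (\<lambda>a b. \<beta> (?e a) (?e b))"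
      using bilinear_form_pullback[OF embeddings(6) True] bilinear_form_pullback[OF e True]
      by (simp add: leg_commutator_apply neg dualZ_ZZ)
    also have "leg_commutator (double \<D>) (LL_minus \<D>) i k (\<lambda>a b. \<beta> (a, 0) (b, 0)) + \<dots> =
        leg_commutator (target \<D>) tLM i k \<beta>"
      by (rule target_leg_commutator[OF LL_minus_eq double_omega_mem(2) e _ True, symmetric])
        (simp add: target_L_minus_def zero_prod_def)
    finally show ?thesis .
  next
    case False
    then show ?thesis
      using tensor_square_not_bilinear[OF tcb_tensor_square[OF tL_mem(2)]] by (simp add: leg_commutator_apply)
  qed
qed

text \<open>The coefficients of the generating matrices span the target by
  \<open>target_generated\<close>, so linear conditions on the cobracket need checking only
  there.\<close>

lemma target_induct [consumes 1, case_names plus minus add scale]: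
  assumes "x \<in> lie_carrier (target \<D>)"
    and "\<And>i j. Q (tLP i j)" "\<And>i j. Q (tLM i j)"
    and "\<And>x y. x \<in> lie_carrier (target \<D>) \<Longrightarrow> y \<in> lie_carrier (target \<D>) \<Longrightarrow> Q x \<Longrightarrow> Q y \<Longrightarrow> Q (x + y)"
    and "\<And>c x. x \<in> lie_carrier (target \<D>) \<Longrightarrow> Q x \<Longrightarrow> Q (tsc c x)"
  shows "Q x"
proof -
  let ?S = "{x \<in> lie_carrier (target \<D>). Q x}"
  have "tsc 0 (tLP i j) \<in> ?S" for i j using assms(2,5) tL_mem target_closed(3) by blast
  then have "0 \<in> ?S" by simp
  then have S: "Tg.subspace ?S" using assms(4,5) target_closed by (intro Tg.subspaceI) auto
  obtain c d where x: "x = contract tsc c tLP + contract tsc d tLM" using target_generated[OF assms(1)] by blast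
  have g: "tLP i j \<in> ?S" "tLM i j \<in> ?S" for i j using assms(2,3) tL_mem by blast+
  have "contract tsc c tLP \<in> ?S" "contract tsc d tLM \<in> ?S" for c d
    unfolding contract_def by (intro Tg.subspace_sum[OF S] Tg.subspace_scale[OF S] g)+
  then have "x \<in> ?S" unfolding x using Tg.subspace_add[OF S] by blast
  then show ?thesis by simp
qed

lemma leg_commutator_skew: "leg_commutator L X i k (\<lambda>a b. tens L b a \<beta>) = - leg_commutator L X i k \<beta>"
proof (cases "bilinear_form L \<beta>")
  case True
  then show ?thesis using bilinear_form_flip[of L \<beta>] by (simp add: leg_commutator_apply tens_apply sum_subtractf)
qed (simp add: leg_commutator_apply tens_apply)

lemma tcb_skew:
  assumes "x \<in> lie_carrier (target \<D>)"
  shows "tcb x (\<lambda>a b. tens (target \<D>) b a \<beta>) = - tcb x \<beta>"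
  using assms
  by (induction rule: target_induct) (simp_all add: tcb_tLP tcb_tLM leg_commutator_skew tcb_linear)

lemma tcb_cong:
  assumes "x \<in> lie_carrier (target \<D>)" "bilinear_form (target \<D>) \<beta>"
    "\<And>a b. a \<in> lie_carrier (target \<D>) \<Longrightarrow> b \<in> lie_carrier (target \<D>) \<Longrightarrow> \<beta> a b = \<beta>' a b"
  shows "tcb x \<beta> = tcb x \<beta>'"
  by (rule tensor_square_cong[OF tcb_tensor_square[OF assms(1)] assms(2,3)]) (simp_all add: target_simps(3) target_closed)

text \<open>The co-Jacobi identity nests two evaluations, and a tensor returns 0 on an argument that
  is not bilinear. This secures the outer evaluation.\<close>

lemma bilinear_tcb_slice:
  assumes \<gamma>: "trilinear_form (target \<D>) \<gamma>"
  shows "bilinear_form (target \<D>) (\<lambda>a b. tcb a (\<lambda>a' a''. \<gamma> a' a'' b))"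
proof (rule bilinear_formI; intro conjI)
  fix x y z c assume xz: "x \<in> lie_carrier (target \<D>)" "z \<in> lie_carrier (target \<D>)"
  note sl = bilinear_form_slice[OF \<gamma>]
  show "tcb (tsc c x) (\<lambda>a' a''. \<gamma> a' a'' z) = c * tcb x (\<lambda>a' a''. \<gamma> a' a'' z)"
    by (simp add: tcb_linear(2)[OF xz(1,1)])
  have "tcb z (\<lambda>a' a''. \<gamma> a' a'' (tsc c x)) = tcb z (\<lambda>a' a''. c * \<gamma> a' a'' x + 0 * \<gamma> a' a'' x)"
    using trilinear_form_D(6)[OF \<gamma> xz(1,1)] by (intro tcb_cong xz sl target_closed) simp
  also have "\<dots> = c * tcb z (\<lambda>a' a''. \<gamma> a' a'' x)"
    using tensor_square_lincomb[OF tcb_tensor_square[OF xz(2)] sl[OF xz(1)] sl[OF xz(1)], of c 0] by simp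
  finally show "tcb z (\<lambda>a' a''. \<gamma> a' a'' (tsc c x)) = c * tcb z (\<lambda>a' a''. \<gamma> a' a'' x)" .
  assume y: "y \<in> lie_carrier (target \<D>)"
  show "tcb (lie_add (target \<D>) x y) (\<lambda>a' a''. \<gamma> a' a'' z) = tcb x (\<lambda>a' a''. \<gamma> a' a'' z) + tcb y (\<lambda>a' a''. \<gamma> a' a'' z)"
    by (simp add: tcb_linear(1)[OF xz(1) y] target_simps(3))
  have "tcb z (\<lambda>a' a''. \<gamma> a' a'' (lie_add (target \<D>) x y)) = tcb z (\<lambda>a' a''. 1 * \<gamma> a' a'' x + 1 * \<gamma> a' a'' y)"
    using trilinear_form_D(3)[OF \<gamma> xz(1) y] target_closed(2)[OF xz(1) y]
    by (intro tcb_cong xz sl) (simp_all add: target_simps(3))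
  also have "\<dots> = tcb z (\<lambda>a' a''. \<gamma> a' a'' x) + tcb z (\<lambda>a' a''. \<gamma> a' a'' y)"
    using tensor_square_lincomb[OF tcb_tensor_square[OF xz(2)] sl[OF xz(1)] sl[OF y], of 1 1] by simp
  finally show "tcb z (\<lambda>a' a''. \<gamma> a' a'' (lie_add (target \<D>) x y)) =
      tcb z (\<lambda>a' a''. \<gamma> a' a'' x) + tcb z (\<lambda>a' a''. \<gamma> a' a'' y)" .
qed

text \<open>On the generating matrices the co-Jacobi identity is the Jacobi identity for matrix
  commutators.\<close>

lemma tcb_co_jacobi:
  assumes \<gamma>: "trilinear_form (target \<D>) \<gamma>" and x: "x \<in> lie_carrier (target \<D>)"
  shows "tcb x (\<lambda>a b. tcb a (\<lambda>a' a''. \<gamma> a' a'' b)) + tcb x (\<lambda>a b. tcb a (\<lambda>a' a''. \<gamma> a'' b a')) +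
    tcb x (\<lambda>a b. tcb a (\<lambda>a' a''. \<gamma> b a' a'')) = 0"
proof -
  have tri: "trilinear_form (target \<D>) (\<lambda>a b c. \<gamma> b c a)" "trilinear_form (target \<D>) (\<lambda>a b c. \<gamma> c a b)"
    using \<gamma> trilinear_form_rotate[of "target \<D>" \<gamma>] trilinear_form_rotate'[of "target \<D>" \<gamma>] by blast+
  have gen: "tcb (X i k) (\<lambda>a b. tcb a (\<lambda>a' a''. \<gamma> a' a'' b)) + tcb (X i k) (\<lambda>a b. tcb a (\<lambda>a' a''. \<gamma> a'' b a')) +
      tcb (X i k) (\<lambda>a b. tcb a (\<lambda>a' a''. \<gamma> b a' a'')) = 0"
    if X: "\<And>i k. tcb (X i k) = leg_commutator (target \<D>) X i k" "\<And>i k. X i k \<in> lie_carrier (target \<D>)" for X i k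
  proof -
    have J: "tcb (X i k) (\<lambda>a b. tcb a (\<lambda>a' a''. \<gamma> a' a'' b)) =
        (\<Sum>j\<in>UNIV. \<Sum>l\<in>UNIV. \<gamma> (X i l) (X l j) (X j k) - \<gamma> (X l j) (X i l) (X j k)) -
        (\<Sum>j\<in>UNIV. \<Sum>l\<in>UNIV. \<gamma> (X l j) (X j k) (X i l) - \<gamma> (X j k) (X l j) (X i l))"
      if t: "trilinear_form (target \<D>) \<gamma>" for \<gamma>
    proof -
      have "tcb (X i k) (\<lambda>a b. tcb a (\<lambda>a' a''. \<gamma> a' a'' b)) =
          (\<Sum>j\<in>UNIV. \<Sum>l\<in>UNIV. \<gamma> (X i l) (X l j) (X j k) - \<gamma> (X l j) (X i l) (X j k)) -
          (\<Sum>j\<in>UNIV. \<Sum>l\<in>UNIV. \<gamma> (X j l) (X l k) (X i j) - \<gamma> (X l k) (X j l) (X i j))"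
        by (simp add: X(1) leg_commutator_apply bilinear_tcb_slice[OF t, unfolded X(1)] bilinear_form_slice[OF t X(2)]
            bilinear_tcb_slice[OF t] sum_subtractf)
      also have "(\<Sum>j\<in>UNIV. \<Sum>l\<in>UNIV. \<gamma> (X j l) (X l k) (X i j) - \<gamma> (X l k) (X j l) (X i j)) =
          (\<Sum>j\<in>UNIV. \<Sum>l\<in>UNIV. \<gamma> (X l j) (X j k) (X i l) - \<gamma> (X j k) (X l j) (X i l))"
        by (rule sum.swap)
      finally show ?thesis .
    qed
    show ?thesis
      unfolding J[OF \<gamma>] J[OF tri(1)] J[OF tri(2)] by (simp add: sum_subtractf)
  qed
  show ?thesis
    using x
  proof (induction rule: target_induct)
    case (plus i j)
    show ?case by (rule gen[OF tcb_tLP tL_mem(1)])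
  next
    case (minus i j)
    show ?case by (rule gen[OF tcb_tLM tL_mem(2)])
  next
    case (add x y)
    then show ?case by (simp add: tcb_linear(1) algebra_simps)
  next
    case (scale c x)
    have "tcb (tsc c x) \<beta> = c * tcb x \<beta>" for \<beta> using scale(1) by (simp add: tcb_linear(2))
    then show ?case using scale(2) by (simp add: distrib_left[symmetric])
  qed
qed

lemma dc_cocycle:
  assumes "bilinear_form (double \<D>) \<beta>"
  shows "dc (lie_bracket (double \<D>) d e) \<beta> =
    dc e (\<lambda>a b. \<beta> (lie_bracket (double \<D>) d a) b + \<beta> a (lie_bracket (double \<D>) d b)) -
    dc d (\<lambda>a b. \<beta> (lie_bracket (double \<D>) e a) b + \<beta> a (lie_bracket (double \<D>) e b))"
proof -
  let ?b = "lie_bracket (double \<D>)"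
  have jac: "?b d (?b e x) = ?b (?b d e) x + ?b e (?b d x)" for x
    by (simp add: double_bracket jacobi[of "fst d"])
  have "\<beta> (?b (?b d e) p) q + \<beta> p (?b (?b d e) q) =
      (\<beta> (?b d (?b e p)) q + \<beta> (?b e p) (?b d q) + (\<beta> (?b d p) (?b e q) + \<beta> p (?b d (?b e q)))) -
      (\<beta> (?b e (?b d p)) q + \<beta> (?b d p) (?b e q) + (\<beta> (?b e p) (?b d q) + \<beta> p (?b e (?b d q))))"
    if "p \<in> lie_carrier (double \<D>)" "q \<in> lie_carrier (double \<D>)" for p q
    using bilinear_form_D(1,2)[OF assms double_bracket_mem double_bracket_mem] that
    by (simp add: jac double_simps(3))
  then have "dc (?b d e) \<beta> = (\<Sum>k\<in>r_index.
      (\<beta> (?b d (?b e (rD_left k))) (rD_right k) + \<beta> (?b e (rD_left k)) (?b d (rD_right k)) + (\<beta> (?b d (rD_left k)) (?b e (rD_right k)) + \<beta> (rD_left k) (?b d (?b e (rD_right k))))) -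
      (\<beta> (?b e (?b d (rD_left k))) (rD_right k) + \<beta> (?b d (rD_left k)) (?b e (rD_right k)) + (\<beta> (?b e (rD_left k)) (?b d (rD_right k)) + \<beta> (rD_left k) (?b e (?b d (rD_right k))))))"
    by (simp only: dc_apply assms if_True rD_mem)
  then show ?thesis
    by (simp only: dc_apply bilinear_form_ad[OF assms] if_True sum_subtractf)
qed

lemma tbr_mem: "tbr x y \<in> lie_carrier (target \<D>)"
  by (cases x; cases y) (auto simp: target_simps double_simps dualZ_closed intro: H_closed)

lemma tcb_cocycle:
  assumes "x \<in> lie_carrier (target \<D>)" "y \<in> lie_carrier (target \<D>)" and \<beta>: "bilinear_form (target \<D>) \<beta>"
  shows "tcb (tbr x y) \<beta> = tcb y (\<lambda>a b. \<beta> (tbr x a) b + \<beta> a (tbr x b)) - tcb x (\<lambda>a b. \<beta> (tbr y a) b + \<beta> a (tbr y b))"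
proof -
  let ?B = "\<lambda>a b. \<beta> (a, 0) (b, 0)"
  have bD: "bilinear_form (double \<D>) ?B" by (rule bilinear_form_pullback[OF embeddings(1) \<beta>])
  have br1: "tbr (d, f) (a, g) = (lie_bracket (double \<D>) d a, 0)" for d a and f g
    by (cases d; cases a; cases f; cases g) (simp add: target_simps double_bracket zero_prod_def)
  have br_z: "lie_bracket (double \<D>) d 0 = 0" for d by (simp add: double_bracket br_linear zero_prod_def)
  have lin: "tbr x (a + b) = tbr x a + tbr x b" "tbr x (tsc c a) = tsc c (tbr x a)" for x a b c
    using linear_maps[OF lie_algebra_D(2)[OF target_lie_algebra, of x]] by blast+
  have bT: "bilinear_form (target \<D>) (\<lambda>a b. \<beta> (tbr x a) b + \<beta> a (tbr x b))" for x
    using bilinear_form_D[OF \<beta>] tbr_mem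
    by (intro bilinear_formI) (simp_all add: target_simps(3) lin algebra_simps)
  have z: "\<beta> 0 t = 0" "\<beta> t 0 = 0" if "t \<in> lie_carrier (target \<D>)" for t
    using bilinear_form_D(1,2)[OF \<beta> target_closed(1) target_closed(1) that] by (simp_all add: target_simps(3))
  obtain d f g where x: "x = (d, f, g)" "f \<in> dualZ" "g \<in> dualZ" using assms(1) by (auto simp: target_simps)
  obtain e f' g' where y: "y = (e, f', g')" "f' \<in> dualZ" "g' \<in> dualZ" using assms(2) by (auto simp: target_simps)
  have ad: "tcb (e, f', g') (\<lambda>a b. \<beta> (tbr (d, f, g) a) b + \<beta> a (tbr (d, f, g) b)) =
      dc e (\<lambda>a b. ?B (lie_bracket (double \<D>) d a) b + ?B a (lie_bracket (double \<D>) d b))"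
    if "f' \<in> dualZ" "g' \<in> dualZ" for d e f g f' g'
  proof -
    \<comment> \<open>Elements of the two copies of \<open>zV\<close> are central in the target, so
      the cobrackets of these copies contribute nothing to the cocycle identity.\<close>
    have "zc h (\<lambda>a b. \<beta> (tbr (d, f, g) (0, a, 0)) (0, b, 0) + \<beta> (0, a, 0) (tbr (d, f, g) (0, b, 0))) = 0"
      "zc h (\<lambda>a b. \<beta> (tbr (d, f, g) (0, 0, a)) (0, 0, b) + \<beta> (0, 0, a) (tbr (d, f, g) (0, 0, b))) = 0" if "h \<in> dualZ" for h
      using embeddings(5,6)
      by (intro tensor_square_vanish[OF zc_tensor_square[OF that]];
          simp add: br1 br_z z linear_between_def flip: zero_prod_def)+
    then show ?thesis using that by (simp add: tcb_apply bT br1)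
  qed
  have "tcb (tbr x y) \<beta> = dc (lie_bracket (double \<D>) d e) ?B"
    by (simp add: x(1) y(1) br1 zero_prod_def tcb_apply dualZ_closed \<beta> zc_zero)
  then show ?thesis
    unfolding x(1) y(1) ad[OF x(2,3)] ad[OF y(2,3)] using dc_cocycle[OF bD] by simp
qed

section \<open>Transport to the r-matrix Lie algebra\<close>

text \<open>The inverse of \<open>Phi\<close> on the carriers; any preimage under \<open>ev\<close>
  will do, since the kernel of \<open>ev\<close> is the relator ideal.\<close>

definition Psi :: "('g, 'n) target_type \<Rightarrow> 'n lgen free_alg set" where
  "Psi x = cls (SOME p. ev p = x)"

lemma Psi_ev: "Psi (ev p) = cls p"
proof -
  have "ev (SOME q. ev q = ev p) = ev p" by (rule someI[of _ p]) simp
  then have "ev ((SOME q. ev q = ev p) - p) = 0" by (simp add: ev_linear)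
  then show ?thesis by (simp add: Psi_def pres_class_eq_iff ev_eq_0_iff)
qed

lemma target_ev: "x \<in> lie_carrier (target \<D>) \<Longrightarrow> \<exists>p. x = ev p"
  using range_ev by blast

lemma ev_mem: "ev p \<in> lie_carrier (target \<D>)"
  using range_ev by blast

lemma Psi_linear: "linear_between (target \<D>) (g_r \<D>) Psi"
proof -
  have "Psi (x + y) = lie_add (g_r \<D>) (Psi x) (Psi y)" "Psi (tsc c x) = lie_scale (g_r \<D>) c (Psi x)" "Psi x \<in> lie_carrier (g_r \<D>)"
    if xy: "x \<in> lie_carrier (target \<D>)" "y \<in> lie_carrier (target \<D>)" for x y c
  proof -
    obtain p q where "x = ev p" "y = ev q" using target_ev xy by blast
    then show "Psi (x + y) = lie_add (g_r \<D>) (Psi x) (Psi y)" "Psi (tsc c x) = lie_scale (g_r \<D>) c (Psi x)" "Psi x \<in> lie_carrier (g_r \<D>)"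
      by (simp_all add: ev_linear(1,2)[symmetric] Psi_ev g_r_simps)
  qed
  then show ?thesis by (simp add: linear_between_def target_simps(3))
qed

lemma Phi_linear: "linear_between (g_r \<D>) (target \<D>) Phi"
  using Phi_iso by (simp add: lie_iso_def linear_between_hom)

definition g_r_cobracket :: "'n lgen free_alg set \<Rightarrow> 'n lgen free_alg set tensor2" where
  "g_r_cobracket A = tensor_map (g_r \<D>) Psi (tcb (Phi A))"

lemma g_r_cobracket_tensor_square: "g_r_cobracket (cls p) \<in> tensor_square (g_r \<D>)"
  unfolding g_r_cobracket_def Phi_cls by (intro tensor_map_tensor_square[OF Psi_linear] tcb_tensor_square ev_mem)

lemma g_r_cobracket_apply: "g_r_cobracket (cls p) \<beta> = (if bilinear_form (g_r \<D>) \<beta> then tcb (ev p) (\<lambda>a b. \<beta> (Psi a) (Psi b)) else 0)"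
  unfolding g_r_cobracket_def Phi_cls by (rule tensor_map_apply[OF tcb_tensor_square[OF ev_mem]])

lemma g_r_closed: "x \<in> lie_carrier (g_r \<D>) \<Longrightarrow> y \<in> lie_carrier (g_r \<D>) \<Longrightarrow> lie_add (g_r \<D>) x y \<in> lie_carrier (g_r \<D>)"
  "x \<in> lie_carrier (g_r \<D>) \<Longrightarrow> lie_scale (g_r \<D>) c x \<in> lie_carrier (g_r \<D>)"
  by (auto simp: g_r_simps)

lemma trilinear_form_pullback:
  "linear_between L M f \<Longrightarrow> trilinear_form M \<gamma> \<Longrightarrow> trilinear_form L (\<lambda>a b c. \<gamma> (f a) (f b) (f c))"
  unfolding linear_between_def trilinear_form_def linear_form_def by auto

text \<open>The inner evaluation agrees with a pulled-back form only on the carrier. Hence the form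
  is first replaced by the pullback along \<open>Phi\<close>, and \<open>Phi\<close> is cancelled
  against \<open>Psi\<close> afterwards.\<close>

lemma g_r_cobracket_co_jacobi_term:
  assumes \<gamma>: "trilinear_form (g_r \<D>) \<gamma>"
  shows "g_r_cobracket (cls p) (\<lambda>a b. g_r_cobracket a (\<lambda>a' a''. \<gamma> a' a'' b)) =
    tcb (ev p) (\<lambda>a b. tcb a (\<lambda>a' a''. \<gamma> (Psi a') (Psi a'') (Psi b)))"
proof -
  let ?G = "\<lambda>a b. tcb a (\<lambda>a' a''. \<gamma> (Psi a') (Psi a'') (Psi b))"
  have G: "bilinear_form (target \<D>) ?G"
    by (rule bilinear_tcb_slice[OF trilinear_form_pullback[OF Psi_linear \<gamma>]])
  have val: "g_r_cobracket (cls q) (\<lambda>a' a''. \<gamma> a' a'' (cls r)) = ?G (ev q) (ev r)" for q r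
    using bilinear_form_slice[OF \<gamma>, of "cls r"] by (simp add: g_r_cobracket_apply Psi_ev g_r_simps)
  have "bilinear_form (g_r \<D>) (\<lambda>a b. ?G (Phi a) (Phi b))"
    by (rule bilinear_form_pullback[OF Phi_linear G])
  then have "g_r_cobracket (cls p) (\<lambda>a b. ?G (Phi a) (Phi b)) = g_r_cobracket (cls p) (\<lambda>a b. g_r_cobracket a (\<lambda>a' a''. \<gamma> a' a'' b))"
    by (intro tensor_square_cong[OF g_r_cobracket_tensor_square]) (auto simp: g_r_closed, auto simp: g_r_simps val Phi_cls)
  moreover have "g_r_cobracket (cls p) (\<lambda>a b. ?G (Phi a) (Phi b)) = tcb (ev p) (\<lambda>a b. ?G (Phi (Psi a)) (Phi (Psi b)))"
    using bilinear_form_pullback[OF Phi_linear G] by (simp add: g_r_cobracket_apply)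
  moreover have "tcb (ev p) ?G = tcb (ev p) (\<lambda>a b. ?G (Phi (Psi a)) (Phi (Psi b)))"
  proof (rule tcb_cong[OF ev_mem G])
    fix a b assume "a \<in> lie_carrier (target \<D>)" "b \<in> lie_carrier (target \<D>)"
    then obtain q r where "a = ev q" "b = ev r" using target_ev by blast
    then show "?G a b = ?G (Phi (Psi a)) (Phi (Psi b))" by (simp add: Psi_ev Phi_cls)
  qed
  ultimately show ?thesis by simp
qed

lemma g_r_cobracket_vanish: "(\<And>q r. \<beta> (cls q) (cls r) = 0) \<Longrightarrow> g_r_cobracket (cls p) \<beta> = 0"
  by (rule tensor_square_vanish[OF g_r_cobracket_tensor_square]) (auto simp: g_r_simps)

lemma lie_cobracket_g_r_cobracket: "lie_cobracket (g_r \<D>) g_r_cobracket"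
  unfolding lie_cobracket_def
proof (intro conjI ballI allI)
  fix A assume "A \<in> lie_carrier (g_r \<D>)"
  then obtain p where A: "A = cls p" by (auto simp: g_r_simps)
  show "g_r_cobracket A \<in> tensor_square (g_r \<D>)" unfolding A by (rule g_r_cobracket_tensor_square)
  show "tlift (\<lambda>a b. tens (g_r \<D>) b a) (g_r_cobracket A) = - g_r_cobracket A"
  proof
    fix \<beta>
    show "tlift (\<lambda>a b. tens (g_r \<D>) b a) (g_r_cobracket A) \<beta> = (- g_r_cobracket A) \<beta>"
    proof (cases "bilinear_form (g_r \<D>) \<beta>")
      case True
      have "bilinear_form (target \<D>) (\<lambda>a b. \<beta> (Psi a) (Psi b))" by (rule bilinear_form_pullback[OF Psi_linear True])
      then show ?thesis
        using tcb_skew[OF ev_mem, of p "\<lambda>a b. \<beta> (Psi a) (Psi b)"] True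
          bilinear_form_flip[of "g_r \<D>" \<beta>] bilinear_form_flip[of "target \<D>" "\<lambda>a b. \<beta> (Psi a) (Psi b)"]
        by (simp add: A tlift_def tens_apply g_r_cobracket_apply)
    qed (simp add: A tlift_def tens_apply g_r_cobracket_apply bilinear_form_zero
        tensor_square_zero_form[OF tcb_tensor_square[OF ev_mem]])
  qed
  show "g_r_cobracket (lie_scale (g_r \<D>) c A) = (\<lambda>\<beta>. c * g_r_cobracket A \<beta>)" for c
    by (auto simp: A g_r_simps fun_eq_iff g_r_cobracket_apply ev_linear tcb_linear(2)[OF ev_mem ev_mem])
  show "let J = tlift (\<lambda>a b. tlift (\<lambda>a' a''. tens3 (g_r \<D>) a' a'' b) (g_r_cobracket a)) (g_r_cobracket A)
      in \<forall>\<gamma>. J \<gamma> + J (\<lambda>a b c. \<gamma> b c a) + J (\<lambda>a b c. \<gamma> c a b) = 0"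
  proof -
    have "g_r_cobracket (cls p) (\<lambda>a b. g_r_cobracket a (\<lambda>a' a''. tens3 (g_r \<D>) a' a'' b \<gamma>)) +
        g_r_cobracket (cls p) (\<lambda>a b. g_r_cobracket a (\<lambda>a' a''. tens3 (g_r \<D>) a' a'' b (\<lambda>a b c. \<gamma> b c a))) +
        g_r_cobracket (cls p) (\<lambda>a b. g_r_cobracket a (\<lambda>a' a''. tens3 (g_r \<D>) a' a'' b (\<lambda>a b c. \<gamma> c a b))) = 0" for \<gamma>
    proof (cases "trilinear_form (g_r \<D>) \<gamma>")
      case True
      then have t: "trilinear_form (g_r \<D>) (\<lambda>a b c. \<gamma> b c a)" "trilinear_form (g_r \<D>) (\<lambda>a b c. \<gamma> c a b)"
        using trilinear_form_rotate[of "g_r \<D>" \<gamma>] trilinear_form_rotate'[of "g_r \<D>" \<gamma>] by blast+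
      show ?thesis
        using tcb_co_jacobi[OF trilinear_form_pullback[OF Psi_linear True] ev_mem, of p]
          g_r_cobracket_co_jacobi_term[OF True, of p] g_r_cobracket_co_jacobi_term[OF t(1), of p] g_r_cobracket_co_jacobi_term[OF t(2), of p]
        by (simp add: tens3_def True t)
    next
      case False
      then have "\<not> trilinear_form (g_r \<D>) (\<lambda>a b c. \<gamma> b c a)" "\<not> trilinear_form (g_r \<D>) (\<lambda>a b c. \<gamma> c a b)"
        using trilinear_form_rotate[of "g_r \<D>" \<gamma>] trilinear_form_rotate'[of "g_r \<D>" \<gamma>] by blast+
      then show ?thesis using False by (simp add: tens3_def g_r_cobracket_vanish)
    qed
    then show ?thesis by (simp add: Let_def tlift_def A)
  qed
next
  fix A B assume "A \<in> lie_carrier (g_r \<D>)" "B \<in> lie_carrier (g_r \<D>)"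
  then obtain p q where AB: "A = cls p" "B = cls q" by (auto simp: g_r_simps)
  show "g_r_cobracket (lie_add (g_r \<D>) A B) = g_r_cobracket A + g_r_cobracket B"
    by (auto simp: AB g_r_simps fun_eq_iff g_r_cobracket_apply ev_linear tcb_linear(1)[OF ev_mem ev_mem])
  show "g_r_cobracket (lie_bracket (g_r \<D>) A B) = adjoint2 (g_r \<D>) A (g_r_cobracket B) - adjoint2 (g_r \<D>) B (g_r_cobracket A)"
  proof
    fix \<beta>
    let ?b = "lie_bracket (g_r \<D>)"
    show "g_r_cobracket (?b A B) \<beta> = (adjoint2 (g_r \<D>) A (g_r_cobracket B) - adjoint2 (g_r \<D>) B (g_r_cobracket A)) \<beta>"
    proof (cases "bilinear_form (g_r \<D>) \<beta>")
      case True
      let ?\<beta> = "\<lambda>a b. \<beta> (Psi a) (Psi b)"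
      have b: "bilinear_form (target \<D>) ?\<beta>" by (rule bilinear_form_pullback[OF Psi_linear True])
      have ad: "adjoint2 (g_r \<D>) (cls p) (g_r_cobracket (cls q)) \<beta> = tcb (ev q) (\<lambda>a b. ?\<beta> (tbr (ev p) a) b + ?\<beta> a (tbr (ev p) b))" for p q
      proof -
        have bA: "bilinear_form (g_r \<D>) (\<lambda>a b. \<beta> (?b (cls p) a) b + \<beta> a (?b (cls p) b))"
        proof -
          have mem: "?b (cls p) x \<in> lie_carrier (g_r \<D>)" if "x \<in> lie_carrier (g_r \<D>)" for x
            using that by (auto simp: g_r_simps)
          have lin: "?b (cls p) (lie_add (g_r \<D>) x y) = lie_add (g_r \<D>) (?b (cls p) x) (?b (cls p) y)"
            "?b (cls p) (lie_scale (g_r \<D>) c x) = lie_scale (g_r \<D>) c (?b (cls p) x)"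
            if "x \<in> lie_carrier (g_r \<D>)" "y \<in> lie_carrier (g_r \<D>)" for x y c
            using that by (auto simp: g_r_simps free_mult_linear)
          show ?thesis
            by (intro bilinear_formI conjI)
              (simp_all add: lin(1) lin(2)[of x x for x] mem bilinear_form_D(1,2)[OF True] bilinear_form_scaleD[OF True] algebra_simps)
        qed
        have "adjoint2 (g_r \<D>) (cls p) (g_r_cobracket (cls q)) \<beta> = g_r_cobracket (cls q) (\<lambda>a b. \<beta> (?b (cls p) a) b + \<beta> a (?b (cls p) b))"
          by (simp add: adjoint2_def tlift_def tens_apply True)
        also have "\<dots> = tcb (ev q) (\<lambda>a b. \<beta> (?b (cls p) (Psi a)) (Psi b) + \<beta> (Psi a) (?b (cls p) (Psi b)))"
          by (simp add: g_r_cobracket_apply bA)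
        also have "\<dots> = tcb (ev q) (\<lambda>a b. ?\<beta> (tbr (ev p) a) b + ?\<beta> a (tbr (ev p) b))"
        proof (rule tcb_cong[OF ev_mem bilinear_form_pullback[OF Psi_linear bA]])
          fix a b assume "a \<in> lie_carrier (target \<D>)" "b \<in> lie_carrier (target \<D>)"
          then obtain q r where "a = ev q" "b = ev r" using target_ev by blast
          then show "\<beta> (?b (cls p) (Psi a)) (Psi b) + \<beta> (Psi a) (?b (cls p) (Psi b)) =
              ?\<beta> (tbr (ev p) a) b + ?\<beta> a (tbr (ev p) b)"
            by (simp add: ev_mult[symmetric] Psi_ev g_r_simps)
        qed
        finally show ?thesis .
      qed
      show ?thesis
        using tcb_cocycle[OF ev_mem ev_mem b, of p q] True by (simp add: AB g_r_simps g_r_cobracket_apply ev_mult ad)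
    next
      case False
      then show ?thesis
        by (simp add: AB g_r_simps g_r_cobracket_apply adjoint2_def tlift_def tens_apply bilinear_form_zero
            tensor_square_zero_form[OF tcb_tensor_square[OF ev_mem]])
    qed
  qed
qed

lemma g_r_cobracket_transports: "transports_cobracket \<D> Phi g_r_cobracket"
  unfolding transports_cobracket_def
proof
  fix A assume "A \<in> lie_carrier (g_r \<D>)"
  then obtain p where A: "A = cls p" by (auto simp: g_r_simps)
  show "tensor_map (target \<D>) Phi (g_r_cobracket A) = tcb (Phi A)"
  proof
    fix \<beta>
    show "tensor_map (target \<D>) Phi (g_r_cobracket A) \<beta> = tcb (Phi A) \<beta>"
    proof (cases "bilinear_form (target \<D>) \<beta>")
      case True
      have "tensor_map (target \<D>) Phi (g_r_cobracket A) \<beta> = tcb (ev p) (\<lambda>a b. \<beta> (Phi (Psi a)) (Phi (Psi b)))"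
        using bilinear_form_pullback[OF Phi_linear True]
        by (simp add: A tensor_map_apply[OF g_r_cobracket_tensor_square] True g_r_cobracket_apply)
      also have "\<dots> = tcb (ev p) \<beta>"
      proof (rule tcb_cong[OF ev_mem True, symmetric])
        fix a b assume "a \<in> lie_carrier (target \<D>)" "b \<in> lie_carrier (target \<D>)"
        then obtain q r where "a = ev q" "b = ev r" using target_ev by blast
        then show "\<beta> a b = \<beta> (Phi (Psi a)) (Phi (Psi b))" by (simp add: Psi_ev Phi_cls)
      qed
      finally show ?thesis by (simp add: A Phi_cls)
    next
      case False
      then show ?thesis
        by (simp add: A Phi_cls tensor_map_apply[OF g_r_cobracket_tensor_square] tensor_square_not_bilinear[OF tcb_tensor_square[OF ev_mem]])
    qed
  qed
qed

text \<open>A tensor over the presented algebra is recovered from its image under \<open>Phi\<close>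
  by composing bilinear forms with \<open>Psi\<close>, and the transport condition prescribes that
  image.\<close>

lemma g_r_cobracket_unique:
  assumes "lie_cobracket (g_r \<D>) \<delta>" "transports_cobracket \<D> Phi \<delta>" "A \<in> lie_carrier (g_r \<D>)"
  shows "\<delta> A = g_r_cobracket A"
proof
  fix \<beta>
  obtain p where A: "A = cls p" using assms(3) by (auto simp: g_r_simps)
  have ts: "\<delta> A \<in> tensor_square (g_r \<D>)" using assms(1,3) by (simp add: lie_cobracket_def)
  show "\<delta> A \<beta> = g_r_cobracket A \<beta>"
  proof (cases "bilinear_form (g_r \<D>) \<beta>")
    case True
    have b: "bilinear_form (target \<D>) (\<lambda>a b. \<beta> (Psi a) (Psi b))" by (rule bilinear_form_pullback[OF Psi_linear True])
    have "\<delta> A \<beta> = \<delta> A (\<lambda>a b. \<beta> (Psi (Phi a)) (Psi (Phi b)))"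
      by (rule tensor_square_cong[OF ts True]) (auto simp: g_r_closed, auto simp: g_r_simps Phi_cls Psi_ev)
    also have "\<dots> = tensor_map (target \<D>) Phi (\<delta> A) (\<lambda>a b. \<beta> (Psi a) (Psi b))"
      by (simp add: tensor_map_apply[OF ts] b)
    also have "\<dots> = tcb (Phi A) (\<lambda>a b. \<beta> (Psi a) (Psi b))"
      using assms(2,3) by (simp add: transports_cobracket_def)
    finally show ?thesis by (simp add: A Phi_cls g_r_cobracket_apply True)
  next
    case False
    have "\<delta> A \<beta> = 0" by (rule tensor_square_not_bilinear[OF ts False])
    then show ?thesis using False by (simp add: A g_r_cobracket_apply)
  qed
qed

lemma g_r_cobracket_generators:
  "g_r_cobracket (L_plus \<D> i j) = leg_commutator (g_r \<D>) (L_plus \<D>) i j"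
  "g_r_cobracket (L_minus \<D> i j) = leg_commutator (g_r \<D>) (L_minus \<D>) i j"
proof -
  have P: "Psi (tLP i j) = L_plus \<D> i j" for i j using Psi_ev[of "fLP i j"] by (simp add: ev_L L_plus_def)
  have M: "Psi (tLM i j) = L_minus \<D> i j" for i j using Psi_ev[of "fLM i j"] by (simp add: ev_L L_minus_def)
  show "g_r_cobracket (L_plus \<D> i j) = leg_commutator (g_r \<D>) (L_plus \<D>) i j"
    using bilinear_form_pullback[OF Psi_linear]
    by (auto simp: fun_eq_iff leg_commutator_apply P L_plus_def[of _ i j] g_r_cobracket_apply ev_L tcb_tLP)
  show "g_r_cobracket (L_minus \<D> i j) = leg_commutator (g_r \<D>) (L_minus \<D>) i j"
    using bilinear_form_pullback[OF Psi_linear]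
    by (auto simp: fun_eq_iff leg_commutator_apply M L_minus_def[of _ i j] g_r_cobracket_apply ev_L tcb_tLM)
qed

end

theorem theorem3p6:
  fixes \<D> :: "('g::ab_group_add, 'i::finite, 'n::finite) rmatrix_datum"
  assumes "simple_lie_algebra (scl \<D>) (brk \<D>)"
    and "cartan_subalgebra (scl \<D>) (brk \<D>) (cartan \<D>)"
    and "is_normalized_form \<D>"
    and "is_simple_system \<D>"
    and "are_root_vectors \<D>"
    and "is_chevalley_involution \<D>"
    and "is_faithful_module \<D>"
  shows "\<exists>\<Phi>. lie_iso (g_r \<D>) (target \<D>) \<Phi> \<and> maps_generators \<D> \<Phi> \<and>
    (\<forall>\<Psi>. lie_hom (g_r \<D>) (target \<D>) \<Psi> \<and> maps_generators \<D> \<Psi> \<longrightarrow>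
       (\<forall>x\<in>lie_carrier (g_r \<D>). \<Psi> x = \<Phi> x)) \<and>
    (\<exists>\<delta>. lie_cobracket (g_r \<D>) \<delta> \<and> transports_cobracket \<D> \<Phi> \<delta> \<and>
      (\<forall>\<delta>'. lie_cobracket (g_r \<D>) \<delta>' \<and> transports_cobracket \<D> \<Phi> \<delta>' \<longrightarrow>
         (\<forall>x\<in>lie_carrier (g_r \<D>). \<delta>' x = \<delta> x)) \<and>
      (\<forall>i j. \<delta> (L_plus \<D> i j) = leg_commutator (g_r \<D>) (L_plus \<D>) i j \<and>
             \<delta> (L_minus \<D> i j) = leg_commutator (g_r \<D>) (L_minus \<D>) i j))"
proof -
  interpret rmatrix \<D> using assms by unfold_locales
  show ?thesis
    using Phi_iso Phi_generators Phi_unique lie_cobracket_g_r_cobracket g_r_cobracket_transports g_r_cobracket_unique g_r_cobracket_generators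
    by (intro exI[of _ Phi] exI[of _ g_r_cobracket] conjI) blast+
qed

end
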